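(* For $r=4$ and for $r=5$, there exists a rational number $a$ such that $q^a\chi_r(1,1,\dots,1;q)$ is modular.
   Context: The tadpole Cartan matrix $T_r=(a_{ij})_{r\times r}$ has $a_{rr}=1$, $a_{ii}=2$ for $i<r$, $a_{ij}=-1$ for $|i-j|=1$, and $a_{ij}=0$ otherwise. With $(q;q)_n=\prod_{k=1}^{n}(1-q^k)$, the tadpole Nahm sum is $$\chi_r(x_1,\dots,x_r;q)=\sum_{n=(n_1,\dots,n_r)^{\mathrm T}\in(\mathbb{Z}_{\ge0})^r}\frac{q^{\frac12 n^{\mathrm T}T_r n}x_1^{n_1}\cdots x_r^{n_r}}{(q;q)_{n_1}\cdots (q;q)_{n_r}},\qquad |q|<1.$$ "Modular" means: putting $q=e^{2\pi i\tau}$ with $\operatorname{Im}\tau>0$ and $q^{s}=e^{2\pi i s\tau}$ for rational $s$, the resulting function of $\tau$ is a modular function (weight $0$, holomorphic on the upper half plane and meromorphic at the cusps) for some finite-index subgroup of $\mathrm{SL}_2(\mathbb{Z})$. *)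

theory Defs
  imports "HOL-Complex_Analysis.Complex_Analysis" "HOL-Algebra.Coset"
begin

section \<open>The tadpole Nahm sum\<close>

definition tadpole :: "nat \<Rightarrow> nat \<Rightarrow> nat \<Rightarrow> int" where
  "tadpole r i j =
     (if i = j then (if i = r then 1 else 2)
      else if \<bar>int i - int j\<bar> = 1 then -1 else 0)"

definition tadpole_form :: "nat \<Rightarrow> (nat \<Rightarrow> nat) \<Rightarrow> int" where
  "tadpole_form r n = (\<Sum>i=1..r. \<Sum>j=1..r. int (n i) * tadpole r i j * int (n j))"

text \<open>Half-integral powers of \<open>q\<close> occur in the sum, so everything is a function of \<open>\<tau>\<close>,
  where \<open>q = exp (2 \<pi> \<i> \<tau>)\<close>; \<open>q_pow \<tau> s\<close> is \<open>q\<^sup>s\<close>.\<close>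

definition q_pow :: "complex \<Rightarrow> rat \<Rightarrow> complex" where
  "q_pow \<tau> s = exp (2 * of_real pi * \<i> * of_rat s * \<tau>)"

definition q_poch :: "complex \<Rightarrow> nat \<Rightarrow> complex" where
  "q_poch q n = (\<Prod>k=1..n. (1 - q ^ k))"

text \<open>The summation index \<open>n = (n\<^sub>1, \<dots>, n\<^sub>r)\<close> is an extensional function on \<open>{1..r}\<close>, so that each
  tuple is counted once. As the quadratic form is
  \<open>n\<^sub>1\<^sup>2 + (n\<^sub>1 - n\<^sub>2)\<^sup>2 + \<dots> + (n\<^bsub>r-1\<^esub> - n\<^sub>r)\<^sup>2\<close>, hence positive definite, the sum converges
  absolutely for \<open>Im \<tau> > 0\<close> and the default value of \<^const>\<open>infsum\<close> plays no role there.\<close>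

definition tadpole_nahm_sum :: "nat \<Rightarrow> (nat \<Rightarrow> complex) \<Rightarrow> complex \<Rightarrow> complex" where
  "tadpole_nahm_sum r x \<tau> =
     (\<Sum>\<^sub>\<infinity>n \<in> {1..r} \<rightarrow>\<^sub>E (UNIV :: nat set).
        q_pow \<tau> (of_int (tadpole_form r n) / 2) * (\<Prod>i=1..r. x i ^ n i)
          / (\<Prod>i=1..r. q_poch (q_pow \<tau> 1) (n i)))"

section \<open>Modular functions\<close>

definition SL2Z :: "(int ^ 2 ^ 2) monoid" where
  "SL2Z = \<lparr>carrier = {A. det A = 1}, monoid.mult = (**), one = mat 1\<rparr>"

lemma group_SL2Z: "group SL2Z"
proof (rule groupI)
  fix A assume A: "A \<in> carrier SL2Z"
  define B :: "int ^ 2 ^ 2" where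
    "B = vector [vector [A $ 2 $ 2, - A $ 1 $ 2], vector [- A $ 2 $ 1, A $ 1 $ 1]]"
  have "det B = 1" "B ** A = mat 1"
    using A by (auto simp: SL2Z_def B_def det_2 matrix_matrix_mult_def mat_def vec_eq_iff
        forall_2 sum_2 algebra_simps)
  then show "\<exists>B \<in> carrier SL2Z. B \<otimes>\<^bsub>SL2Z\<^esub> A = \<one>\<^bsub>SL2Z\<^esub>"
    by (auto simp: SL2Z_def)
qed (auto simp: SL2Z_def det_mul matrix_mul_assoc)

definition moebius :: "int ^ 2 ^ 2 \<Rightarrow> complex \<Rightarrow> complex" where
  "moebius A \<tau> = (of_int (A $ 1 $ 1) * \<tau> + of_int (A $ 1 $ 2))
               / (of_int (A $ 2 $ 1) * \<tau> + of_int (A $ 2 $ 2))"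

abbreviation upper_half_plane :: "complex set" where
  "upper_half_plane \<equiv> {\<tau>. Im \<tau> > 0}"

text \<open>Meromorphy at \<open>\<i>\<infinity>\<close>: the function is given by a Laurent series with finite principal
  part in the local parameter \<open>exp (2 \<pi> \<i> \<tau> / N)\<close> for some width \<open>N > 0\<close>.\<close>

definition meromorphic_at_ii_inf :: "(complex \<Rightarrow> complex) \<Rightarrow> bool" where
  "meromorphic_at_ii_inf f \<longleftrightarrow>
     (\<exists>N::nat. N > 0 \<and> (\<exists>g. g meromorphic_on {0} \<and>
        (\<forall>\<tau>\<in>upper_half_plane. f \<tau> = g (exp (2 * of_real pi * \<i> * \<tau> / of_nat N)))))"

text \<open>Every cusp is the image of \<open>\<i>\<infinity>\<close> under some element of the full modular group, so
  meromorphy at all cusps is meromorphy of all translates of \<open>f\<close> at \<open>\<i>\<infinity>\<close>.\<close>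

definition modular_function_for :: "(int ^ 2 ^ 2) set \<Rightarrow> (complex \<Rightarrow> complex) \<Rightarrow> bool" where
  "modular_function_for \<Gamma> f \<longleftrightarrow>
     f holomorphic_on upper_half_plane \<and>
     (\<forall>A\<in>\<Gamma>. \<forall>\<tau>\<in>upper_half_plane. f (moebius A \<tau>) = f \<tau>) \<and>
     (\<forall>A\<in>carrier SL2Z. meromorphic_at_ii_inf (\<lambda>\<tau>. f (moebius A \<tau>)))"

definition modular :: "(complex \<Rightarrow> complex) \<Rightarrow> bool" where
  "modular f \<longleftrightarrow>
     (\<exists>\<Gamma>. subgroup \<Gamma> SL2Z \<and> finite (rcosets\<^bsub>SL2Z\<^esub> \<Gamma>) \<and> modular_function_for \<Gamma> f)"

end

theory Submission
  imports Defs
begin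

text \<open>
  Put \<open>p = q\<^bsup>1/2\<^esup>\<close> and \<open>x = q\<^bsup>1/4\<^esup>\<close>. Completing squares, the quadratic form of the tadpole matrix is
  \<open>n\<^sub>1\<^sup>2 + (n\<^sub>1 - n\<^sub>2)\<^sup>2 + \<dots> + (n\<^bsub>r-1\<^esub> - n\<^sub>r)\<^sup>2\<close>, so the Nahm sum runs along a chain of nodes in which only
  neighbours interact. The proof first finds closed forms for \<open>r = 4\<close> and \<open>r = 5\<close> and then shows that
  every ingredient of these forms is modular up to a power of \<open>q\<close>.

  \<^emph>\<open>Closed forms.\<close> The two nodes at the far end of the chain are summed along the diagonals
  \<open>n\<^sub>1 - n\<^sub>2 = d\<close>: on a diagonal the summand is that of a Durfee rectangle sum
  (lemma \<open>durfee_shifted_sum\<close>), and the remaining sum over \<open>d\<close> is one of the two theta series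
  \<open>A 0\<close>, \<open>A 1\<close>, according to the parity of an index. The last node of the chain is summed by Euler's
  theorem. What is left is a double sum: at once for \<open>r = 4\<close>, and for \<open>r = 5\<close> after one more use of
  Durfee rectangles (\<open>chain4_reduction\<close>, \<open>chain5_reduction\<close>). In it one variable is summed by
  Euler's theorems, the other by identities of Slater's type that come from Bailey's method:
  \<open>slater_alternating\<close> and \<open>slater_squares\<close> for \<open>r = 4\<close>, where the natural base is \<open>w = \<i>x\<close> instead of
  \<open>x\<close>, and \<open>slater_double_even\<close> and \<open>slater_double_odd\<close> for \<open>r = 5\<close>. The Durfee rectangle sums,
  \<open>slater_alternating\<close> and the columns of Bailey's transform are all instances of one identity,
  \<open>q_gauss_sum\<close>. The results \<open>chain4_evaluation\<close> and \<open>chain5_evaluation\<close> are polynomials in theta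
  series divided by \<open>(q;q)\<^sub>\<infinity>\<close> and in Weber functions and their quotients, at \<open>\<tau>\<close> and, because of the
  base \<open>w\<close>, at \<open>(\<tau> + 1) / 2\<close>.

  \<^emph>\<open>Modularity.\<close> No congruence subgroup is determined. Instead, consider the functions, holomorphic
  on the upper half plane, that have only finitely many translates under \<open>SL\<^sub>2(\<int>)\<close>, each of at most
  exponential growth towards \<open>\<i>\<infinity>\<close> (\<open>finite_orbit\<close>). They form a ring, closed under taking roots of
  functions without zeros and under \<open>\<tau> \<mapsto> (a\<tau> + b) / d\<close>; and each of them is modular, since its
  stabiliser has finite index and is large enough to make all translates periodic
  (\<open>finite_orbit_imp_modular\<close>). The basic members are the Siegel functions: for parameters in
  \<open>(1/N) \<int>\<close>, their \<open>12 N\<^sup>2\<close>-th powers are permuted by \<open>\<tau> \<mapsto> \<tau> + 1\<close>, which is plain from the product, and by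
  \<open>\<tau> \<mapsto> - 1 / \<tau>\<close>, which follows from Liouville's theorem for elliptic functions (\<open>theta_prod_inversion\<close>,
  \<open>siegel_inversion\<close>). Squares of Weber functions are Siegel functions up to constants,
  \<open>\<eta>(\<tau>)/\<eta>(N\<tau>)\<close> is a square root of a product of Siegel functions, and by the Jacobi triple product a
  theta series over \<open>\<eta>\<close> is a Siegel function times \<open>\<eta>(N\<tau>)/\<eta>(\<tau>)\<close>. So all ingredients lie in the ring
  once they carry the right power of \<open>q\<close>. Collecting the powers gives \<open>a = - 1/8\<close> for \<open>r = 4\<close> and
  \<open>a = - 55/336\<close> for \<open>r = 5\<close>.
\<close>

section \<open>Infinite products and Euler's expansions\<close>

text \<open>The infinite product \<open>(z;q)\<^sub>\<infinity>\<close>; below, \<open>qf\<close> is the finite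
  product \<open>(z;q)\<^sub>n\<close>.\<close>

definition qp :: "complex \<Rightarrow> complex \<Rightarrow> complex" where
  "qp z q = (\<Prod>n. 1 - z * q ^ n)"

definition qf :: "complex \<Rightarrow> complex \<Rightarrow> nat \<Rightarrow> complex" where
  "qf z q n = (\<Prod>k<n. 1 - z * q ^ k)"

lemma qf_0 [simp]: "qf z q 0 = 1" and qf_Suc: "qf z q (Suc n) = qf z q n * (1 - z * q ^ n)"
  by (simp_all add: qf_def)

lemma qf_add: "qf z q (m + n) = qf z q m * qf (z * q ^ m) q n"
  by (induction n) (simp_all add: qf_Suc power_add mult_ac)

lemma q_poch_eq_qf: "q_poch q n = qf q q n"
  unfolding q_poch_def qf_def by (induction n) simp_all

lemma qp_convergent: assumes "norm (q::complex) < 1" shows "convergent_prod (\<lambda>n. 1 - z * q ^ n)"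
proof -
  have "summable (\<lambda>n. norm z * norm q ^ n)"
    using assms by (intro summable_mult summable_geometric) auto
  also have "(\<lambda>n. norm z * norm q ^ n) = (\<lambda>n. norm ((1 - z * q ^ n) - 1))"
    by (simp add: norm_mult norm_power)
  finally have "summable (\<lambda>n. norm ((1 - z * q ^ n) - 1))" .
  then show ?thesis
    by (intro abs_convergent_prod_imp_convergent_prod summable_imp_abs_convergent_prod)
qed

lemma qf_LIMSEQ: assumes "norm q < 1" shows "qf z q \<longlonglongrightarrow> qp z q"
proof -
  have "(\<lambda>n. \<Prod>k\<le>n. 1 - z * q ^ k) \<longlonglongrightarrow> qp z q"
    unfolding qp_def by (intro convergent_prod_LIMSEQ qp_convergent assms)
  then have "(\<lambda>n. qf z q (Suc n)) \<longlonglongrightarrow> qp z q"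
    by (simp add: qf_def lessThan_Suc_atMost)
  then show ?thesis by (simp add: filterlim_sequentially_Suc)
qed

lemma qp_split: assumes "norm q < 1" shows "qp z q = qf z q n * qp (z * q ^ n) q"
proof -
  have "(\<lambda>m. qf z q (m + n)) \<longlonglongrightarrow> qp z q"
    using qf_LIMSEQ[OF assms, of z] by (simp add: LIMSEQ_ignore_initial_segment)
  moreover have "(\<lambda>m. qf z q (m + n)) \<longlonglongrightarrow> qf z q n * qp (z * q ^ n) q"
    unfolding add.commute[of _ n] qf_add by (intro tendsto_mult tendsto_const qf_LIMSEQ assms)
  ultimately show ?thesis by (rule LIMSEQ_unique)
qed

lemma qp_step: "norm q < 1 \<Longrightarrow> qp z q = (1 - z) * qp (z * q) q"
  using qp_split[of q z 1] by (simp add: qf_def)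

lemma qp_eq_0_iff: assumes "norm q < 1" shows "qp z q = 0 \<longleftrightarrow> (\<exists>n. z * q ^ n = 1)"
proof
  assume "\<exists>n. z * q ^ n = 1"
  then obtain n where "z * q ^ n = 1" ..
  then show "qp z q = 0" using qp_split[OF assms, of z "Suc n"] by (simp add: qf_Suc)
next
  assume "qp z q = 0"
  then show "\<exists>n. z * q ^ n = 1"
    using prodinf_nonzero[OF qp_convergent[OF assms, of z]] unfolding qp_def by fastforce
qed

lemma norm_mult_power_less:
  fixes z q :: complex
  assumes "norm q < 1" "norm z < 1" shows "norm (z * q ^ n) < 1"
proof -
  have "norm z * norm q ^ n \<le> norm z * 1"
    using assms by (intro mult_left_mono power_le_one) auto
  then show ?thesis using assms by (simp add: norm_mult norm_power)
qed

lemma qp_nonzero: assumes "norm q < 1" "norm z < 1" shows "qp z q \<noteq> 0"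
proof
  assume "qp z q = 0"
  then obtain n where "z * q ^ n = 1" using assms(1) by (auto simp: qp_eq_0_iff)
  moreover have "norm (z * q ^ n) < 1"
    using assms by (rule norm_mult_power_less)
  ultimately show False by auto
qed

lemma qf_nonzero: assumes "norm q < 1" shows "qf q q n \<noteq> 0"
proof -
  have "q * q ^ k \<noteq> 1" for k
  proof
    assume "q * q ^ k = 1"
    then show False using norm_mult_power_less[OF assms assms, of k] by simp
  qed
  then show ?thesis by (auto simp: qf_def)
qed

lemma qf_inverse_bound:
  assumes "norm q < 1"
  obtains C where "C > 0" "\<And>n. norm (1 / qf q q n) \<le> C"
proof -
  have "(\<lambda>n. 1 / qf q q n) \<longlonglongrightarrow> 1 / qp q q"
    using assms by (intro tendsto_divide tendsto_const qf_LIMSEQ qp_nonzero)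
  then have "Bseq (\<lambda>n. 1 / qf q q n)" by (auto intro!: convergent_imp_Bseq simp: convergent_def)
  then show ?thesis using that unfolding Bseq_def by blast
qed

lemma qf_bound:
  assumes "norm q < 1"
  obtains C where "C > 0" "\<And>n. norm (qf z q n) \<le> C"
proof -
  have "Bseq (qf z q)"
    using qf_LIMSEQ[OF assms, of z] by (auto intro!: convergent_imp_Bseq simp: convergent_def)
  then show ?thesis using that unfolding Bseq_def by blast
qed

lemma Suc_choose_two: "Suc n choose 2 = n + (n choose 2)"
  by (simp add: numeral_2_eq_2)

lemma summable_triangular:
  fixes r t :: real
  assumes "0 \<le> r" "r < 1" "0 \<le> t"
  shows "summable (\<lambda>n. r ^ (n choose 2) * t ^ n)"
proof -
  have "(\<lambda>n. r ^ n * t) \<longlonglongrightarrow> 0 * t"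
    using assms by (intro tendsto_intros LIMSEQ_realpow_zero) auto
  then have "eventually (\<lambda>n. r ^ n * t < 1/2) sequentially"
    by (intro order_tendstoD) auto
  then obtain N where N: "\<And>n. n \<ge> N \<Longrightarrow> r ^ n * t < 1/2"
    by (auto simp: eventually_sequentially)
  show ?thesis
  proof (rule summable_ratio_test[where c = "1/2" and N = N])
    fix n assume "n \<ge> N"
    have "norm (r ^ (Suc n choose 2) * t ^ Suc n) = (r ^ n * t) * norm (r ^ (n choose 2) * t ^ n)"
      using assms by (simp add: Suc_choose_two power_add abs_mult)
    also have "\<dots> \<le> 1/2 * norm (r ^ (n choose 2) * t ^ n)"
      using N[OF \<open>n \<ge> N\<close>] by (intro mult_right_mono) auto
    finally show "norm (r ^ (Suc n choose 2) * t ^ Suc n) \<le> 1/2 * norm (r ^ (n choose 2) * t ^ n)" .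
  qed auto
qed

text \<open>A power series solving a functional equation that relates its values at \<open>z\<close> and
  \<open>z q\<close> is determined by iterating the equation; the iteration ends at the constant term
  because \<open>z q\<^sup>n\<close> tends to \<open>0\<close>.\<close>

lemma q_functional_limit:
  fixes a :: "nat \<Rightarrow> complex"
  assumes q: "norm q < 1" and s: "summable (\<lambda>n. a n * K ^ n)" and "K \<noteq> 0"
  shows "(\<lambda>n. \<Sum>k. a k * (z * q ^ n) ^ k) \<longlonglongrightarrow> a 0"
proof -
  have "isCont (\<lambda>x. \<Sum>k. a k * x ^ k) 0"
    using s \<open>K \<noteq> 0\<close> by (intro isCont_powser[of _ K]) auto
  moreover have "(\<lambda>n. z * q ^ n) \<longlonglongrightarrow> z * 0"
    by (intro tendsto_intros LIMSEQ_power_zero q)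
  ultimately have "(\<lambda>n. \<Sum>k. a k * (z * q ^ n) ^ k) \<longlonglongrightarrow> (\<Sum>k. a k * 0 ^ k)"
    using isCont_tendsto_compose[of 0 "\<lambda>x. \<Sum>k. a k * x ^ k"] by simp
  then show ?thesis by simp
qed

text \<open>Both sides satisfy \<open>f(z) = (1 - z) f(z q)\<close>: for the series, subtract \<open>f(z q)\<close>
  and shift the index.\<close>

lemma euler_product_sum:
  assumes q: "norm q < 1"
  shows "((\<lambda>n. (-1) ^ n * q ^ (n choose 2) * z ^ n / qf q q n) has_sum qp z q) UNIV"
proof -
  define a where "a n = (-1) ^ n * q ^ (n choose 2) / qf q q n" for n
  define f where "f z = (\<Sum>n. a n * z ^ n)" for z
  obtain C where C: "C > 0" "\<And>n. norm (1 / qf q q n) \<le> C" using qf_inverse_bound[OF q] by blast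
  have summ: "summable (\<lambda>n. norm (a n * z ^ n))" for z
  proof (rule summable_comparison_test)
    show "\<exists>N. \<forall>n\<ge>N. norm (norm (a n * z ^ n)) \<le> C * (norm q ^ (n choose 2) * norm z ^ n)"
    proof (intro exI allI impI)
      fix n
      have "norm (norm (a n * z ^ n)) = norm (1 / qf q q n) * (norm q ^ (n choose 2) * norm z ^ n)"
        by (simp add: a_def norm_mult norm_divide norm_power)
      also have "\<dots> \<le> C * (norm q ^ (n choose 2) * norm z ^ n)"
        by (intro mult_right_mono C) auto
      finally show "norm (norm (a n * z ^ n)) \<le> C * (norm q ^ (n choose 2) * norm z ^ n)" .
    qed
    show "summable (\<lambda>n. C * (norm q ^ (n choose 2) * norm z ^ n))"
      using q by (intro summable_mult summable_triangular) auto
  qed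
  have sums: "(\<lambda>n. a n * z ^ n) sums f z" for z
    unfolding f_def by (rule summable_sums[OF summable_norm_cancel[OF summ]])
  have step: "f z = (1 - z) * f (z * q)" for z
  proof -
    have "(\<lambda>n. a n * z ^ n - a n * (z * q) ^ n) sums (f z - f (z * q))"
      by (intro sums_diff sums)
    then have "(\<lambda>n. a (Suc n) * z ^ Suc n - a (Suc n) * (z * q) ^ Suc n) sums (f z - f (z * q))"
      by (subst sums_Suc_iff) simp
    moreover have "a (Suc n) * z ^ Suc n - a (Suc n) * (z * q) ^ Suc n = - z * (a n * (z * q) ^ n)" for n
    proof -
      have "1 - q * q ^ n \<noteq> 0" using qf_nonzero[OF q, of "Suc n"] by (simp add: qf_Suc)
      then have "a (Suc n) * (1 - q * q ^ n) = - a n * q ^ n"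
        using qf_nonzero[OF q, of n]
        by (simp add: a_def qf_Suc Suc_choose_two power_add)
      moreover have "a (Suc n) * z ^ Suc n - a (Suc n) * (z * q) ^ Suc n
          = a (Suc n) * (1 - q * q ^ n) * z ^ Suc n"
        by (simp add: algebra_simps power_mult_distrib)
      ultimately show ?thesis by (simp add: power_mult_distrib)
    qed
    ultimately have "(\<lambda>n. - z * (a n * (z * q) ^ n)) sums (f z - f (z * q))" by simp
    moreover have "(\<lambda>n. - z * (a n * (z * q) ^ n)) sums (- z * f (z * q))"
      by (intro sums_mult sums)
    ultimately have "f z - f (z * q) = - z * f (z * q)" by (rule sums_unique2)
    then show ?thesis by (simp add: algebra_simps)
  qed
  have iter: "f z = qf z q n * f (z * q ^ n)" for n
  proof (induction n)
    case (Suc n)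
    then show ?case using step[of "z * q ^ n"] by (simp add: qf_Suc mult_ac)
  qed auto
  have "summable (\<lambda>n. a n * 1 ^ n)" using summ[of 1] by (rule summable_norm_cancel)
  then have "(\<lambda>n. f (z * q ^ n)) \<longlonglongrightarrow> a 0"
    unfolding f_def by (intro q_functional_limit[where K = 1] q) auto
  then have "(\<lambda>n. qf z q n * f (z * q ^ n)) \<longlonglongrightarrow> qp z q * a 0"
    by (intro tendsto_mult qf_LIMSEQ q)
  then have "f z = qp z q"
    unfolding iter[symmetric] by (simp add: a_def LIMSEQ_const_iff numeral_2_eq_2)
  then have "(\<lambda>n. a n * z ^ n) sums qp z q" using sums[of z] by simp
  then have "((\<lambda>n. a n * z ^ n) has_sum qp z q) UNIV"
    by (intro norm_summable_imp_has_sum summ)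
  then show ?thesis by (simp add: a_def mult_ac)
qed

text \<open>Here the functional equation is \<open>(1 - z) f(z) = f(z q)\<close>.\<close>

lemma euler_reciprocal_sum:
  assumes q: "norm q < 1" and z: "norm z < 1"
  shows "((\<lambda>n. z ^ n / qf q q n) has_sum (1 / qp z q)) UNIV"
proof -
  define a where "a n = 1 / qf q q n" for n
  define f where "f z = (\<Sum>n. a n * z ^ n)" for z
  obtain C where C: "C > 0" "\<And>n. norm (1 / qf q q n) \<le> C" using qf_inverse_bound[OF q] by blast
  have summ: "summable (\<lambda>n. norm (a n * z ^ n))" if "norm z < 1" for z
  proof (rule summable_comparison_test)
    show "\<exists>N. \<forall>n\<ge>N. norm (norm (a n * z ^ n)) \<le> C * norm z ^ n"
    proof (intro exI allI impI)
      fix n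
      have "norm (norm (a n * z ^ n)) = norm (1 / qf q q n) * norm z ^ n"
        by (simp add: a_def norm_mult norm_divide norm_power)
      also have "\<dots> \<le> C * norm z ^ n"
        by (intro mult_right_mono C) auto
      finally show "norm (norm (a n * z ^ n)) \<le> C * norm z ^ n" .
    qed
    show "summable (\<lambda>n. C * norm z ^ n)"
      using that by (intro summable_mult summable_geometric) auto
  qed
  have sums: "(\<lambda>n. a n * z ^ n) sums f z" if "norm z < 1" for z
    unfolding f_def by (rule summable_sums[OF summable_norm_cancel[OF summ[OF that]]])
  have zq: "norm (z * q ^ n) < 1" for n
    by (rule norm_mult_power_less[OF q z])
  have step: "(1 - z) * f z = f (z * q)" if z: "norm z < 1" "norm (z * q) < 1" for z
  proof -
    have "(\<lambda>n. a n * z ^ n - a n * (z * q) ^ n) sums (f z - f (z * q))"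
      by (intro sums_diff sums z)
    then have "(\<lambda>n. a (Suc n) * z ^ Suc n - a (Suc n) * (z * q) ^ Suc n) sums (f z - f (z * q))"
      by (subst sums_Suc_iff) simp
    moreover have "a (Suc n) * z ^ Suc n - a (Suc n) * (z * q) ^ Suc n = z * (a n * z ^ n)" for n
    proof -
      have "1 - q * q ^ n \<noteq> 0" using qf_nonzero[OF q, of "Suc n"] by (simp add: qf_Suc)
      then have "a (Suc n) * (1 - q * q ^ n) = a n"
        by (simp add: a_def qf_Suc)
      moreover have "a (Suc n) * z ^ Suc n - a (Suc n) * (z * q) ^ Suc n
          = a (Suc n) * (1 - q * q ^ n) * z ^ Suc n"
        by (simp add: algebra_simps power_mult_distrib)
      ultimately show ?thesis by simp
    qed
    ultimately have "(\<lambda>n. z * (a n * z ^ n)) sums (f z - f (z * q))" by simp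
    moreover have "(\<lambda>n. z * (a n * z ^ n)) sums (z * f z)"
      by (intro sums_mult sums z)
    ultimately have "f z - f (z * q) = z * f z" by (rule sums_unique2)
    then show ?thesis by (simp add: algebra_simps)
  qed
  have iter: "qf z q n * f z = f (z * q ^ n)" for n
  proof (induction n)
    case (Suc n)
    have "qf z q (Suc n) * f z = (1 - z * q ^ n) * (qf z q n * f z)" by (simp add: qf_Suc)
    also have "\<dots> = f (z * q ^ n * q)"
      unfolding Suc using zq[of n] zq[of "Suc n"] by (intro step) (auto simp: mult_ac)
    finally show ?case by (simp add: mult_ac)
  qed auto
  have "summable (\<lambda>n. a n * (1/2) ^ n)" by (rule summable_norm_cancel[OF summ]) auto
  then have "(\<lambda>n. f (z * q ^ n)) \<longlonglongrightarrow> a 0"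
    unfolding f_def by (intro q_functional_limit[where K = "1/2"] q) auto
  moreover have "(\<lambda>n. qf z q n * f z) \<longlonglongrightarrow> qp z q * f z"
    by (intro tendsto_mult qf_LIMSEQ q tendsto_const)
  ultimately have "qp z q * f z = a 0"
    unfolding iter[symmetric] by (rule LIMSEQ_unique[rotated])
  then have "f z = 1 / qp z q"
    using qp_nonzero[OF q z] by (simp add: a_def eq_divide_eq mult.commute)
  then have "(\<lambda>n. a n * z ^ n) sums (1 / qp z q)" using sums[OF z] by simp
  then have "((\<lambda>n. a n * z ^ n) has_sum (1 / qp z q)) UNIV"
    by (intro norm_summable_imp_has_sum summ z)
  then show ?thesis by (simp add: a_def)
qed

section \<open>Rearranging sums\<close>

text \<open>A sum over a set may be carried out over the fibres of any map first. This is used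
  for the diagonals \<open>i - j = d\<close>, for the antidiagonals \<open>i + j = N\<close> and, through the next
  lemma, for iterated sums.\<close>

lemma has_sum_fibers:
  fixes f :: "'a \<Rightarrow> complex"
  assumes f: "(f has_sum S) A" and g: "\<And>d. (f has_sum g d) {x \<in> A. h x = d}"
  shows "(g has_sum S) UNIV"
proof -
  have bij: "bij_betw snd (SIGMA d:UNIV. {x \<in> A. h x = d}) A"
    by (rule bij_betwI[where g = "\<lambda>x. (h x, x)"]) auto
  have "((\<lambda>y. f (snd y)) has_sum S) (SIGMA d:UNIV. {x \<in> A. h x = d})"
    using f has_sum_reindex_bij_betw[OF bij, of f S] by simp
  then show ?thesis
    by (rule has_sum_SigmaD) (use g in auto)
qed

lemma has_sum_product_iterated:
  fixes f :: "'a \<times> 'b \<Rightarrow> complex"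
  assumes f: "(f has_sum S) UNIV" and g: "\<And>a. ((\<lambda>b. f (a, b)) has_sum g a) UNIV"
  shows "(g has_sum S) UNIV"
  by (rule has_sum_SigmaD[where B = "\<lambda>_. UNIV" and f = f]) (use assms in auto)

lemma has_sum_antidiagonal:
  fixes f :: "nat \<times> nat \<Rightarrow> complex"
  shows "(f has_sum (\<Sum>m\<le>N. f (m, N - m))) {x. fst x + snd x = N}"
proof -
  have "bij_betw (\<lambda>m. (m, N - m)) {..N} {x. fst x + snd x = N}"
    by (rule bij_betwI[where g = fst]) auto
  moreover have "((\<lambda>m. f (m, N - m)) has_sum (\<Sum>m\<le>N. f (m, N - m))) {..N}"
    by (intro has_sum_finite) auto
  ultimately show ?thesis
    using has_sum_reindex_bij_betw[of "\<lambda>m. (m, N - m)" "{..N}" "{x. fst x + snd x = N}" f] by blast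
qed

lemma summable_on_times:
  fixes f :: "'a \<Rightarrow> real" and g :: "'b \<Rightarrow> real"
  assumes f: "f summable_on A" and g: "g summable_on B"
      and "\<And>x. f x \<ge> 0" "\<And>x. g x \<ge> 0"
  shows "(\<lambda>(x, y). f x * g y) summable_on A \<times> B"
proof (rule summable_on_SigmaI)
  show "((\<lambda>y. case (x, y) of (x, y) \<Rightarrow> f x * g y) has_sum f x * infsum g B) B" for x
    using has_sum_cmult_right[OF has_sum_infsum[OF g], of "f x"] by simp
  show "(\<lambda>x. f x * infsum g B) summable_on A" by (intro summable_on_cmult_left f)
qed (use assms in auto)

lemma summable_on_norm_bound:
  fixes f :: "'a \<Rightarrow> complex" and g :: "'a \<Rightarrow> real"
  assumes "g summable_on A" "\<And>x. x \<in> A \<Longrightarrow> norm (f x) \<le> g x"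
  shows "f summable_on A"
  using Infinite_Sum.abs_summable_on_comparison_test'[OF assms] by (rule abs_summable_summable)

lemma summable_on_triangular:
  fixes r t :: real
  assumes "0 \<le> r" "r < 1" "0 \<le> t"
  shows "(\<lambda>n. r ^ (n choose 2) * t ^ n) summable_on UNIV"
  using norm_summable_imp_summable_on[of "\<lambda>n. r ^ (n choose 2) * t ^ n"] summable_triangular[OF assms] assms
  by simp

section \<open>Gaussian binomials, the q-Gauss sum and Durfee rectangles\<close>

text \<open>The Gaussian binomial coefficient. The lower index is an integer, and the value
  outside \<open>{0..n}\<close> is zero, so that Pascal's rules hold without side conditions and shifted
  sums need no boundary terms.\<close>

definition gbinom :: "complex \<Rightarrow> nat \<Rightarrow> int \<Rightarrow> complex" where
  "gbinom q n k = (if 0 \<le> k \<and> k \<le> int n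
     then qf q q n / (qf q q (nat k) * qf q q (nat (int n - k))) else 0)"

lemma gbinom_outside: "k < 0 \<or> int n < k \<Longrightarrow> gbinom q n k = 0"
  by (auto simp: gbinom_def)

lemma gbinom_nat: "m \<le> n \<Longrightarrow> gbinom q n (int m) = qf q q n / (qf q q m * qf q q (n - m))"
  by (auto simp: gbinom_def nat_diff_distrib)

lemma gbinom_sym: "gbinom q n (int n - k) = gbinom q n k"
  by (auto simp: gbinom_def)

lemma qf_step_nonzero: "norm (q::complex) < 1 \<Longrightarrow> 1 - q * q ^ n \<noteq> 0"
  using qf_nonzero[of q "Suc n"] by (simp add: qf_Suc)

lemma gbinom_Suc:
  assumes q: "norm q < 1"
  shows "gbinom q (Suc n) k = gbinom q n (k - 1) + q powi k * gbinom q n k"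
proof -
  consider "k < 0" | "k = 0" | "k = int (Suc n)" | "int (Suc n) < k" | "1 \<le> k" "k \<le> int n" by linarith
  then show ?thesis
  proof cases
    case 5
    define j m where "j = nat (k - 1)" and "m = nat (int n - k)"
    have k: "k = int (Suc j)" and n: "n = Suc j + m" using 5 by (auto simp: j_def m_def)
    have nats: "nat k = Suc j" "nat (k - 1) = j" "nat (int n - k) = m"
      "nat (int n - (k - 1)) = Suc m" "nat (int (Suc n) - k) = Suc m"
      using 5 by (auto simp: j_def m_def)
    have A: "gbinom q (Suc n) k = qf q q (Suc n) / (qf q q (Suc j) * qf q q (Suc m))"
     and B: "gbinom q n (k - 1) = qf q q n / (qf q q j * qf q q (Suc m))"
     and C: "gbinom q n k = qf q q n / (qf q q (Suc j) * qf q q m)"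
      unfolding gbinom_def nats using 5 by auto
    have nz: "qf q q j \<noteq> 0" "qf q q m \<noteq> 0" "1 - q * q ^ j \<noteq> 0" "1 - q * q ^ m \<noteq> 0"
      using qf_nonzero[OF q] qf_step_nonzero[OF q] by blast+
    have "1 - q * q ^ n = (1 - q * q ^ j) + q * q ^ j * (1 - q * q ^ m)"
      by (simp add: n algebra_simps power_add)
    then have "qf q q (Suc n) / (qf q q (Suc j) * qf q q (Suc m))
        = qf q q n * ((1 - q * q ^ j) + q * q ^ j * (1 - q * q ^ m)) / (qf q q (Suc j) * qf q q (Suc m))"
      by (simp add: qf_Suc)
    also have "\<dots> = qf q q n / (qf q q j * qf q q (Suc m)) + q * q ^ j * (qf q q n / (qf q q (Suc j) * qf q q m))"
    proof -
      have "X * (u + w * v) / ((a * u) * (b * v)) = X / (a * (b * v)) + w * (X / ((a * u) * b))"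
        if "a \<noteq> 0" "b \<noteq> 0" "u \<noteq> 0" "v \<noteq> 0" for X a b u v w :: complex
        using that by (simp add: field_simps)
      then show ?thesis using nz by (simp only: qf_Suc not_False_eq_True)
    qed
    also have "q * q ^ j = q powi k" unfolding k by (simp only: power_int_of_nat power_Suc)
    finally show ?thesis unfolding A B C .
  qed (use qf_nonzero[OF q] in \<open>auto simp: gbinom_def nat_add_distrib\<close>)
qed

lemma gbinom_Suc':
  assumes q: "norm q < 1"
  shows "gbinom q (Suc n) k = gbinom q n k + q powi (int (Suc n) - k) * gbinom q n (k - 1)"
proof -
  have "gbinom q (Suc n) k = gbinom q (Suc n) (int (Suc n) - k)" by (rule gbinom_sym[symmetric])
  also have "\<dots> = gbinom q n (int n - k) + q powi (int (Suc n) - k) * gbinom q n (int n - (k - 1))"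
    unfolding gbinom_Suc[OF q] by (simp add: algebra_simps)
  finally show ?thesis unfolding gbinom_sym .
qed

lemma choose_two_add: "(m + k) choose 2 = (m choose 2) + (k choose 2) + m * k"
proof (induction k)
  case 0 then show ?case by (simp add: numeral_2_eq_2)
next
  case (Suc k) then show ?case by (simp add: Suc_choose_two)
qed

lemma square_eq_choose_two: "n ^ 2 = 2 * (n choose 2) + n"
proof (induction n)
  case 0 then show ?case by (simp add: numeral_2_eq_2)
next
  case (Suc n) then show ?case by (simp add: Suc_choose_two power2_eq_square)
qed

text \<open>The finite identity behind \<open>q_gauss_sum\<close>, by induction on \<open>N\<close>: Pascal's rule
  splits the sum in two, and in \<open>P (m + 1) - c q\<^sup>m P m\<close> only \<open>- x P m\<close> survives, where
  \<open>P m\<close> is the product.\<close>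

lemma q_chu_sum:
  assumes q: "norm q < 1"
  shows "(\<Sum>m\<le>N. gbinom q N (int m) * (-c) ^ (N - m) * (\<Prod>j<m. c * q ^ j - x)) = (-x) ^ N"
proof (induction N)
  case 0
  show ?case by (simp add: gbinom_def)
next
  case (Suc N)
  define P where "P m = (\<Prod>j<m. c * q ^ j - x)" for m
  have P: "P (Suc m) = P m * (c * q ^ m - x)" for m by (simp add: P_def)
  have "(\<Sum>m\<le>Suc N. gbinom q (Suc N) (int m) * (-c) ^ (Suc N - m) * P m)
      = (\<Sum>m\<le>Suc N. gbinom q N (int m - 1) * (-c) ^ (Suc N - m) * P m)
      + (\<Sum>m\<le>Suc N. q ^ m * gbinom q N (int m) * (-c) ^ (Suc N - m) * P m)"
    unfolding gbinom_Suc[OF q] by (simp add: sum.distrib[symmetric] ring_distribs)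
  also have "(\<Sum>m\<le>Suc N. gbinom q N (int m - 1) * (-c) ^ (Suc N - m) * P m)
      = (\<Sum>m\<le>N. gbinom q N (int m) * (-c) ^ (N - m) * P (Suc m))"
    by (subst sum.atMost_Suc_shift) (simp add: gbinom_outside)
  also have "(\<Sum>m\<le>Suc N. q ^ m * gbinom q N (int m) * (-c) ^ (Suc N - m) * P m)
      = (\<Sum>m\<le>N. q ^ m * gbinom q N (int m) * (-c) ^ (Suc N - m) * P m)"
    by (simp add: gbinom_outside)
  also have "\<dots> = (\<Sum>m\<le>N. q ^ m * gbinom q N (int m) * ((-c) * (-c) ^ (N - m)) * P m)"
    by (intro sum.cong refl) (simp add: Suc_diff_le)
  also have "(\<Sum>m\<le>N. gbinom q N (int m) * (-c) ^ (N - m) * P (Suc m)) + \<dots>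
      = (-x) * (\<Sum>m\<le>N. gbinom q N (int m) * (-c) ^ (N - m) * P m)"
    unfolding P by (simp add: sum_distrib_left sum.distrib[symmetric] algebra_simps)
  also have "\<dots> = (-x) ^ Suc N" using Suc by (simp add: P_def)
  finally show ?case by (simp add: P_def)
qed

text \<open>A form of the q-Gauss sum that makes sense for all \<open>c\<close> and \<open>x\<close>. Expand
  \<open>(c q\<^sup>m;q)\<^sub>\<infinity>\<close> by Euler's theorem into a sum over \<open>k\<close> and collect the
  terms with \<open>m + k = N\<close>. By \<open>q_chu_sum\<close> they add up to the \<open>N\<close>-th term of Euler's series
  for \<open>(x;q)\<^sub>\<infinity>\<close>.\<close>

lemma q_gauss_sum:
  assumes q: "norm q < 1"
  shows "((\<lambda>m. (\<Prod>k<m. c * q ^ k - x) * q ^ (m choose 2) * qp (c * q ^ m) q / qf q q m) has_sum qp x q) UNIV"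
proof -
  define P where "P m = (\<Prod>j<m. c * q ^ j - x)" for m
  define F where "F = (\<lambda>(m, k). P m * (q ^ (m choose 2) / qf q q m)
     * ((-1) ^ k * q ^ (k choose 2) * (c * q ^ m) ^ k / qf q q k))"
  define t where "t = norm c + norm x"
  obtain C where C: "C > 0" "\<And>n. norm (1 / qf q q n) \<le> C" using qf_inverse_bound[OF q] by blast
  define g where "g n = C * (norm q ^ (n choose 2) * t ^ n)" for n
  have t0: "t \<ge> 0" by (simp add: t_def)
  have g0: "g n \<ge> 0" for n using C t0 by (simp add: g_def)
  have "g summable_on UNIV"
    unfolding g_def using q t0 by (intro summable_on_cmult_right summable_on_triangular) auto
  then have gg: "(\<lambda>(m, k). g m * g k) summable_on UNIV"
    using summable_on_times[of g UNIV g UNIV] g0 by simp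
  have qle: "norm q ^ m \<le> 1" for m using q by (intro power_le_one) auto
  have Pb: "norm (P m) \<le> t ^ m" for m
  proof -
    have "norm (P m) \<le> (\<Prod>j<m. t)"
      unfolding P_def prod_norm[symmetric]
    proof (intro prod_mono conjI)
      fix j
      have "norm (c * q ^ j - x) \<le> norm c * norm q ^ j + norm x"
        by (metis norm_mult norm_power norm_triangle_ineq4)
      also have "\<dots> \<le> norm c * 1 + norm x" by (intro add_right_mono mult_left_mono qle) auto
      finally show "norm (c * q ^ j - x) \<le> t" by (simp add: t_def)
    qed auto
    then show ?thesis by simp
  qed
  have summ: "F summable_on UNIV"
  proof (rule summable_on_norm_bound[OF gg])
    fix mk :: "nat \<times> nat"
    obtain m k where mk: "mk = (m, k)" by force
    have ck: "norm ((c * q ^ m) ^ k) \<le> t ^ k"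
    proof -
      have "norm (c * q ^ m) \<le> norm c * 1" unfolding norm_mult norm_power by (intro mult_left_mono qle) auto
      also have "\<dots> \<le> t" by (simp add: t_def)
      finally show ?thesis unfolding norm_power by (intro power_mono) auto
    qed
    have "norm (F mk) = norm (1 / qf q q m) * (norm q ^ (m choose 2) * norm (P m))
        * (norm (1 / qf q q k) * (norm q ^ (k choose 2) * norm ((c * q ^ m) ^ k)))"
      by (simp add: F_def mk norm_mult norm_divide norm_power)
    also have "\<dots> \<le> g m * g k"
      unfolding g_def using C t0 Pb ck
      by (intro mult_mono) auto
    finally show "norm (F mk) \<le> (case mk of (m, k) \<Rightarrow> g m * g k)" by (simp add: mk)
  qed
  then obtain S where S: "(F has_sum S) UNIV" by (auto simp: summable_on_def)
  have A: "((\<lambda>m. P m * (q ^ (m choose 2) / qf q q m) * qp (c * q ^ m) q) has_sum S) UNIV"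
  proof (rule has_sum_product_iterated[OF S])
    fix m
    have "((\<lambda>k. P m * (q ^ (m choose 2) / qf q q m) * ((-1) ^ k * q ^ (k choose 2) * (c * q ^ m) ^ k / qf q q k))
        has_sum P m * (q ^ (m choose 2) / qf q q m) * qp (c * q ^ m) q) UNIV"
      by (intro has_sum_cmult_right euler_product_sum q)
    then show "((\<lambda>k. F (m, k)) has_sum P m * (q ^ (m choose 2) / qf q q m) * qp (c * q ^ m) q) UNIV"
      by (simp add: F_def)
  qed
  have "((\<lambda>N. \<Sum>m\<le>N. F (m, N - m)) has_sum S) UNIV"
    using has_sum_fibers[where h = "\<lambda>x. fst x + snd x", OF S] has_sum_antidiagonal[of F] by simp
  moreover have "(\<Sum>m\<le>N. F (m, N - m)) = (-1) ^ N * q ^ (N choose 2) * x ^ N / qf q q N" for N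
  proof -
    have "(\<Sum>m\<le>N. F (m, N - m))
       = (\<Sum>m\<le>N. q ^ (N choose 2) / qf q q N * (gbinom q N (int m) * (-c) ^ (N - m) * P m))"
    proof (intro sum.cong refl)
      fix m assume "m \<in> {..N}"
      then obtain k where k: "N = m + k" by (auto simp: le_iff_add)
      show "F (m, N - m) = q ^ (N choose 2) / qf q q N * (gbinom q N (int m) * (-c) ^ (N - m) * P m)"
        using qf_nonzero[OF q]
        by (simp add: F_def k gbinom_nat choose_two_add power_add power_mult_distrib power_mult[symmetric]
              power_minus[of c] mult.commute)
    qed
    also have "\<dots> = q ^ (N choose 2) / qf q q N * (-x) ^ N"
      unfolding sum_distrib_left[symmetric] P_def q_chu_sum[OF q] ..
    finally show ?thesis by (simp add: power_minus[of x])
  qed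
  ultimately have "((\<lambda>N. (-1) ^ N * q ^ (N choose 2) * x ^ N / qf q q N) has_sum S) UNIV" by simp
  then have "S = qp x q" using euler_product_sum[OF q] has_sum_unique by blast
  then show ?thesis using A by (simp add: P_def)
qed

text \<open>The case \<open>x = 0\<close>, \<open>c = q\<^bsup>D+1\<^esup>\<close> of \<open>q_gauss_sum\<close>.
  Combinatorially, partitions are sorted by their largest Durfee rectangle of shape
  \<open>m \<times> (m + D)\<close>.\<close>

lemma durfee_sum_nat:
  assumes q: "norm q < 1"
  shows "((\<lambda>m. q ^ (m * (m + D)) / (qf q q m * qf q q (m + D))) has_sum (1 / qp q q)) UNIV"
proof -
  have qq: "qp q q \<noteq> 0" using q by (intro qp_nonzero)
  have "((\<lambda>m. (\<Prod>k<m. q ^ Suc D * q ^ k - 0) * q ^ (m choose 2) * qp (q ^ Suc D * q ^ m) q / qf q q m) has_sum qp 0 q) UNIV"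
    by (rule q_gauss_sum[OF q])
  moreover have "(\<Prod>k<m. q ^ Suc D * q ^ k - 0) * q ^ (m choose 2) * qp (q ^ Suc D * q ^ m) q / qf q q m
     = qp q q * (q ^ (m * (m + D)) / (qf q q m * qf q q (m + D)))" for m
  proof -
    have "(\<Prod>k<m. q ^ Suc D * q ^ k - 0) * q ^ (m choose 2) = q ^ (m * (m + D))"
    proof (induction m)
      case (Suc m)
      have "(\<Prod>k<Suc m. q ^ Suc D * q ^ k - 0) * q ^ (Suc m choose 2)
          = ((\<Prod>k<m. q ^ Suc D * q ^ k - 0) * q ^ (m choose 2)) * q ^ (Suc D + m + m)"
        by (simp add: Suc_choose_two power_add mult_ac)
      also have "\<dots> = q ^ (m * (m + D)) * q ^ (Suc D + m + m)" using Suc by simp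
      also have "\<dots> = q ^ (Suc m * (Suc m + D))"
        unfolding power_add[symmetric] by (rule arg_cong[where f = "\<lambda>e. q ^ e"]) simp
      finally show ?case .
    qed (simp add: numeral_2_eq_2)
    moreover have "qp q q = qf q q (m + D) * qp (q ^ Suc D * q ^ m) q"
      using qp_split[OF q, of q "m + D"] by (simp add: power_add mult_ac)
    ultimately show ?thesis using qf_nonzero[OF q, of "m + D"] by (simp add: field_simps)
  qed
  moreover have "qp 0 q = 1" by (simp add: qp_def)
  ultimately have "((\<lambda>m. qp q q * (q ^ (m * (m + D)) / (qf q q m * qf q q (m + D)))) has_sum 1) UNIV"
    by simp
  then have "((\<lambda>m. 1 / qp q q * (qp q q * (q ^ (m * (m + D)) / (qf q q m * qf q q (m + D))))) has_sum 1 / qp q q * 1) UNIV"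
    by (rule has_sum_cmult_right)
  then show ?thesis using qq by simp
qed

lemma durfee_sum:
  assumes q: "norm q < 1"
  shows "((\<lambda>(i, j). q ^ (i * j) / (qf q q i * qf q q j)) has_sum (1 / qp q q)) {x. int (fst x) - int (snd x) = d}"
proof (cases "d \<ge> 0")
  case True
  have "bij_betw (\<lambda>m. (m + nat d, m)) UNIV {x. int (fst x) - int (snd x) = d}"
    using True by (intro bij_betwI[where g = snd]) auto
  from has_sum_reindex_bij_betw[OF this, of "\<lambda>(i, j). q ^ (i * j) / (qf q q i * qf q q j)"]
  show ?thesis using durfee_sum_nat[OF q, of "nat d"] by (simp add: mult_ac)
next
  case False
  have "bij_betw (\<lambda>m. (m, m + nat (-d))) UNIV {x. int (fst x) - int (snd x) = d}"
    using False by (intro bij_betwI[where g = fst]) auto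
  from has_sum_reindex_bij_betw[OF this, of "\<lambda>(i, j). q ^ (i * j) / (qf q q i * qf q q j)"]
  show ?thesis using durfee_sum_nat[OF q, of "nat (-d)"] by (simp add: mult_ac)
qed

lemma has_sum_times:
  fixes f :: "'a \<Rightarrow> complex" and g :: "'b \<Rightarrow> complex"
  assumes f: "(f has_sum a) A" and g: "(g has_sum b) B"
  shows "((\<lambda>(x, y). f x * g y) has_sum (a * b)) (A \<times> B)"
proof (rule has_sum_SigmaI)
  show "((\<lambda>y. case (x, y) of (x, y) \<Rightarrow> f x * g y) has_sum f x * b) B" for x
    using has_sum_cmult_right[OF g, of "f x"] by simp
  show "((\<lambda>x. f x * b) has_sum a * b) A" by (rule has_sum_cmult_left[OF f])
  have "(\<lambda>x. norm (f x)) summable_on A" "(\<lambda>x. norm (g x)) summable_on B"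
    using f g by (auto simp: summable_on_iff_abs_summable_on_complex[symmetric] summable_on_def)
  then have "(\<lambda>(x, y). norm (f x) * norm (g y)) summable_on A \<times> B"
    by (intro summable_on_times) auto
  then show "(\<lambda>(x, y). f x * g y) summable_on A \<times> B"
    by (rule summable_on_norm_bound) (auto simp: norm_mult)
qed

lemma norm_power2_less_1: "norm (p::complex) < 1 \<Longrightarrow> norm (p ^ 2) < 1"
  by (simp add: norm_power power_less_one_iff)

lemma euler_square_sum:
  assumes p: "norm p < 1"
  shows "((\<lambda>i. p ^ (i ^ 2) * z ^ i / qf (p ^ 2) (p ^ 2) i) has_sum qp (- p * z) (p ^ 2)) UNIV"
proof -
  have "((\<lambda>n. (-1) ^ n * (p ^ 2) ^ (n choose 2) * (- p * z) ^ n / qf (p ^ 2) (p ^ 2) n) has_sum qp (- p * z) (p ^ 2)) UNIV"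
    by (rule euler_product_sum[OF norm_power2_less_1[OF p]])
  moreover have "(-1) ^ n * (p ^ 2) ^ (n choose 2) * (- p * z) ^ n = p ^ (n ^ 2) * z ^ n" for n
  proof -
    have "(-1) ^ n * (- p * z) ^ n = (p * z) ^ n" by (simp flip: power_mult_distrib)
    then show ?thesis
      by (simp add: square_eq_choose_two power_mult_distrib power_add power_mult mult_ac)
  qed
  ultimately show ?thesis by simp
qed

text \<open>Expand both products by Euler's theorem and sum along the diagonals \<open>i - j = d\<close>:
  there \<open>i\<^sup>2 + j\<^sup>2 = d\<^sup>2 + 2 i j\<close>, so that the Durfee sum evaluates every
  diagonal.\<close>

theorem jacobi_triple_product:
  assumes p: "norm p < 1" "p \<noteq> 0" and z: "z \<noteq> 0"
  shows "((\<lambda>n::int. p powi (n ^ 2) * z powi n) has_sum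
            qp (p ^ 2) (p ^ 2) * qp (- p * z) (p ^ 2) * qp (- p / z) (p ^ 2)) UNIV"
proof -
  define q where "q = p ^ 2"
  have q: "norm q < 1" using norm_power2_less_1[OF p(1)] by (simp add: q_def)
  define a where "a i w = p ^ (i ^ 2) * w ^ i / qf q q i" for i w
  have "((\<lambda>(i, j). a i z * a j (1 / z)) has_sum (qp (- p * z) q * qp (- p / z) q)) UNIV"
    using has_sum_times[OF euler_square_sum[OF p(1), of z] euler_square_sum[OF p(1), of "1 / z"]]
    by (simp add: a_def q_def)
  note prod = this
  have fib: "((\<lambda>(i, j). a i z * a j (1 / z)) has_sum p powi (d ^ 2) * z powi d * (1 / qp q q))
      {x \<in> UNIV. int (fst x) - int (snd x) = d}" for d
  proof -
    have "((\<lambda>x. p powi (d ^ 2) * z powi d * (case x of (i, j) \<Rightarrow> q ^ (i * j) / (qf q q i * qf q q j)))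
       has_sum p powi (d ^ 2) * z powi d * (1 / qp q q)) {x. int (fst x) - int (snd x) = d}"
      by (intro has_sum_cmult_right durfee_sum q)
    also have "?this \<longleftrightarrow> ((\<lambda>(i, j). a i z * a j (1 / z)) has_sum p powi (d ^ 2) * z powi d * (1 / qp q q)) {x. int (fst x) - int (snd x) = d}"
    proof (rule has_sum_cong)
      fix x assume "x \<in> {x. int (fst x) - int (snd x) = d}"
      then obtain i j where x: "x = (i, j)" and d: "int i - int j = d" by (cases x) auto
      have "p powi (d ^ 2) * q ^ (i * j) = p powi (d ^ 2) * p powi (2 * int i * int j)"
        by (simp add: q_def power_mult[symmetric] power_int_def nat_mult_distrib mult.assoc)
      also have "\<dots> = p powi (d ^ 2 + 2 * int i * int j)" using p by (simp add: power_int_add)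
      also have "d ^ 2 + 2 * int i * int j = int (i ^ 2 + j ^ 2)"
        unfolding d[symmetric] by (simp add: power2_eq_square algebra_simps)
      also have "p powi \<dots> = p ^ (i ^ 2) * p ^ (j ^ 2)" by (simp only: power_int_of_nat power_add)
      finally have 1: "p powi (d ^ 2) * q ^ (i * j) = p ^ (i ^ 2) * p ^ (j ^ 2)" .
      have 2: "z powi d = z ^ i * (1 / z) ^ j"
        using z d[symmetric] by (simp add: power_int_diff power_divide)
      have "p powi (d ^ 2) * z powi d * (q ^ (i * j) / (qf q q i * qf q q j))
          = (p powi (d ^ 2) * q ^ (i * j)) * z powi d / (qf q q i * qf q q j)" by simp
      also have "\<dots> = a i z * a j (1 / z)" unfolding 1 2 a_def by simp
      finally show "p powi (d ^ 2) * z powi d * (case x of (i, j) \<Rightarrow> q ^ (i * j) / (qf q q i * qf q q j))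
          = (case x of (i, j) \<Rightarrow> a i z * a j (1 / z))" by (simp add: x)
    qed
    finally show ?thesis by simp
  qed
  have "((\<lambda>d. p powi (d ^ 2) * z powi d * (1 / qp q q)) has_sum (qp (- p * z) q * qp (- p / z) q)) UNIV"
    by (rule has_sum_fibers[OF prod fib])
  from has_sum_cmult_right[OF this, of "qp q q"] show ?thesis
    using qp_nonzero[OF q q] by (simp add: q_def mult_ac)
qed

text \<open>Durfee rectangles with the extra factor \<open>q\<^bsup>- n j\<^esup>\<close>, which comes from
  a neighbour with value \<open>n\<close> in the chain. Induct on \<open>n\<close>: writing \<open>1\<close> as
  \<open>q\<^sup>j + (1 - q\<^sup>j)\<close>, the first part turns \<open>n + 1\<close> into \<open>n\<close>, and in the second
  the factor cancels against \<open>(q;q)\<^sub>j\<close>, which moves the sum to the diagonal \<open>d + 1\<close>.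
  The recursion so obtained is Pascal's rule for the right-hand side.\<close>

lemma durfee_shifted_sum:
  assumes q: "norm q < 1" "q \<noteq> 0"
  shows "((\<lambda>(i, j). q powi (int i * int j - int n * int j) / (qf q q i * qf q q j)) has_sum
          1 / qp q q * (\<Sum>k\<le>n. gbinom q n (int k) * q powi (int k * d - int k * (int n - int k))))
         {x. int (fst x) - int (snd x) = d}"
proof (induction n arbitrary: d)
  case 0
  have "q powi (int i * int j) = q ^ (i * j)" for i j
    by (metis of_nat_mult power_int_of_nat)
  then show ?case using durfee_sum[OF q(1), of d] by (simp add: gbinom_def)
next
  case (Suc n)
  define S where "S d = {x :: nat \<times> nat. int (fst x) - int (snd x) = d}" for d
  define T where "T n = (\<lambda>(i, j). q powi (int i * int j - int n * int j) / (qf q q i * qf q q j))" for n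
  define D where "D n d = 1 / qp q q * (\<Sum>k\<le>n. gbinom q n (int k) * q powi (int k * d - int k * (int n - int k)))" for n :: nat and d
  have IH: "(T n has_sum D n d) (S d)" for d
    using Suc unfolding T_def S_def D_def .
  define U where "U = (\<lambda>(i, j). if j = 0 then 0 else q powi (int i * int j - int (Suc n) * int j) / (qf q q i * qf q q (j - 1)))"
  have U: "(U has_sum q powi (d - int n) * D n (d + 1)) (S d)"
  proof -
    define g where "g = (\<lambda>(i, j :: nat). (i :: nat, Suc j))"
    have "((\<lambda>x. q powi (d - int n) * T n x) has_sum q powi (d - int n) * D n (d + 1)) (S (d + 1))"
      by (intro has_sum_cmult_right IH)
    also have "?this \<longleftrightarrow> ((U \<circ> g) has_sum q powi (d - int n) * D n (d + 1)) (S (d + 1))"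
    proof (rule has_sum_cong)
      fix x assume "x \<in> S (d + 1)"
      then obtain i j where x: "x = (i, j)" and d: "d = int i - int j - 1" by (cases x) (auto simp: S_def)
      have "int i * int (Suc j) - int (Suc n) * int (Suc j) = (d - int n) + (int i * int j - int n * int j)"
        unfolding d by (simp add: algebra_simps)
      note e = this
      have "q powi (int i * int (Suc j) - int (Suc n) * int (Suc j))
          = q powi (d - int n) * q powi (int i * int j - int n * int j)"
        unfolding e by (rule power_int_add) (use q in simp)
      then show "q powi (d - int n) * T n x = (U \<circ> g) x"
        by (simp add: x U_def g_def T_def del: of_nat_Suc)
    qed
    also have "\<dots> \<longleftrightarrow> (U has_sum q powi (d - int n) * D n (d + 1)) (g ` S (d + 1))"
      by (rule has_sum_reindex[symmetric]) (auto simp: inj_on_def g_def)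
    also have "\<dots> \<longleftrightarrow> (U has_sum q powi (d - int n) * D n (d + 1)) (S d)"
    proof (rule has_sum_cong_neutral)
      fix x assume x: "x \<in> S d - g ` S (d + 1)"
      obtain i j where ij: "x = (i, j)" by force
      have "j = 0"
      proof (rule ccontr)
        assume "j \<noteq> 0"
        then have "x = g (i, j - 1)" "(i, j - 1) \<in> S (d + 1)" using x by (auto simp: g_def ij S_def)
        then show False using x by blast
      qed
      then show "U x = 0" by (simp add: U_def ij)
    qed (auto simp: S_def g_def)
    finally show ?thesis .
  qed
  have step: "T (Suc n) x = T n x + U x" for x
  proof -
    obtain i j where ij: "x = (i, j)" by force
    show ?thesis
    proof (cases j)
      case 0 then show ?thesis by (simp add: T_def U_def ij)
    next
      case (Suc j')
      define E where "E = q powi (int i * int j - int (Suc n) * int j)"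
      have e: "int i * int j - int n * int j = (int i * int j - int (Suc n) * int j) + int j"
        by (simp add: algebra_simps)
      have "q powi (int i * int j - int n * int j) = E * q powi int j"
        unfolding e E_def by (rule power_int_add) (use q in simp)
      then have 1: "q powi (int i * int j - int n * int j) = E * (q * q ^ j')"
        by (simp only: Suc power_int_of_nat power_Suc)
      have nz: "qf q q j' \<noteq> 0" "qf q q i \<noteq> 0" "1 - q * q ^ j' \<noteq> 0"
        using qf_nonzero[OF q(1)] qf_step_nonzero[OF q(1)] by blast+
      have gen: "E / (a * (b * (1 - w))) = E * w / (a * (b * (1 - w))) + E / (a * b)"
        if "a \<noteq> 0" "b \<noteq> 0" "1 - w \<noteq> 0" for a b w
        using that by (simp add: divide_simps) (simp add: algebra_simps)
      have "T (Suc n) x = E / (qf q q i * (qf q q j' * (1 - q * q ^ j')))"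
        by (simp add: T_def ij E_def Suc qf_Suc)
      also have "\<dots> = E * (q * q ^ j') / (qf q q i * (qf q q j' * (1 - q * q ^ j'))) + E / (qf q q i * qf q q j')"
        by (rule gen) (use nz in auto)
      also have "\<dots> = T n x + U x"
        unfolding T_def U_def ij prod.case 1 by (simp add: Suc qf_Suc E_def del: of_nat_Suc)
      finally show ?thesis .
    qed
  qed
  have "(T (Suc n) has_sum D n d + q powi (d - int n) * D n (d + 1)) (S d)"
    unfolding step by (intro has_sum_add IH U)
  moreover have "D n d + q powi (d - int n) * D n (d + 1) = D (Suc n) d"
  proof -
    have padd: "q powi (a + b) = q powi a * q powi b" for a b
      using q by (simp add: power_int_add)
    let ?e = "\<lambda>n k. int k * d - int k * (int n - int k)"
    have "(\<Sum>k\<le>Suc n. gbinom q (Suc n) (int k) * q powi ?e (Suc n) k)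
        = (\<Sum>k\<le>Suc n. gbinom q n (int k - 1) * q powi ?e (Suc n) k)
        + (\<Sum>k\<le>Suc n. q powi int k * gbinom q n (int k) * q powi ?e (Suc n) k)"
      unfolding gbinom_Suc[OF q(1)] by (simp only: sum.distrib[symmetric] ring_distribs)
    also have "(\<Sum>k\<le>Suc n. gbinom q n (int k - 1) * q powi ?e (Suc n) k)
        = (\<Sum>k\<le>n. gbinom q n (int k) * q powi ?e (Suc n) (Suc k))"
      by (subst sum.atMost_Suc_shift) (simp add: gbinom_outside)
    also have "\<dots> = (\<Sum>k\<le>n. q powi (d - int n) * (gbinom q n (int k) * q powi (int k * (d + 1) - int k * (int n - int k))))"
    proof (intro sum.cong refl)
      fix k
      have e: "?e (Suc n) (Suc k) = (d - int n) + (int k * (d + 1) - int k * (int n - int k))"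
        by (simp add: algebra_simps)
      show "gbinom q n (int k) * q powi ?e (Suc n) (Suc k)
         = q powi (d - int n) * (gbinom q n (int k) * q powi (int k * (d + 1) - int k * (int n - int k)))"
        unfolding e padd by simp
    qed
    also have "(\<Sum>k\<le>Suc n. q powi int k * gbinom q n (int k) * q powi ?e (Suc n) k)
        = (\<Sum>k\<le>n. q powi int k * gbinom q n (int k) * q powi ?e (Suc n) k)"
      by (simp add: gbinom_outside)
    also have "\<dots> = (\<Sum>k\<le>n. gbinom q n (int k) * q powi ?e n k)"
    proof (intro sum.cong refl)
      fix k
      have e: "?e n k = int k + ?e (Suc n) k" by (simp add: algebra_simps)
      show "q powi int k * gbinom q n (int k) * q powi ?e (Suc n) k = gbinom q n (int k) * q powi ?e n k"
        unfolding e padd by simp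
    qed
    finally show ?thesis
      unfolding D_def sum_distrib_left[symmetric] by (simp add: algebra_simps)
  qed
  ultimately show ?case unfolding T_def S_def D_def by simp
qed

text \<open>The q-binomial theorem, from the second Pascal rule.\<close>

lemma finite_q_binomial:
  assumes q: "norm q < 1"
  shows "qf z q n = (\<Sum>l\<le>n. gbinom q n (int l) * (-z) ^ l * q ^ (l choose 2))"
proof (induction n)
  case 0
  show ?case by (simp add: gbinom_def numeral_2_eq_2)
next
  case (Suc n)
  have "(\<Sum>l\<le>Suc n. gbinom q (Suc n) (int l) * (-z) ^ l * q ^ (l choose 2))
    = (\<Sum>l\<le>Suc n. gbinom q n (int l) * (-z) ^ l * q ^ (l choose 2))
    + (\<Sum>l\<le>Suc n. q powi (int (Suc n) - int l) * gbinom q n (int l - 1) * (-z) ^ l * q ^ (l choose 2))"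
    unfolding gbinom_Suc'[OF q] by (simp only: sum.distrib[symmetric] ring_distribs)
  also have "(\<Sum>l\<le>Suc n. gbinom q n (int l) * (-z) ^ l * q ^ (l choose 2)) = qf z q n"
    unfolding Suc by (simp add: gbinom_outside)
  also have "(\<Sum>l\<le>Suc n. q powi (int (Suc n) - int l) * gbinom q n (int l - 1) * (-z) ^ l * q ^ (l choose 2))
     = (\<Sum>l\<le>n. q powi (int n - int l) * gbinom q n (int l) * (-z) ^ Suc l * q ^ (Suc l choose 2))"
    by (subst sum.atMost_Suc_shift) (simp add: gbinom_outside)
  also have "\<dots> = (\<Sum>l\<le>n. - z * q ^ n * (gbinom q n (int l) * (-z) ^ l * q ^ (l choose 2)))"
  proof (intro sum.cong refl)
    fix l assume l: "l \<in> {..n}"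
    have "q powi (int n - int l) * q ^ l = q ^ n"
      using l by (simp add: power_int_def nat_diff_distrib flip: power_add)
    then have "q powi (int n - int l) * gbinom q n (int l) * (-z) ^ Suc l * q ^ (Suc l choose 2)
       = - z * (q powi (int n - int l) * q ^ l) * (gbinom q n (int l) * (-z) ^ l * q ^ (l choose 2))"
      by (simp add: Suc_choose_two power_add mult_ac)
    also have "q powi (int n - int l) * q ^ l = q ^ n" by fact
    finally show "q powi (int n - int l) * gbinom q n (int l) * (-z) ^ Suc l * q ^ (Suc l choose 2)
        = - z * q ^ n * (gbinom q n (int l) * (-z) ^ l * q ^ (l choose 2))" .
  qed
  also have "\<dots> = - z * q ^ n * qf z q n" unfolding Suc sum_distrib_left ..
  finally show ?case by (simp add: qf_Suc algebra_simps)
qed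

text \<open>Pulling \<open>n\<close> factors out of the product at \<open>z q\<^bsup>-n\<^esup>\<close> and turning
  each of them around.\<close>

lemma qp_reflect:
  assumes q: "norm q < 1" "q \<noteq> 0" and z: "z \<noteq> 0"
  shows "qp (z * q powi (- int n)) q = (-z) ^ n * q powi (- int (Suc n choose 2)) * qf (q / z) q n * qp z q"
proof (induction n)
  case 0
  show ?case by (simp add: numeral_2_eq_2)
next
  case (Suc n)
  have "q powi (- int (Suc n)) * q powi 1 = q powi (- int n)"
    by (subst power_int_add[symmetric]) (use q in auto)
  then have "q powi (- int (Suc n)) * q = q powi (- int n)" by (simp only: power_int_1_right)
  then have "qp (z * q powi (- int (Suc n))) q = (1 - z * q powi (- int (Suc n))) * qp (z * q powi (- int n)) q"
    using qp_step[OF q(1), of "z * q powi (- int (Suc n))"] by (simp add: mult.assoc)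
  also have "1 - z * q powi (- int (Suc n)) = - z * q powi (- int (Suc n)) * (1 - q / z * q ^ n)"
  proof -
    have "q powi (- int (Suc n)) * q powi int (Suc n) = 1"
      by (subst power_int_add[symmetric]) (use q in auto)
    then have "q powi (- int (Suc n)) * (q * q ^ n) = 1" by (simp only: power_int_of_nat power_Suc)
    then have "z * q powi (- int (Suc n)) * (q / z * q ^ n) = 1"
      using z by (simp del: of_nat_Suc)
    then show ?thesis by (simp only: right_diff_distrib) simp
  qed
  also have "- z * q powi (- int (Suc n)) * (1 - q / z * q ^ n) * qp (z * q powi (- int n)) q
      = (-z) ^ Suc n * (q powi (- int (Suc n)) * q powi (- int (Suc n choose 2))) * qf (q / z) q (Suc n) * qp z q"
    unfolding Suc qf_Suc by (simp only: power_Suc mult_ac)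
  also have "q powi (- int (Suc n)) * q powi (- int (Suc n choose 2)) = q powi (- int (Suc (Suc n) choose 2))"
    unfolding Suc_choose_two[of "Suc n"] of_nat_add minus_add_distrib
    by (rule power_int_add[symmetric]) (use q in simp)
  finally show ?case .
qed

section \<open>Summing the ends of the chain\<close>

lemma summable_on_inj_compose:
  fixes f :: "'a \<Rightarrow> real"
  assumes "f summable_on UNIV" "inj h"
  shows "(\<lambda>x. f (h x)) summable_on UNIV"
proof -
  have "f summable_on range h" by (rule summable_on_subset_banach[OF assms(1)]) auto
  then show ?thesis using summable_on_reindex[OF assms(2), of f] by (simp add: o_def)
qed

text \<open>The exponents of \<open>q\<close> in the reduced sums are quarters of integers. The variable is
  therefore \<open>x = q\<^bsup>1/4\<^esup>\<close>, and all powers are written as integral powers of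
  \<open>x\<close>.\<close>

locale nome =
  fixes x :: complex
  assumes x_nonzero: "x \<noteq> 0" and norm_x: "norm x < 1"
begin

definition p where "p = x ^ 2"
definition q where "q = x ^ 4"

lemma norm_q: "norm q < 1" and norm_p: "norm p < 1" and q_nonzero: "q \<noteq> 0" and p_nonzero: "p \<noteq> 0"
  using x_nonzero norm_x by (auto simp: p_def q_def norm_power power_less_one_iff)

lemma p_squared: "p ^ 2 = q"
  by (simp add: p_def q_def)

lemma q_powi: "q powi e = x powi (4 * e)" and p_powi: "p powi e = x powi (2 * e)"
  by (simp_all add: p_def q_def power_int_mult)

lemma x_powi_add: "x powi (a + b) = x powi a * x powi b"
  using x_nonzero by (simp add: power_int_add)

text \<open>Majorants: all summability statements about chains compare with products of
  these.\<close>

definition sq :: "int \<Rightarrow> real" where "sq m = norm x powi (m ^ 2)"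

lemma sq_summable: "sq summable_on UNIV"
proof -
  have "((\<lambda>n::int. x powi (n ^ 2) * 1 powi n) has_sum
            qp (x ^ 2) (x ^ 2) * qp (- x * 1) (x ^ 2) * qp (- x / 1) (x ^ 2)) UNIV"
    by (intro jacobi_triple_product norm_x x_nonzero) auto
  then have "(\<lambda>n::int. x powi (n ^ 2)) summable_on UNIV" by (auto simp: summable_on_def)
  then have "(\<lambda>n::int. norm (x powi (n ^ 2))) summable_on UNIV"
    by (simp add: summable_on_iff_abs_summable_on_complex)
  then show ?thesis by (simp add: sq_def[abs_def] norm_power_int)
qed

lemma sq_nonneg: "sq m \<ge> 0" by (simp add: sq_def)

lemma sq_add: "sq a * sq b = norm x powi (a ^ 2 + b ^ 2)"
  using x_nonzero by (simp add: sq_def power_int_add)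

lemma norm_powi_le: "m \<le> n \<Longrightarrow> norm x powi n \<le> norm x powi m"
  using x_nonzero norm_x by (intro power_int_decreasing) auto

lemma sq2_summable: "(\<lambda>(a, b). sq a * sq b) summable_on UNIV"
  using summable_on_times[OF sq_summable sq_summable sq_nonneg sq_nonneg] by simp

lemma sq3_summable: "(\<lambda>(a, b, c). sq a * (sq b * sq c)) summable_on UNIV"
proof -
  have "0 \<le> (case y of (a, b) \<Rightarrow> sq a * sq b)" for y
    by (auto simp: sq_nonneg split: prod.splits)
  from summable_on_times[OF sq_summable sq2_summable sq_nonneg this]
  show ?thesis by (simp add: case_prod_unfold)
qed

lemma sq4_summable: "(\<lambda>(a, b, c, d). sq a * (sq b * (sq c * sq d))) summable_on UNIV"
proof -
  have "0 \<le> (case y of (a, b, c) \<Rightarrow> sq a * (sq b * sq c))" for y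
    by (auto simp: sq_nonneg split: prod.splits)
  from summable_on_times[OF sq_summable sq3_summable sq_nonneg this]
  show ?thesis by (simp add: case_prod_unfold)
qed

lemma sq5_summable: "(\<lambda>(a, b, c, d, e). sq a * (sq b * (sq c * (sq d * sq e)))) summable_on UNIV"
proof -
  have "0 \<le> (case y of (a, b, c, d) \<Rightarrow> sq a * (sq b * (sq c * sq d)))" for y
    by (auto simp: sq_nonneg split: prod.splits)
  from summable_on_times[OF sq_summable sq4_summable sq_nonneg this]
  show ?thesis by (simp add: case_prod_unfold)
qed

end

lemma has_sum_finite_sum:
  fixes f :: "'i \<Rightarrow> 'a \<Rightarrow> complex"
  assumes "finite I" "\<And>i. i \<in> I \<Longrightarrow> (f i has_sum s i) B"
  shows "((\<lambda>z. \<Sum>i\<in>I. f i z) has_sum (\<Sum>i\<in>I. s i)) B"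
  using assms by (induction I rule: finite_induct) (auto intro!: has_sum_add)

context nome
begin

text \<open>The theta series that remains when the two nodes at the end of the chain are summed.
  Shifting \<open>d\<close> shows that only the parity of \<open>s\<close> matters, which is what splits the
  evaluations in two.\<close>

definition A :: "int \<Rightarrow> complex" where "A s = (\<Sum>\<^sub>\<infinity>d::int. x powi ((2 * d + s) ^ 2))"

lemma A_has_sum: "((\<lambda>d::int. x powi ((2 * d + s) ^ 2)) has_sum A s) UNIV"
proof -
  have "sq summable_on range (\<lambda>d. 2 * d + s)"
    by (rule summable_on_subset_banach[OF sq_summable]) auto
  then have "(\<lambda>d. sq (2 * d + s)) summable_on UNIV"
    using summable_on_reindex[of "\<lambda>d. 2 * d + s" UNIV sq] by (simp add: o_def inj_on_def)
  then have "(\<lambda>d::int. x powi ((2 * d + s) ^ 2)) summable_on UNIV"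
    by (rule summable_on_norm_bound) (simp add: sq_def norm_power_int)
  then show ?thesis unfolding A_def by (rule has_sum_infsum)
qed

lemma A_periodic: "A (s + 2 * k) = A s"
proof -
  have "bij_betw (\<lambda>d::int. d + k) UNIV UNIV"
    by (rule bij_betwI[where g = "\<lambda>d. d - k"]) auto
  from has_sum_reindex_bij_betw[OF this, of "\<lambda>d. x powi ((2 * d + s) ^ 2)" "A s"]
  have "((\<lambda>d. x powi ((2 * (d + k) + s) ^ 2)) has_sum A s) UNIV" using A_has_sum by simp
  then have "((\<lambda>d. x powi ((2 * d + (s + 2 * k)) ^ 2)) has_sum A s) UNIV" by (simp add: algebra_simps)
  then show ?thesis using A_has_sum has_sum_unique by blast
qed

lemma A_parity: "A s = (if even s then A 0 else A 1)"
  using A_periodic[of 0 "s div 2"] A_periodic[of 1 "s div 2"]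
  by (auto elim!: evenE oddE simp: add.commute)

lemma A_bound: obtains M where "M > 0" "\<And>s. norm (A s) \<le> M"
proof
  show "norm (A s) \<le> norm (A 0) + norm (A 1) + 1" for s
    by (subst A_parity) auto
qed (smt (verit) norm_ge_zero)

lemma qf_q_bound:
  obtains C where "C > 0" "\<And>n. norm (1 / qf q q n) \<le> C"
  using qf_inverse_bound[OF norm_q] by blast

lemma chain_end_summable:
  "(\<lambda>(a, b). p powi (int a ^ 2 + (int a - int b) ^ 2 + (int b - c) ^ 2) / (qf q q a * qf q q b)) summable_on UNIV"
proof -
  obtain C where C: "C > 0" "\<And>n. norm (1 / qf q q n) \<le> C" using qf_q_bound by blast
  define h where "h = (\<lambda>(a :: nat, b :: nat). (int a, int a - int b))"
  have "inj h" by (auto simp: inj_def h_def)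
  from summable_on_inj_compose[OF sq2_summable this]
  have "(\<lambda>z. C * C * (case h z of (a, b) \<Rightarrow> sq a * sq b)) summable_on UNIV"
    by (intro summable_on_cmult_right)
  then show ?thesis
  proof (rule summable_on_norm_bound)
    fix z :: "nat \<times> nat"
    obtain a b where z: "z = (a, b)" by force
    let ?e = "int a ^ 2 + (int a - int b) ^ 2 + (int b - c) ^ 2"
    have "norm (p powi ?e / (qf q q a * qf q q b))
        = (norm (1 / qf q q a) * norm (1 / qf q q b)) * norm x powi (2 * ?e)"
      by (simp add: norm_divide norm_mult p_powi norm_power_int)
    also have "\<dots> \<le> (C * C) * (norm x powi (int a ^ 2 + (int a - int b) ^ 2))"
      using C by (intro mult_mono norm_powi_le) auto
    finally show "norm (case z of (a, b) \<Rightarrow> p powi (int a ^ 2 + (int a - int b) ^ 2 + (int b - c) ^ 2) / (qf q q a * qf q q b))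
        \<le> C * C * (case h z of (a, b) \<Rightarrow> sq a * sq b)"
      by (simp add: z h_def sq_add)
  qed
qed

text \<open>On the diagonal \<open>a - b = d\<close> the exponent is
  \<open>d\<^sup>2 + c\<^sup>2/2 + a b - c b\<close> in terms of \<open>q\<close>, so that \<open>durfee_shifted_sum\<close>
  applies with \<open>n = c\<close>. In the \<open>s\<close>-th term of its value, completing the square in \<open>d\<close>
  leaves the summand of \<open>A s\<close>.\<close>

lemma chain_end_sum:
  "((\<lambda>(a, b). p powi (int a ^ 2 + (int a - int b) ^ 2 + (int b - int c) ^ 2) / (qf q q a * qf q q b))
     has_sum 1 / qp q q * (\<Sum>s\<le>c. gbinom q c (int s) * (x powi (int s ^ 2 + 2 * (int c - int s) ^ 2) * A (int s)))) UNIV"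
proof -
  define F where "F = (\<lambda>(a, b). p powi (int a ^ 2 + (int a - int b) ^ 2 + (int b - int c) ^ 2) / (qf q q a * qf q q b))"
  obtain S where S: "(F has_sum S) UNIV"
    using chain_end_summable[of "int c"] by (auto simp: summable_on_def F_def)
  define G where "G d = q powi (d ^ 2) * p powi (int c ^ 2) *
     (1 / qp q q * (\<Sum>k\<le>c. gbinom q c (int k) * q powi (int k * d - int k * (int c - int k))))" for d
  have fib: "(F has_sum G d) {z \<in> UNIV. int (fst z) - int (snd z) = d}" for d
  proof -
    have "((\<lambda>z. q powi (d ^ 2) * p powi (int c ^ 2) *
        (case z of (i, j) \<Rightarrow> q powi (int i * int j - int c * int j) / (qf q q i * qf q q j))) has_sum G d)
        {z. int (fst z) - int (snd z) = d}"
      unfolding G_def by (intro has_sum_cmult_right durfee_shifted_sum norm_q q_nonzero)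
    also have "?this \<longleftrightarrow> (F has_sum G d) {z. int (fst z) - int (snd z) = d}"
    proof (rule has_sum_cong)
      fix z assume "z \<in> {z. int (fst z) - int (snd z) = d}"
      then obtain i j where z: "z = (i, j)" and d: "int i = int j + d" by (cases z) auto
      have "2 * (int i ^ 2 + (int i - int j) ^ 2 + (int j - int c) ^ 2)
          = 4 * d ^ 2 + 2 * int c ^ 2 + 4 * (int i * int j - int c * int j)"
        unfolding d by (simp add: power2_eq_square algebra_simps)
      then have "p powi (int i ^ 2 + (int i - int j) ^ 2 + (int j - int c) ^ 2)
          = q powi (d ^ 2) * p powi (int c ^ 2) * q powi (int i * int j - int c * int j)"
        unfolding q_powi p_powi x_powi_add[symmetric] by simp
      then show "q powi (d ^ 2) * p powi (int c ^ 2) *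
        (case z of (i, j) \<Rightarrow> q powi (int i * int j - int c * int j) / (qf q q i * qf q q j)) = F z"
        by (simp add: z F_def)
    qed
    finally show ?thesis by simp
  qed
  have "(G has_sum S) UNIV" by (rule has_sum_fibers[OF S fib])
  moreover have "(G has_sum 1 / qp q q * (\<Sum>s\<le>c. gbinom q c (int s) * (x powi (int s ^ 2 + 2 * (int c - int s) ^ 2) * A (int s)))) UNIV"
  proof -
    have "((\<lambda>d. 1 / qp q q * (\<Sum>s\<le>c. gbinom q c (int s) * (x powi (2 * (int c - int s) ^ 2 + int s ^ 2 ) * x powi ((2 * d + int s) ^ 2))))
       has_sum 1 / qp q q * (\<Sum>s\<le>c. gbinom q c (int s) * (x powi (2 * (int c - int s) ^ 2 + int s ^ 2) * A (int s)))) UNIV"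
      by (intro has_sum_cmult_right has_sum_finite_sum A_has_sum) auto
    also have "(\<lambda>d. 1 / qp q q * (\<Sum>s\<le>c. gbinom q c (int s) * (x powi (2 * (int c - int s) ^ 2 + int s ^ 2) * x powi ((2 * d + int s) ^ 2)))) = G"
    proof
      fix d
      have e: "q powi (d ^ 2) * p powi (int c ^ 2) * q powi (int k * d - int k * (int c - int k))
         = x powi (2 * (int c - int k) ^ 2 + int k ^ 2) * x powi ((2 * d + int k) ^ 2)" for k
      proof -
        have "4 * d ^ 2 + 2 * int c ^ 2 + 4 * (int k * d - int k * (int c - int k))
           = 2 * (int c - int k) ^ 2 + int k ^ 2 + (2 * d + int k) ^ 2"
          by (simp add: power2_eq_square algebra_simps)
        then show ?thesis unfolding q_powi p_powi x_powi_add[symmetric] by simp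
      qed
      have "G d = 1 / qp q q * (\<Sum>k\<le>c. gbinom q c (int k) * (q powi (d ^ 2) * p powi (int c ^ 2) * q powi (int k * d - int k * (int c - int k))))"
        by (simp add: G_def sum_distrib_left mult_ac)
      then show "1 / qp q q * (\<Sum>s\<le>c. gbinom q c (int s) * (x powi (2 * (int c - int s) ^ 2 + int s ^ 2) * x powi ((2 * d + int s) ^ 2))) = G d"
        unfolding e by simp
    qed
    finally show ?thesis by (simp add: add.commute)
  qed
  ultimately show ?thesis using S has_sum_unique unfolding F_def by blast
qed

lemma powi_square_nat: "z powi (int e ^ 2) = z ^ (e ^ 2)" for z :: complex
  by (metis of_nat_power power_int_of_nat)

lemma p_powi_add: "p powi (a + b) = p powi a * p powi b"
  using p_nonzero by (simp add: power_int_add)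

text \<open>After expanding \<open>(d - e)\<^sup>2\<close> this is Euler's series at
  \<open>- p q\<^bsup>-d\<^esup>\<close>.\<close>

lemma chain_last_sum:
  "((\<lambda>e. p powi ((int d - int e) ^ 2) / qf q q e) has_sum qp (-p) q * qf (-p) q d) UNIV"
proof -
  define z where "z = q powi (- int d)"
  have z: "z = p powi (- 2 * int d)" by (simp add: z_def q_powi p_powi)
  have "((\<lambda>i. p powi (int d ^ 2) * (p ^ (i ^ 2) * z ^ i / qf (p ^ 2) (p ^ 2) i)) has_sum
      p powi (int d ^ 2) * qp (- p * z) (p ^ 2)) UNIV"
    by (intro has_sum_cmult_right euler_square_sum norm_p)
  moreover have "p powi (int d ^ 2) * (p ^ (i ^ 2) * z ^ i) = p powi ((int d - int i) ^ 2)" for i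
  proof -
    have "z ^ i = p powi (- 2 * int d * int i)"
      unfolding z power_int_of_nat[symmetric] power_int_mult ..
    moreover have "(int d - int i) ^ 2 = int d ^ 2 + (int i ^ 2 + (- 2 * int d * int i))"
      by (simp add: power2_eq_square algebra_simps)
    ultimately show ?thesis by (simp only: p_powi_add powi_square_nat)
  qed
  moreover have "p powi (int d ^ 2) * qp (- p * z) q = qp (-p) q * qf (-p) q d"
  proof -
    have "qp (- p * z) q = p ^ d * q powi (- int (Suc d choose 2)) * qf (q / (- p)) q d * qp (- p) q"
      unfolding z_def by (subst qp_reflect) (use norm_q q_nonzero p_nonzero in auto)
    moreover have "q / (- p) = - p" using p_nonzero by (simp add: p_squared[symmetric] power2_eq_square)
    moreover have "p powi (int d ^ 2) * (p ^ d * q powi (- int (Suc d choose 2))) = 1"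
    proof -
      have "int d ^ 2 + (int d + 2 * (- int (Suc d choose 2))) = 0"
        using arg_cong[OF square_eq_choose_two[of d], of int] by (simp add: Suc_choose_two)
      moreover have "p ^ d = p powi int d" "q powi (- int (Suc d choose 2)) = p powi (2 * (- int (Suc d choose 2)))"
        by (simp_all add: q_powi p_powi)
      ultimately show ?thesis by (simp only: p_powi_add[symmetric]) simp
    qed
    ultimately show ?thesis by (simp add: mult_ac)
  qed
  ultimately show ?thesis by (simp add: p_squared mult.assoc[symmetric])
qed

text \<open>Durfee rectangles again: on \<open>k - l = d\<close> the exponent is
  \<open>d\<^sup>2 + (d + t)\<^sup>2 + 2 k l\<close>.\<close>

lemma cross_sum:
  "((\<lambda>(k, l). p powi (int k ^ 2 + int l ^ 2 + (int k - int l + t) ^ 2) / (qf q q k * qf q q l))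
     has_sum 1 / qp q q * (x powi (t ^ 2) * A t)) UNIV"
proof -
  define F where "F = (\<lambda>(k, l). p powi (int k ^ 2 + int l ^ 2 + (int k - int l + t) ^ 2) / (qf q q k * qf q q l))"
  obtain C where C: "C > 0" "\<And>n. norm (1 / qf q q n) \<le> C" using qf_q_bound by blast
  define h where "h = (\<lambda>(a :: nat, b :: nat). (int a, int b))"
  have "inj h" by (auto simp: inj_def h_def)
  from summable_on_inj_compose[OF sq2_summable this]
  have "(\<lambda>z. C * C * (case h z of (a, b) \<Rightarrow> sq a * sq b)) summable_on UNIV"
    by (intro summable_on_cmult_right)
  then have "F summable_on UNIV"
  proof (rule summable_on_norm_bound)
    fix z :: "nat \<times> nat"
    obtain a b where z: "z = (a, b)" by force
    let ?e = "int a ^ 2 + int b ^ 2 + (int a - int b + t) ^ 2"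
    have "norm (p powi ?e / (qf q q a * qf q q b))
        = (norm (1 / qf q q a) * norm (1 / qf q q b)) * norm x powi (2 * ?e)"
      by (simp add: norm_divide norm_mult p_powi norm_power_int)
    also have "\<dots> \<le> (C * C) * (norm x powi (int a ^ 2 + int b ^ 2))"
      using C by (intro mult_mono norm_powi_le) auto
    finally show "norm (F z) \<le> C * C * (case h z of (a, b) \<Rightarrow> sq a * sq b)"
      by (simp add: z h_def sq_add F_def)
  qed
  then obtain S where S: "(F has_sum S) UNIV" by (auto simp: summable_on_def)
  define G where "G d = p powi (d ^ 2 + (d + t) ^ 2) * (1 / qp q q)" for d
  have fib: "(F has_sum G d) {z \<in> UNIV. int (fst z) - int (snd z) = d}" for d
  proof -
    have "((\<lambda>z. p powi (d ^ 2 + (d + t) ^ 2) *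
        (case z of (i, j) \<Rightarrow> q ^ (i * j) / (qf q q i * qf q q j))) has_sum G d)
        {z. int (fst z) - int (snd z) = d}"
      unfolding G_def by (intro has_sum_cmult_right durfee_sum norm_q)
    also have "?this \<longleftrightarrow> (F has_sum G d) {z. int (fst z) - int (snd z) = d}"
    proof (rule has_sum_cong)
      fix z assume "z \<in> {z. int (fst z) - int (snd z) = d}"
      then obtain i j where z: "z = (i, j)" and d: "int i = int j + d" by (cases z) auto
      have "2 * (int i ^ 2 + int j ^ 2 + (int i - int j + t) ^ 2)
          = 2 * (d ^ 2 + (d + t) ^ 2) + 4 * (int i * int j)"
        unfolding d by (simp add: power2_eq_square algebra_simps)
      then have e: "p powi (int i ^ 2 + int j ^ 2 + (int i - int j + t) ^ 2) = p powi (d ^ 2 + (d + t) ^ 2) * q powi (int i * int j)"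
        unfolding q_powi p_powi x_powi_add[symmetric] by simp
      have "q powi (int i * int j) = q ^ (i * j)" by (metis of_nat_mult power_int_of_nat)
      then show "p powi (d ^ 2 + (d + t) ^ 2) *
        (case z of (i, j) \<Rightarrow> q ^ (i * j) / (qf q q i * qf q q j)) = F z"
        by (simp add: z F_def e)
    qed
    finally show ?thesis by simp
  qed
  have "(G has_sum S) UNIV" by (rule has_sum_fibers[OF S fib])
  moreover have "(G has_sum 1 / qp q q * (x powi (t ^ 2) * A t)) UNIV"
  proof -
    have "((\<lambda>d. 1 / qp q q * (x powi (t ^ 2) * x powi ((2 * d + t) ^ 2)))
       has_sum 1 / qp q q * (x powi (t ^ 2) * A t)) UNIV"
      by (intro has_sum_cmult_right A_has_sum)
    also have "(\<lambda>d. 1 / qp q q * (x powi (t ^ 2) * x powi ((2 * d + t) ^ 2))) = G"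
    proof
      fix d
      have "2 * (d ^ 2 + (d + t) ^ 2) = t ^ 2 + (2 * d + t) ^ 2"
        by (simp add: power2_eq_square algebra_simps)
      then show "1 / qp q q * (x powi (t ^ 2) * x powi ((2 * d + t) ^ 2)) = G d"
        unfolding G_def p_powi x_powi_add[symmetric] by simp
    qed
    finally show ?thesis .
  qed
  ultimately show ?thesis using S has_sum_unique unfolding F_def by blast
qed

section \<open>Reduction of the chain sums to double sums\<close>

text \<open>The summand of the Nahm sum in the variables
  \<open>n\<^sub>1, n\<^sub>2, n\<^sub>3, n\<^sub>4\<close> named \<open>a, b, c, d\<close>. The tuples are nested in
  the order in which the sums are carried out: \<open>c\<close> last, the end \<open>(a, b)\<close> and the end \<open>d\<close>
  independently of each other before.\<close>

definition chain4 :: "nat \<times> ((nat \<times> nat) \<times> nat) \<Rightarrow> complex" where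
  "chain4 = (\<lambda>(c, ((a, b), d)).
     p powi (int a ^ 2 + (int a - int b) ^ 2 + (int b - int c) ^ 2 + (int c - int d) ^ 2)
       / (qf q q a * qf q q b * qf q q c * qf q q d))"

definition chain5 :: "(nat \<times> nat) \<times> ((nat \<times> nat) \<times> nat) \<Rightarrow> complex" where
  "chain5 = (\<lambda>((c, d), ((a, b), e)).
     p powi (int a ^ 2 + (int a - int b) ^ 2 + (int b - int c) ^ 2 + (int c - int d) ^ 2 + (int d - int e) ^ 2)
       / (qf q q a * qf q q b * qf q q c * qf q q d * qf q q e))"

lemma chain4_summable: "chain4 summable_on UNIV"
proof -
  obtain C where C: "C > 0" "\<And>n. norm (1 / qf q q n) \<le> C" using qf_q_bound by blast
  define h where "h = (\<lambda>(c :: nat, ((a :: nat, b :: nat), d :: nat)).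
     (int a, int a - int b, int b - int c, int c - int d))"
  have "inj h" by (auto simp: inj_def h_def)
  from summable_on_inj_compose[OF sq4_summable this]
  have "(\<lambda>z. C * C * C * C * (case h z of (a, b, c, d) \<Rightarrow> sq a * (sq b * (sq c * sq d)))) summable_on UNIV"
    by (intro summable_on_cmult_right)
  then show ?thesis
  proof (rule summable_on_norm_bound)
    fix z :: "nat \<times> ((nat \<times> nat) \<times> nat)"
    obtain a b c d where z: "z = (c, ((a, b), d))" by (metis prod.collapse)
    let ?e = "int a ^ 2 + (int a - int b) ^ 2 + (int b - int c) ^ 2 + (int c - int d) ^ 2"
    have "norm (chain4 z) = (norm (1 / qf q q a) * norm (1 / qf q q b) * norm (1 / qf q q c) * norm (1 / qf q q d))
        * norm x powi (2 * ?e)"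
      by (simp add: chain4_def z norm_divide norm_mult p_powi norm_power_int)
    also have "\<dots> \<le> (C * C * C * C) * norm x powi ?e"
      using C by (intro mult_mono norm_powi_le) auto
    finally show "norm (chain4 z) \<le> C * C * C * C * (case h z of (a, b, c, d) \<Rightarrow> sq a * (sq b * (sq c * sq d)))"
      unfolding z h_def prod.case sq_def by (simp add: power_int_add x_nonzero)
  qed
qed

lemma chain5_summable: "chain5 summable_on UNIV"
proof -
  obtain C where C: "C > 0" "\<And>n. norm (1 / qf q q n) \<le> C" using qf_q_bound by blast
  define h where "h = (\<lambda>((c :: nat, d :: nat), ((a :: nat, b :: nat), e :: nat)).
     (int a, int a - int b, int b - int c, int c - int d, int d - int e))"
  have "inj h" by (auto simp: inj_def h_def)
  from summable_on_inj_compose[OF sq5_summable this]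
  have "(\<lambda>z. C * C * C * C * C * (case h z of (a, b, c, d, e) \<Rightarrow> sq a * (sq b * (sq c * (sq d * sq e))))) summable_on UNIV"
    by (intro summable_on_cmult_right)
  then show ?thesis
  proof (rule summable_on_norm_bound)
    fix z :: "(nat \<times> nat) \<times> ((nat \<times> nat) \<times> nat)"
    obtain a b c d e where z: "z = ((c, d), ((a, b), e))" by (metis prod.collapse)
    let ?e = "int a ^ 2 + (int a - int b) ^ 2 + (int b - int c) ^ 2 + (int c - int d) ^ 2 + (int d - int e) ^ 2"
    have "norm (chain5 z) = (norm (1 / qf q q a) * norm (1 / qf q q b) * norm (1 / qf q q c) * norm (1 / qf q q d) * norm (1 / qf q q e))
        * norm x powi (2 * ?e)"
      by (simp add: chain5_def z norm_divide norm_mult p_powi norm_power_int)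
    also have "\<dots> \<le> (C * C * C * C * C) * norm x powi ?e"
      using C by (intro mult_mono norm_powi_le) auto
    finally show "norm (chain5 z) \<le> C * C * C * C * C * (case h z of (a, b, c, d, e) \<Rightarrow> sq a * (sq b * (sq c * (sq d * sq e))))"
      unfolding z h_def prod.case sq_def by (simp add: power_int_add x_nonzero)
  qed
qed

text \<open>The value of \<open>chain_end_sum\<close> without its factor
  \<open>1 / (q;q)\<^sub>\<infinity>\<close>.\<close>

definition endsum :: "nat \<Rightarrow> complex" where
  "endsum c = (\<Sum>s\<le>c. gbinom q c (int s) * (x powi (int s ^ 2 + 2 * (int c - int s) ^ 2) * A (int s)))"

text \<open>What is left of the chain for \<open>r = 4\<close>.\<close>

definition red4 :: "nat \<times> nat \<Rightarrow> complex" where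
  "red4 = (\<lambda>(s, k). A (int s) * x powi (int s ^ 2 + 2 * int k ^ 2) * qf (-p) q (s + k) / (qf q q s * qf q q k))"

lemma red4_summable: "red4 summable_on UNIV"
proof -
  obtain C where C: "C > 0" "\<And>n. norm (1 / qf q q n) \<le> C" using qf_q_bound by blast
  obtain M where M: "M > 0" "\<And>s. norm (A s) \<le> M" using A_bound by blast
  obtain B where B: "B > 0" "\<And>n. norm (qf (-p) q n) \<le> B" using qf_bound[OF norm_q] by blast
  define h where "h = (\<lambda>(a :: nat, b :: nat). (int a, int b))"
  have "inj h" by (auto simp: inj_def h_def)
  from summable_on_inj_compose[OF sq2_summable this]
  have "(\<lambda>z. M * B * C * C * (case h z of (a, b) \<Rightarrow> sq a * sq b)) summable_on UNIV"
    by (intro summable_on_cmult_right)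
  then show ?thesis
  proof (rule summable_on_norm_bound)
    fix z :: "nat \<times> nat"
    obtain s k where z: "z = (s, k)" by force
    have "norm (red4 z) = (norm (A (int s)) * norm (qf (-p) q (s + k)) * norm (1 / qf q q s) * norm (1 / qf q q k))
        * norm x powi (int s ^ 2 + 2 * int k ^ 2)"
      by (simp add: red4_def z norm_divide norm_mult norm_power_int)
    also have "\<dots> \<le> (M * B * C * C) * norm x powi (int s ^ 2 + int k ^ 2)"
      using C M B by (intro mult_mono norm_powi_le) auto
    finally show "norm (red4 z) \<le> M * B * C * C * (case h z of (a, b) \<Rightarrow> sq a * sq b)"
      by (simp add: z h_def sq_add)
  qed
qed

lemma endsum_over_qf:
  "endsum c / qf q q c = (\<Sum>s\<le>c. A (int s) * x powi (int s ^ 2 + 2 * (int c - int s) ^ 2) / (qf q q s * qf q q (c - s)))"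
  unfolding endsum_def sum_divide_distrib
  by (intro sum.cong refl) (use qf_nonzero[OF norm_q] in \<open>simp add: gbinom_nat\<close>)

text \<open>For fixed \<open>c\<close> the chain falls apart into the end \<open>(a, b)\<close> and the end \<open>d\<close>. The
  coefficient \<open>endsum c / (q;q)\<^sub>c\<close> is a convolution, and \<open>c = s + k\<close> turns the sum
  over \<open>c\<close> into a double sum.\<close>

theorem chain4_reduction:
  "infsum chain4 UNIV = qp (-p) q / qp q q * infsum red4 UNIV"
proof -
  have S: "(chain4 has_sum infsum chain4 UNIV) UNIV" using chain4_summable by (rule has_sum_infsum)
  have S': "(red4 has_sum infsum red4 UNIV) UNIV" using red4_summable by (rule has_sum_infsum)
  have 1: "((\<lambda>c. 1 / qf q q c * ((1 / qp q q * endsum c) * (qp (-p) q * qf (-p) q c))) has_sum infsum chain4 UNIV) UNIV"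
  proof (rule has_sum_product_iterated[OF S])
    fix c
    have "((\<lambda>z. 1 / qf q q c * (case z of (u, d) \<Rightarrow>
         (case u of (a, b) \<Rightarrow> p powi (int a ^ 2 + (int a - int b) ^ 2 + (int b - int c) ^ 2) / (qf q q a * qf q q b))
          * (p powi ((int c - int d) ^ 2) / qf q q d)))
        has_sum 1 / qf q q c * ((1 / qp q q * endsum c) * (qp (-p) q * qf (-p) q c))) (UNIV \<times> UNIV)"
      unfolding endsum_def by (intro has_sum_cmult_right has_sum_times chain_end_sum chain_last_sum)
    also have "(\<lambda>z. 1 / qf q q c * (case z of (u, d) \<Rightarrow>
         (case u of (a, b) \<Rightarrow> p powi (int a ^ 2 + (int a - int b) ^ 2 + (int b - int c) ^ 2) / (qf q q a * qf q q b))
          * (p powi ((int c - int d) ^ 2) / qf q q d))) = (\<lambda>z. chain4 (c, z))"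
      by (auto simp: chain4_def fun_eq_iff p_powi_add)
    finally show "((\<lambda>z. chain4 (c, z)) has_sum 1 / qf q q c * ((1 / qp q q * endsum c) * (qp (-p) q * qf (-p) q c))) UNIV"
      by simp
  qed
  have 2: "((\<lambda>c. \<Sum>s\<le>c. red4 (s, c - s)) has_sum infsum red4 UNIV) UNIV"
    using has_sum_fibers[where h = "\<lambda>x. fst x + snd x", OF S'] has_sum_antidiagonal[of red4] by simp
  have 3: "qp (-p) q / qp q q * (\<Sum>s\<le>c. red4 (s, c - s))
     = 1 / qf q q c * ((1 / qp q q * endsum c) * (qp (-p) q * qf (-p) q c))" for c
  proof -
    have "(\<Sum>s\<le>c. red4 (s, c - s)) = endsum c / qf q q c * qf (-p) q c"
      unfolding endsum_over_qf sum_distrib_right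
      by (intro sum.cong refl) (auto simp: red4_def of_nat_diff)
    then show ?thesis by (simp add: mult_ac)
  qed
  have "((\<lambda>c. qp (-p) q / qp q q * (\<Sum>s\<le>c. red4 (s, c - s))) has_sum qp (-p) q / qp q q * infsum red4 UNIV) UNIV"
    by (rule has_sum_cmult_right[OF 2])
  with 1 show ?thesis unfolding 3 using has_sum_unique by blast
qed

text \<open>The fourfold sum between \<open>chain5\<close> and \<open>red5\<close>: with \<open>c = s + k\<close> and
  \<open>d = l + m\<close> the coefficients of the two end sums are convolutions, and the coupling
  \<open>(c - d)\<^sup>2\<close> of the middle nodes becomes \<open>(k - l + s - m)\<^sup>2\<close>. For fixed
  \<open>s, m\<close> the sum over \<open>k, l\<close> is then \<open>cross_sum\<close>.\<close>

definition split5 :: "(nat \<times> nat) \<times> (nat \<times> nat) \<Rightarrow> complex" where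
  "split5 = (\<lambda>((s, m), (k, l)). A (int s) * x powi (int s ^ 2)
      * p powi (int k ^ 2 + int l ^ 2 + (int k - int l + (int s - int m)) ^ 2)
      / (qf q q s * qf q q m * qf q q k * qf q q l))"

definition red5 :: "nat \<times> nat \<Rightarrow> complex" where
  "red5 = (\<lambda>(s, m). A (int s) * A (int s - int m) * x powi (int s ^ 2 + (int s - int m) ^ 2) / (qf q q s * qf q q m))"

lemma split5_summable: "split5 summable_on UNIV"
proof -
  obtain C where C: "C > 0" "\<And>n. norm (1 / qf q q n) \<le> C" using qf_q_bound by blast
  obtain M where M: "M > 0" "\<And>s. norm (A s) \<le> M" using A_bound by blast
  define h where "h = (\<lambda>((s :: nat, m :: nat), (k :: nat, l :: nat)). (int s, int k, int l, int k - int l + (int s - int m)))"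
  have "inj h" by (auto simp: inj_def h_def)
  from summable_on_inj_compose[OF sq4_summable this]
  have "(\<lambda>z. M * C * C * C * C * (case h z of (a, b, c, d) \<Rightarrow> sq a * (sq b * (sq c * sq d)))) summable_on UNIV"
    by (intro summable_on_cmult_right)
  then show ?thesis
  proof (rule summable_on_norm_bound)
    fix z :: "(nat \<times> nat) \<times> (nat \<times> nat)"
    obtain s m k l where z: "z = ((s, m), (k, l))" by (metis prod.collapse)
    let ?e = "int k ^ 2 + int l ^ 2 + (int k - int l + (int s - int m)) ^ 2"
    have "norm (split5 z) = (norm (A (int s)) * norm (1 / qf q q s) * norm (1 / qf q q m) * norm (1 / qf q q k) * norm (1 / qf q q l))
        * norm x powi (int s ^ 2 + 2 * ?e)"
      by (simp add: split5_def z norm_divide norm_mult norm_power_int p_powi power_int_add x_nonzero)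
    also have "\<dots> \<le> (M * C * C * C * C) * norm x powi (int s ^ 2 + ?e)"
      using C M by (intro mult_mono norm_powi_le) auto
    finally show "norm (split5 z) \<le> M * C * C * C * C * (case h z of (a, b, c, d) \<Rightarrow> sq a * (sq b * (sq c * sq d)))"
      unfolding z h_def prod.case sq_def by (simp add: power_int_add x_nonzero)
  qed
qed

text \<open>Gives the end sum of the last node the same convolution form as that of the two
  first nodes.\<close>

lemma qf_minus_p_expansion: "qf (-p) q d / qf q q d = (\<Sum>l\<le>d. p powi (int l ^ 2) / (qf q q l * qf q q (d - l)))"
proof -
  have "qf (-p) q d = (\<Sum>l\<le>d. gbinom q d (int l) * p powi (int l ^ 2))"
    unfolding finite_q_binomial[OF norm_q, of "-p"] powi_square_nat square_eq_choose_two
    by (simp add: power_add power_mult p_squared mult_ac)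
  then show ?thesis
    unfolding sum_divide_distrib
    by (simp add: sum_divide_distrib) (intro sum.cong refl, use qf_nonzero[OF norm_q] in \<open>simp add: gbinom_nat\<close>)
qed

text \<open>Sum both ends for fixed middle nodes \<open>c, d\<close>, expand the result into \<open>split5\<close>,
  and carry out the sum over \<open>k, l\<close> in it by \<open>cross_sum\<close>.\<close>

theorem chain5_reduction:
  "red5 summable_on UNIV" "infsum chain5 UNIV = qp (-p) q / (qp q q) ^ 2 * infsum red5 UNIV"
proof -
  define S where "S = infsum chain5 UNIV"
  define S' where "S' = infsum split5 UNIV"
  have S: "(chain5 has_sum S) UNIV" unfolding S_def using chain5_summable by (rule has_sum_infsum)
  have S': "(split5 has_sum S') UNIV" unfolding S'_def using split5_summable by (rule has_sum_infsum)
  define R where "R = (\<lambda>(c, d). (endsum c / qf q q c) * (qf (-p) q d / qf q q d) * p powi ((int c - int d) ^ 2))"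
  have 1: "((\<lambda>z. qp (-p) q / qp q q * R z) has_sum S) UNIV"
  proof (rule has_sum_product_iterated[OF S])
    fix cd :: "nat \<times> nat"
    obtain c d where cd: "cd = (c, d)" by force
    have "((\<lambda>z. p powi ((int c - int d) ^ 2) / (qf q q c * qf q q d) * (case z of (u, e) \<Rightarrow>
         (case u of (a, b) \<Rightarrow> p powi (int a ^ 2 + (int a - int b) ^ 2 + (int b - int c) ^ 2) / (qf q q a * qf q q b))
          * (p powi ((int d - int e) ^ 2) / qf q q e)))
        has_sum p powi ((int c - int d) ^ 2) / (qf q q c * qf q q d) * ((1 / qp q q * endsum c) * (qp (-p) q * qf (-p) q d))) (UNIV \<times> UNIV)"
      unfolding endsum_def by (intro has_sum_cmult_right has_sum_times chain_end_sum chain_last_sum)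
    also have "(\<lambda>z. p powi ((int c - int d) ^ 2) / (qf q q c * qf q q d) * (case z of (u, e) \<Rightarrow>
         (case u of (a, b) \<Rightarrow> p powi (int a ^ 2 + (int a - int b) ^ 2 + (int b - int c) ^ 2) / (qf q q a * qf q q b))
          * (p powi ((int d - int e) ^ 2) / qf q q e))) = (\<lambda>z. chain5 (cd, z))"
      by (auto simp: chain5_def fun_eq_iff p_powi_add cd mult_ac)
    also have "p powi ((int c - int d) ^ 2) / (qf q q c * qf q q d) * ((1 / qp q q * endsum c) * (qp (-p) q * qf (-p) q d))
       = qp (-p) q / qp q q * R cd"
      by (simp add: R_def cd mult_ac)
    finally show "((\<lambda>z. chain5 (cd, z)) has_sum qp (-p) q / qp q q * R cd) UNIV" by simp
  qed
  have 2: "(R has_sum S') UNIV"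
  proof (rule has_sum_fibers[where h = "\<lambda>z. (fst (fst z) + fst (snd z), snd (snd z) + snd (fst z))", OF S'])
    fix cd :: "nat \<times> nat"
    obtain c d where cd: "cd = (c, d)" by force
    define B where "B = {z :: (nat \<times> nat) \<times> (nat \<times> nat). (fst (fst z) + fst (snd z), snd (snd z) + snd (fst z)) = cd}"
    have "bij_betw (\<lambda>(s, l). ((s, d - l), (c - s, l))) ({..c} \<times> {..d}) B"
      by (rule bij_betwI[where g = "\<lambda>z. (fst (fst z), snd (snd z))"]) (auto simp: B_def cd)
    moreover have "((\<lambda>(s, l). split5 ((s, d - l), (c - s, l))) has_sum R cd) ({..c} \<times> {..d})"
    proof (rule has_sum_finiteI)
      have "R cd = (\<Sum>s\<le>c. A (int s) * x powi (int s ^ 2 + 2 * (int c - int s) ^ 2) / (qf q q s * qf q q (c - s)))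
         * (\<Sum>l\<le>d. p powi (int l ^ 2) / (qf q q l * qf q q (d - l))) * p powi ((int c - int d) ^ 2)"
        by (simp add: R_def cd endsum_over_qf qf_minus_p_expansion)
      also have "\<dots> = (\<Sum>s\<le>c. \<Sum>l\<le>d. A (int s) * x powi (int s ^ 2 + 2 * (int c - int s) ^ 2) / (qf q q s * qf q q (c - s))
         * (p powi (int l ^ 2) / (qf q q l * qf q q (d - l))) * p powi ((int c - int d) ^ 2))"
        by (subst sum_product) (simp only: sum_distrib_right)
      also have "\<dots> = (\<Sum>(s, l)\<in>{..c} \<times> {..d}. split5 ((s, d - l), (c - s, l)))"
        unfolding sum.cartesian_product
      proof (rule sum.cong[OF refl])
        fix z assume "z \<in> {..c} \<times> {..d}"
        then obtain s l where z: "z = (s, l)" and sl: "s \<in> {..c}" "l \<in> {..d}" by (cases z) auto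
        from sl have e: "int (c - s) = int c - int s" "int c - int s - int l + (int s - int (d - l)) = int c - int d" by auto
        have "x powi (int s ^ 2 + 2 * (int c - int s) ^ 2) = x powi (int s ^ 2) * p powi ((int c - int s) ^ 2)"
          by (simp add: x_powi_add p_powi)
        then show "(case z of (s, l) \<Rightarrow> A (int s) * x powi (int s ^ 2 + 2 * (int c - int s) ^ 2) / (qf q q s * qf q q (c - s))
           * (p powi (int l ^ 2) / (qf q q l * qf q q (d - l))) * p powi ((int c - int d) ^ 2))
           = (case z of (s, l) \<Rightarrow> split5 ((s, d - l), (c - s, l)))"
          unfolding z split5_def prod.case e p_powi_add by (simp add: mult_ac)
      qed
      finally show "R cd = (\<Sum>(s, l)\<in>{..c} \<times> {..d}. split5 ((s, d - l), (c - s, l)))" .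
    qed auto
    ultimately have "(split5 has_sum R cd) B"
      using has_sum_reindex_bij_betw[of "\<lambda>(s, l). ((s, d - l), (c - s, l))" "{..c} \<times> {..d}" B split5 "R cd"]
      by (simp add: case_prod_unfold)
    then show "(split5 has_sum R cd) {z \<in> UNIV. (fst (fst z) + fst (snd z), snd (snd z) + snd (fst z)) = cd}"
      by (simp add: B_def)
  qed
  have SS: "S = qp (-p) q / qp q q * S'"
    using 1 has_sum_cmult_right[OF 2, of "qp (-p) q / qp q q"] has_sum_unique by blast
  have 3: "((\<lambda>z. 1 / qp q q * red5 z) has_sum S') UNIV"
  proof (rule has_sum_product_iterated[OF S'])
    fix sm :: "nat \<times> nat"
    obtain s m where sm: "sm = (s, m)" by force
    let ?t = "int s - int m"
    have "((\<lambda>z. A (int s) * x powi (int s ^ 2) / (qf q q s * qf q q m) *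
       (case z of (k, l) \<Rightarrow> p powi (int k ^ 2 + int l ^ 2 + (int k - int l + ?t) ^ 2) / (qf q q k * qf q q l)))
       has_sum A (int s) * x powi (int s ^ 2) / (qf q q s * qf q q m) * (1 / qp q q * (x powi (?t ^ 2) * A ?t))) UNIV"
      by (intro has_sum_cmult_right cross_sum)
    also have "(\<lambda>z. A (int s) * x powi (int s ^ 2) / (qf q q s * qf q q m) *
       (case z of (k, l) \<Rightarrow> p powi (int k ^ 2 + int l ^ 2 + (int k - int l + ?t) ^ 2) / (qf q q k * qf q q l)))
       = (\<lambda>z. split5 (sm, z))"
      by (auto simp: split5_def sm fun_eq_iff)
    finally show "((\<lambda>z. split5 (sm, z)) has_sum 1 / qp q q * red5 sm) UNIV"
      by (simp add: red5_def sm x_powi_add mult_ac)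
  qed
  have Q: "qp q q \<noteq> 0" by (intro qp_nonzero norm_q)
  have 4: "(red5 has_sum qp q q * S') UNIV"
    using has_sum_cmult_right[OF 3, of "qp q q"] Q by simp
  then show "red5 summable_on UNIV" by (auto simp: summable_on_def)
  show "infsum chain5 UNIV = qp (-p) q / (qp q q) ^ 2 * infsum red5 UNIV"
    using infsumI[OF 4] SS Q by (simp add: S_def power2_eq_square)
qed

end

section \<open>The Nahm sums as chain sums\<close>

lemma tadpole_form_4:
  "tadpole_form 4 n = int (n 1) ^ 2 + (int (n 1) - int (n 2)) ^ 2 + (int (n 2) - int (n 3)) ^ 2
     + (int (n 3) - int (n 4)) ^ 2"
proof -
  have s: "{1..4::nat} = {1, 2, 3, 4}" by auto
  show ?thesis
    unfolding tadpole_form_def s by (simp add: tadpole_def power2_eq_square algebra_simps)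
qed

lemma tadpole_form_5:
  "tadpole_form 5 n = int (n 1) ^ 2 + (int (n 1) - int (n 2)) ^ 2 + (int (n 2) - int (n 3)) ^ 2
     + (int (n 3) - int (n 4)) ^ 2 + (int (n 4) - int (n 5)) ^ 2"
proof -
  have s: "{1..5::nat} = {1, 2, 3, 4, 5}" by auto
  show ?thesis
    unfolding tadpole_form_def s by (simp add: tadpole_def power2_eq_square algebra_simps)
qed

lemma nome_exp:
  assumes "Im \<tau> > 0"
  shows "nome (exp (\<i> * of_real pi * \<tau> / 2))"
  using assms by unfold_locales auto

lemma q_pow_half: "q_pow \<tau> (of_int m / 2) = (exp (\<i> * of_real pi * \<tau> / 2) ^ 2) powi m"
  by (simp add: q_pow_def exp_power_int of_rat_divide flip: exp_of_nat_mult) (simp add: mult_ac)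

lemma q_pow_one: "q_pow \<tau> 1 = exp (\<i> * of_real pi * \<tau> / 2) ^ 4"
  by (simp add: q_pow_def flip: exp_of_nat_mult) (simp add: mult_ac)

text \<open>Only a reordering of the summation variables; the junk value \<open>undefined\<close> is the
  one of extensional functions outside \<open>{1..4}\<close>.\<close>

lemma tadpole_nahm_sum_4:
  assumes "Im \<tau> > 0"
  shows "tadpole_nahm_sum 4 (\<lambda>_. 1) \<tau> = infsum (nome.chain4 (exp (\<i> * of_real pi * \<tau> / 2))) UNIV"
proof -
  define x where "x = exp (\<i> * of_real pi * \<tau> / 2)"
  interpret nome x unfolding x_def by (rule nome_exp[OF assms])
  have s: "{1..4::nat} = {1, 2, 3, 4}" by auto
  show ?thesis
    unfolding tadpole_nahm_sum_def x_def[symmetric]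
  proof (rule infsum_reindex_bij_witness[where j = "\<lambda>n. (n 3, ((n 1, n 2), n 4))"
        and i = "\<lambda>(c, ((a, b), d)). \<lambda>k. if k = 1 then a else if k = 2 then b else if k = 3 then c else if k = 4 then d else undefined"], goal_cases)
    case (1 n)
    then show ?case
      by (auto simp: fun_eq_iff PiE_def extensional_def s)
  next
    case (5 n)
    show ?case
      unfolding s q_pow_half q_pow_one tadpole_form_4 x_def[symmetric]
      by (simp add: chain4_def p_def q_def q_poch_eq_qf mult_ac)
  qed (auto simp: PiE_def extensional_def)
qed

lemma tadpole_nahm_sum_5:
  assumes "Im \<tau> > 0"
  shows "tadpole_nahm_sum 5 (\<lambda>_. 1) \<tau> = infsum (nome.chain5 (exp (\<i> * of_real pi * \<tau> / 2))) UNIV"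
proof -
  define x where "x = exp (\<i> * of_real pi * \<tau> / 2)"
  interpret nome x unfolding x_def by (rule nome_exp[OF assms])
  have s: "{1..5::nat} = {1, 2, 3, 4, 5}" by auto
  show ?thesis
    unfolding tadpole_nahm_sum_def x_def[symmetric]
  proof (rule infsum_reindex_bij_witness[where j = "\<lambda>n. ((n 3, n 4), ((n 1, n 2), n 5))"
        and i = "\<lambda>((c, d), ((a, b), e)). \<lambda>k. if k = 1 then a else if k = 2 then b else if k = 3 then c else if k = 4 then d else if k = 5 then e else undefined"], goal_cases)
    case (1 n)
    then show ?case
      by (auto simp: fun_eq_iff PiE_def extensional_def s)
  next
    case (5 n)
    show ?case
      unfolding s q_pow_half q_pow_one tadpole_form_5 x_def[symmetric]
      by (simp add: chain5_def p_def q_def q_poch_eq_qf mult_ac)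
  qed (auto simp: PiE_def extensional_def)
qed

section \<open>Bailey's transform and identities of Slater type\<close>

lemma qf_square: "qf z q n * qf (- z) q n = qf (z ^ 2) (q ^ 2) n"
proof (induction n)
  case (Suc n)
  have "qf z q (Suc n) * qf (- z) q (Suc n) = (qf z q n * qf (- z) q n) * ((1 - z * q ^ n) * (1 + z * q ^ n))"
    by (simp add: qf_Suc mult_ac)
  also have "(1 - z * q ^ n) * (1 + z * q ^ n) = 1 - z ^ 2 * (q ^ 2) ^ n"
    by (simp add: power_mult[symmetric] mult.commute[of 2] power_mult power2_eq_square algebra_simps)
  finally show ?case unfolding Suc by (simp add: qf_Suc)
qed simp

lemma qf_double: "qf q q (2 * n) = qf q (q ^ 2) n * qf (q ^ 2) (q ^ 2) n"
proof (induction n)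
  case (Suc n)
  have "qf q q (2 * Suc n) = qf q q (2 * n) * ((1 - q * (q ^ 2) ^ n) * (1 - q ^ 2 * (q ^ 2) ^ n))"
    by (simp add: qf_Suc power_mult power2_eq_square mult_ac power_mult_distrib)
  then show ?case unfolding Suc by (simp add: qf_Suc mult_ac)
qed simp

lemma qf_q_square_nonzero: "norm q < 1 \<Longrightarrow> qf q (q ^ 2) n \<noteq> 0"
  using qf_double[of q n] qf_nonzero[of q "2 * n"] by auto

text \<open>The case \<open>c = - w\<^sup>2\<close>, \<open>x = w\<close> of \<open>q_gauss_sum\<close> to the base
  \<open>w\<^sup>2\<close>.\<close>

lemma slater_alternating:
  assumes w: "norm w < 1"
  shows "((\<lambda>s. (-1) ^ s * w ^ (s ^ 2) * qf (- w) (w ^ 2) s / qf (w ^ 4) (w ^ 4) s) has_sum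
           qp w (w ^ 2) / qp (- (w ^ 2)) (w ^ 2)) UNIV"
proof -
  define Q where "Q = w ^ 2"
  have Q: "norm Q < 1" unfolding Q_def by (rule norm_power2_less_1[OF w])
  have nz: "qp (- Q) Q \<noteq> 0" using Q by (intro qp_nonzero) auto
  have "((\<lambda>m. 1 / qp (- Q) Q * ((\<Prod>k<m. - Q * Q ^ k - w) * Q ^ (m choose 2) * qp (- Q * Q ^ m) Q / qf Q Q m))
      has_sum 1 / qp (- Q) Q * qp w Q) UNIV"
    by (intro has_sum_cmult_right q_gauss_sum Q)
  moreover have "1 / qp (- Q) Q * ((\<Prod>k<m. - Q * Q ^ k - w) * Q ^ (m choose 2) * qp (- Q * Q ^ m) Q / qf Q Q m)
     = (-1) ^ m * w ^ (m ^ 2) * qf (- w) (w ^ 2) m / qf (w ^ 4) (w ^ 4) m" for m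
  proof -
    have "(\<Prod>k<m. - Q * Q ^ k - w) = (\<Prod>k<m. (- w) * (1 - (- w) * Q ^ k))"
      by (intro prod.cong refl) (simp add: Q_def power2_eq_square algebra_simps)
    also have "\<dots> = (-1) ^ m * w ^ m * qf (- w) Q m"
      by (simp only: prod.distrib prod_constant card_lessThan qf_def power_minus[of w])
    finally have 1: "(\<Prod>k<m. - Q * Q ^ k - w) = (-1) ^ m * w ^ m * qf (- w) Q m" .
    have 2: "qp (- Q) Q = qf (- Q) Q m * qp (- Q * Q ^ m) Q" by (rule qp_split[OF Q])
    have 3: "qf Q Q m * qf (- Q) Q m = qf (w ^ 4) (w ^ 4) m"
      unfolding qf_square by (simp add: Q_def)
    have 4: "w ^ m * Q ^ (m choose 2) = w ^ (m ^ 2)"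
      by (simp add: square_eq_choose_two power_add power_mult Q_def mult_ac)
    have nz': "qf (- Q) Q m \<noteq> 0" "qp (- Q * Q ^ m) Q \<noteq> 0" using nz 2 by auto
    have "1 / qp (- Q) Q * ((\<Prod>k<m. - Q * Q ^ k - w) * Q ^ (m choose 2) * qp (- Q * Q ^ m) Q / qf Q Q m)
      = (-1) ^ m * (w ^ m * Q ^ (m choose 2)) * qf (- w) Q m / (qf Q Q m * qf (- Q) Q m)"
      unfolding 1 2 using nz' qf_nonzero[OF Q, of m] by (simp add: field_simps)
    then show ?thesis unfolding 3 4 by (simp add: Q_def)
  qed
  ultimately show ?thesis by (simp add: Q_def)
qed

lemma has_sum_diff:
  fixes f g :: "'a \<Rightarrow> complex"
  assumes "(f has_sum a) B" "(g has_sum b) B"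
  shows "((\<lambda>x. f x - g x) has_sum (a - b)) B"
proof -
  have "((\<lambda>x. f x + (- g x)) has_sum (a + - b)) B"
    using assms by (intro has_sum_add) (auto simp: has_sum_uminus)
  then show ?thesis by simp
qed

lemma finite_support_summable:
  fixes f :: "int \<Rightarrow> complex"
  assumes "\<And>j. f j \<noteq> 0 \<Longrightarrow> \<bar>j\<bar> \<le> N"
  shows "f summable_on UNIV"
proof -
  have "finite {j. f j \<noteq> 0}"
    by (rule finite_subset[of _ "{-N..N}"]) (use assms in force)+
  then show ?thesis by (intro finite_nonzero_values_imp_summable_on) auto
qed

lemma has_sum_shift_int:
  fixes f :: "int \<Rightarrow> complex"
  assumes "(f has_sum S) UNIV"
  shows "((\<lambda>j. f (j + k)) has_sum S) UNIV"
proof -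
  have "bij_betw (\<lambda>j::int. j + k) UNIV UNIV" by (rule bij_betwI[where g = "\<lambda>j. j - k"]) auto
  from has_sum_reindex_bij_betw[OF this, of f S] assms show ?thesis by simp
qed

lemma has_sum_reflect_int:
  fixes f :: "int \<Rightarrow> complex"
  assumes "(f has_sum S) UNIV"
  shows "((\<lambda>j. f (k - j)) has_sum S) UNIV"
proof -
  have "bij_betw (\<lambda>j::int. k - j) UNIV UNIV" by (rule bij_betwI[where g = "\<lambda>j. k - j"]) auto
  from has_sum_reindex_bij_betw[OF this, of f S] assms show ?thesis by simp
qed

definition parity_sign :: "int \<Rightarrow> complex" where "parity_sign j = (if even j then 1 else -1)"

lemma parity_sign_add: "parity_sign (a + b) = parity_sign a * parity_sign b"
  and parity_sign_1: "parity_sign 1 = -1" and parity_sign_norm: "norm (parity_sign j) = 1"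
  by (auto simp: parity_sign_def)

text \<open>Schur's polynomial form of the pentagonal number theorem. The two Pascal rules, used
  according to the parity of \<open>L + j\<close>, show that passing from \<open>L\<close> to \<open>L + 1\<close> changes the
  \<open>j\<close>-th term by \<open>f j - f (j - 1)\<close>, where \<open>f\<close> has finite support; so the sum is constant
  in \<open>L\<close>.\<close>

lemma schur_polynomial_identity:
  assumes q: "norm q < 1" "q \<noteq> 0"
  shows "((\<lambda>j. parity_sign j * q powi (j * (3 * j + 1) div 2) * gbinom q L ((int L + 3 * j + 1) div 2)) has_sum 1) UNIV"
proof (induction L)
  case 0
  have "(\<lambda>j. parity_sign j * q powi (j * (3 * j + 1) div 2) * gbinom q 0 ((int 0 + 3 * j + 1) div 2)) = (\<lambda>j. if j = 0 then 1 else 0)"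
  proof
    fix j :: int
    show "parity_sign j * q powi (j * (3 * j + 1) div 2) * gbinom q 0 ((int 0 + 3 * j + 1) div 2) = (if j = 0 then 1 else 0)"
    proof (cases "j = 0")
      case False
      then have "(3 * j + 1) div 2 < 0 \<or> int 0 < (3 * j + 1) div 2" by presburger
      then show ?thesis using False gbinom_outside[of "(3 * j + 1) div 2" 0 q] by simp
    qed (simp add: gbinom_def parity_sign_def)
  qed
  moreover have "((\<lambda>j::int. if j = 0 then 1 else 0 :: complex) has_sum 1) UNIV"
    using has_sum_finite_neutralI[of "{0::int}" UNIV "\<lambda>j. if j = 0 then 1 else 0 :: complex" 1] by simp
  ultimately show ?case by simp
next
  case (Suc L)
  define t where "t L j = parity_sign j * q powi (j * (3 * j + 1) div 2) * gbinom q L ((int L + 3 * j + 1) div 2)" for L and j :: int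
  define f where "f j = (if even (int L + j) then parity_sign j * q powi (j * (3 * j + 1) div 2 + (int L + 3 * j + 2) div 2)
      * gbinom q L ((int L + 3 * j + 2) div 2) else 0)" for j
  have padd: "q powi (a + b) = q powi a * q powi b" for a b
    using q by (simp add: power_int_add)
  have tri: "even (j * (3 * j + 1))" for j :: int by simp
  have step: "t (Suc L) j = t L j + (f j - f (j + (-1)))" for j
  proof (cases "even (int L + j)")
    case True
    then have e: "even (int L + 3 * j)" by presburger
    have k: "(int (Suc L) + 3 * j + 1) div 2 = (int L + 3 * j + 2) div 2"
      by simp
    have k': "(int L + 3 * j + 2) div 2 - 1 = (int L + 3 * j + 1) div 2" using e by presburger
    have "odd (int L + (j + (-1)))" using True by simp
    then have "f (j + (-1)) = 0" by (simp add: f_def)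
    moreover have "t (Suc L) j = t L j + f j"
      unfolding t_def k gbinom_Suc[OF q(1)] k' f_def padd using True by (simp add: ring_distribs)
    ultimately show ?thesis by simp
  next
    case False
    then have e: "odd (int L + 3 * j)" by presburger
    define i where "i = j - 1"
    have i: "j = i + 1" by (simp add: i_def)
    have k: "(int (Suc L) + 3 * j + 1) div 2 = (int L + 3 * j + 1) div 2" using e by presburger
    have k': "(int L + 3 * j + 1) div 2 - 1 = (int L + 3 * i + 2) div 2" unfolding i using e by presburger
    have ex: "j * (3 * j + 1) div 2 + (int (Suc L) - (int L + 3 * j + 1) div 2)
        = i * (3 * i + 1) div 2 + (int L + 3 * i + 2) div 2"
    proof -
      have "even (int L + 3 * j + 1)" using e by simp
      then obtain u where u: "int L + 3 * j + 1 = 2 * u" by (rule evenE)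
      obtain v where v: "i * (3 * i + 1) = 2 * v" using tri by blast
      have "j * (3 * j + 1) = 2 * (v + 3 * i + 2)"
        using v unfolding i by (simp add: algebra_simps)
      moreover have "int L + 3 * i + 2 = 2 * (u - 1)" using u unfolding i by simp
      ultimately show ?thesis unfolding u v using u unfolding i by simp
    qed
    have "f j = 0" using False by (simp add: f_def)
    moreover have "f (j + (-1)) = f i" by (simp add: i_def)
    moreover have "t (Suc L) j = t L j - f i"
    proof -
      have ev: "even (int L + i)" using False unfolding i by simp
      have s: "parity_sign j = - parity_sign i" unfolding i parity_sign_add parity_sign_1 by simp
      have "t (Suc L) j = t L j + parity_sign j * q powi (j * (3 * j + 1) div 2 + (int (Suc L) - (int L + 3 * j + 1) div 2)) * gbinom q L ((int L + 3 * j + 1) div 2 - 1)"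
        unfolding t_def k gbinom_Suc'[OF q(1)] padd by (simp add: ring_distribs)
      also have "\<dots> = t L j - f i" unfolding ex k' s using ev by (simp add: f_def)
      finally show ?thesis .
    qed
    ultimately show ?thesis by simp
  qed
  have "f summable_on UNIV"
  proof (rule finite_support_summable)
    fix j assume "f j \<noteq> 0"
    then have "gbinom q L ((int L + 3 * j + 2) div 2) \<noteq> 0" by (auto simp: f_def split: if_splits)
    then have "0 \<le> (int L + 3 * j + 2) div 2" "(int L + 3 * j + 2) div 2 \<le> int L"
      using gbinom_outside by force+
    then show "\<bar>j\<bar> \<le> int L + 1" by linarith
  qed
  then obtain F where F: "(f has_sum F) UNIV" by (auto simp: summable_on_def)
  have "((\<lambda>j. t L j + (f j - f (j + (-1)))) has_sum 1 + (F - F)) UNIV"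
    using Suc unfolding t_def[symmetric]
    by (intro has_sum_add has_sum_diff F has_sum_shift_int)
  then show ?case unfolding step[symmetric] unfolding t_def by simp
qed

text \<open>Gauss's alternating sum as a finite identity, by induction on \<open>n\<close>: both Pascal
  rules lead from row \<open>2 n + 2\<close> through the odd row in between down to row \<open>2 n\<close>, and the
  sum is multiplied by \<open>1 - q\<^bsup>2n+1\<^esup>\<close>.\<close>

lemma alternating_square_identity:
  assumes q: "norm q < 1" "q \<noteq> 0"
  shows "((\<lambda>r. parity_sign r * q powi (r ^ 2) * gbinom q (2 * n) (int n + r)) has_sum qf q (q ^ 2) n) UNIV"
proof (induction n)
  case 0
  have "(\<lambda>r. parity_sign r * q powi (r ^ 2) * gbinom q (2 * 0) (int 0 + r)) = (\<lambda>r. if r = 0 then 1 else 0)"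
    by (auto simp: fun_eq_iff gbinom_def parity_sign_def)
  moreover have "((\<lambda>j::int. if j = 0 then 1 else 0 :: complex) has_sum 1) UNIV"
    using has_sum_finite_neutralI[of "{0::int}" UNIV "\<lambda>j. if j = 0 then 1 else 0 :: complex" 1] by simp
  ultimately show ?case by simp
next
  case (Suc n)
  have padd: "q powi (a + b) = q powi a * q powi b" for a b
    using q by (simp add: power_int_add)
  define Y where "Y = qf q (q ^ 2) n"
  have Y: "((\<lambda>r. parity_sign r * q powi (r ^ 2) * gbinom q (2 * n) (int n + r)) has_sum Y) UNIV"
    using Suc by (simp add: Y_def)
  define w' where "w' r = parity_sign r * q powi (r ^ 2 + r) * gbinom q (2 * n + 1) (int n + 1 + r)" for r
  define v where "v r = parity_sign r * q powi (r ^ 2 + r) * gbinom q (2 * n) (int n + r)" for r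
  have "w' summable_on UNIV"
  proof (rule finite_support_summable[where N = "int n + 1"])
    fix r assume "w' r \<noteq> 0"
    then have "0 \<le> int n + 1 + r" "int n + 1 + r \<le> int (2 * n + 1)"
      using gbinom_outside unfolding w'_def by force+
    then show "\<bar>r\<bar> \<le> int n + 1" by linarith
  qed
  then obtain W where W: "(w' has_sum W) UNIV" by (auto simp: summable_on_def)
  \<comment> \<open>The sum \<open>W\<close> over the odd row vanishes: the substitution
    \<open>r \<mapsto> - 1 - r\<close> changes the sign of every term.\<close>
  have "((\<lambda>r. w' (-1 - r)) has_sum W) UNIV" by (rule has_sum_reflect_int[OF W])
  moreover have "w' (-1 - r) = - w' r" for r
  proof -
    have g: "gbinom q (2 * n + 1) (int n + 1 + (-1 - r)) = gbinom q (2 * n + 1) (int n + 1 + r)"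
      using gbinom_sym[of q "2 * n + 1" "int n + 1 + r"] by (simp add: algebra_simps)
    have e: "(-1 - r) ^ 2 + (-1 - r) = r ^ 2 + r" by (simp add: power2_eq_square algebra_simps)
    have s: "parity_sign (-1 - r) = - parity_sign r" by (simp add: parity_sign_def)
    show ?thesis unfolding w'_def g e s by simp
  qed
  ultimately have "((\<lambda>r. - w' r) has_sum W) UNIV" by simp
  moreover have "((\<lambda>r. - w' r) has_sum - W) UNIV" using W by (simp add: has_sum_uminus)
  ultimately have "W = - W" by (rule has_sum_unique)
  then have W0: "W = 0" by simp
  \<comment> \<open>Pascal's rule expresses the odd row by two sums over row \<open>2 n\<close>; one of
    them is the induction hypothesis, which gives the other one.\<close>
  have "((\<lambda>r. w' r - (- (q powi int n)) * (parity_sign (r + 1) * q powi ((r + 1) ^ 2) * gbinom q (2 * n) (int n + (r + 1))) )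
      has_sum W - (- (q powi int n)) * Y) UNIV"
    by (intro has_sum_diff W has_sum_cmult_right has_sum_shift_int[where k = 1, OF Y])
  moreover have "w' r - (- (q powi int n)) * (parity_sign (r + 1) * q powi ((r + 1) ^ 2) * gbinom q (2 * n) (int n + (r + 1))) = v r" for r
  proof -
    have e: "q powi (r ^ 2 + r) * q powi (int n + 1 + r) = q powi int n * q powi ((r + 1) ^ 2)"
      unfolding padd[symmetric] by (simp add: power2_eq_square algebra_simps)
    have k: "int n + 1 + r - 1 = int n + r" "int n + (r + 1) = int n + 1 + r" by simp_all
    have "w' r = v r + parity_sign r * (q powi (r ^ 2 + r) * q powi (int n + 1 + r)) * gbinom q (2 * n) (int n + 1 + r)"
      using gbinom_Suc[OF q(1), of "2 * n" "int n + 1 + r"]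
      unfolding w'_def v_def k by (simp add: ring_distribs)
    then show ?thesis unfolding e k parity_sign_add parity_sign_1 by simp
  qed
  ultimately have V: "(v has_sum q powi int n * Y) UNIV" using W0 by simp
  \<comment> \<open>Row \<open>2 n + 2\<close> in terms of the three sums known by now.\<close>
  have "((\<lambda>r. (parity_sign r * q powi (r ^ 2) * gbinom q (2 * n) (int n + r) - q powi (int n + 1) * v (r + (-1))) + q powi (int n + 1) * w' r) has_sum
     (Y - q powi (int n + 1) * (q powi int n * Y)) + q powi (int n + 1) * W) UNIV"
    by (intro has_sum_add has_sum_diff Y has_sum_cmult_right has_sum_shift_int V W)
  moreover have "(parity_sign r * q powi (r ^ 2) * gbinom q (2 * n) (int n + r) - q powi (int n + 1) * v (r + (-1))) + q powi (int n + 1) * w' r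
      = parity_sign r * q powi (r ^ 2) * gbinom q (2 * Suc n) (int (Suc n) + r)" for r
  proof -
    have e1: "q powi (int n + 1) * q powi (r ^ 2 + r) = q powi (r ^ 2) * q powi (int n + 1 + r)"
      unfolding padd[symmetric] by (simp add: algebra_simps)
    have e2: "q powi (int n + 1) * q powi ((r + (-1)) ^ 2 + (r + (-1))) = q powi (r ^ 2) * q powi (int n + 1 - r)"
      unfolding padd[symmetric] by (simp add: power2_eq_square algebra_simps)
    have s: "parity_sign (r + (-1)) = - parity_sign r" by (simp add: parity_sign_def)
    have g1: "gbinom q (2 * Suc n) (int (Suc n) + r) = gbinom q (2 * n + 1) (int n + r) + q powi (int n + 1 + r) * gbinom q (2 * n + 1) (int n + 1 + r)"
      using gbinom_Suc[OF q(1), of "2 * n + 1" "int n + 1 + r"] by (simp add: algebra_simps)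
    have g2: "gbinom q (2 * n + 1) (int n + r) = gbinom q (2 * n) (int n + r) + q powi (int n + 1 - r) * gbinom q (2 * n) (int n + (r + (-1)))"
      using gbinom_Suc'[OF q(1), of "2 * n" "int n + r"] by (simp add: algebra_simps)
    have "parity_sign r * q powi (r ^ 2) * gbinom q (2 * Suc n) (int (Suc n) + r)
       = parity_sign r * q powi (r ^ 2) * gbinom q (2 * n) (int n + r)
       + parity_sign r * (q powi (r ^ 2) * q powi (int n + 1 - r)) * gbinom q (2 * n) (int n + (r + (-1)))
       + parity_sign r * (q powi (r ^ 2) * q powi (int n + 1 + r)) * gbinom q (2 * n + 1) (int n + 1 + r)"
      unfolding g1 g2 by (simp add: ring_distribs)
    also have "\<dots> = (parity_sign r * q powi (r ^ 2) * gbinom q (2 * n) (int n + r) - q powi (int n + 1) * v (r + (-1))) + q powi (int n + 1) * w' r"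
      unfolding e1[symmetric] e2[symmetric] v_def w'_def s by simp
    finally show ?thesis by simp
  qed
  moreover have "(Y - q powi (int n + 1) * (q powi int n * Y)) + q powi (int n + 1) * W = qf q (q ^ 2) (Suc n)"
  proof -
    have "q powi (int n + 1) * q powi int n = q powi int (Suc (2 * n))"
      unfolding padd[symmetric] by (simp add: algebra_simps)
    also have "\<dots> = q * (q ^ 2) ^ n" by (simp only: power_int_of_nat power_Suc power_mult)
    finally have e: "q powi (int n + 1) * q powi int n = q * (q ^ 2) ^ n" .
    have "(Y - q powi (int n + 1) * (q powi int n * Y)) + q powi (int n + 1) * W
        = Y - (q powi (int n + 1) * q powi int n) * Y" by (simp add: W0)
    also have "\<dots> = qf q (q ^ 2) (Suc n)" unfolding e by (simp add: Y_def qf_Suc algebra_simps)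
    finally show ?thesis .
  qed
  ultimately show ?case by simp
qed

text \<open>The columns of the Bailey transform. Only \<open>n \<ge> r\<close> contributes, and with
  \<open>n = m + r\<close> the sum is \<open>q_gauss_sum\<close> at \<open>c = q\<^bsup>2r+1\<^esup>\<close>,
  \<open>x = - p q\<^sup>r\<close>. Negative \<open>r\<close> follow by the symmetry of the Gaussian binomials.\<close>

lemma bailey_weight_even:
  assumes p: "norm p < 1" "p \<noteq> 0"
  shows "((\<lambda>n. p ^ (n ^ 2) * qf (- p) (p ^ 2) n * gbinom (p ^ 2) (2 * n) (int n + r) / qf (p ^ 2) (p ^ 2) (2 * n))
          has_sum p powi (r ^ 2) * qp (- p) (p ^ 2) / qp (p ^ 2) (p ^ 2)) UNIV"
proof -
  define q where "q = p ^ 2"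
  have q: "norm q < 1" unfolding q_def by (rule norm_power2_less_1[OF p(1)])
  define T where "T r n = p ^ (n ^ 2) * qf (- p) q n * gbinom q (2 * n) (int n + r) / qf q q (2 * n)" for r n
  have main: "(T (int r) has_sum p ^ (r ^ 2) * qp (- p) q / qp q q) UNIV" for r
  proof -
    \<comment> \<open>The constant \<open>K\<close> collects what does not depend on \<open>m = n - r\<close>.\<close>
    define c where "c = q ^ (2 * r + 1)"
    define y where "y = - (p * q ^ r)"
    define K where "K = p ^ (r ^ 2) * qf (- p) q r / qp q q"
    have "((\<lambda>m. K * ((\<Prod>k<m. c * q ^ k - y) * q ^ (m choose 2) * qp (c * q ^ m) q / qf q q m)) has_sum K * qp y q) UNIV"
      by (intro has_sum_cmult_right q_gauss_sum q)
    also have "K * qp y q = p ^ (r ^ 2) * qp (- p) q / qp q q"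
      using qp_split[OF q, of "- p" r] by (simp add: K_def y_def)
    also have "(\<lambda>m. K * ((\<Prod>k<m. c * q ^ k - y) * q ^ (m choose 2) * qp (c * q ^ m) q / qf q q m)) = T (int r) \<circ> (\<lambda>m. m + r)"
    proof
      fix m
      have "(\<Prod>k<m. c * q ^ k - y) = (\<Prod>k<m. (p * q ^ r) * (1 - y * q ^ k))"
        by (intro prod.cong refl)
           (simp add: c_def y_def q_def power2_eq_square power_mult_distrib power_add power_mult algebra_simps)
      also have "\<dots> = (p * q ^ r) ^ m * qf y q m"
        by (simp only: prod.distrib prod_constant card_lessThan qf_def power_mult_distrib)
      finally have 1: "(\<Prod>k<m. c * q ^ k - y) = (p * q ^ r) ^ m * qf y q m" .
      have 2: "qp q q = qf q q (m + r + r) * qp (c * q ^ m) q"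
        using qp_split[OF q, of q "m + r + r"] unfolding c_def mult_2 by (simp add: power_add mult_ac)
      have 3: "qf (- p) q (m + r) = qf (- p) q r * qf y q m"
        unfolding add.commute[of m] qf_add by (simp add: y_def)
      have 4: "p ^ (r ^ 2) * ((p * q ^ r) ^ m * q ^ (m choose 2)) = p ^ ((m + r) ^ 2)"
      proof -
        have "(m + r) ^ 2 = r ^ 2 + (m + 2 * r * m + 2 * (m choose 2))"
          using square_eq_choose_two[of m] by (simp add: power2_eq_square algebra_simps)
        then show ?thesis
          by (simp only: power_add power_mult q_def[symmetric] power_mult_distrib)
      qed
      have 5: "gbinom q (2 * (m + r)) (int (m + r) + int r) = qf q q (2 * (m + r)) / (qf q q (m + r + r) * qf q q m)"
        using gbinom_nat[of "m + r + r" "2 * (m + r)" q] by simp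
      have nz: "qp q q \<noteq> 0" "qf q q (m + r + r) \<noteq> 0" "qf q q m \<noteq> 0" "qf q q (2 * (m + r)) \<noteq> 0"
        using qp_nonzero[OF q q] qf_nonzero[OF q] by blast+
      then have nz': "qp (c * q ^ m) q \<noteq> 0" using 2 by auto
      have "K * ((\<Prod>k<m. c * q ^ k - y) * q ^ (m choose 2) * qp (c * q ^ m) q / qf q q m)
        = (p ^ (r ^ 2) * ((p * q ^ r) ^ m * q ^ (m choose 2))) * (qf (- p) q r * qf y q m) * (qp (c * q ^ m) q / (qp q q * qf q q m))"
        unfolding K_def 1 by (simp add: mult_ac)
      also have "qp (c * q ^ m) q / (qp q q * qf q q m) = 1 / (qf q q (m + r + r) * qf q q m)"
        unfolding 2 using nz nz' by simp
      also have "(p ^ (r ^ 2) * ((p * q ^ r) ^ m * q ^ (m choose 2))) * (qf (- p) q r * qf y q m) * \<dots> = T (int r) (m + r)"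
        unfolding 4 3[symmetric] T_def 5 using nz by simp
      finally show "K * ((\<Prod>k<m. c * q ^ k - y) * q ^ (m choose 2) * qp (c * q ^ m) q / qf q q m) = (T (int r) \<circ> (\<lambda>m. m + r)) m"
        by simp
    qed
    also have "((T (int r) \<circ> (\<lambda>m. m + r)) has_sum p ^ (r ^ 2) * qp (- p) q / qp q q) UNIV
       \<longleftrightarrow> (T (int r) has_sum p ^ (r ^ 2) * qp (- p) q / qp q q) (range (\<lambda>m. m + r))"
      by (rule has_sum_reindex[symmetric]) (auto simp: inj_on_def)
    also have "\<dots> \<longleftrightarrow> (T (int r) has_sum p ^ (r ^ 2) * qp (- p) q / qp q q) UNIV"
    proof (rule has_sum_cong_neutral)
      fix n assume n: "n \<in> UNIV - range (\<lambda>m. m + r)"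
      have "n < r"
      proof (rule ccontr)
        assume "\<not> n < r"
        then have "n = (n - r) + r" by simp
        then show False using n by blast
      qed
      then show "T (int r) n = 0" by (simp add: T_def gbinom_outside)
    qed auto
    finally show ?thesis .
  qed
  have "T r = T (int (nat \<bar>r\<bar>))"
  proof (cases "r \<ge> 0")
    case False
    have "gbinom q (2 * n) (int n + r) = gbinom q (2 * n) (int n + \<bar>r\<bar>)" for n
      using gbinom_sym[of q "2 * n" "int n + r"] False by (simp add: algebra_simps)
    then show ?thesis by (simp add: T_def fun_eq_iff)
  qed simp
  moreover have "p ^ (nat \<bar>r\<bar> ^ 2) = p powi (r ^ 2)"
  proof -
    have "p powi (r ^ 2) = p powi (int (nat \<bar>r\<bar>) ^ 2)" by simp
    also have "\<dots> = p ^ (nat \<bar>r\<bar> ^ 2)" by (metis of_nat_power power_int_of_nat)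
    finally show ?thesis by simp
  qed
  ultimately show ?thesis using main[of "nat \<bar>r\<bar>"] unfolding T_def q_def by simp
qed

text \<open>The same for odd rows, with \<open>c = q\<^bsup>2r+2\<^esup>\<close> and
  \<open>x = - q\<^bsup>r+1\<^esup>\<close>.\<close>

lemma bailey_weight_odd:
  assumes q: "norm q < 1" "q \<noteq> 0"
  shows "((\<lambda>n. q ^ (Suc n choose 2) * qf (- q) q n * gbinom q (2 * n + 1) (int n + 1 + r) / qf q q (2 * n + 1))
          has_sum q powi (r * (r + 1) div 2) * qp (- q) q / qp q q) UNIV"
proof -
  define T where "T r n = q ^ (Suc n choose 2) * qf (- q) q n * gbinom q (2 * n + 1) (int n + 1 + r) / qf q q (2 * n + 1)" for r n
  have main: "(T (int r) has_sum q ^ (Suc r choose 2) * qp (- q) q / qp q q) UNIV" for r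
  proof -
    define c where "c = q ^ (2 * r + 2)"
    define y where "y = - (q * q ^ r)"
    define K where "K = q ^ (Suc r choose 2) * qf (- q) q r / qp q q"
    have "((\<lambda>m. K * ((\<Prod>k<m. c * q ^ k - y) * q ^ (m choose 2) * qp (c * q ^ m) q / qf q q m)) has_sum K * qp y q) UNIV"
      by (intro has_sum_cmult_right q_gauss_sum q)
    also have "K * qp y q = q ^ (Suc r choose 2) * qp (- q) q / qp q q"
      using qp_split[OF q(1), of "- q" r] by (simp add: K_def y_def)
    also have "(\<lambda>m. K * ((\<Prod>k<m. c * q ^ k - y) * q ^ (m choose 2) * qp (c * q ^ m) q / qf q q m)) = T (int r) \<circ> (\<lambda>m. m + r)"
    proof
      fix m
      have "(\<Prod>k<m. c * q ^ k - y) = (\<Prod>k<m. (q * q ^ r) * (1 - y * q ^ k))"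
        by (intro prod.cong refl)
           (simp add: c_def y_def power2_eq_square power_mult_distrib power_add power_mult algebra_simps)
      also have "\<dots> = (q * q ^ r) ^ m * qf y q m"
        by (simp only: prod.distrib prod_constant card_lessThan qf_def power_mult_distrib)
      finally have 1: "(\<Prod>k<m. c * q ^ k - y) = (q * q ^ r) ^ m * qf y q m" .
      have 2: "qp q q = qf q q (m + r + r + 1) * qp (c * q ^ m) q"
        using qp_split[OF q(1), of q "m + r + r + 1"] unfolding c_def mult_2 by (simp add: power_add mult_ac)
      have 3: "qf (- q) q (m + r) = qf (- q) q r * qf y q m"
        unfolding add.commute[of m] qf_add by (simp add: y_def)
      have 4: "q ^ (Suc r choose 2) * ((q * q ^ r) ^ m * q ^ (m choose 2)) = q ^ (Suc (m + r) choose 2)"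
      proof -
        have "Suc (m + r) choose 2 = (Suc r choose 2) + (Suc r * m + (m choose 2))"
          using choose_two_add[of "Suc r" m] by (simp add: add_ac)
        then show ?thesis by (simp only: power_add power_mult power_Suc)
      qed
      have 5: "gbinom q (2 * (m + r) + 1) (int (m + r) + 1 + int r) = qf q q (2 * (m + r) + 1) / (qf q q (m + r + r + 1) * qf q q m)"
        using gbinom_nat[of "m + r + r + 1" "2 * (m + r) + 1" q] by (simp add: algebra_simps)
      have nz: "qp q q \<noteq> 0" "qf q q (m + r + r + 1) \<noteq> 0" "qf q q m \<noteq> 0" "qf q q (2 * (m + r) + 1) \<noteq> 0"
        using qp_nonzero[OF q(1) q(1)] qf_nonzero[OF q(1)] by blast+
      then have nz': "qp (c * q ^ m) q \<noteq> 0" using 2 by auto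
      have "K * ((\<Prod>k<m. c * q ^ k - y) * q ^ (m choose 2) * qp (c * q ^ m) q / qf q q m)
        = (q ^ (Suc r choose 2) * ((q * q ^ r) ^ m * q ^ (m choose 2))) * (qf (- q) q r * qf y q m) * (qp (c * q ^ m) q / (qp q q * qf q q m))"
        unfolding K_def 1 by (simp only: mult_ac times_divide_eq_left times_divide_eq_right divide_divide_eq_left)
      also have "qp (c * q ^ m) q / (qp q q * qf q q m) = 1 / (qf q q (m + r + r + 1) * qf q q m)"
        unfolding 2 using nz nz' by (simp del: add_Suc_right)
      also have "(q ^ (Suc r choose 2) * ((q * q ^ r) ^ m * q ^ (m choose 2))) * (qf (- q) q r * qf y q m) * \<dots> = T (int r) (m + r)"
        unfolding 4 3[symmetric] T_def 5 using nz by (simp del: add_Suc_right)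
      finally show "K * ((\<Prod>k<m. c * q ^ k - y) * q ^ (m choose 2) * qp (c * q ^ m) q / qf q q m) = (T (int r) \<circ> (\<lambda>m. m + r)) m"
        by simp
    qed
    also have "((T (int r) \<circ> (\<lambda>m. m + r)) has_sum q ^ (Suc r choose 2) * qp (- q) q / qp q q) UNIV
       \<longleftrightarrow> (T (int r) has_sum q ^ (Suc r choose 2) * qp (- q) q / qp q q) (range (\<lambda>m. m + r))"
      by (rule has_sum_reindex[symmetric]) (auto simp: inj_on_def)
    also have "\<dots> \<longleftrightarrow> (T (int r) has_sum q ^ (Suc r choose 2) * qp (- q) q / qp q q) UNIV"
    proof (rule has_sum_cong_neutral)
      fix n assume n: "n \<in> UNIV - range (\<lambda>m. m + r)"
      have "n < r"
      proof (rule ccontr)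
        assume "\<not> n < r"
        then have "n = (n - r) + r" by simp
        then show False using n by blast
      qed
      then show "T (int r) n = 0" by (simp add: T_def gbinom_outside)
    qed auto
    finally show ?thesis .
  qed
  have tri: "q ^ (Suc r choose 2) = q powi (int r * (int r + 1) div 2)" for r
  proof -
    have "int r * (int r + 1) = 2 * int (Suc r choose 2)"
      using arg_cong[OF square_eq_choose_two[of r], of int] by (simp add: Suc_choose_two power2_eq_square algebra_simps)
    then have "int r * (int r + 1) div 2 = int (Suc r choose 2)" by linarith
    then show ?thesis by simp
  qed
  show ?thesis
  proof (cases "r \<ge> 0")
    case True
    then show ?thesis using main[of "nat r"] unfolding T_def tri by simp
  next
    case False
    define s where "s = nat (- 1 - r)"
    have s: "int s = - 1 - r" using False by (simp add: s_def)
    have "gbinom q (2 * n + 1) (int n + 1 + r) = gbinom q (2 * n + 1) (int n + 1 + int s)" for n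
      using gbinom_sym[of q "2 * n + 1" "int n + 1 + r"] unfolding s by (simp add: algebra_simps)
    moreover have "int s * (int s + 1) = r * (r + 1)" unfolding s by (simp add: algebra_simps)
    ultimately show ?thesis using main[of s] unfolding T_def tri by simp
  qed
qed

text \<open>Bailey's transform: exchange of the two summations. The bound \<open>g\<close>, uniform in
  \<open>j\<close>, makes the double sum absolutely convergent.\<close>

lemma bailey_sum:
  fixes a :: "int \<Rightarrow> complex" and k :: "nat \<Rightarrow> int \<Rightarrow> complex"
  assumes a: "(\<lambda>j. norm (a j)) summable_on UNIV"
    and k: "\<And>n j. norm (k n j) \<le> g n" and g: "g summable_on UNIV"
    and col: "\<And>j. ((\<lambda>n. k n j) has_sum c j) UNIV"
    and row: "\<And>n. ((\<lambda>j. a j * k n j) has_sum b n) UNIV"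
    and tot: "((\<lambda>j. a j * c j) has_sum S) UNIV"
  shows "(b has_sum S) UNIV"
proof -
  have g0: "g n \<ge> 0" for n using k[of n 0] norm_ge_zero order_trans by blast
  have "(\<lambda>(j, n). norm (a j) * g n) summable_on UNIV"
    using summable_on_times[OF a g _ g0] by simp
  then have "(\<lambda>(j, n). a j * k n j) summable_on UNIV"
    by (rule summable_on_norm_bound) (auto simp: norm_mult intro!: mult_left_mono k)
  then obtain S' where S': "((\<lambda>(j, n). a j * k n j) has_sum S') UNIV" by (auto simp: summable_on_def)
  have "((\<lambda>j. a j * c j) has_sum S') UNIV"
    by (rule has_sum_product_iterated[OF S']) (use has_sum_cmult_right[OF col] in auto)
  then have SS: "S' = S" using tot has_sum_unique by blast
  have "bij_betw prod.swap (UNIV :: (nat \<times> int) set) UNIV" by (rule bij_betwI[where g = prod.swap]) auto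
  from has_sum_reindex_bij_betw[OF this, of "\<lambda>(j, n). a j * k n j" S'] S' 
  have "((\<lambda>(n, j). a j * k n j) has_sum S') UNIV" by (simp add: case_prod_unfold)
  then show ?thesis unfolding SS
    by (rule has_sum_product_iterated) (use row in auto)
qed

lemma norm_square_summable:
  assumes p: "norm (p::complex) < 1" "p \<noteq> 0"
  shows "(\<lambda>j::int. norm p powi (j ^ 2)) summable_on UNIV"
proof -
  interpret nome p by unfold_locales (use p in auto)
  show ?thesis using sq_summable by (simp add: sq_def[abs_def])
qed

lemma gbinom_bound:
  assumes q: "norm q < 1"
  obtains C where "C > 0" "\<And>L k. norm (gbinom q L k / qf q q L) \<le> C"
proof -
  obtain C where C: "C > 0" "\<And>n. norm (1 / qf q q n) \<le> C" using qf_inverse_bound[OF q] by blast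
  have "norm (gbinom q L k / qf q q L) \<le> C * C" for L k
  proof (cases "0 \<le> k \<and> k \<le> int L")
    case True
    then have "norm (gbinom q L k / qf q q L) = norm (1 / qf q q (nat k)) * norm (1 / qf q q (nat (int L - k)))"
      using qf_nonzero[OF q, of L] by (simp add: gbinom_def norm_divide norm_mult)
    also have "\<dots> \<le> C * C" using C by (intro mult_mono) auto
    finally show ?thesis .
  next
    case False
    then have "gbinom q L k = 0" by (intro gbinom_outside) auto
    then show ?thesis using C by simp
  qed
  then show ?thesis using that[of "C * C"] C by simp
qed

lemma even_weight_bound:
  assumes p: "norm (p::complex) < 1"
  obtains g where "g summable_on UNIV"
    "\<And>n k. norm (p ^ (n ^ 2) * qf (- p) (p ^ 2) n * gbinom (p ^ 2) (2 * n) k / qf (p ^ 2) (p ^ 2) (2 * n)) \<le> g n"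
proof -
  have q: "norm (p ^ 2) < 1" by (rule norm_power2_less_1[OF p])
  obtain C where C: "C > 0" "\<And>L k. norm (gbinom (p ^ 2) L k / qf (p ^ 2) (p ^ 2) L) \<le> C" using gbinom_bound[OF q] by blast
  obtain B where B: "B > 0" "\<And>n. norm (qf (-p) (p ^ 2) n) \<le> B" using qf_bound[OF q] by blast
  show ?thesis
  proof (rule that[of "\<lambda>n. B * C * (norm (p ^ 2) ^ (n choose 2) * norm p ^ n)"])
    show "(\<lambda>n. B * C * (norm (p ^ 2) ^ (n choose 2) * norm p ^ n)) summable_on UNIV"
      using q by (intro summable_on_cmult_right summable_on_triangular) auto
    fix n k
    have "norm (p ^ (n ^ 2) * qf (- p) (p ^ 2) n * gbinom (p ^ 2) (2 * n) k / qf (p ^ 2) (p ^ 2) (2 * n))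
      = (norm (qf (- p) (p ^ 2) n) * norm (gbinom (p ^ 2) (2 * n) k / qf (p ^ 2) (p ^ 2) (2 * n))) * (norm (p ^ 2) ^ (n choose 2) * norm p ^ n)"
      by (simp add: norm_mult norm_divide norm_power square_eq_choose_two power_add power_mult mult_ac)
    also have "\<dots> \<le> B * C * (norm (p ^ 2) ^ (n choose 2) * norm p ^ n)"
      using B C by (intro mult_right_mono mult_mono) auto
    finally show "norm (p ^ (n ^ 2) * qf (- p) (p ^ 2) n * gbinom (p ^ 2) (2 * n) k / qf (p ^ 2) (p ^ 2) (2 * n)) \<le> \<dots>" .
  qed
qed

lemma odd_weight_bound:
  assumes q: "norm (q::complex) < 1"
  obtains g where "g summable_on UNIV"
    "\<And>n k. norm (q ^ (Suc n choose 2) * qf (- q) q n * gbinom q (2 * n + 1) k / qf q q (2 * n + 1)) \<le> g n"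
proof -
  obtain C where C: "C > 0" "\<And>L k. norm (gbinom q L k / qf q q L) \<le> C" using gbinom_bound[OF q] by blast
  obtain B where B: "B > 0" "\<And>n. norm (qf (-q) q n) \<le> B" using qf_bound[OF q] by blast
  show ?thesis
  proof (rule that[of "\<lambda>n. B * C * (norm q ^ (n choose 2) * norm q ^ n)"])
    show "(\<lambda>n. B * C * (norm q ^ (n choose 2) * norm q ^ n)) summable_on UNIV"
      using q by (intro summable_on_cmult_right summable_on_triangular) auto
    fix n k
    have "norm (q ^ (Suc n choose 2) * qf (- q) q n * gbinom q (2 * n + 1) k / qf q q (2 * n + 1))
      = (norm (qf (- q) q n) * norm (gbinom q (2 * n + 1) k / qf q q (2 * n + 1))) * (norm q ^ (n choose 2) * norm q ^ n)"
      by (simp add: norm_mult norm_divide norm_power Suc_choose_two power_add mult_ac)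
    also have "\<dots> \<le> B * C * (norm q ^ (n choose 2) * norm q ^ n)"
      using B C by (intro mult_right_mono mult_mono) auto
    finally show "norm (q ^ (Suc n choose 2) * qf (- q) q n * gbinom q (2 * n + 1) k / qf q q (2 * n + 1)) \<le> \<dots>" .
  qed
qed

lemma power2_powi: "(z ^ 2) powi e = z powi (2 * e)" for z :: complex
proof -
  have "z powi (2 * e) = (z powi 2) powi e" by (rule power_int_mult)
  then show ?thesis by simp
qed

lemma theta_summable:
  fixes p :: complex
  assumes p: "norm p < 1" "p \<noteq> 0" and N: "N > 0"
  shows "(\<lambda>i::int. p powi (int N * i ^ 2 + b * i + c)) summable_on UNIV"
proof -
  have "norm (p ^ N) < 1" "p ^ N \<noteq> 0" "p powi b \<noteq> 0"
    using p N by (auto simp: norm_power power_less_one_iff)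
  from jacobi_triple_product[OF this]
  have "(\<lambda>i::int. (p ^ N) powi (i ^ 2) * (p powi b) powi i) summable_on UNIV"
    by (auto simp: summable_on_def)
  then have "(\<lambda>i::int. p powi c * ((p ^ N) powi (i ^ 2) * (p powi b) powi i)) summable_on UNIV"
    by (rule summable_on_cmult_right)
  also have "(\<lambda>i::int. p powi c * ((p ^ N) powi (i ^ 2) * (p powi b) powi i)) = (\<lambda>i. p powi (int N * i ^ 2 + b * i + c))"
    using p by (simp add: power_int_add fun_eq_iff mult_ac flip: power_int_mult power_int_of_nat)
  finally show ?thesis .
qed

lemma has_sum_even_odd:
  fixes f :: "int \<Rightarrow> complex"
  assumes e: "((\<lambda>i. f (2 * i)) has_sum a) UNIV" and o: "((\<lambda>i. f (2 * i + 1)) has_sum b) UNIV"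
  shows "(f has_sum (a + b)) UNIV"
proof -
  have "(f has_sum a) (range (\<lambda>i. 2 * i))"
    using e has_sum_reindex[of "\<lambda>i::int. 2 * i" UNIV f a] by (simp add: o_def inj_on_def)
  moreover have "(f has_sum b) (range (\<lambda>i. 2 * i + 1))"
    using o has_sum_reindex[of "\<lambda>i::int. 2 * i + 1" UNIV f b] by (simp add: o_def inj_on_def)
  moreover have "range (\<lambda>i::int. 2 * i) \<inter> range (\<lambda>i. 2 * i + 1) = {}"
    by (auto, presburger)
  ultimately have "(f has_sum (a + b)) (range (\<lambda>i::int. 2 * i) \<union> range (\<lambda>i. 2 * i + 1))"
    by (rule has_sum_Un_disjoint)
  moreover have "n \<in> range (\<lambda>i::int. 2 * i) \<union> range (\<lambda>i. 2 * i + 1)" for n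
    by (cases "even n") (auto elim!: evenE oddE)
  then have "range (\<lambda>i::int. 2 * i) \<union> range (\<lambda>i. 2 * i + 1) = UNIV" by blast
  ultimately show ?thesis by simp
qed

lemma abs_summable_pentagonal:
  assumes p: "norm (p::complex) < 1" "p \<noteq> 0"
  shows "(\<lambda>j. norm (parity_sign j * (p ^ 2) powi (j * (3 * j + 1) div 2))) summable_on UNIV"
proof -
  have "(\<lambda>j::int. p powi (int 3 * j ^ 2 + 1 * j + 0)) summable_on UNIV"
    by (rule theta_summable[OF p]) auto
  then have "(\<lambda>j::int. norm (p powi (int 3 * j ^ 2 + 1 * j + 0))) summable_on UNIV"
    by (simp only: summable_on_iff_abs_summable_on_complex)
  moreover have "(p ^ 2) powi (j * (3 * j + 1) div 2) = p powi (int 3 * j ^ 2 + 1 * j + 0)" for j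
  proof -
    have "(p ^ 2) powi (j * (3 * j + 1) div 2) = p powi (2 * (j * (3 * j + 1) div 2))"
      by (rule power2_powi)
    also have "2 * (j * (3 * j + 1) div 2) = int 3 * j ^ 2 + 1 * j + 0"
      by (simp add: power2_eq_square algebra_simps)
    finally show ?thesis .
  qed
  ultimately show ?thesis by (simp add: norm_mult parity_sign_norm)
qed

text \<open>Rows from \<open>alternating_square_identity\<close>, columns from \<open>bailey_weight_even\<close>.\<close>

lemma slater_squares:
  assumes w: "norm w < 1" "w \<noteq> 0"
  shows "((\<lambda>n. w ^ (n ^ 2) * qf (- w) (w ^ 2) n / qf (w ^ 4) (w ^ 4) n) has_sum
           qp (- w) (w ^ 2) / qp (w ^ 2) (w ^ 2) * (\<Sum>\<^sub>\<infinity>j. parity_sign j * w powi (3 * j ^ 2))) UNIV"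
proof -
  define q where "q = w ^ 2"
  have q: "norm q < 1" "q \<noteq> 0" using norm_power2_less_1[OF w(1)] w by (auto simp: q_def)
  obtain g where g: "g summable_on UNIV"
    "\<And>n k. norm (w ^ (n ^ 2) * qf (- w) (w ^ 2) n * gbinom (w ^ 2) (2 * n) k / qf (w ^ 2) (w ^ 2) (2 * n)) \<le> g n"
    using even_weight_bound[OF w(1)] by blast
  have sm: "(\<lambda>j::int. parity_sign j * w powi (3 * j ^ 2)) summable_on UNIV"
  proof (rule summable_on_norm_bound)
    show "(\<lambda>j::int. norm (w powi (int 3 * j ^ 2 + 0 * j + 0))) summable_on UNIV"
      unfolding summable_on_iff_abs_summable_on_complex[symmetric] by (rule theta_summable[OF w]) auto
  qed (simp add: norm_mult parity_sign_norm)
  show ?thesis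
  proof (rule bailey_sum[where a = "\<lambda>j. parity_sign j * q powi (j ^ 2)" and g = g
        and k = "\<lambda>n j. w ^ (n ^ 2) * qf (- w) q n * gbinom q (2 * n) (int n + j) / qf q q (2 * n)"
        and c = "\<lambda>j. w powi (j ^ 2) * qp (- w) q / qp q q"])
    show "(\<lambda>j. norm (parity_sign j * q powi (j ^ 2))) summable_on UNIV"
      using norm_square_summable[OF q] by (simp add: norm_mult parity_sign_norm norm_power_int)
    show "norm (w ^ (n ^ 2) * qf (- w) q n * gbinom q (2 * n) (int n + j) / qf q q (2 * n)) \<le> g n" for n j
      unfolding q_def by (rule g)
    show "((\<lambda>n. w ^ (n ^ 2) * qf (- w) q n * gbinom q (2 * n) (int n + j) / qf q q (2 * n)) has_sum w powi (j ^ 2) * qp (- w) q / qp q q) UNIV" for j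
      unfolding q_def by (rule bailey_weight_even[OF w])
    show "((\<lambda>j. parity_sign j * q powi (j ^ 2) * (w ^ (n ^ 2) * qf (- w) q n * gbinom q (2 * n) (int n + j) / qf q q (2 * n)))
        has_sum w ^ (n ^ 2) * qf (- w) (w ^ 2) n / qf (w ^ 4) (w ^ 4) n) UNIV" for n
    proof -
      have "((\<lambda>j. w ^ (n ^ 2) * qf (- w) q n / qf q q (2 * n) * (parity_sign j * q powi (j ^ 2) * gbinom q (2 * n) (int n + j)))
        has_sum w ^ (n ^ 2) * qf (- w) q n / qf q q (2 * n) * qf q (q ^ 2) n) UNIV"
        by (intro has_sum_cmult_right alternating_square_identity q)
      moreover have "w ^ (n ^ 2) * qf (- w) q n / qf q q (2 * n) * qf q (q ^ 2) n
         = w ^ (n ^ 2) * qf (- w) (w ^ 2) n / qf (w ^ 4) (w ^ 4) n"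
        unfolding qf_double using qf_q_square_nonzero[OF q(1), of n] by (simp add: q_def)
      ultimately show ?thesis by (simp add: mult_ac)
    qed
    have "((\<lambda>j. qp (- w) q / qp q q * (parity_sign j * w powi (3 * j ^ 2))) has_sum qp (- w) q / qp q q * (\<Sum>\<^sub>\<infinity>j. parity_sign j * w powi (3 * j ^ 2))) UNIV"
      by (intro has_sum_cmult_right has_sum_infsum sm)
    moreover have "q powi (j ^ 2) * w powi (j ^ 2) = w powi (3 * j ^ 2)" for j
    proof -
      have "q powi (j ^ 2) = w powi (2 * j ^ 2)" unfolding q_def by (rule power2_powi)
      then show ?thesis using w by (simp flip: power_int_add)
    qed
    ultimately show "((\<lambda>j. parity_sign j * q powi (j ^ 2) * (w powi (j ^ 2) * qp (- w) q / qp q q)) has_sum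
        qp (- w) (w ^ 2) / qp (w ^ 2) (w ^ 2) * (\<Sum>\<^sub>\<infinity>j. parity_sign j * w powi (3 * j ^ 2))) UNIV"
      by (simp add: q_def[symmetric] mult_ac)
  qed (rule g)
qed

text \<open>Rows from \<open>schur_polynomial_identity\<close> with \<open>L = 2 n\<close>, columns from
  \<open>bailey_weight_even\<close> at \<open>r = (3 j + 1) div 2\<close>; even and odd \<open>j\<close> give the two theta
  series.\<close>

lemma slater_double_even:
  assumes p: "norm p < 1" "p \<noteq> 0"
  shows "((\<lambda>n. p ^ (n ^ 2) * qf (- p) (p ^ 2) n / qf (p ^ 2) (p ^ 2) (2 * n)) has_sum
           qp (- p) (p ^ 2) / qp (p ^ 2) (p ^ 2) *
            ((\<Sum>\<^sub>\<infinity>i::int. p powi (21 * i ^ 2 + 2 * i)) - (\<Sum>\<^sub>\<infinity>i::int. p powi (21 * i ^ 2 + 26 * i + 8)))) UNIV"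
proof -
  define q where "q = p ^ 2"
  have q: "norm q < 1" "q \<noteq> 0" using norm_power2_less_1[OF p(1)] p by (auto simp: q_def)
  obtain g where g: "g summable_on UNIV"
    "\<And>n k. norm (p ^ (n ^ 2) * qf (- p) (p ^ 2) n * gbinom (p ^ 2) (2 * n) k / qf (p ^ 2) (p ^ 2) (2 * n)) \<le> g n"
    using even_weight_bound[OF p(1)] by blast
  define r where "r j = (3 * j + 1) div 2" for j :: int
  define a where "a j = parity_sign j * q powi (j * (3 * j + 1) div 2)" for j
  define T where "T = (\<Sum>\<^sub>\<infinity>i::int. p powi (21 * i ^ 2 + 2 * i)) + - (\<Sum>\<^sub>\<infinity>i::int. p powi (21 * i ^ 2 + 26 * i + 8))"
  have T: "((\<lambda>j. a j * p powi (r j ^ 2)) has_sum T) UNIV"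
    unfolding T_def
  proof (rule has_sum_even_odd)
    have "(\<lambda>i::int. p powi (int 21 * i ^ 2 + 2 * i + 0)) summable_on UNIV"
      by (rule theta_summable[OF p]) auto
    moreover have "a (2 * i) * p powi (r (2 * i) ^ 2) = p powi (21 * i ^ 2 + 2 * i)" for i
    proof -
      have "r (2 * i) = 3 * i" unfolding r_def by presburger
      moreover have "a (2 * i) = p powi (2 * (i * (6 * i + 1)))"
        by (simp add: a_def parity_sign_def q_def power2_powi mult.assoc)
      ultimately show ?thesis
        using p by (simp add: power2_eq_square algebra_simps flip: power_int_add)
    qed
    ultimately show "((\<lambda>i. a (2 * i) * p powi (r (2 * i) ^ 2)) has_sum (\<Sum>\<^sub>\<infinity>i::int. p powi (21 * i ^ 2 + 2 * i))) UNIV"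
      by simp
    have "(\<lambda>i::int. p powi (int 21 * i ^ 2 + 26 * i + 8)) summable_on UNIV"
      by (rule theta_summable[OF p]) auto
    moreover have "a (2 * i + 1) * p powi (r (2 * i + 1) ^ 2) = - (p powi (21 * i ^ 2 + 26 * i + 8))" for i
    proof -
      have 1: "r (2 * i + 1) = 3 * i + 2" unfolding r_def by presburger
      have "(2 * i + 1) * (3 * (2 * i + 1) + 1) = 2 * ((2 * i + 1) * (3 * i + 2))" by (simp add: algebra_simps)
      note e = this
      have "(2 * i + 1) * (3 * (2 * i + 1) + 1) div 2 = (2 * i + 1) * (3 * i + 2)" unfolding e by simp
      then have 2: "a (2 * i + 1) = - (p powi (2 * ((2 * i + 1) * (3 * i + 2))))"
        by (simp add: a_def parity_sign_def q_def power2_powi)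
      have "2 * ((2 * i + 1) * (3 * i + 2)) + (3 * i + 2) ^ 2 = 21 * i ^ 2 + 26 * i + 8"
        by (simp add: power2_eq_square algebra_simps)
      then show ?thesis unfolding 1 2 using p by (simp flip: power_int_add)
    qed
    ultimately show "((\<lambda>i. a (2 * i + 1) * p powi (r (2 * i + 1) ^ 2)) has_sum - (\<Sum>\<^sub>\<infinity>i::int. p powi (21 * i ^ 2 + 26 * i + 8))) UNIV"
      by (simp add: has_sum_uminus)
  qed
  have "((\<lambda>n. p ^ (n ^ 2) * qf (- p) q n / qf q q (2 * n)) has_sum qp (- p) q / qp q q * T) UNIV"
  proof (rule bailey_sum[where a = a and g = g
        and k = "\<lambda>n j. p ^ (n ^ 2) * qf (- p) q n * gbinom q (2 * n) (int n + r j) / qf q q (2 * n)"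
        and c = "\<lambda>j. p powi (r j ^ 2) * qp (- p) q / qp q q"])
    show "(\<lambda>j. norm (a j)) summable_on UNIV"
      unfolding a_def q_def by (rule abs_summable_pentagonal[OF p])
    show "norm (p ^ (n ^ 2) * qf (- p) q n * gbinom q (2 * n) (int n + r j) / qf q q (2 * n)) \<le> g n" for n j
      unfolding q_def by (rule g)
    show "((\<lambda>n. p ^ (n ^ 2) * qf (- p) q n * gbinom q (2 * n) (int n + r j) / qf q q (2 * n)) has_sum p powi (r j ^ 2) * qp (- p) q / qp q q) UNIV" for j
      unfolding q_def by (rule bailey_weight_even[OF p])
    show "((\<lambda>j. a j * (p ^ (n ^ 2) * qf (- p) q n * gbinom q (2 * n) (int n + r j) / qf q q (2 * n)))
        has_sum p ^ (n ^ 2) * qf (- p) q n / qf q q (2 * n)) UNIV" for n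
    proof -
      have idx: "(int (2 * n) + 3 * j + 1) div 2 = int n + r j" for j
        unfolding r_def by simp
      have "((\<lambda>j. p ^ (n ^ 2) * qf (- p) q n / qf q q (2 * n) * (a j * gbinom q (2 * n) (int n + r j)))
        has_sum p ^ (n ^ 2) * qf (- p) q n / qf q q (2 * n) * 1) UNIV"
        unfolding a_def idx[symmetric] by (intro has_sum_cmult_right schur_polynomial_identity q)
      then show ?thesis by (simp add: mult_ac)
    qed
    show "((\<lambda>j. a j * (p powi (r j ^ 2) * qp (- p) q / qp q q)) has_sum qp (- p) q / qp q q * T) UNIV"
      using has_sum_cmult_right[OF T, of "qp (- p) q / qp q q"] by (simp add: mult_ac)
  qed (rule g)
  then show ?thesis by (simp add: q_def T_def)
qed

text \<open>Rows from \<open>schur_polynomial_identity\<close> with \<open>L = 2 n + 1\<close>, columns from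
  \<open>bailey_weight_odd\<close> at \<open>r = 3 j div 2\<close>.\<close>

lemma slater_double_odd:
  assumes p: "norm p < 1" "p \<noteq> 0" and q_def: "q = p ^ 2"
  shows "((\<lambda>n. q ^ (Suc n choose 2) * qf (- q) q n / qf q q (2 * n + 1)) has_sum
           qp (- q) q / qp q q *
            ((\<Sum>\<^sub>\<infinity>i::int. p powi (21 * i ^ 2 + 5 * i)) - (\<Sum>\<^sub>\<infinity>i::int. p powi (21 * i ^ 2 + 23 * i + 6)))) UNIV"
proof -
  have q: "norm q < 1" "q \<noteq> 0" using norm_power2_less_1[OF p(1)] p by (auto simp: q_def)
  obtain g where g: "g summable_on UNIV"
    "\<And>n k. norm (q ^ (Suc n choose 2) * qf (- q) q n * gbinom q (2 * n + 1) k / qf q q (2 * n + 1)) \<le> g n"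
    using odd_weight_bound[OF q(1)] by blast
  define r where "r j = (3 * j) div 2" for j :: int
  define a where "a j = parity_sign j * q powi (j * (3 * j + 1) div 2)" for j
  define T where "T = (\<Sum>\<^sub>\<infinity>i::int. p powi (21 * i ^ 2 + 5 * i)) + - (\<Sum>\<^sub>\<infinity>i::int. p powi (21 * i ^ 2 + 23 * i + 6))"
  have tri: "q powi (m * (m + 1) div 2) = p powi (m * (m + 1))" for m
  proof -
    have "q powi (m * (m + 1) div 2) = p powi (2 * (m * (m + 1) div 2))" unfolding q_def by (rule power2_powi)
    then show ?thesis by simp
  qed
  have T: "((\<lambda>j. a j * q powi (r j * (r j + 1) div 2)) has_sum T) UNIV"
    unfolding T_def
  proof (rule has_sum_even_odd)
    have "(\<lambda>i::int. p powi (int 21 * i ^ 2 + 5 * i + 0)) summable_on UNIV"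
      by (rule theta_summable[OF p]) auto
    moreover have "a (2 * i) * q powi (r (2 * i) * (r (2 * i) + 1) div 2) = p powi (21 * i ^ 2 + 5 * i)" for i
    proof -
      have 1: "r (2 * i) = 3 * i" unfolding r_def by presburger
      have 2: "a (2 * i) = p powi (2 * (i * (6 * i + 1)))"
        by (simp add: a_def parity_sign_def q_def power2_powi mult.assoc)
      have "2 * (i * (6 * i + 1)) + 3 * i * (3 * i + 1) = 21 * i ^ 2 + 5 * i"
        by (simp add: power2_eq_square algebra_simps)
      then show ?thesis unfolding tri 1 2 using p by (simp flip: power_int_add)
    qed
    ultimately show "((\<lambda>i. a (2 * i) * q powi (r (2 * i) * (r (2 * i) + 1) div 2)) has_sum (\<Sum>\<^sub>\<infinity>i::int. p powi (21 * i ^ 2 + 5 * i))) UNIV"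
      by simp
    have "(\<lambda>i::int. p powi (int 21 * i ^ 2 + 23 * i + 6)) summable_on UNIV"
      by (rule theta_summable[OF p]) auto
    moreover have "a (2 * i + 1) * q powi (r (2 * i + 1) * (r (2 * i + 1) + 1) div 2) = - (p powi (21 * i ^ 2 + 23 * i + 6))" for i
    proof -
      have 1: "r (2 * i + 1) = 3 * i + 1" unfolding r_def by presburger
      have "(2 * i + 1) * (3 * (2 * i + 1) + 1) = 2 * ((2 * i + 1) * (3 * i + 2))" by (simp add: algebra_simps)
      note e = this
      have "(2 * i + 1) * (3 * (2 * i + 1) + 1) div 2 = (2 * i + 1) * (3 * i + 2)" unfolding e by simp
      then have 2: "a (2 * i + 1) = - (p powi (2 * ((2 * i + 1) * (3 * i + 2))))"
        by (simp add: a_def parity_sign_def q_def power2_powi)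
      have "2 * ((2 * i + 1) * (3 * i + 2)) + (3 * i + 1) * (3 * i + 1 + 1) = 21 * i ^ 2 + 23 * i + 6"
        by (simp add: power2_eq_square algebra_simps)
      then show ?thesis unfolding tri 1 2 using p by (simp flip: power_int_add)
    qed
    ultimately show "((\<lambda>i. a (2 * i + 1) * q powi (r (2 * i + 1) * (r (2 * i + 1) + 1) div 2)) has_sum - (\<Sum>\<^sub>\<infinity>i::int. p powi (21 * i ^ 2 + 23 * i + 6))) UNIV"
      by (simp add: has_sum_uminus)
  qed
  have "((\<lambda>n. q ^ (Suc n choose 2) * qf (- q) q n / qf q q (2 * n + 1)) has_sum qp (- q) q / qp q q * T) UNIV"
  proof (rule bailey_sum[where a = a and g = g
        and k = "\<lambda>n j. q ^ (Suc n choose 2) * qf (- q) q n * gbinom q (2 * n + 1) (int n + 1 + r j) / qf q q (2 * n + 1)"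
        and c = "\<lambda>j. q powi (r j * (r j + 1) div 2) * qp (- q) q / qp q q"])
    show "(\<lambda>j. norm (a j)) summable_on UNIV"
      unfolding a_def q_def by (rule abs_summable_pentagonal[OF p])
    show "((\<lambda>n. q ^ (Suc n choose 2) * qf (- q) q n * gbinom q (2 * n + 1) (int n + 1 + r j) / qf q q (2 * n + 1)) has_sum q powi (r j * (r j + 1) div 2) * qp (- q) q / qp q q) UNIV" for j
      by (rule bailey_weight_odd[OF q])
    show "((\<lambda>j. a j * (q ^ (Suc n choose 2) * qf (- q) q n * gbinom q (2 * n + 1) (int n + 1 + r j) / qf q q (2 * n + 1)))
        has_sum q ^ (Suc n choose 2) * qf (- q) q n / qf q q (2 * n + 1)) UNIV" for n
    proof -
      have "(int (2 * n + 1) + 3 * j + 1) div 2 = int n + 1 + r j" for j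
        unfolding r_def by presburger
      then have "((\<lambda>j. q ^ (Suc n choose 2) * qf (- q) q n / qf q q (2 * n + 1) * (a j * gbinom q (2 * n + 1) (int n + 1 + r j)))
        has_sum q ^ (Suc n choose 2) * qf (- q) q n / qf q q (2 * n + 1) * 1) UNIV"
        using has_sum_cmult_right[OF schur_polynomial_identity[OF q, of "2 * n + 1"]] by (simp only: a_def)
      then show ?thesis by (simp add: mult_ac)
    qed
    show "((\<lambda>j. a j * (q powi (r j * (r j + 1) div 2) * qp (- q) q / qp q q)) has_sum qp (- q) q / qp q q * T) UNIV"
      using has_sum_cmult_right[OF T, of "qp (- q) q / qp q q"] by (simp add: mult_ac)
  qed (rule g)+
  then show ?thesis by (simp add: T_def)
qed

section \<open>Closed forms of the chain sums\<close>

lemma euler_reciprocal_even_sum: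
  assumes q: "norm q < 1" and z: "norm z < 1"
  shows "((\<lambda>m. z ^ (2 * m) / qf q q (2 * m)) has_sum (1 / qp z q + 1 / qp (- z) q) / 2) UNIV"
proof -
  define f where "f n = 1/2 * (z ^ n / qf q q n + (- z) ^ n / qf q q n)" for n
  have "(f has_sum 1/2 * (1 / qp z q + 1 / qp (- z) q)) UNIV"
    unfolding f_def by (intro has_sum_cmult_right has_sum_add euler_reciprocal_sum q) (use z in auto)
  also have "?this \<longleftrightarrow> (f has_sum 1/2 * (1 / qp z q + 1 / qp (- z) q)) (range (\<lambda>m. 2 * m))"
  proof (rule has_sum_cong_neutral)
    fix n assume "n \<in> UNIV - range (\<lambda>m::nat. 2 * m)"
    then have "odd n" by (auto elim!: evenE)
    then show "f n = 0" by (simp add: f_def)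
  qed auto
  also have "\<dots> \<longleftrightarrow> ((f \<circ> (\<lambda>m. 2 * m)) has_sum 1/2 * (1 / qp z q + 1 / qp (- z) q)) UNIV"
    by (rule has_sum_reindex) (auto simp: inj_on_def)
  finally show ?thesis by (simp add: f_def o_def)
qed

text \<open>Expand \<open>(w\<^sup>2;q)\<^bsub>s+k\<^esub>\<close>, up to the factor
  \<open>(w\<^sup>2;q)\<^sub>\<infinity>\<close>, as a sum over \<open>m\<close> by Euler's second theorem and carry
  out the sum over \<open>k\<close> by the first one. Because the bases are \<open>w\<^sup>2\<close> and
  \<open>w\<^sup>4\<close>, the products combine to \<open>(w\<^sup>2;w\<^sup>2)\<^bsub>2m\<^esub>\<close>, so that
  the sum over \<open>m\<close> is the even part of Euler's series at \<open>w\<^bsup>2s+1\<^esup>\<close>.\<close>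

lemma heine_type_sum:
  assumes w: "norm w < 1" "w \<noteq> 0"
  shows "((\<lambda>k. (- (w ^ 2)) ^ (k ^ 2) * qf (w ^ 2) (w ^ 4) (s + k) / qf (w ^ 4) (w ^ 4) k) has_sum
      (qp (w ^ 2) (w ^ 4)) ^ 2 / 2 * (qf w (w ^ 2) s / qp w (w ^ 2) + qf (- w) (w ^ 2) s / qp (- w) (w ^ 2))) UNIV"
proof -
  define P where "P = w ^ 2"
  define q where "q = w ^ 4"
  define p where "p = - P"
  have P: "norm P < 1" unfolding P_def by (rule norm_power2_less_1[OF w(1)])
  have qP: "q = P ^ 2" by (simp add: q_def P_def)
  have q: "norm q < 1" unfolding qP by (rule norm_power2_less_1[OF P])
  have p: "norm p < 1" using P by (simp add: p_def)
  have pq: "p ^ 2 = q" by (simp add: p_def qP)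
  obtain C where C: "C > 0" "\<And>n. norm (1 / qf q q n) \<le> C" using qf_inverse_bound[OF q] by blast
  define F where "F = (\<lambda>(k, m). p ^ (k ^ 2) / qf q q k * ((P * q ^ (s + k)) ^ m / qf q q m))"
  have qle: "norm q ^ m \<le> 1" for m using q by (intro power_le_one) auto
  have summ: "F summable_on UNIV"
  proof (rule summable_on_norm_bound)
    have "(\<lambda>k. norm (p ^ 2) ^ (k choose 2) * norm p ^ k) summable_on UNIV"
      by (intro summable_on_triangular) (use norm_power2_less_1[OF p] in auto)
    moreover have "(\<lambda>m. norm P ^ m) summable_on UNIV"
      by (intro norm_summable_imp_summable_on) (use P in \<open>simp add: summable_geometric\<close>)
    ultimately have "(\<lambda>(k, m). (norm (p ^ 2) ^ (k choose 2) * norm p ^ k) * norm P ^ m) summable_on UNIV \<times> UNIV"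
      by (rule summable_on_times) auto
    then have "(\<lambda>km. C * C * (case km of (k, m) \<Rightarrow> (norm (p ^ 2) ^ (k choose 2) * norm p ^ k) * norm P ^ m)) summable_on UNIV \<times> UNIV"
      by (rule summable_on_cmult_right)
    then show "(\<lambda>km. C * C * (case km of (k, m) \<Rightarrow> (norm (p ^ 2) ^ (k choose 2) * norm p ^ k) * norm P ^ m)) summable_on UNIV"
      by simp
  next
    fix km :: "nat \<times> nat"
    obtain k m where km: "km = (k, m)" by force
    have "norm (F km) = (norm (1 / qf q q k) * norm (1 / qf q q m)) * (norm p ^ (k ^ 2) * (norm P * norm q ^ (s + k)) ^ m)"
      by (simp add: F_def km norm_mult norm_divide norm_power)
    also have "\<dots> \<le> (C * C) * (norm p ^ (k ^ 2) * norm P ^ m)"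
      using C mult_left_mono[OF qle[of "s + k"], of "norm P"] by (intro mult_mono power_mono) auto
    also have "norm p ^ (k ^ 2) = norm (p ^ 2) ^ (k choose 2) * norm p ^ k"
      by (simp add: square_eq_choose_two power_add power_mult norm_power)
    finally show "norm (F km) \<le> C * C * (case km of (k, m) \<Rightarrow> (norm (p ^ 2) ^ (k choose 2) * norm p ^ k) * norm P ^ m)"
      by (simp add: km)
  qed
  then obtain S where S: "(F has_sum S) UNIV" by (auto simp: summable_on_def)
  have qpP: "qp P q \<noteq> 0" by (rule qp_nonzero[OF q P])
  have 1: "((\<lambda>k. 1 / qp P q * (p ^ (k ^ 2) * qf P q (s + k) / qf q q k)) has_sum S) UNIV"
  proof (rule has_sum_product_iterated[OF S])
    fix k
    have "((\<lambda>m. p ^ (k ^ 2) / qf q q k * ((P * q ^ (s + k)) ^ m / qf q q m)) has_sum p ^ (k ^ 2) / qf q q k * (1 / qp (P * q ^ (s + k)) q)) UNIV"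
      by (intro has_sum_cmult_right euler_reciprocal_sum q norm_mult_power_less P)
    moreover have "1 / qp (P * q ^ (s + k)) q = qf P q (s + k) / qp P q"
      using qp_split[OF q, of P "s + k"] qpP by (simp add: field_simps)
    ultimately show "((\<lambda>m. F (k, m)) has_sum 1 / qp P q * (p ^ (k ^ 2) * qf P q (s + k) / qf q q k)) UNIV"
      by (simp add: F_def mult_ac)
  qed
  have bij: "bij_betw prod.swap (UNIV :: (nat \<times> nat) set) UNIV" by (rule bij_betwI[where g = prod.swap]) auto
  have S': "((\<lambda>z. F (prod.swap z)) has_sum S) UNIV"
    using has_sum_reindex_bij_betw[OF bij, of F S] S by simp
  have 2: "((\<lambda>m. qp P q * ((w * P ^ s) ^ (2 * m) / qf P P (2 * m))) has_sum S) UNIV"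
  proof (rule has_sum_product_iterated[OF S'])
    fix m
    have "((\<lambda>k. P ^ m * q ^ (s * m) / qf q q m * (p ^ (k ^ 2) * (q ^ m) ^ k / qf (p ^ 2) (p ^ 2) k)) has_sum
        P ^ m * q ^ (s * m) / qf q q m * qp (- p * q ^ m) (p ^ 2)) UNIV"
      by (intro has_sum_cmult_right euler_square_sum p)
    moreover have "P ^ m * q ^ (s * m) / qf q q m * (p ^ (k ^ 2) * (q ^ m) ^ k / qf (p ^ 2) (p ^ 2) k) = F (prod.swap (m, k))" for k
      by (simp add: F_def pq power_mult_distrib power_add mult_ac flip: power_mult)
    moreover have "P ^ m * q ^ (s * m) / qf q q m * qp (- p * q ^ m) (p ^ 2) = qp P q * ((w * P ^ s) ^ (2 * m) / qf P P (2 * m))"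
    proof -
      have "qp P q = qf P q m * qp (P * q ^ m) q" by (rule qp_split[OF q])
      moreover have "qf P P (2 * m) = qf P q m * qf q q m" unfolding qf_double qP ..
      moreover have "(w * P ^ s) ^ (2 * m) = P ^ m * q ^ (s * m)"
        by (simp add: P_def q_def power_mult_distrib mult_ac flip: power_mult)
      moreover have "qf P q m \<noteq> 0" using qf_q_square_nonzero[OF P, of m] by (simp add: qP)
      ultimately show ?thesis unfolding pq by (simp add: p_def)
    qed
    ultimately show "((\<lambda>k. F (prod.swap (m, k))) has_sum qp P q * ((w * P ^ s) ^ (2 * m) / qf P P (2 * m))) UNIV"
      by simp
  qed
  have wP: "norm (w * P ^ s) < 1" by (rule norm_mult_power_less[OF P w(1)])
  have "((\<lambda>m. qp P q * ((w * P ^ s) ^ (2 * m) / qf P P (2 * m))) has_sum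
      qp P q * ((1 / qp (w * P ^ s) P + 1 / qp (- (w * P ^ s)) P) / 2)) UNIV"
    by (intro has_sum_cmult_right euler_reciprocal_even_sum P wP)
  with 2 have S_eq: "S = qp P q * ((1 / qp (w * P ^ s) P + 1 / qp (- (w * P ^ s)) P) / 2)"
    using has_sum_unique by blast
  have r1: "1 / qp (w * P ^ s) P = qf w P s / qp w P"
    using qp_split[OF P, of w s] qp_nonzero[OF P w(1)] by (simp add: field_simps)
  have r2: "1 / qp (- (w * P ^ s)) P = qf (- w) P s / qp (- w) P"
    using qp_split[OF P, of "- w" s] qp_nonzero[OF P, of "- w"] w(1) by (simp add: field_simps)
  have "((\<lambda>k. qp P q * (1 / qp P q * (p ^ (k ^ 2) * qf P q (s + k) / qf q q k))) has_sum qp P q * S) UNIV"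
    by (rule has_sum_cmult_right[OF 1])
  then have "((\<lambda>k. p ^ (k ^ 2) * qf P q (s + k) / qf q q k) has_sum qp P q * S) UNIV"
    using qpP by simp
  moreover have "qp P q * S = (qp P q) ^ 2 / 2 * (qf w P s / qp w P + qf (- w) P s / qp (- w) P)"
    unfolding S_eq r1 r2 by (simp add: power2_eq_square)
  ultimately have "((\<lambda>k. p ^ (k ^ 2) * qf P q (s + k) / qf q q k) has_sum
      (qp P q) ^ 2 / 2 * (qf w P s / qp w P + qf (- w) P s / qp (- w) P)) UNIV" by (simp only:)
  then show ?thesis by (simp only: P_def q_def p_def)
qed

context nome
begin

text \<open>With this base, \<open>p = - w\<^sup>2\<close> and \<open>q = w\<^sup>4\<close>, which is the shape of
  \<open>heine_type_sum\<close> and of the Slater identities for \<open>r = 4\<close>.\<close>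

definition w where "w = \<i> * x"

lemma w_nonzero: "w \<noteq> 0" and norm_w: "norm w < 1"
  using x_nonzero norm_x by (auto simp: w_def norm_mult)

lemma w_squared: "w ^ 2 = - p" and w_fourth: "w ^ 4 = q"
proof -
  show 1: "w ^ 2 = - p" by (simp add: w_def p_def power_mult_distrib)
  have "w ^ 4 = (w ^ 2) ^ 2" by (simp flip: power_mult)
  then show "w ^ 4 = q" unfolding 1 by (simp add: p_squared)
qed

lemma q_pow_nat: "q ^ n = x powi (4 * int n)"
  by (simp flip: q_powi)

text \<open>Replacing \<open>x\<close> by \<open>w\<close> in \<open>x\<^bsup>s\<^sup>2\<^esup>\<close> costs a factor \<open>1\<close> or
  \<open>- \<i>\<close> according to the parity of \<open>s\<close>, and \<open>A s\<close> also depends on that parity only;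
  both are absorbed into one combination of \<open>1\<close> and \<open>(-1)\<^sup>s\<close>.\<close>

lemma A_times_square_power:
  "A (int s) * x powi (int s ^ 2) = ((A 0 - \<i> * A 1) / 2 + (-1) ^ s * ((A 0 + \<i> * A 1) / 2)) * w ^ (s ^ 2)"
proof (cases "even s")
  case True
  then obtain t where "s = 2 * t" by (rule evenE)
  then have s: "s ^ 2 = 4 * t ^ 2" by (simp add: power_mult_distrib)
  have "w ^ (s ^ 2) = x ^ (s ^ 2)"
    unfolding s power_mult w_fourth by (simp add: q_def)
  then show ?thesis using True by (simp add: A_parity[of "int s"] powi_square_nat field_simps)
next
  case False
  then obtain t where "s = 2 * t + 1" by (rule oddE)
  then have s: "s ^ 2 = 4 * (t ^ 2 + t) + 1" by (simp add: power2_eq_square algebra_simps)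
  have "w ^ (s ^ 2) = \<i> * x ^ (s ^ 2)"
    unfolding s power_add power_mult w_fourth by (simp add: q_def w_def)
  then show ?thesis using False by (simp add: A_parity[of "int s"] powi_square_nat field_simps)
qed

lemma parity_sign_powi_square: "(- z) powi (3 * j ^ 2) = parity_sign j * z powi (3 * j ^ 2)" for z :: complex
  by (auto simp: power_int_minus_left parity_sign_def)

text \<open>In \<open>red4\<close> the sum over \<open>k\<close> is \<open>heine_type_sum\<close>, a combination of
  \<open>(w;w\<^sup>2)\<^sub>s\<close> and \<open>(-w;w\<^sup>2)\<^sub>s\<close>. By \<open>A_times_square_power\<close> the sums
  over \<open>s\<close> are then the two Slater identities, alternating and not, at \<open>w\<close> and at
  \<open>- w\<close>.\<close>

theorem chain4_evaluation:
  defines "\<alpha> \<equiv> (A 0 - \<i> * A 1) / 2" and "\<beta> \<equiv> (A 0 + \<i> * A 1) / 2"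
  shows "infsum chain4 UNIV = (qp (- p) q) ^ 3 / (2 * qp q q) *
    ((\<alpha> * (\<Sum>\<^sub>\<infinity>j. parity_sign j * w powi (3 * j ^ 2)) + \<beta> * (\<Sum>\<^sub>\<infinity>j. w powi (3 * j ^ 2))) / qp (- p) (- p)
     + (\<alpha> * (qp (- w) (- p) / qp w (- p)) + \<beta> * (qp w (- p) / qp (- w) (- p))) / qp p (- p))"
proof -
  define P where "P = - p"
  have wP: "w ^ 2 = P" "- (w ^ 2) = p" by (simp_all add: w_squared P_def)
  define \<phi>0 where "\<phi>0 = (\<Sum>\<^sub>\<infinity>j. parity_sign j * w powi (3 * j ^ 2))"
  define \<phi>1 where "\<phi>1 = (\<Sum>\<^sub>\<infinity>j::int. w powi (3 * j ^ 2))"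
  have P: "norm P < 1" using norm_p by (simp add: P_def)
  have nz: "qp w P \<noteq> 0" "qp (- w) P \<noteq> 0" by (intro qp_nonzero P; simp add: norm_w)+
  define t where "t y \<epsilon> s = \<epsilon> ^ s * y ^ (s ^ 2) * qf (- y) P s / qf q q s" for y \<epsilon> :: complex and s
  have S4: "(t w (-1) has_sum qp w P / qp p P) UNIV"
    using slater_alternating[OF norm_w] unfolding t_def wP w_fourth by (simp add: P_def)
  have S4': "(t (- w) (-1) has_sum qp (- w) P / qp p P) UNIV"
    using slater_alternating[of "- w"] norm_w unfolding t_def by (simp add: w_squared w_fourth P_def)
  have S25: "(t w 1 has_sum qp (- w) P / qp P P * \<phi>0) UNIV"
    using slater_squares[OF norm_w w_nonzero] unfolding t_def wP w_fourth \<phi>0_def by simp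
  have S25': "(t (- w) 1 has_sum qp w P / qp P P * \<phi>1) UNIV"
  proof -
    have "(\<Sum>\<^sub>\<infinity>j. parity_sign j * (- w) powi (3 * j ^ 2)) = \<phi>1"
      unfolding \<phi>1_def parity_sign_powi_square by (intro infsum_cong) (simp add: parity_sign_def)
    then show ?thesis
      using slater_squares[of "- w"] norm_w w_nonzero unfolding t_def by (simp add: wP w_fourth)
  qed
  define \<Phi> where "\<Phi> = (\<alpha> * (qp (- w) P / qp P P * \<phi>0) + \<beta> * (qp w P / qp p P)) / qp (- w) P
     + (\<alpha> * (qp (- w) P / qp p P) + \<beta> * (qp w P / qp P P * \<phi>1)) / qp w P"
  have sum1: "((\<lambda>s. (qp P q) ^ 2 / 2 * ((\<alpha> * t w 1 s + \<beta> * t w (-1) s) * (1 / qp (- w) P)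
      + (\<alpha> * t (- w) (-1) s + \<beta> * t (- w) 1 s) * (1 / qp w P))) has_sum (qp P q) ^ 2 / 2 *
        ((\<alpha> * (qp (- w) P / qp P P * \<phi>0) + \<beta> * (qp w P / qp p P)) * (1 / qp (- w) P)
     + (\<alpha> * (qp (- w) P / qp p P) + \<beta> * (qp w P / qp P P * \<phi>1)) * (1 / qp w P))) UNIV"
    by (intro has_sum_cmult_right has_sum_add has_sum_cmult_left S4 S4' S25 S25')
  have sum2: "((\<lambda>s. A (int s) * x powi (int s ^ 2) / qf q q s *
      ((qp P q) ^ 2 / 2 * (qf w P s / qp w P + qf (- w) P s / qp (- w) P))) has_sum infsum red4 UNIV) UNIV"
  proof (rule has_sum_product_iterated[OF has_sum_infsum[OF red4_summable]])
    fix s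
    have "((\<lambda>k. A (int s) * x powi (int s ^ 2) / qf q q s * (p ^ (k ^ 2) * qf P q (s + k) / qf q q k)) has_sum
      A (int s) * x powi (int s ^ 2) / qf q q s *
      ((qp P q) ^ 2 / 2 * (qf w P s / qp w P + qf (- w) P s / qp (- w) P))) UNIV"
      using heine_type_sum[OF norm_w w_nonzero, of s] unfolding wP(2) unfolding wP(1) w_fourth
      by (intro has_sum_cmult_right)
    also have "(\<lambda>k. A (int s) * x powi (int s ^ 2) / qf q q s * (p ^ (k ^ 2) * qf P q (s + k) / qf q q k)) = (\<lambda>k. red4 (s, k))"
      by (simp add: red4_def x_powi_add P_def fun_eq_iff flip: p_powi) (simp add: powi_square_nat)
    finally show "((\<lambda>k. red4 (s, k)) has_sum A (int s) * x powi (int s ^ 2) / qf q q s *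
      ((qp P q) ^ 2 / 2 * (qf w P s / qp w P + qf (- w) P s / qp (- w) P))) UNIV" .
  qed
  have eq: "A (int s) * x powi (int s ^ 2) / qf q q s *
      ((qp P q) ^ 2 / 2 * (qf w P s / qp w P + qf (- w) P s / qp (- w) P))
      = (qp P q) ^ 2 / 2 * ((\<alpha> * t w 1 s + \<beta> * t w (-1) s) * (1 / qp (- w) P)
      + (\<alpha> * t (- w) (-1) s + \<beta> * t (- w) 1 s) * (1 / qp w P))" for s
  proof -
    have m: "(- w) ^ (s ^ 2) = (-1) ^ s * w ^ (s ^ 2)"
      by (cases "even s") auto
    have 1: "\<alpha> * t w 1 s + \<beta> * t w (-1) s = (\<alpha> + (-1) ^ s * \<beta>) * w ^ (s ^ 2) * (qf (- w) P s / qf q q s)"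
      by (simp add: t_def algebra_simps add_divide_distrib)
    have "(-1) ^ s * ((-1) ^ s * z) = z" for z :: complex by (cases "even s") auto
    then have 2: "\<alpha> * t (- w) (-1) s + \<beta> * t (- w) 1 s = (\<alpha> + (-1) ^ s * \<beta>) * w ^ (s ^ 2) * (qf w P s / qf q q s)"
      by (simp add: t_def m algebra_simps add_divide_distrib)
    show ?thesis
      unfolding 1 2 unfolding \<alpha>_def \<beta>_def A_times_square_power[symmetric] by (simp add: algebra_simps)
  qed
  have "infsum red4 UNIV = (qp P q) ^ 2 / 2 *
        ((\<alpha> * (qp (- w) P / qp P P * \<phi>0) + \<beta> * (qp w P / qp p P)) * (1 / qp (- w) P)
     + (\<alpha> * (qp (- w) P / qp p P) + \<beta> * (qp w P / qp P P * \<phi>1)) * (1 / qp w P))"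
    using sum1 sum2 unfolding eq using has_sum_unique by blast
  also have "\<dots> = (qp P q) ^ 2 / 2 * ((\<alpha> * \<phi>0 + \<beta> * \<phi>1) / qp P P
     + (\<alpha> * (qp (- w) P / qp w P) + \<beta> * (qp w P / qp (- w) P)) / qp p P)"
    using nz by (simp add: ring_distribs add_divide_distrib mult_ac)
  finally have R: "infsum red4 UNIV = (qp P q) ^ 2 / 2 * ((\<alpha> * \<phi>0 + \<beta> * \<phi>1) / qp P P
     + (\<alpha> * (qp (- w) P / qp w P) + \<beta> * (qp w P / qp (- w) P)) / qp p P)" .
  have "a / b * (a ^ 2 / 2 * X) = a ^ 3 / (2 * b) * X" for a b X :: complex
    by (simp add: power3_eq_cube power2_eq_square mult_ac)
  then show ?thesis
    unfolding chain4_reduction R unfolding P_def \<phi>0_def \<phi>1_def .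
qed

end

lemma has_sum_even_odd_nat:
  fixes f :: "nat \<Rightarrow> complex"
  assumes e: "((\<lambda>i. f (2 * i)) has_sum a) UNIV" and o: "((\<lambda>i. f (2 * i + 1)) has_sum b) UNIV"
  shows "(f has_sum (a + b)) UNIV"
proof -
  have "(f has_sum a) (range (\<lambda>i. 2 * i))"
    using e has_sum_reindex[of "\<lambda>i::nat. 2 * i" UNIV f a] by (simp add: o_def inj_on_def)
  moreover have "(f has_sum b) (range (\<lambda>i. 2 * i + 1))"
    using o has_sum_reindex[of "\<lambda>i::nat. 2 * i + 1" UNIV f b] by (simp add: o_def inj_on_def)
  moreover have "range (\<lambda>i::nat. 2 * i) \<inter> range (\<lambda>i. 2 * i + 1) = {}"
    by (auto, presburger)
  ultimately have "(f has_sum (a + b)) (range (\<lambda>i::nat. 2 * i) \<union> range (\<lambda>i. 2 * i + 1))"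
    by (rule has_sum_Un_disjoint)
  moreover have "n \<in> range (\<lambda>i::nat. 2 * i) \<union> range (\<lambda>i. 2 * i + 1)" for n
    by (cases "even n") (auto elim!: evenE oddE)
  then have "range (\<lambda>i::nat. 2 * i) \<union> range (\<lambda>i. 2 * i + 1) = UNIV" by blast
  ultimately show ?thesis by simp
qed

context nome
begin

definition T1 :: "complex \<Rightarrow> complex" where
  "T1 y = (\<Sum>\<^sub>\<infinity>i::int. y powi (21 * i ^ 2 + 2 * i)) - (\<Sum>\<^sub>\<infinity>i::int. y powi (21 * i ^ 2 + 26 * i + 8))"

definition T2 :: complex where
  "T2 = (\<Sum>\<^sub>\<infinity>i::int. p powi (21 * i ^ 2 + 5 * i)) - (\<Sum>\<^sub>\<infinity>i::int. p powi (21 * i ^ 2 + 23 * i + 6))"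

text \<open>For fixed \<open>m\<close> the sum over \<open>s\<close> in \<open>red5\<close> is of Euler's type. If \<open>m\<close> is even,
  \<open>s\<close> and \<open>s - m\<close> have the same parity, and the product of the two \<open>A\<close> depends on the
  parity of \<open>s\<close>, which gives the base points \<open>p\<close> and \<open>- p\<close>; if \<open>m\<close> is odd the product is
  always \<open>A 0 * A 1\<close>. The remaining sums over even and odd \<open>m\<close> are \<open>slater_double_even\<close>
  and \<open>slater_double_odd\<close>.\<close>

theorem chain5_evaluation:
  "infsum chain5 UNIV = qp (- p) q / (qp q q) ^ 3 *
     ((A 0 ^ 2 + A 1 ^ 2) / 2 * (qp (- p) q) ^ 2 * T1 p + (A 0 ^ 2 - A 1 ^ 2) / 2 * (qp p q) ^ 2 * T1 (- p)
       + 2 * A 0 * A 1 * x * (qp (- q) q) ^ 2 * T2)"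
proof -
  define u where "u = (A 0 ^ 2 + A 1 ^ 2) / 2"
  define v where "v = (A 0 ^ 2 - A 1 ^ 2) / 2"
  have padd: "x powi (a + b) = x powi a * x powi b" for a b by (rule x_powi_add)
  define g where "g m = (if even m then
      u * qp (- p) q * (p ^ ((m div 2) ^ 2) * qf (- p) q (m div 2) / qf q q (2 * (m div 2)))
    + v * qp p q * ((- p) ^ ((m div 2) ^ 2) * qf p q (m div 2) / qf q q (2 * (m div 2)))
    else 2 * A 0 * A 1 * x * qp (- q) q * (q ^ (Suc (m div 2) choose 2) * qf (- q) q (m div 2) / qf q q (2 * (m div 2) + 1)))" for m
  have red: "(red5 has_sum infsum red5 UNIV) UNIV"
    using chain5_reduction(1) by (rule has_sum_infsum)
  have "bij_betw prod.swap (UNIV :: (nat \<times> nat) set) UNIV" by (rule bij_betwI[where g = prod.swap]) auto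
  from has_sum_reindex_bij_betw[OF this, of red5 "infsum red5 UNIV"]
  have red': "((\<lambda>z. red5 (prod.swap z)) has_sum infsum red5 UNIV) UNIV" using red by simp
  have "(g has_sum infsum red5 UNIV) UNIV"
  proof (rule has_sum_product_iterated[OF red'])
    fix m
    show "((\<lambda>s. red5 (prod.swap (m, s))) has_sum g m) UNIV"
    proof (cases "even m")
      case True
      then obtain j where m: "m = 2 * j" by (rule evenE)
      define z where "z = q powi (- int j)"
      have AA: "A (int s) * A (int s - int m) = u + (-1) ^ s * v" for s
        using A_parity[of "int s"] A_parity[of "int s - int m"]
        by (auto simp: m u_def v_def power2_eq_square field_simps)
      have xx: "x powi (int s ^ 2 + (int s - int m) ^ 2) = q ^ (j ^ 2) * (p ^ (s ^ 2) * z ^ s)" for s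
      proof -
        have "z ^ s = x powi (4 * (- int j) * int s)"
          unfolding z_def q_powi power_int_of_nat[symmetric] power_int_mult ..
        moreover have "q ^ (j ^ 2) = x powi (4 * int j ^ 2)" "p ^ (s ^ 2) = x powi (2 * int s ^ 2)"
          by (simp_all add: powi_square_nat flip: q_powi p_powi)
        moreover have "int s ^ 2 + (int s - int m) ^ 2 = 4 * int j ^ 2 + (2 * int s ^ 2 + 4 * (- int j) * int s)"
          by (simp add: m power2_eq_square algebra_simps)
        ultimately show ?thesis by (simp only: padd)
      qed
      have "((\<lambda>s. q ^ (j ^ 2) / qf q q m * (u * (p ^ (s ^ 2) * z ^ s / qf (p ^ 2) (p ^ 2) s) + v * (p ^ (s ^ 2) * (- z) ^ s / qf (p ^ 2) (p ^ 2) s)))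
        has_sum q ^ (j ^ 2) / qf q q m * (u * qp (- p * z) (p ^ 2) + v * qp (- p * (- z)) (p ^ 2))) UNIV"
        by (intro has_sum_cmult_right has_sum_add euler_square_sum norm_p)
      also have "(\<lambda>s. q ^ (j ^ 2) / qf q q m * (u * (p ^ (s ^ 2) * z ^ s / qf (p ^ 2) (p ^ 2) s) + v * (p ^ (s ^ 2) * (- z) ^ s / qf (p ^ 2) (p ^ 2) s)))
        = (\<lambda>s. red5 (prod.swap (m, s)))"
      proof
        fix s
        have "red5 (prod.swap (m, s)) = (u + (-1) ^ s * v) * (q ^ (j ^ 2) * (p ^ (s ^ 2) * z ^ s)) / (qf q q s * qf q q m)"
          by (simp add: red5_def AA xx)
        then show "q ^ (j ^ 2) / qf q q m * (u * (p ^ (s ^ 2) * z ^ s / qf (p ^ 2) (p ^ 2) s) + v * (p ^ (s ^ 2) * (- z) ^ s / qf (p ^ 2) (p ^ 2) s))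
          = red5 (prod.swap (m, s))"
          by (simp add: p_squared power_minus[of z] algebra_simps add_divide_distrib)
      qed
      also have "q ^ (j ^ 2) / qf q q m * (u * qp (- p * z) (p ^ 2) + v * qp (- p * (- z)) (p ^ 2)) = g m"
      proof -
        have pp: "q / p = p" using p_nonzero by (simp add: p_squared[symmetric] power2_eq_square)
        have r1: "qp (- p * z) q = p ^ j * q powi (- int (Suc j choose 2)) * qf (- p) q j * qp (- p) q"
          unfolding z_def by (subst qp_reflect) (use norm_q q_nonzero p_nonzero pp in auto)
        have r2: "qp (- p * (- z)) q = (- p) ^ j * q powi (- int (Suc j choose 2)) * qf p q j * qp p q"
          using qp_reflect[OF norm_q q_nonzero p_nonzero, of j] unfolding z_def pp by simp
        have e: "q ^ (j ^ 2) * (p ^ j * q powi (- int (Suc j choose 2))) = p ^ (j ^ 2)"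
        proof -
          have "2 * int (Suc j choose 2) = int j ^ 2 + int j"
            using arg_cong[OF square_eq_choose_two[of j], of int] by (simp add: Suc_choose_two)
          then have "4 * int j ^ 2 + (2 * int j + 4 * (- int (Suc j choose 2))) = 2 * int j ^ 2" by simp
          moreover have "q ^ (j ^ 2) = x powi (4 * int j ^ 2)" "p ^ j = x powi (2 * int j)"
             "q powi (- int (Suc j choose 2)) = x powi (4 * (- int (Suc j choose 2)))" "p ^ (j ^ 2) = x powi (2 * int j ^ 2)"
            by (simp_all only: powi_square_nat flip: q_powi p_powi) simp
          ultimately show ?thesis by (simp only: padd[symmetric])
        qed
        have e': "q ^ (j ^ 2) * ((- p) ^ j * q powi (- int (Suc j choose 2))) = (- p) ^ (j ^ 2)"
        proof -
          have "(- p) ^ j = (-1) ^ j * p ^ j" "(- p) ^ (j ^ 2) = (-1) ^ j * p ^ (j ^ 2)"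
            by (cases "even j"; simp)+
          then show ?thesis using e by (simp add: mult_ac)
        qed
        have "q ^ (j ^ 2) / qf q q m * (u * qp (- p * z) q + v * qp (- p * (- z)) q)
           = u * qp (- p) q * ((q ^ (j ^ 2) * (p ^ j * q powi (- int (Suc j choose 2)))) * qf (- p) q j / qf q q m)
           + v * qp p q * ((q ^ (j ^ 2) * ((- p) ^ j * q powi (- int (Suc j choose 2)))) * qf p q j / qf q q m)"
          unfolding r1 r2 by (simp add: algebra_simps add_divide_distrib)
        then show ?thesis unfolding e e' p_squared by (simp add: g_def m)
      qed
      finally show ?thesis .
    next
      case False
      then obtain j where m: "m = 2 * j + 1" by (rule oddE)
      define z where "z = q powi (- int j)"
      have AA: "A (int s) * A (int s - int m) = A 0 * A 1" for s
        using A_parity[of "int s"] A_parity[of "int s - int m"]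
        by (auto simp: m)
      have xx: "x powi (int s ^ 2 + (int s - int m) ^ 2) = x * q ^ (j ^ 2 + j) * (q ^ (s choose 2) * z ^ s)" for s
      proof -
        have z: "z ^ s = x powi (4 * (- int j) * int s)"
          unfolding z_def q_powi power_int_of_nat[symmetric] power_int_mult ..
        have e: "int s ^ 2 + (int s - int m) ^ 2 = 1 + 4 * int (j ^ 2 + j) + (4 * int (s choose 2) + 4 * (- int j) * int s)"
          using arg_cong[OF square_eq_choose_two[of s], of int] by (simp add: m power2_eq_square algebra_simps)
        show ?thesis unfolding e padd q_pow_nat z by simp
      qed
      have "((\<lambda>s. A 0 * A 1 * x * q ^ (j ^ 2 + j) / qf q q m * ((-1) ^ s * q ^ (s choose 2) * (- z) ^ s / qf q q s))
        has_sum A 0 * A 1 * x * q ^ (j ^ 2 + j) / qf q q m * qp (- z) q) UNIV"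
        by (intro has_sum_cmult_right euler_product_sum norm_q)
      also have "(\<lambda>s. A 0 * A 1 * x * q ^ (j ^ 2 + j) / qf q q m * ((-1) ^ s * q ^ (s choose 2) * (- z) ^ s / qf q q s))
        = (\<lambda>s. red5 (prod.swap (m, s)))"
      proof
        fix s
        have 1: "(-1) ^ s * q ^ (s choose 2) * (- z) ^ s = q ^ (s choose 2) * z ^ s"
          by (cases "even s") auto
        have 2: "red5 (prod.swap (m, s)) = A 0 * A 1 * (x * q ^ (j ^ 2 + j) * (q ^ (s choose 2) * z ^ s)) / (qf q q s * qf q q m)"
          by (simp add: red5_def AA xx)
        show "A 0 * A 1 * x * q ^ (j ^ 2 + j) / qf q q m * ((-1) ^ s * q ^ (s choose 2) * (- z) ^ s / qf q q s) = red5 (prod.swap (m, s))"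
          unfolding 1 2 by (simp add: mult_ac)
      qed
      also have "A 0 * A 1 * x * q ^ (j ^ 2 + j) / qf q q m * qp (- z) q = g m"
      proof -
        have "qp (- 1 * z) q = 1 ^ j * q powi (- int (Suc j choose 2)) * qf (- q) q j * qp (- 1) q"
          using qp_reflect[OF norm_q q_nonzero, of "- 1" j] by (simp add: z_def)
        moreover have "qp (- 1) q = 2 * qp (- q) q" using qp_step[OF norm_q, of "- 1"] by simp
        moreover have "q ^ (j ^ 2 + j) * q powi (- int (Suc j choose 2)) = q ^ (Suc j choose 2)"
        proof -
          define c where "c = Suc j choose 2"
          have e: "j ^ 2 + j = c + c"
            using square_eq_choose_two[of j] by (simp add: c_def Suc_choose_two)
          show ?thesis
            unfolding e c_def[symmetric] power_add power_int_minus power_int_of_nat using q_nonzero by simp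
        qed
        ultimately have "A 0 * A 1 * x * q ^ (j ^ 2 + j) / qf q q m * qp (- z) q
           = 2 * A 0 * A 1 * x * qp (- q) q * (q ^ (Suc j choose 2) * qf (- q) q j / qf q q m)"
          by (simp add: mult_ac)
        then show ?thesis by (simp add: g_def m)
      qed
      finally show ?thesis .
    qed
  qed
  moreover have "(g has_sum (u * qp (- p) q * (qp (- p) q / qp q q * T1 p) + v * qp p q * (qp p q / qp q q * T1 (- p)))
      + 2 * A 0 * A 1 * x * qp (- q) q * (qp (- q) q / qp q q * T2)) UNIV"
  proof (rule has_sum_even_odd_nat)
    have 1: "((\<lambda>j. p ^ (j ^ 2) * qf (- p) q j / qf q q (2 * j)) has_sum qp (- p) q / qp q q * T1 p) UNIV"
      using slater_double_even[OF norm_p p_nonzero] unfolding p_squared T1_def .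
    have 2: "((\<lambda>j. (- p) ^ (j ^ 2) * qf p q j / qf q q (2 * j)) has_sum qp p q / qp q q * T1 (- p)) UNIV"
      using slater_double_even[of "- p"] norm_p p_nonzero unfolding T1_def by (simp add: p_squared)
    have eq: "g (2 * i) = u * qp (- p) q * (p ^ (i ^ 2) * qf (- p) q i / qf q q (2 * i))
       + v * qp p q * ((- p) ^ (i ^ 2) * qf p q i / qf q q (2 * i))" for i
      by (simp add: g_def)
    show "((\<lambda>i. g (2 * i)) has_sum (u * qp (- p) q * (qp (- p) q / qp q q * T1 p) + v * qp p q * (qp p q / qp q q * T1 (- p)))) UNIV"
      unfolding eq by (intro has_sum_add has_sum_cmult_right 1 2)
    have 3: "((\<lambda>n. q ^ (Suc n choose 2) * qf (- q) q n / qf q q (2 * n + 1)) has_sum qp (- q) q / qp q q * T2) UNIV"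
      unfolding T2_def by (rule slater_double_odd[OF norm_p p_nonzero p_squared[symmetric]])
    have eq': "g (2 * i + 1) = 2 * A 0 * A 1 * x * qp (- q) q * (q ^ (Suc i choose 2) * qf (- q) q i / qf q q (2 * i + 1))" for i
      by (simp add: g_def)
    show "((\<lambda>i. g (2 * i + 1)) has_sum 2 * A 0 * A 1 * x * qp (- q) q * (qp (- q) q / qp q q * T2)) UNIV"
      unfolding eq' by (intro has_sum_cmult_right 3)
  qed
  ultimately have "infsum red5 UNIV = (u * qp (- p) q * (qp (- p) q / qp q q * T1 p) + v * qp p q * (qp p q / qp q q * T1 (- p)))
      + 2 * A 0 * A 1 * x * qp (- q) q * (qp (- q) q / qp q q * T2)"
    using has_sum_unique by blast
  note R = this
  have "a / b ^ 2 * ((u * a * (a / b * t) + v * c * (c / b * t')) + y * d * (d / b * t''))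
      = a / b ^ 3 * (u * a ^ 2 * t + v * c ^ 2 * t' + y * d ^ 2 * t'')" for a b c d t t' t'' y :: complex
    by (simp add: power2_eq_square power3_eq_cube ring_distribs add_divide_distrib mult_ac)
  then show ?thesis
    unfolding chain5_reduction(2) R u_def[symmetric] v_def[symmetric] .
qed

end

section \<open>Functions with finite orbit under the modular group\<close>

abbreviation "uhp \<equiv> upper_half_plane"

lemma SL2Z_iff:
  fixes A :: "int ^ 2 ^ 2"
  shows "A \<in> carrier SL2Z \<longleftrightarrow> A $ 1 $ 1 * A $ 2 $ 2 - A $ 1 $ 2 * A $ 2 $ 1 = 1"
  by (simp add: SL2Z_def det_2)

lemma moebius_denominator_nonzero:
  fixes A :: "int ^ 2 ^ 2"
  assumes "A \<in> carrier SL2Z" "Im \<tau> > 0"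
  shows "of_int (A $ 2 $ 1) * \<tau> + of_int (A $ 2 $ 2) \<noteq> (0::complex)"
proof
  assume 0: "of_int (A $ 2 $ 1) * \<tau> + of_int (A $ 2 $ 2) = (0::complex)"
  from arg_cong[OF 0, of Im] have "A $ 2 $ 1 = 0" using assms(2) by simp
  moreover from this 0 have "A $ 2 $ 2 = 0" by simp
  ultimately show False using assms(1) by (simp add: SL2Z_iff)
qed

lemma Im_moebius:
  fixes A :: "int ^ 2 ^ 2"
  assumes "A \<in> carrier SL2Z" "Im \<tau> > 0"
  shows "Im (moebius A \<tau>) > 0"
proof -
  define a b c d where "a = A $ 1 $ 1" and "b = A $ 1 $ 2" and "c = A $ 2 $ 1" and "d = A $ 2 $ 2"
  define z where "z = of_int c * \<tau> + of_int d"
  have det: "a * d - b * c = 1" using assms(1) by (simp add: SL2Z_iff a_def b_def c_def d_def)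
  have z: "z \<noteq> 0" using moebius_denominator_nonzero[OF assms] by (simp add: z_def c_def d_def)
  have "Im ((of_int a * \<tau> + of_int b) * cnj z) = of_int (a * d - b * c) * Im \<tau>"
    by (simp add: z_def algebra_simps)
  then have "Im ((of_int a * \<tau> + of_int b) / z) = Im \<tau> / (norm z) ^ 2"
    unfolding det complex_div_cnj[of _ z] by (simp add: Im_divide_of_real flip: of_real_power)
  then show ?thesis using z assms(2)
    by (simp add: moebius_def z_def a_def b_def c_def d_def)
qed

lemma moebius_mult:
  fixes A B :: "int ^ 2 ^ 2"
  assumes "A \<in> carrier SL2Z" "B \<in> carrier SL2Z" "Im \<tau> > 0"
  shows "moebius (A ** B) \<tau> = moebius A (moebius B \<tau>)"
proof -
  define z where "z = of_int (B $ 2 $ 1) * \<tau> + of_int (B $ 2 $ 2)"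
  define u where "u = of_int (B $ 1 $ 1) * \<tau> + of_int (B $ 1 $ 2)"
  have z: "z \<noteq> 0" using moebius_denominator_nonzero[OF assms(2,3)] by (simp add: z_def)
  have 1: "of_int m * (u / z) + of_int n = (of_int m * u + of_int n * z) / z" for m n :: int
    using z by (simp add: field_simps)
  have "moebius A (moebius B \<tau>) = (of_int (A $ 1 $ 1) * (u / z) + of_int (A $ 1 $ 2)) / (of_int (A $ 2 $ 1) * (u / z) + of_int (A $ 2 $ 2))"
    by (simp add: moebius_def u_def z_def)
  also have "\<dots> = (of_int (A $ 1 $ 1) * u + of_int (A $ 1 $ 2) * z) / (of_int (A $ 2 $ 1) * u + of_int (A $ 2 $ 2) * z)"
    unfolding 1 using z by simp
  also have "\<dots> = moebius (A ** B) \<tau>"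
    by (simp add: moebius_def matrix_matrix_mult_def sum_2 u_def z_def algebra_simps)
  finally show ?thesis ..
qed

lemma moebius_one: "moebius (mat 1) \<tau> = \<tau>"
  by (simp add: moebius_def mat_def)

lemma one_in_SL2Z: "mat 1 \<in> carrier SL2Z"
  by (simp add: SL2Z_def)

lemma mult_in_SL2Z: "A \<in> carrier SL2Z \<Longrightarrow> B \<in> carrier SL2Z \<Longrightarrow> A ** B \<in> carrier SL2Z"
  by (simp add: SL2Z_def det_mul)

text \<open>At most exponential growth towards \<open>\<i>\<infinity>\<close>: in a local parameter at the
  cusp, at most a pole.\<close>

definition moderate :: "(complex \<Rightarrow> complex) \<Rightarrow> bool" where
  "moderate f \<longleftrightarrow> (\<exists>C c Y. \<forall>\<tau>. Im \<tau> \<ge> Y \<longrightarrow> norm (f \<tau>) \<le> C * exp (c * Im \<tau>))"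

lemma moderateI:
  assumes "\<And>\<tau>. Im \<tau> \<ge> Y \<Longrightarrow> norm (f \<tau>) \<le> C * exp (c * Im \<tau>)"
  shows "moderate f"
  using assms unfolding moderate_def by blast

lemma moderateE:
  assumes "moderate f"
  obtains C c Y where "C \<ge> 1" "c \<ge> 0" "Y \<ge> 1" "\<And>\<tau>. Im \<tau> \<ge> Y \<Longrightarrow> norm (f \<tau>) \<le> C * exp (c * Im \<tau>)"
proof -
  obtain C c Y where *: "\<And>\<tau>. Im \<tau> \<ge> Y \<Longrightarrow> norm (f \<tau>) \<le> C * exp (c * Im \<tau>)"
    using assms unfolding moderate_def by blast
  show ?thesis
  proof (rule that[of "max C 1" "max c 0" "max Y 1"])
    fix \<tau> assume \<tau>: "Im \<tau> \<ge> max Y 1"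
    have "norm (f \<tau>) \<le> C * exp (c * Im \<tau>)" using * \<tau> by simp
    also have "\<dots> \<le> max C 1 * exp (max c 0 * Im \<tau>)"
      using \<tau> by (intro mult_mono) (auto intro!: mult_right_mono)
    finally show "norm (f \<tau>) \<le> max C 1 * exp (max c 0 * Im \<tau>)" .
  qed auto
qed

lemma moderate_const: "moderate (\<lambda>_. c)"
  by (rule moderateI[of 0 _ "norm c" 0]) simp

lemma moderate_add:
  assumes "moderate f" "moderate g" shows "moderate (\<lambda>\<tau>. f \<tau> + g \<tau>)"
proof -
  obtain C c Y where f: "C \<ge> 1" "c \<ge> 0" "Y \<ge> 1" "\<And>\<tau>. Im \<tau> \<ge> Y \<Longrightarrow> norm (f \<tau>) \<le> C * exp (c * Im \<tau>)"
    using moderateE[OF assms(1)] by metis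
  obtain D d Z where g: "D \<ge> 1" "d \<ge> 0" "Z \<ge> 1" "\<And>\<tau>. Im \<tau> \<ge> Z \<Longrightarrow> norm (g \<tau>) \<le> D * exp (d * Im \<tau>)"
    using moderateE[OF assms(2)] by metis
  show ?thesis
  proof (rule moderateI[of "max Y Z" _ "C + D" "c + d"])
    fix \<tau> assume \<tau>: "Im \<tau> \<ge> max Y Z"
    have "norm (f \<tau> + g \<tau>) \<le> C * exp (c * Im \<tau>) + D * exp (d * Im \<tau>)"
      using f(4)[of \<tau>] g(4)[of \<tau>] \<tau> norm_triangle_ineq[of "f \<tau>" "g \<tau>"] by simp
    also have "\<dots> \<le> C * exp ((c + d) * Im \<tau>) + D * exp ((c + d) * Im \<tau>)"
      using f g \<tau> by (intro add_mono mult_left_mono) (auto intro!: mult_right_mono)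
    finally show "norm (f \<tau> + g \<tau>) \<le> (C + D) * exp ((c + d) * Im \<tau>)" by (simp add: algebra_simps)
  qed
qed

lemma moderate_mult:
  assumes "moderate f" "moderate g" shows "moderate (\<lambda>\<tau>. f \<tau> * g \<tau>)"
proof -
  obtain C c Y where f: "C \<ge> 1" "c \<ge> 0" "Y \<ge> 1" "\<And>\<tau>. Im \<tau> \<ge> Y \<Longrightarrow> norm (f \<tau>) \<le> C * exp (c * Im \<tau>)"
    using moderateE[OF assms(1)] by metis
  obtain D d Z where g: "D \<ge> 1" "d \<ge> 0" "Z \<ge> 1" "\<And>\<tau>. Im \<tau> \<ge> Z \<Longrightarrow> norm (g \<tau>) \<le> D * exp (d * Im \<tau>)"
    using moderateE[OF assms(2)] by metis
  show ?thesis
  proof (rule moderateI[of "max Y Z" _ "C * D" "c + d"])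
    fix \<tau> assume \<tau>: "Im \<tau> \<ge> max Y Z"
    have "norm (f \<tau> * g \<tau>) \<le> (C * exp (c * Im \<tau>)) * (D * exp (d * Im \<tau>))"
      unfolding norm_mult using f(4)[of \<tau>] g(4)[of \<tau>] f(1) \<tau> by (intro mult_mono) auto
    then show "norm (f \<tau> * g \<tau>) \<le> (C * D) * exp ((c + d) * Im \<tau>)" by (simp add: algebra_simps exp_add)
  qed
qed

lemma moderate_root:
  assumes "k > 0" "moderate (\<lambda>\<tau>. f \<tau> ^ k)" shows "moderate f"
proof -
  obtain C c Y where f: "C \<ge> 1" "c \<ge> 0" "Y \<ge> 1" "\<And>\<tau>. Im \<tau> \<ge> Y \<Longrightarrow> norm (f \<tau> ^ k) \<le> C * exp (c * Im \<tau>)"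
    using moderateE[OF assms(2)] by metis
  show ?thesis
  proof (rule moderateI[of Y _ C c])
    fix \<tau> assume \<tau>: "Im \<tau> \<ge> Y"
    have 1: "1 * 1 \<le> C * exp (c * Im \<tau>)" using f \<tau> by (intro mult_mono) auto
    show "norm (f \<tau>) \<le> C * exp (c * Im \<tau>)"
    proof (cases "norm (f \<tau>) \<le> 1")
      case False
      then have "norm (f \<tau>) \<le> norm (f \<tau>) ^ k" using assms(1) by (intro self_le_power) auto
      then show ?thesis using f(4)[OF \<tau>] by (simp add: norm_power)
    qed (use 1 in simp)
  qed
qed

lemma moderate_affine:
  assumes "moderate f" "(a::real) > 0" "\<And>\<tau>. Im (m \<tau>) = a * Im \<tau>"
  shows "moderate (\<lambda>\<tau>. f (m \<tau>))"
proof -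
  obtain C c Y where f: "C \<ge> 1" "c \<ge> 0" "Y \<ge> 1" "\<And>\<tau>. Im \<tau> \<ge> Y \<Longrightarrow> norm (f \<tau>) \<le> C * exp (c * Im \<tau>)"
    using moderateE[OF assms(1)] by metis
  show ?thesis
  proof (rule moderateI[of "Y / a" _ C "c * a"])
    fix \<tau> assume "Im \<tau> \<ge> Y / a"
    then have "Im (m \<tau>) \<ge> Y" using assms(2,3) by (simp add: field_simps)
    from f(4)[OF this] show "norm (f (m \<tau>)) \<le> C * exp (c * a * Im \<tau>)" by (simp add: assms(3) mult.assoc)
  qed
qed

text \<open>The class of functions in which modularity is proved. It avoids any bookkeeping of
  levels and multipliers, and it is closed under all operations needed for the closed forms.\<close>

definition finite_orbit :: "(complex \<Rightarrow> complex) \<Rightarrow> bool" where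
  "finite_orbit f \<longleftrightarrow> f holomorphic_on uhp \<and>
     (\<exists>F. finite F \<and> (\<forall>A\<in>carrier SL2Z. \<exists>h\<in>F. moderate h \<and> (\<forall>\<tau>\<in>uhp. f (moebius A \<tau>) = h \<tau>)))"

lemma finite_orbitI:
  assumes "f holomorphic_on uhp" "finite F"
    "\<And>A. A \<in> carrier SL2Z \<Longrightarrow> \<exists>h\<in>F. moderate h \<and> (\<forall>\<tau>\<in>uhp. f (moebius A \<tau>) = h \<tau>)"
  shows "finite_orbit f"
  using assms unfolding finite_orbit_def by blast

lemma finite_orbitE:
  assumes "finite_orbit f"
  obtains F where "finite F" "\<And>A. A \<in> carrier SL2Z \<Longrightarrow> \<exists>h\<in>F. moderate h \<and> (\<forall>\<tau>\<in>uhp. f (moebius A \<tau>) = h \<tau>)"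
  using assms unfolding finite_orbit_def by blast

lemma finite_orbit_holomorphic: "finite_orbit f \<Longrightarrow> f holomorphic_on uhp"
  by (simp add: finite_orbit_def)

lemma finite_orbit_const: "finite_orbit (\<lambda>_. c)"
  by (rule finite_orbitI[of _ "{\<lambda>_. c}"]) (auto simp: moderate_const)

lemma finite_orbit_add:
  assumes "finite_orbit f" "finite_orbit g" shows "finite_orbit (\<lambda>\<tau>. f \<tau> + g \<tau>)"
proof -
  obtain F where F: "finite F" "\<And>A. A \<in> carrier SL2Z \<Longrightarrow> \<exists>h\<in>F. moderate h \<and> (\<forall>\<tau>\<in>uhp. f (moebius A \<tau>) = h \<tau>)"
    using finite_orbitE[OF assms(1)] by metis
  obtain G where G: "finite G" "\<And>A. A \<in> carrier SL2Z \<Longrightarrow> \<exists>h\<in>G. moderate h \<and> (\<forall>\<tau>\<in>uhp. g (moebius A \<tau>) = h \<tau>)"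
    using finite_orbitE[OF assms(2)] by metis
  show ?thesis
  proof (rule finite_orbitI[of _ "(\<lambda>(h, k) \<tau>. h \<tau> + k \<tau>) ` (F \<times> G)"])
    fix A assume A: "A \<in> carrier SL2Z"
    from F(2)[OF A] obtain h where h: "h \<in> F" "moderate h" "\<And>\<tau>. \<tau> \<in> uhp \<Longrightarrow> f (moebius A \<tau>) = h \<tau>" by blast
    from G(2)[OF A] obtain k where k: "k \<in> G" "moderate k" "\<And>\<tau>. \<tau> \<in> uhp \<Longrightarrow> g (moebius A \<tau>) = k \<tau>" by blast
    show "\<exists>h\<in>(\<lambda>(h, k) \<tau>. h \<tau> + k \<tau>) ` (F \<times> G). moderate h \<and> (\<forall>\<tau>\<in>uhp. f (moebius A \<tau>) + g (moebius A \<tau>) = h \<tau>)"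
      by (rule bexI[of _ "\<lambda>\<tau>. h \<tau> + k \<tau>"]) (use h k in \<open>auto intro: moderate_add\<close>)
  qed (use assms F(1) G(1) in \<open>auto simp: finite_orbit_def intro!: holomorphic_intros\<close>)
qed

lemma finite_orbit_mult:
  assumes "finite_orbit f" "finite_orbit g" shows "finite_orbit (\<lambda>\<tau>. f \<tau> * g \<tau>)"
proof -
  obtain F where F: "finite F" "\<And>A. A \<in> carrier SL2Z \<Longrightarrow> \<exists>h\<in>F. moderate h \<and> (\<forall>\<tau>\<in>uhp. f (moebius A \<tau>) = h \<tau>)"
    using finite_orbitE[OF assms(1)] by metis
  obtain G where G: "finite G" "\<And>A. A \<in> carrier SL2Z \<Longrightarrow> \<exists>h\<in>G. moderate h \<and> (\<forall>\<tau>\<in>uhp. g (moebius A \<tau>) = h \<tau>)"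
    using finite_orbitE[OF assms(2)] by metis
  show ?thesis
  proof (rule finite_orbitI[of _ "(\<lambda>(h, k) \<tau>. h \<tau> * k \<tau>) ` (F \<times> G)"])
    fix A assume A: "A \<in> carrier SL2Z"
    from F(2)[OF A] obtain h where h: "h \<in> F" "moderate h" "\<And>\<tau>. \<tau> \<in> uhp \<Longrightarrow> f (moebius A \<tau>) = h \<tau>" by blast
    from G(2)[OF A] obtain k where k: "k \<in> G" "moderate k" "\<And>\<tau>. \<tau> \<in> uhp \<Longrightarrow> g (moebius A \<tau>) = k \<tau>" by blast
    show "\<exists>h\<in>(\<lambda>(h, k) \<tau>. h \<tau> * k \<tau>) ` (F \<times> G). moderate h \<and> (\<forall>\<tau>\<in>uhp. f (moebius A \<tau>) * g (moebius A \<tau>) = h \<tau>)"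
      by (rule bexI[of _ "\<lambda>\<tau>. h \<tau> * k \<tau>"]) (use h k in \<open>auto intro: moderate_mult\<close>)
  qed (use assms F(1) G(1) in \<open>auto simp: finite_orbit_def intro!: holomorphic_intros\<close>)
qed

lemma finite_orbit_cong:
  assumes "finite_orbit f" "\<And>\<tau>. \<tau> \<in> uhp \<Longrightarrow> g \<tau> = f \<tau>"
  shows "finite_orbit g"
proof -
  obtain F where F: "finite F" "\<And>A. A \<in> carrier SL2Z \<Longrightarrow> \<exists>h\<in>F. moderate h \<and> (\<forall>\<tau>\<in>uhp. f (moebius A \<tau>) = h \<tau>)"
    using finite_orbitE[OF assms(1)] by metis
  show ?thesis
  proof (rule finite_orbitI[OF _ F(1)])
    show "g holomorphic_on uhp"
      by (rule holomorphic_transform[OF finite_orbit_holomorphic[OF assms(1)]]) (use assms(2) in auto)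
    fix A assume A: "A \<in> carrier SL2Z"
    show "\<exists>h\<in>F. moderate h \<and> (\<forall>\<tau>\<in>uhp. g (moebius A \<tau>) = h \<tau>)"
      using F(2)[OF A] assms(2) Im_moebius[OF A] by simp
  qed
qed

lemma convex_uhp: "convex uhp"
  by (rule convex_halfspace_Im_gt)

lemma moebius_continuous: "A \<in> carrier SL2Z \<Longrightarrow> continuous_on uhp (moebius A)"
  unfolding moebius_def using moebius_denominator_nonzero
  by (intro continuous_intros) auto

text \<open>If two matrices transform \<open>f\<^sup>k\<close> into the same function, the two translates
  of \<open>f\<close> have a quotient with values in the \<open>k\<close>-th roots of unity, which is constant by
  connectedness.\<close>

lemma finite_orbit_root:
  assumes k: "k > 0" and fk: "finite_orbit (\<lambda>\<tau>. f \<tau> ^ k)"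
    and f: "f holomorphic_on uhp" and nz: "\<And>\<tau>. \<tau> \<in> uhp \<Longrightarrow> f \<tau> \<noteq> 0"
  shows "finite_orbit f"
proof -
  obtain F where F: "finite F" "\<And>A. A \<in> carrier SL2Z \<Longrightarrow> \<exists>h\<in>F. moderate h \<and> (\<forall>\<tau>\<in>uhp. f (moebius A \<tau>) ^ k = h \<tau>)"
    using finite_orbitE[OF fk] by metis
  define good where "good h A \<longleftrightarrow> A \<in> carrier SL2Z \<and> (\<forall>\<tau>\<in>uhp. f (moebius A \<tau>) ^ k = h \<tau>)" for h A
  define rep where "rep h = (SOME A. good h A)" for h
  define U where "U = {z::complex. z ^ k = 1}"
  have U: "finite U" unfolding U_def using k by (intro finite_roots_unity) auto
  \<comment> \<open>All translates arise from one representative for each translate of the power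
    by multiplication with a root of unity.\<close>
  define G where "G = (\<lambda>(h, z) \<tau>. z * f (moebius (rep h) \<tau>)) ` (F \<times> U)"
  show ?thesis
  proof (rule finite_orbitI[OF f])
    show "finite G" unfolding G_def using F(1) U by auto
    fix A assume A: "A \<in> carrier SL2Z"
    from F(2)[OF A] obtain h where h: "h \<in> F" "moderate h" "\<And>\<tau>. \<tau> \<in> uhp \<Longrightarrow> f (moebius A \<tau>) ^ k = h \<tau>" by blast
    then have "good h A" using A by (simp add: good_def)
    then have "good h (rep h)" unfolding rep_def by (rule someI)
    then have B: "rep h \<in> carrier SL2Z" "\<And>\<tau>. \<tau> \<in> uhp \<Longrightarrow> f (moebius (rep h) \<tau>) ^ k = h \<tau>" by (auto simp: good_def)
    define r where "r \<tau> = f (moebius A \<tau>) / f (moebius (rep h) \<tau>)" for \<tau>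
    have nz': "f (moebius (rep h) \<tau>) \<noteq> 0" if "\<tau> \<in> uhp" for \<tau>
      using nz Im_moebius[OF B(1)] that by auto
    have cont: "continuous_on uhp (\<lambda>\<tau>. f (moebius C \<tau>))" if "C \<in> carrier SL2Z" for C
      using continuous_on_compose2[OF holomorphic_on_imp_continuous_on[OF f] moebius_continuous[OF that]] Im_moebius[OF that] by auto
    have rU: "r \<tau> \<in> U" if "\<tau> \<in> uhp" for \<tau>
    proof -
      have "h \<tau> \<noteq> 0" using B(2)[OF that] nz'[OF that] by (metis power_eq_0_iff)
      then show ?thesis unfolding U_def r_def using h(3)[OF that] B(2)[OF that] by (simp add: power_divide)
    qed
    have "r constant_on uhp"
    proof (rule continuous_finite_range_constant)
      show "connected uhp" by (rule convex_connected[OF convex_uhp])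
      show "continuous_on uhp r" unfolding r_def using nz' by (intro continuous_intros cont A B) auto
      show "finite (r ` uhp)" using rU by (intro finite_subset[OF _ U]) auto
    qed
    then obtain z where z: "\<And>\<tau>. \<tau> \<in> uhp \<Longrightarrow> r \<tau> = z" by (auto simp: constant_on_def)
    have zU: "z \<in> U" using rU[of \<i>] z[of \<i>] by simp
    have eq: "f (moebius A \<tau>) = z * f (moebius (rep h) \<tau>)" if "\<tau> \<in> uhp" for \<tau>
      using z[OF that] nz'[OF that] by (simp add: r_def field_simps)
    obtain C c Y where m: "C \<ge> 1" "c \<ge> 0" "Y \<ge> 1" "\<And>\<tau>. Im \<tau> \<ge> Y \<Longrightarrow> norm (h \<tau>) \<le> C * exp (c * Im \<tau>)"
      using moderateE[OF h(2)] by metis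
    have "moderate (\<lambda>\<tau>. (z * f (moebius (rep h) \<tau>)) ^ k)"
    proof (rule moderateI[of Y _ C c])
      fix \<tau> assume \<tau>: "Im \<tau> \<ge> Y"
      then have "\<tau> \<in> uhp" using m by auto
      then have "(z * f (moebius (rep h) \<tau>)) ^ k = h \<tau>" using eq h(3) by metis
      then show "norm ((z * f (moebius (rep h) \<tau>)) ^ k) \<le> C * exp (c * Im \<tau>)"
        using m(4)[OF \<tau>] by simp
    qed
    then have "moderate (\<lambda>\<tau>. z * f (moebius (rep h) \<tau>))" by (rule moderate_root[OF k])
    then show "\<exists>h\<in>G. moderate h \<and> (\<forall>\<tau>\<in>uhp. f (moebius A \<tau>) = h \<tau>)"
      unfolding G_def using h(1) zU eq by (intro bexI[of _ "\<lambda>\<tau>. z * f (moebius (rep h) \<tau>)"]) auto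
  qed
qed

text \<open>Hermite normal form: an integral matrix of determinant \<open>a d\<close> is an element of
  \<open>SL\<^sub>2(\<int>)\<close> times one of finitely many upper triangular matrices.\<close>

lemma hermite_decomposition:
  fixes a b d :: int and A :: "int ^ 2 ^ 2"
  assumes "a > 0" "d > 0" "A \<in> carrier SL2Z"
  shows "\<exists>B a' b' d'. B \<in> carrier SL2Z \<and> a' > 0 \<and> a' * d' = a * d \<and> 0 \<le> b' \<and> b' < d' \<and>
    (\<forall>\<tau>\<in>uhp. (of_int a * moebius A \<tau> + of_int b) / of_int d
        = moebius B ((of_int a' * \<tau> + of_int b') / of_int d'))"
proof -
  define X where "X = a * A $ 1 $ 1 + b * A $ 2 $ 1"
  define Y where "Y = a * A $ 1 $ 2 + b * A $ 2 $ 2"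
  define Z where "Z = d * A $ 2 $ 1"
  define W where "W = d * A $ 2 $ 2"
  have detA: "A $ 1 $ 1 * A $ 2 $ 2 - A $ 1 $ 2 * A $ 2 $ 1 = 1" using assms(3) by (simp add: SL2Z_iff)
  have det: "X * W - Y * Z = a * d"
  proof -
    have "X * W - Y * Z = a * d * (A $ 1 $ 1 * A $ 2 $ 2 - A $ 1 $ 2 * A $ 2 $ 1)"
      by (simp add: X_def Y_def Z_def W_def algebra_simps)
    then show ?thesis using detA by simp
  qed
  define g where "g = gcd X Z"
  have "g \<noteq> 0" using det assms by (auto simp: g_def)
  then have g: "g > 0" by (simp add: g_def order_less_le)
  obtain al ga where al: "X = g * al" "Z = g * ga" "coprime al ga"
    using gcd_coprime_exists[of X Z] \<open>g \<noteq> 0\<close> unfolding g_def by (metis mult.commute)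
  then obtain u v where uv: "u * al + v * ga = 1"
    using bezout_int[of al ga] by (metis coprime_imp_gcd_eq_1)
  \<comment> \<open>The matrix with rows \<open>(al, - v)\<close> and \<open>(ga, u)\<close> has determinant \<open>1\<close> and
    maps the one with rows \<open>(g, Y')\<close> and \<open>(0, d')\<close> to the given one. Afterwards \<open>Y'\<close> is
    reduced modulo \<open>d'\<close>.\<close>
  define Y' where "Y' = u * Y + v * W"
  define d' where "d' = al * W - ga * Y"
  have gd: "g * d' = a * d" using det unfolding d'_def al(1,2) by (simp add: algebra_simps)
  have d': "d' > 0" using gd g assms by (metis mult_pos_pos zero_less_mult_pos)
  have YW: "Y = al * Y' - v * d'" "W = ga * Y' + u * d'"
  proof -
    have "al * Y' - v * d' = (u * al + v * ga) * Y" unfolding Y'_def d'_def by (simp add: algebra_simps)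
    then show "Y = al * Y' - v * d'" using uv by simp
    have "ga * Y' + u * d' = (u * al + v * ga) * W" unfolding Y'_def d'_def by (simp add: algebra_simps)
    then show "W = ga * Y' + u * d'" using uv by simp
  qed
  define k where "k = Y' div d'"
  define b' where "b' = Y' mod d'"
  have Yk: "Y' = b' + k * d'" by (simp add: b'_def k_def)
  define B :: "int ^ 2 ^ 2" where "B = vector [vector [al, al * k - v], vector [ga, ga * k + u]]"
  have B: "B $ 1 $ 1 = al" "B $ 1 $ 2 = al * k - v" "B $ 2 $ 1 = ga" "B $ 2 $ 2 = ga * k + u"
    by (simp_all add: B_def)
  have "B \<in> carrier SL2Z" unfolding SL2Z_iff B using uv by (simp add: algebra_simps)
  moreover have "(of_int a * moebius A \<tau> + of_int b) / of_int d
        = moebius B ((of_int g * \<tau> + of_int b') / of_int d')" if "\<tau> \<in> uhp" for \<tau>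
  proof -
    define z where "z = of_int (A $ 2 $ 1) * \<tau> + of_int (A $ 2 $ 2)"
    have z: "z \<noteq> 0" using moebius_denominator_nonzero[OF assms(3)] that by (simp add: z_def)
    have "(of_int a * moebius A \<tau> + of_int b) / of_int d = (of_int X * \<tau> + of_int Y) / (of_int d * z)"
      using z assms unfolding moebius_def z_def[symmetric] X_def Y_def
      by (simp add: divide_simps) (simp add: z_def algebra_simps)
    also have "of_int d * z = of_int Z * \<tau> + of_int W" by (simp add: z_def Z_def W_def algebra_simps)
    also have "(of_int X * \<tau> + of_int Y) / (of_int Z * \<tau> + of_int W) = moebius B ((of_int g * \<tau> + of_int b') / of_int d')"
    proof -
      define s where "s = of_int g * \<tau> + of_int b'"
      have d0: "(of_int d' :: complex) \<noteq> 0" using d' by simp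
      have 1: "of_int al * (s / of_int d') + of_int (al * k - v) = (of_int X * \<tau> + of_int Y) / of_int d'"
        using d0 unfolding YW Yk al(1,2) by (simp add: s_def field_simps)
      have 2: "of_int ga * (s / of_int d') + of_int (ga * k + u) = (of_int Z * \<tau> + of_int W) / of_int d'"
        using d0 unfolding YW Yk al(1,2) by (simp add: s_def field_simps)
      show ?thesis unfolding moebius_def B s_def[symmetric] 1 2 using d0 by simp
    qed
    finally show ?thesis .
  qed
  moreover have "0 \<le> b'" "b' < d'" using d' by (auto simp: b'_def)
  ultimately show ?thesis using g gd by (intro exI[of _ B] exI[of _ g] exI[of _ b'] exI[of _ d']) auto
qed

lemma finite_orbit_affine:
  fixes a b d :: int
  assumes f: "finite_orbit f" and ad: "a > 0" "d > 0"
  shows "finite_orbit (\<lambda>\<tau>. f ((of_int a * \<tau> + of_int b) / of_int d))"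
proof -
  obtain F where F: "finite F" "\<And>A. A \<in> carrier SL2Z \<Longrightarrow> \<exists>h\<in>F. moderate h \<and> (\<forall>\<tau>\<in>uhp. f (moebius A \<tau>) = h \<tau>)"
    using finite_orbitE[OF f] by metis
  define aff where "aff a b d \<tau> = (of_int a * \<tau> + of_int b) / of_int d" for a b d :: int and \<tau> :: complex
  have Im_aff: "Im (aff a b d \<tau>) = of_int a / of_int d * Im \<tau>" for a b d \<tau>
    by (simp add: aff_def)
  define G where "G = (\<lambda>(h, a, b, d) \<tau>. h (aff a b d \<tau>)) ` (F \<times> {0..a * d} \<times> {0..a * d} \<times> {0..a * d})"
  show ?thesis unfolding aff_def[symmetric]
  proof (rule finite_orbitI)
    show "(\<lambda>\<tau>. f (aff a b d \<tau>)) holomorphic_on uhp"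
    proof (rule holomorphic_on_compose_gen[unfolded o_def, OF _ finite_orbit_holomorphic[OF f]])
      show "aff a b d holomorphic_on uhp" unfolding aff_def using ad by (intro holomorphic_intros) auto
      show "aff a b d ` uhp \<subseteq> uhp" using ad by (auto simp: Im_aff)
    qed
    show "finite G" unfolding G_def using F(1) by auto
    fix A assume A: "A \<in> carrier SL2Z"
    obtain B a' b' d' where B: "B \<in> carrier SL2Z" and a': "a' > 0" "a' * d' = a * d" "0 \<le> b'" "b' < d'"
      and eq: "\<And>\<tau>. \<tau> \<in> uhp \<Longrightarrow> aff a b d (moebius A \<tau>) = moebius B (aff a' b' d' \<tau>)"
      using hermite_decomposition[OF ad A, of b] unfolding aff_def by blast
    from F(2)[OF B] obtain h where h: "h \<in> F" "moderate h" "\<And>\<tau>. \<tau> \<in> uhp \<Longrightarrow> f (moebius B \<tau>) = h \<tau>" by blast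
    have d': "d' > 0" using a' by linarith
    have "moderate (\<lambda>\<tau>. h (aff a' b' d' \<tau>))"
      using a' d' by (intro moderate_affine[OF h(2), of "of_int a' / of_int d'"]) (auto simp: Im_aff)
    moreover have "f (aff a b d (moebius A \<tau>)) = h (aff a' b' d' \<tau>)" if "\<tau> \<in> uhp" for \<tau>
      unfolding eq[OF that] using that a' d' by (intro h(3)) (auto simp: Im_aff)
    moreover have "(\<lambda>\<tau>. h (aff a' b' d' \<tau>)) \<in> G"
    proof -
      have "a' \<le> a * d" "d' \<le> a * d" unfolding a'(2)[symmetric] using a'(1) d' by auto
      then have "(h, a', b', d') \<in> F \<times> {0..a * d} \<times> {0..a * d} \<times> {0..a * d}" using a' d' h(1) by auto
      then show ?thesis unfolding G_def by (intro image_eqI[of _ _ "(h, a', b', d')"]) auto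
    qed
    ultimately show "\<exists>h\<in>G. moderate h \<and> (\<forall>\<tau>\<in>uhp. f (aff a b d (moebius A \<tau>)) = h \<tau>)" by blast
  qed
qed

section \<open>Functions with finite orbit are modular\<close>

text \<open>The exponential normalised so that \<open>q = ee \<tau>\<close>.\<close>

definition ee :: "complex \<Rightarrow> complex" where "ee z = exp (2 * of_real pi * \<i> * z)"

lemma ee_add: "ee (a + b) = ee a * ee b" and ee_0 [simp]: "ee 0 = 1" and ee_nonzero [simp]: "ee z \<noteq> 0"
  and ee_minus: "ee (- z) = 1 / ee z"
  by (simp_all add: ee_def exp_add ring_distribs exp_minus field_simps)

lemma ee_of_int [simp]: "ee (of_int n) = 1"
proof -
  have "ee (of_int n) = exp (of_int (2 * n) * of_real pi * \<i>)" by (simp add: ee_def mult_ac)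
  then show ?thesis using exp_integer_2pi[of "of_int n"] by (simp add: mult_ac)
qed

lemma ee_1 [simp]: "ee 1 = 1" using ee_of_int[of 1] by simp

lemma ee_eq_1_iff: "ee z = 1 \<longleftrightarrow> (\<exists>n::int. z = of_int n)"
proof
  assume "ee z = 1"
  then obtain n :: int where "2 * of_real pi * \<i> * z = of_int (2 * n) * of_real pi * \<i>"
    unfolding ee_def exp_eq_1 by (auto simp: complex_eq_iff)
  then have "2 * of_real pi * \<i> * z = 2 * of_real pi * \<i> * of_int n" by simp
  then show "\<exists>n::int. z = of_int n" by (auto simp del: of_real_mult)
qed auto

lemma ee_eq_iff: "ee a = ee b \<longleftrightarrow> (\<exists>n::int. a = b + of_int n)"
proof -
  have "ee a = ee b \<longleftrightarrow> ee (a - b) = 1" using ee_add[of "a - b" b] by auto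
  then show ?thesis unfolding ee_eq_1_iff by (simp add: algebra_simps)
qed

lemma ee_power: "ee z ^ n = ee (of_nat n * z)"
  by (simp add: ee_def mult_ac flip: exp_of_nat_mult)

lemma norm_ee: "norm (ee z) = exp (- 2 * pi * Im z)"
  by (simp add: ee_def)

lemma norm_ee_less_1: "Im z > 0 \<Longrightarrow> norm (ee z) < 1"
  by (simp add: norm_ee)

lemma ee_holomorphic [holomorphic_intros]: "f holomorphic_on S \<Longrightarrow> (\<lambda>z. ee (f z)) holomorphic_on S"
  unfolding ee_def by (intro holomorphic_intros)

text \<open>A periodic function is a function of the local parameter on the punctured disc.
  Moderate growth says that this function, times a power of the parameter, is bounded, so its
  singularity is removable.\<close>

lemma meromorphic_at_ii_inf_periodic:
  assumes u: "u holomorphic_on uhp" and N: "N > 0"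
    and per: "\<And>\<tau>. \<tau> \<in> uhp \<Longrightarrow> u (\<tau> + of_nat N) = u \<tau>"
    and h: "moderate h" "\<And>\<tau>. \<tau> \<in> uhp \<Longrightarrow> u \<tau> = h \<tau>"
  shows "meromorphic_at_ii_inf u"
proof -
  have per_nat: "u (\<tau> + of_nat (N * k)) = u \<tau>" if "\<tau> \<in> uhp" for \<tau> k
  proof (induction k)
    case (Suc k)
    have "u (\<tau> + of_nat (N * Suc k)) = u ((\<tau> + of_nat (N * k)) + of_nat N)" by (simp add: algebra_simps)
    also have "\<dots> = u (\<tau> + of_nat (N * k))" using that by (intro per) auto
    finally show ?case using Suc by simp
  qed simp
  have per_int: "u (\<tau> + of_nat N * of_int k) = u \<tau>" if "\<tau> \<in> uhp" for \<tau> k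
  proof (cases "k \<ge> 0")
    case True
    then show ?thesis using per_nat[OF that, of "nat k"] by simp
  next
    case False
    have "\<tau> + of_nat N * of_int k \<in> uhp" using that by simp
    from per_nat[OF this, of "nat (- k)"] show ?thesis using False by (simp add: algebra_simps)
  qed
  define s where "s t = of_nat N * Ln t / (2 * of_real pi * \<i>)" for t
  \<comment> \<open>The function of the local parameter; the branch of the logarithm is
    immaterial because of periodicity.\<close>
  define g where "g t = u (s t)" for t
  have ee_s: "ee (s t / of_nat N) = t" if "t \<noteq> 0" for t
    using that N by (simp add: ee_def s_def)
  have Im_s: "Im (s t) = - of_nat N * ln (norm t) / (2 * pi)" if "t \<noteq> 0" for t
    using that by (simp add: s_def Im_divide power2_eq_square)
  have gu: "g (ee (\<tau> / of_nat N)) = u \<tau>" if "\<tau> \<in> uhp" for \<tau>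
  proof -
    have "ee (s (ee (\<tau> / of_nat N)) / of_nat N) = ee (\<tau> / of_nat N)" by (rule ee_s) simp
    then obtain k :: int where "s (ee (\<tau> / of_nat N)) / of_nat N = \<tau> / of_nat N + of_int k"
      unfolding ee_eq_iff by blast
    then have "s (ee (\<tau> / of_nat N)) = \<tau> + of_nat N * of_int k" using N by (simp add: field_simps)
    then show ?thesis unfolding g_def using per_int[OF that] by simp
  qed
  have ana: "g analytic_on ball 0 1 - {0}"
    unfolding analytic_on_def
  proof
    fix t0 :: complex assume t0: "t0 \<in> ball 0 1 - {0}"
    define r where "r = min (norm t0) (1 - norm t0)"
    have r: "r > 0" using t0 by (auto simp: r_def)
    define L where "L t = of_nat N * (Ln (t / t0) + Ln t0) / (2 * of_real pi * \<i>)" for t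
    have ball: "t \<noteq> 0" "norm t < 1" "Re (t / t0) > 0" if "t \<in> ball t0 r" for t
    proof -
      have d: "norm (t - t0) < norm t0" "norm (t - t0) < 1 - norm t0"
        using that by (auto simp: r_def dist_norm norm_minus_commute)
      show "t \<noteq> 0" using d by auto
      show "norm t < 1" using d norm_triangle_ineq[of "t - t0" t0] by simp
      have "norm (t / t0 - 1) < 1" using d t0 by (simp add: diff_divide_distrib[symmetric] norm_divide divide_less_eq field_simps flip: diff_divide_eq_iff)
      then have "\<bar>Re (t / t0 - 1)\<bar> < 1" using abs_Re_le_cmod order_le_less_trans by blast
      then show "Re (t / t0) > 0" by simp
    qed
    have np: "t / t0 \<notin> \<real>\<^sub>\<le>\<^sub>0" if "t \<in> ball t0 r" for t
      using ball(3)[OF that] by (auto simp: complex_nonpos_Reals_iff)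
    have hL: "L holomorphic_on ball t0 r"
      unfolding L_def using np t0 by (intro holomorphic_intros) auto
    have eL: "ee (L t / of_nat N) = t" if "t \<in> ball t0 r" for t
      using ball[OF that] t0 N by (simp add: ee_def L_def exp_add)
    have ImL: "L t \<in> uhp" if "t \<in> ball t0 r" for t
    proof -
      have "norm (ee (L t / of_nat N)) < 1" using eL[OF that] ball[OF that] by simp
      then have "0 < 2 * pi * Im (L t) / real N" by (simp add: norm_ee)
      then show ?thesis using N by (auto simp: zero_less_divide_iff zero_less_mult_iff)
    qed
    have "(\<lambda>t. u (L t)) holomorphic_on ball t0 r"
      by (rule holomorphic_on_compose_gen[unfolded o_def, OF hL u]) (use ImL in auto)
    then have "g holomorphic_on ball t0 r"
      by (rule holomorphic_transform) (use gu[OF ImL] eL in auto)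
    then show "\<exists>e>0. g holomorphic_on ball t0 e" using r by blast
  qed
  obtain C c Y where m: "C \<ge> 1" "c \<ge> 0" "Y \<ge> 1" "\<And>\<tau>. Im \<tau> \<ge> Y \<Longrightarrow> norm (h \<tau>) \<le> C * exp (c * Im \<tau>)"
    using moderateE[OF h(1)] by metis
  define k where "k = nat \<lceil>c * of_nat N / (2 * pi)\<rceil> + 1"
  have k: "c * of_nat N / (2 * pi) + 1 \<le> real k" unfolding k_def by linarith
  define \<rho> where "\<rho> = exp (- 2 * pi * Y / of_nat N)"
  have \<rho>: "\<rho> > 0" "\<rho> < 1" using m N by (auto simp: \<rho>_def)
  have bound: "norm (t ^ k * g t) \<le> C * norm t" if t: "t \<noteq> 0" "norm t < \<rho>" for t
  proof -
    have l: "ln (norm t) < - 2 * pi * Y / of_nat N"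
      using t \<rho> by (metis \<rho>_def ln_exp ln_less_cancel_iff zero_less_norm_iff)
    then have "Y \<le> Im (s t)" unfolding Im_s[OF t(1)] using N by (simp add: field_simps)
    then have "norm (g t) \<le> C * exp (c * Im (s t))" unfolding g_def using h(2)[of "s t"] m by auto
    also have "c * Im (s t) = - (c * of_nat N / (2 * pi)) * ln (norm t)" unfolding Im_s[OF t(1)] by simp
    finally have 1: "norm (g t) \<le> C * exp (- (c * of_nat N / (2 * pi)) * ln (norm t))" .
    have l0: "ln (norm t) \<le> 0" using t \<rho> by simp
    have "norm (t ^ k * g t) \<le> exp (real k * ln (norm t)) * (C * exp (- (c * of_nat N / (2 * pi)) * ln (norm t)))"
      unfolding norm_mult norm_power using t 1 by (intro mult_mono) (auto simp: exp_of_nat_mult)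
    also have "\<dots> = C * exp ((real k - c * of_nat N / (2 * pi)) * ln (norm t))"
      by (simp add: algebra_simps flip: exp_add)
    also have "\<dots> \<le> C * exp (1 * ln (norm t))"
    proof -
      have "(real k - c * of_nat N / (2 * pi)) * ln (norm t) \<le> 1 * ln (norm t)"
        using k l0 by (intro mult_right_mono_neg) auto
      then show ?thesis using m(1) by simp
    qed
    also have "\<dots> = C * norm t" using t by simp
    finally show ?thesis .
  qed
  have lim: "((\<lambda>t. t ^ k * g t) \<longlongrightarrow> 0) (at 0)"
  proof (rule Lim_null_comparison)
    show "eventually (\<lambda>t. norm (t ^ k * g t) \<le> C * norm t) (at 0)"
      unfolding eventually_at using \<rho> bound by (intro exI[of _ \<rho>]) auto
    show "((\<lambda>t::complex. C * norm t) \<longlongrightarrow> 0) (at 0)"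
      by (rule tendsto_eq_intros refl | simp)+
  qed
  have "(\<lambda>t. t ^ k * g t) analytic_on ball 0 1 - {0}" by (intro analytic_intros ana)
  then have "isolated_singularity_at (\<lambda>t. t ^ k * g t) 0"
    unfolding isolated_singularity_at_def by (intro exI[of _ 1]) auto
  then have "(\<lambda>t. t ^ k * g t) meromorphic_on {0}"
    unfolding meromorphic_at_iff not_essential_def using lim by blast
  then have "(\<lambda>t. t ^ k * g t / t ^ k) meromorphic_on {0}"
    by (rule meromorphic_on_divide) (intro analytic_on_imp_meromorphic_on analytic_intros)
  moreover have "(\<lambda>t. t ^ k * g t / t ^ k) meromorphic_on {0} \<longleftrightarrow> g meromorphic_on {0}"
    by (intro meromorphic_on_cong) (auto simp: eventually_at intro!: exI[of _ 1])
  ultimately have "g meromorphic_on {0}" by simp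
  then show ?thesis
    unfolding meromorphic_at_ii_inf_def
    using N gu by (intro exI[of _ N] conjI exI[of _ g]) (auto simp: ee_def)
qed

text \<open>The cosets of the stabiliser correspond to the translates, so the stabiliser has
  finite index. For a given \<open>A\<close>, two of the infinitely many matrices \<open>A T\<^sup>n\<close> give the
  same translate, by the pigeonhole principle, and therefore \<open>f \<circ> A\<close> is periodic.\<close>

theorem finite_orbit_imp_modular:
  assumes f: "finite_orbit f"
  shows "modular f"
proof -
  obtain F where F: "finite F" "\<And>A. A \<in> carrier SL2Z \<Longrightarrow> \<exists>h\<in>F. moderate h \<and> (\<forall>\<tau>\<in>uhp. f (moebius A \<tau>) = h \<tau>)"
    using finite_orbitE[OF f] by metis
  interpret G: group SL2Z by (rule group_SL2Z)
  have mult: "A \<otimes>\<^bsub>SL2Z\<^esub> B = A ** B" for A B by (simp add: SL2Z_def)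
  have one: "\<one>\<^bsub>SL2Z\<^esub> = mat 1" by (simp add: SL2Z_def)
  define \<Gamma> where "\<Gamma> = {A \<in> carrier SL2Z. \<forall>\<tau>\<in>uhp. f (moebius A \<tau>) = f \<tau>}"
  have inv_cancel: "moebius A (moebius (inv\<^bsub>SL2Z\<^esub> A) \<tau>) = \<tau>" if "A \<in> carrier SL2Z" "\<tau> \<in> uhp" for A \<tau>
  proof -
    have "moebius A (moebius (inv\<^bsub>SL2Z\<^esub> A) \<tau>) = moebius (A ** inv\<^bsub>SL2Z\<^esub> A) \<tau>"
      using that by (intro moebius_mult[symmetric]) auto
    also have "A ** inv\<^bsub>SL2Z\<^esub> A = mat 1" using G.r_inv[OF that(1)] by (simp add: mult one)
    finally show ?thesis by (simp add: moebius_one)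
  qed
  have sub: "subgroup \<Gamma> SL2Z"
  proof (rule G.subgroupI)
    show "\<Gamma> \<subseteq> carrier SL2Z" by (auto simp: \<Gamma>_def)
    have "mat 1 \<in> \<Gamma>" using one_in_SL2Z by (simp add: \<Gamma>_def moebius_one)
    then show "\<Gamma> \<noteq> {}" by blast
  next
    fix A assume A: "A \<in> \<Gamma>"
    then have Ac: "A \<in> carrier SL2Z" by (simp add: \<Gamma>_def)
    have "f (moebius (inv\<^bsub>SL2Z\<^esub> A) \<tau>) = f \<tau>" if "\<tau> \<in> uhp" for \<tau>
    proof -
      have "moebius (inv\<^bsub>SL2Z\<^esub> A) \<tau> \<in> uhp" using Im_moebius[OF G.inv_closed[OF Ac]] that by simp
      then have "f (moebius A (moebius (inv\<^bsub>SL2Z\<^esub> A) \<tau>)) = f (moebius (inv\<^bsub>SL2Z\<^esub> A) \<tau>)"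
        using A unfolding \<Gamma>_def by blast
      then show ?thesis using inv_cancel[OF Ac that] by simp
    qed
    then show "inv\<^bsub>SL2Z\<^esub> A \<in> \<Gamma>" using Ac by (simp add: \<Gamma>_def)
  next
    fix A B assume A: "A \<in> \<Gamma>" and B: "B \<in> \<Gamma>"
    have "f (moebius (A ** B) \<tau>) = f \<tau>" if "\<tau> \<in> uhp" for \<tau>
      using A B that Im_moebius[of B \<tau>] by (simp add: \<Gamma>_def moebius_mult)
    then show "A \<otimes>\<^bsub>SL2Z\<^esub> B \<in> \<Gamma>" using A B by (simp add: \<Gamma>_def mult mult_in_SL2Z)
  qed
  \<comment> \<open>Picks one of the finitely many translates; two matrices with the same choice
    lie in the same coset.\<close>
  define sel where "sel A = (SOME h. h \<in> F \<and> (\<forall>\<tau>\<in>uhp. f (moebius A \<tau>) = h \<tau>))" for A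
  have sel: "sel A \<in> F" "\<And>\<tau>. \<tau> \<in> uhp \<Longrightarrow> f (moebius A \<tau>) = sel A \<tau>" if "A \<in> carrier SL2Z" for A
  proof -
    have "\<exists>h. h \<in> F \<and> (\<forall>\<tau>\<in>uhp. f (moebius A \<tau>) = h \<tau>)" using F(2)[OF that] by blast
    then have "sel A \<in> F \<and> (\<forall>\<tau>\<in>uhp. f (moebius A \<tau>) = sel A \<tau>)" unfolding sel_def by (rule someI_ex)
    then show "sel A \<in> F" "\<And>\<tau>. \<tau> \<in> uhp \<Longrightarrow> f (moebius A \<tau>) = sel A \<tau>" by auto
  qed
  have coset: "\<Gamma> #>\<^bsub>SL2Z\<^esub> B = \<Gamma> #>\<^bsub>SL2Z\<^esub> A"
    if A: "A \<in> carrier SL2Z" and B: "B \<in> carrier SL2Z" and eq: "sel A = sel B" for A B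
  proof (rule G.repr_independence[OF _ B sub])
    have "f (moebius (A ** inv\<^bsub>SL2Z\<^esub> B) \<tau>) = f \<tau>" if "\<tau> \<in> uhp" for \<tau>
    proof -
      have s: "moebius (inv\<^bsub>SL2Z\<^esub> B) \<tau> \<in> uhp" using Im_moebius[OF G.inv_closed[OF B]] that by simp
      have "f (moebius (A ** inv\<^bsub>SL2Z\<^esub> B) \<tau>) = f (moebius A (moebius (inv\<^bsub>SL2Z\<^esub> B) \<tau>))"
        using moebius_mult[OF A G.inv_closed[OF B]] that by simp
      also have "\<dots> = f (moebius B (moebius (inv\<^bsub>SL2Z\<^esub> B) \<tau>))" using sel(2)[OF A s] sel(2)[OF B s] eq by simp
      finally show ?thesis using inv_cancel[OF B that] by simp
    qed
    then have "A \<otimes>\<^bsub>SL2Z\<^esub> inv\<^bsub>SL2Z\<^esub> B \<in> \<Gamma>" using A B by (simp add: \<Gamma>_def mult_in_SL2Z flip: mult)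
    moreover have "A = (A \<otimes>\<^bsub>SL2Z\<^esub> inv\<^bsub>SL2Z\<^esub> B) \<otimes>\<^bsub>SL2Z\<^esub> B" using A B by (simp add: G.m_assoc)
    ultimately show "A \<in> \<Gamma> #>\<^bsub>SL2Z\<^esub> B" unfolding r_coset_def by blast
  qed
  have "rcosets\<^bsub>SL2Z\<^esub> \<Gamma> \<subseteq> (\<lambda>h. \<Gamma> #>\<^bsub>SL2Z\<^esub> (SOME A. A \<in> carrier SL2Z \<and> sel A = h)) ` F"
  proof
    fix R assume "R \<in> rcosets\<^bsub>SL2Z\<^esub> \<Gamma>"
    then obtain A where A: "A \<in> carrier SL2Z" "R = \<Gamma> #>\<^bsub>SL2Z\<^esub> A" unfolding RCOSETS_def by blast
    define B where "B = (SOME B. B \<in> carrier SL2Z \<and> sel B = sel A)"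
    have "B \<in> carrier SL2Z \<and> sel B = sel A" unfolding B_def by (rule someI[of _ A]) (use A in auto)
    then have "R = \<Gamma> #>\<^bsub>SL2Z\<^esub> B" unfolding A(2) by (intro coset) (use A in auto)
    then show "R \<in> (\<lambda>h. \<Gamma> #>\<^bsub>SL2Z\<^esub> (SOME A. A \<in> carrier SL2Z \<and> sel A = h)) ` F"
      unfolding B_def using sel(1)[OF A(1)] by blast
  qed
  then have fin: "finite (rcosets\<^bsub>SL2Z\<^esub> \<Gamma>)" using F(1) finite_surj by blast
  have mero: "meromorphic_at_ii_inf (\<lambda>\<tau>. f (moebius A \<tau>))" if A: "A \<in> carrier SL2Z" for A
  proof -
    define T :: "nat \<Rightarrow> int ^ 2 ^ 2" where "T n = vector [vector [1, int n], vector [0, 1]]" for n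
    have T: "T n \<in> carrier SL2Z" "moebius (T n) \<tau> = \<tau> + of_nat n" for n \<tau>
      by (simp_all add: SL2Z_iff T_def moebius_def)
    have fT: "f (moebius (A ** T n) \<tau>) = f (moebius A (\<tau> + of_nat n))" if "\<tau> \<in> uhp" for n \<tau>
      using moebius_mult[OF A T(1)] that by (simp add: T(2))
    have "\<not> inj_on (\<lambda>n. sel (A ** T n)) (UNIV :: nat set)"
    proof
      assume "inj_on (\<lambda>n. sel (A ** T n)) (UNIV :: nat set)"
      moreover have "range (\<lambda>n. sel (A ** T n)) \<subseteq> F" using sel(1) mult_in_SL2Z[OF A T(1)] by blast
      ultimately show False using F(1) by (metis finite_imageD finite_subset infinite_UNIV_nat)
    qed
    \<comment> \<open>Two translations give the same translate, so their difference is a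
      period.\<close>
    then obtain m n where mn: "m < n" "sel (A ** T m) = sel (A ** T n)"
      unfolding inj_on_def by (metis linorder_neqE_nat)
    have per: "f (moebius A (\<tau> + of_nat (n - m))) = f (moebius A \<tau>)" if "\<tau> \<in> uhp" for \<tau>
    proof -
      have s: "\<tau> - of_nat m \<in> uhp" using that by simp
      have "f (moebius A ((\<tau> - of_nat m) + of_nat n)) = f (moebius A ((\<tau> - of_nat m) + of_nat m))"
        using sel(2)[OF mult_in_SL2Z[OF A T(1)] s, of m] sel(2)[OF mult_in_SL2Z[OF A T(1)] s, of n] fT[OF s] mn by simp
      then show ?thesis using mn(1) by (simp add: of_nat_diff algebra_simps)
    qed
    obtain h where h: "moderate h" "\<And>\<tau>. \<tau> \<in> uhp \<Longrightarrow> f (moebius A \<tau>) = h \<tau>" using F(2)[OF A] by blast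
    have hol: "(\<lambda>\<tau>. f (moebius A \<tau>)) holomorphic_on uhp"
    proof (rule holomorphic_on_compose_gen[unfolded o_def, OF _ finite_orbit_holomorphic[OF f]])
      show "moebius A holomorphic_on uhp"
        unfolding moebius_def using moebius_denominator_nonzero[OF A] by (intro holomorphic_intros) auto
      show "moebius A ` uhp \<subseteq> uhp" using Im_moebius[OF A] by auto
    qed
    show ?thesis
      by (rule meromorphic_at_ii_inf_periodic[OF hol _ per h]) (use mn in auto)
  qed
  show ?thesis
    unfolding modular_def modular_function_for_def
    using sub fin mero finite_orbit_holomorphic[OF f] by (intro exI[of _ \<Gamma>]) (auto simp: \<Gamma>_def)
qed

section \<open>The theta product under inversion\<close>

lemma qf_holomorphic:
  "f holomorphic_on S \<Longrightarrow> g holomorphic_on S \<Longrightarrow> (\<lambda>s. qf (f s) (g s) n) holomorphic_on S"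
  unfolding qf_def by (intro holomorphic_intros)

text \<open>A locally uniform limit of the finite products: on a compact set the nome is bounded
  away from the unit circle.\<close>

lemma qp_holomorphic:
  assumes f: "f holomorphic_on S" and g: "g holomorphic_on S" and S: "open S"
    and g1: "\<And>s. s \<in> S \<Longrightarrow> norm (g s) < 1"
  shows "(\<lambda>s. qp (f s) (g s)) holomorphic_on S"
proof (rule holomorphic_uniform_sequence[OF S qf_holomorphic[OF f g]])
  fix x assume "x \<in> S"
  then obtain d where d: "d > 0" "cball x d \<subseteq> S" using S open_contains_cball by blast
  define K where "K = cball x d"
  have K: "compact K" "K \<noteq> {}" using d by (auto simp: K_def)
  have cf: "continuous_on K f" "continuous_on K g"
    using f g d by (auto simp: K_def intro: holomorphic_on_imp_continuous_on holomorphic_on_subset)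
  obtain B where B: "\<And>s. s \<in> K \<Longrightarrow> norm (f s) \<le> B"
    using compact_imp_bounded[OF compact_continuous_image[OF cf(1) K(1)]] unfolding bounded_iff by auto
  obtain s0 where s0: "s0 \<in> K" "\<And>s. s \<in> K \<Longrightarrow> norm (g s) \<le> norm (g s0)"
    using continuous_attains_sup[OF K, of "\<lambda>s. norm (g s)"] cf by (auto intro: continuous_intros)
  define r where "r = norm (g s0)"
  have r: "0 \<le> r" "r < 1" using g1 s0 d by (auto simp: r_def K_def)
  have B0: "B \<ge> 0" using B[OF s0(1)] norm_ge_zero order_trans by blast
  have "uniformly_convergent_on K (\<lambda>N s. \<Prod>n<N. 1 - f s * g s ^ n)"
  proof (rule uniformly_convergent_on_prod')
    show "uniformly_convergent_on K (\<lambda>N s. \<Sum>n<N. norm (1 - f s * g s ^ n - 1))"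
    proof (rule Weierstrass_m_test'[where M = "\<lambda>n. B * r ^ n"])
      show "norm (norm (1 - f s * g s ^ n - 1)) \<le> B * r ^ n" if "s \<in> K" for n s
        using B[OF that] s0(2)[OF that] B0 by (auto simp: norm_mult norm_power r_def intro!: mult_mono power_mono)
      show "summable (\<lambda>n. B * r ^ n)" using r by (intro summable_mult summable_geometric) auto
    qed
  qed (auto intro!: continuous_intros cf K)
  then have "uniform_limit K (\<lambda>N s. \<Prod>n<N. 1 - f s * g s ^ n) (\<lambda>s. lim (\<lambda>N. \<Prod>n<N. 1 - f s * g s ^ n)) sequentially"
    by (simp add: uniformly_convergent_uniform_limit_iff)
  also have "?this \<longleftrightarrow> uniform_limit K (\<lambda>N s. qf (f s) (g s) N) (\<lambda>s. qp (f s) (g s)) sequentially"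
  proof (rule uniform_limit_cong')
    fix s assume "s \<in> K"
    then have "norm (g s) < 1" using g1 d by (auto simp: K_def)
    from qf_LIMSEQ[OF this, of "f s"] show "lim (\<lambda>N. \<Prod>n<N. 1 - f s * g s ^ n) = qp (f s) (g s)"
      by (intro limI) (simp add: qf_def[abs_def])
  qed (simp add: qf_def)
  finally show "\<exists>d>0. cball x d \<subseteq> S \<and> uniform_limit (cball x d) (\<lambda>n s. qf (f s) (g s) n) (\<lambda>s. qp (f s) (g s)) sequentially"
    using d unfolding K_def by blast
qed

definition lattice :: "complex \<Rightarrow> complex set" where
  "lattice \<tau> = {of_int i + of_int j * \<tau> | i j. True}"

lemma lattice_iff: "z \<in> lattice \<tau> \<longleftrightarrow> (\<exists>i j::int. z = of_int i + of_int j * \<tau>)"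
  by (auto simp: lattice_def)

lemma lattice_add: "a \<in> lattice \<tau> \<Longrightarrow> b \<in> lattice \<tau> \<Longrightarrow> a + b \<in> lattice \<tau>"
proof -
  assume "a \<in> lattice \<tau>" "b \<in> lattice \<tau>"
  then obtain i j k l :: int where "a = of_int i + of_int j * \<tau>" "b = of_int k + of_int l * \<tau>"
    unfolding lattice_iff by blast
  then have "a + b = of_int (i + k) + of_int (j + l) * \<tau>" by (simp add: algebra_simps)
  then show ?thesis unfolding lattice_iff by blast
qed

lemma lattice_minus: "a \<in> lattice \<tau> \<Longrightarrow> - a \<in> lattice \<tau>"
proof -
  assume "a \<in> lattice \<tau>"
  then obtain i j :: int where "a = of_int i + of_int j * \<tau>" unfolding lattice_iff by blast
  then have "- a = of_int (- i) + of_int (- j) * \<tau>" by simp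
  then show ?thesis unfolding lattice_iff by blast
qed

lemma lattice_shift: "a \<in> lattice \<tau> \<Longrightarrow> z + a \<in> lattice \<tau> \<longleftrightarrow> z \<in> lattice \<tau>"
  using lattice_add[of z \<tau> a] lattice_add[of "z + a" \<tau> "- a"] lattice_minus[of a \<tau>] by auto

lemma int_periodic:
  fixes h :: "complex \<Rightarrow> 'a"
  assumes "\<And>z. h (z + w) = h z"
  shows "h (z + of_int k * w) = h z"
proof (induction k rule: int_induct[where k = 0])
  case (step1 i)
  have "z + of_int (i + 1) * w = (z + of_int i * w) + w" by (simp add: algebra_simps)
  then show ?case using assms step1 by metis
next
  case (step2 i)
  have "(z + of_int (i - 1) * w) + w = z + of_int i * w" by (simp add: algebra_simps)
  then show ?case using assms step2 by metis
qed simp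

text \<open>Its values are those on a compact period parallelogram, so Liouville's theorem
  applies.\<close>

lemma elliptic_entire_constant:
  assumes \<tau>: "Im \<tau> > 0" and h: "h holomorphic_on UNIV"
    and 1: "\<And>z. h (z + 1) = h z" and 2: "\<And>z. h (z + \<tau>) = h z"
  shows "\<exists>C. \<forall>z. h z = C"
proof -
  define K where "K = (\<lambda>(s, t). complex_of_real s + complex_of_real t * \<tau>) ` ({0..1} \<times> {0..1})"
  have "compact K" unfolding K_def
    by (intro compact_continuous_image compact_Times) (auto simp: case_prod_unfold intro!: continuous_intros)
  then have "bounded (h ` K)"
    using h by (intro compact_imp_bounded compact_continuous_image) (auto intro: holomorphic_on_imp_continuous_on holomorphic_on_subset)
  moreover have "range h \<subseteq> h ` K"
  proof clarify
    fix z
    define t where "t = Im z / Im \<tau>"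
    define s where "s = Re z - t * Re \<tau>"
    have z: "z = of_real s + of_real t * \<tau>" using \<tau> by (simp add: complex_eq_iff s_def t_def)
    define z0 where "z0 = of_real (frac s) + of_real (frac t) * \<tau>"
    have "z = (z0 + of_int \<lfloor>s\<rfloor> * 1) + of_int \<lfloor>t\<rfloor> * \<tau>"
      by (simp add: z z0_def frac_def algebra_simps)
    then have "h z = h z0" using int_periodic[of h, OF 1] int_periodic[of h, OF 2] by metis
    moreover have "z0 \<in> K"
    proof -
      have "(frac s, frac t) \<in> {0..1} \<times> {0..1}"
        using frac_ge_0 frac_lt_1 by (auto intro: less_imp_le)
      then show ?thesis unfolding K_def z0_def by (force intro!: image_eqI[of _ _ "(frac s, frac t)"])
    qed
    ultimately show "h z \<in> h ` K" by blast
  qed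
  ultimately have "bounded (range h)" by (rule bounded_subset)
  from Liouville_theorem[OF h this] show ?thesis by (auto simp: constant_on_def)
qed

text \<open>Two functions with the same multipliers under the lattice have a doubly periodic
  quotient. The zeros of \<open>D\<close> at lattice points are simple and cancelled by zeros of \<open>N\<close>; by
  periodicity this has to be checked at \<open>0\<close> only.\<close>

lemma elliptic_quotient_constant:
  assumes \<tau>: "Im \<tau> > 0" and D: "D holomorphic_on UNIV" and N: "N holomorphic_on UNIV"
    and D1: "\<And>z. D (z + 1) = D z" and N1: "\<And>z. N (z + 1) = N z"
    and D2: "\<And>z. D (z + \<tau>) = m z * D z" and N2: "\<And>z. N (z + \<tau>) = m z * N z"
    and m: "\<And>z. m z \<noteq> 0"
    and zeros: "\<And>z. D z = 0 \<longleftrightarrow> z \<in> lattice \<tau>"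
    and N0: "N 0 = 0" and dD: "deriv D 0 \<noteq> 0"
  shows "\<exists>C. \<forall>z. z \<notin> lattice \<tau> \<longrightarrow> N z = C * D z"
proof -
  have D0: "D 0 = 0" unfolding zeros lattice_iff by (intro exI[of _ 0]) simp
  define E where "E z = (if z = 0 then deriv D 0 else D z / z)" for z
  define M where "M z = (if z = 0 then deriv N 0 else N z / z)" for z
  have E: "E holomorphic_on UNIV"
    by (rule pole_theorem_open_0[OF D, of 0]) (auto simp: E_def D0)
  have M: "M holomorphic_on UNIV"
    by (rule pole_theorem_open_0[OF N, of 0]) (auto simp: M_def N0)
  define h where "h z = (if z \<in> lattice \<tau> then M 0 / E 0 else N z / D z)" for z
  have unit: "1 \<in> lattice \<tau>" "\<tau> \<in> lattice \<tau>"
    unfolding lattice_iff by (rule exI[of _ 1], rule exI[of _ 0], simp) (rule exI[of _ 0], rule exI[of _ 1], simp)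
  have h1: "h (z + 1) = h z" for z
    unfolding h_def lattice_shift[OF unit(1)] D1 N1 ..
  have h2: "h (z + \<tau>) = h z" for z
    unfolding h_def lattice_shift[OF unit(2)] D2 N2 using m[of z] by simp
  have diff0: "h field_differentiable at 0"
  proof -
    define W where "W = {z. E z \<noteq> 0}"
    have "open W" unfolding W_def
      using open_Collect_neq[of E "\<lambda>_. 0"] holomorphic_on_imp_continuous_on[OF E] by simp
    have "0 \<in> W" using dD by (simp add: W_def E_def)
    have "(\<lambda>z. M z / E z) holomorphic_on W"
      using E M by (intro holomorphic_intros) (auto simp: W_def intro: holomorphic_on_subset)
    then have "h holomorphic_on W"
    proof (rule holomorphic_transform)
      fix z assume z: "z \<in> W"
      show "M z / E z = h z"
      proof (cases "z = 0")
        case True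
        then show ?thesis using zeros[of 0] D0 by (simp add: h_def)
      next
        case False
        then have "D z \<noteq> 0" using z by (auto simp: W_def E_def)
        then show ?thesis using False zeros[of z] by (simp add: h_def M_def E_def)
      qed
    qed
    then show ?thesis using \<open>open W\<close> \<open>0 \<in> W\<close> holomorphic_on_imp_differentiable_at by blast
  qed
  have "h holomorphic_on UNIV"
    unfolding holomorphic_on_def
  proof
    fix z0
    have "h field_differentiable at z0"
    proof (cases "z0 \<in> lattice \<tau>")
      case True
      then obtain i j :: int where ij: "z0 = of_int i + of_int j * \<tau>" unfolding lattice_iff by blast
      have "h z = (h \<circ> (\<lambda>z. z - z0)) z" for z
      proof -
        have "z = ((z - z0) + of_int i * 1) + of_int j * \<tau>" by (simp add: ij)
        then show ?thesis using int_periodic[of h, OF h1] int_periodic[of h, OF h2] by (metis comp_apply)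
      qed
      then have "h = h \<circ> (\<lambda>z. z - z0)" by blast
      moreover have "(h \<circ> (\<lambda>z. z - z0)) field_differentiable at z0"
        by (intro field_differentiable_compose derivative_intros) (use diff0 in auto)
      ultimately show ?thesis by simp
    next
      case False
      define V where "V = {z. D z \<noteq> 0}"
      have "open V" unfolding V_def
        using open_Collect_neq[of D "\<lambda>_. 0"] holomorphic_on_imp_continuous_on[OF D] by simp
      have "z0 \<in> V" using False zeros by (simp add: V_def)
      have "(\<lambda>z. N z / D z) holomorphic_on V"
        using D N by (intro holomorphic_intros) (auto simp: V_def intro: holomorphic_on_subset)
      then have "h holomorphic_on V"
        by (rule holomorphic_transform) (use zeros in \<open>auto simp: V_def h_def\<close>)
      then show ?thesis using \<open>open V\<close> \<open>z0 \<in> V\<close> holomorphic_on_imp_differentiable_at by blast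
    qed
    then show "h field_differentiable at z0 within UNIV" by simp
  qed
  from elliptic_entire_constant[OF \<tau> this h1 h2] obtain C where C: "\<And>z. h z = C" by blast
  have "N z = C * D z" if "z \<notin> lattice \<tau>" for z
    using C[of z] that zeros[of z] by (simp add: h_def field_simps)
  then show ?thesis by blast
qed

text \<open>Up to a factor this is the odd Jacobi theta function divided by the product
  \<open>(q;q)\<^sub>\<infinity>\<close>. Its zeros are the lattice points.\<close>

definition theta_prod :: "complex \<Rightarrow> complex \<Rightarrow> complex" where
  "theta_prod z \<tau> = qp (ee z) (ee \<tau>) * qp (ee (\<tau> - z)) (ee \<tau>)"

lemma theta_prod_add_1: "theta_prod (z + 1) \<tau> = theta_prod z \<tau>"
proof -
  have "ee (\<tau> - (z + 1)) = ee (\<tau> - z)" unfolding ee_eq_iff by (rule exI[of _ "-1"]) simp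
  then show ?thesis by (simp add: theta_prod_def ee_add)
qed

lemma theta_prod_add_tau:
  assumes \<tau>: "Im \<tau> > 0"
  shows "theta_prod (z + \<tau>) \<tau> = - ee (- z) * theta_prod z \<tau>"
proof -
  have q: "norm (ee \<tau>) < 1" by (rule norm_ee_less_1[OF \<tau>])
  have a: "theta_prod (z + \<tau>) \<tau> = qp (ee z * ee \<tau>) (ee \<tau>) * qp (ee (- z)) (ee \<tau>)"
    by (simp add: theta_prod_def ee_add)
  have b: "qp (ee z) (ee \<tau>) = (1 - ee z) * qp (ee z * ee \<tau>) (ee \<tau>)" by (rule qp_step[OF q])
  have c: "qp (ee (- z)) (ee \<tau>) = (1 - ee (- z)) * qp (ee (\<tau> - z)) (ee \<tau>)"
    using qp_step[OF q, of "ee (- z)"] by (simp add: ee_add[symmetric])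
  have d: "1 - ee (- z) = - ee (- z) * (1 - ee z)" by (simp add: ee_minus field_simps)
  show ?thesis unfolding a unfolding c d theta_prod_def b by simp
qed

lemma theta_prod_zero_iff:
  assumes \<tau>: "Im \<tau> > 0"
  shows "theta_prod z \<tau> = 0 \<longleftrightarrow> z \<in> lattice \<tau>"
proof -
  have q: "norm (ee \<tau>) < 1" by (rule norm_ee_less_1[OF \<tau>])
  have Z: "qp (ee y) (ee \<tau>) = 0 \<longleftrightarrow> (\<exists>n::nat. \<exists>k::int. y + of_nat n * \<tau> = of_int k)" for y
    unfolding qp_eq_0_iff[OF q] ee_power ee_add[symmetric] ee_eq_1_iff ..
  show ?thesis
  proof
    assume "theta_prod z \<tau> = 0"
    then consider "qp (ee z) (ee \<tau>) = 0" | "qp (ee (\<tau> - z)) (ee \<tau>) = 0" by (auto simp: theta_prod_def)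
    then show "z \<in> lattice \<tau>"
    proof cases
      case 1
      then obtain n :: nat and k :: int where "z + of_nat n * \<tau> = of_int k" unfolding Z by blast
      then have "z = of_int k + of_int (- int n) * \<tau>" by (simp add: algebra_simps eq_diff_eq)
      then show ?thesis unfolding lattice_iff by blast
    next
      case 2
      then obtain n :: nat and k :: int where "\<tau> - z + of_nat n * \<tau> = of_int k" unfolding Z by blast
      then have "z = of_int (- k) + of_int (int n + 1) * \<tau>" by (simp add: algebra_simps)
      then show ?thesis unfolding lattice_iff by blast
    qed
  next
    assume "z \<in> lattice \<tau>"
    then obtain i j :: int where ij: "z = of_int i + of_int j * \<tau>" unfolding lattice_iff by blast
    show "theta_prod z \<tau> = 0"
    proof (cases "j \<le> 0")
      case True
      then have "z + of_nat (nat (- j)) * \<tau> = of_int i" by (simp add: ij)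
      then have "qp (ee z) (ee \<tau>) = 0" unfolding Z by blast
      then show ?thesis by (simp add: theta_prod_def)
    next
      case False
      then have e: "of_nat (nat (j - 1)) = (of_int j - 1 :: complex)" by simp
      have "\<tau> - z + of_nat (nat (j - 1)) * \<tau> = of_int (- i)"
        unfolding e ij by (simp add: algebra_simps)
      then have "qp (ee (\<tau> - z)) (ee \<tau>) = 0" unfolding Z by blast
      then show ?thesis by (simp add: theta_prod_def)
    qed
  qed
qed

lemma theta_prod_holomorphic:
  assumes "f holomorphic_on S" "g holomorphic_on S" "open S" "\<And>s. s \<in> S \<Longrightarrow> Im (g s) > 0"
  shows "(\<lambda>s. theta_prod (f s) (g s)) holomorphic_on S"
  unfolding theta_prod_def using assms
  by (intro holomorphic_intros qp_holomorphic norm_ee_less_1) auto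

lemma deriv_theta_prod:
  assumes \<tau>: "Im \<tau> > 0"
  shows "deriv (\<lambda>z. theta_prod z \<tau>) 0 \<noteq> 0"
proof -
  have q: "norm (ee \<tau>) < 1" by (rule norm_ee_less_1[OF \<tau>])
  define U where "U z = qp (ee z * ee \<tau>) (ee \<tau>) * qp (ee (\<tau> - z)) (ee \<tau>)" for z
  have "theta_prod z \<tau> = (1 - ee z) * U z" for z
    unfolding theta_prod_def U_def using qp_step[OF q, of "ee z"] by simp
  then have eq: "(\<lambda>z. theta_prod z \<tau>) = (\<lambda>z. (1 - ee z) * U z)" by blast
  have "U holomorphic_on UNIV"
    unfolding U_def by (intro holomorphic_intros qp_holomorphic q) auto
  then have U: "(U has_field_derivative deriv U 0) (at 0)"
    by (rule holomorphic_derivI) auto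
  have e: "((\<lambda>z. 1 - ee z) has_field_derivative - (2 * of_real pi * \<i>)) (at 0)"
    unfolding ee_def by (auto intro!: derivative_eq_intros)
  have "((\<lambda>z. (1 - ee z) * U z) has_field_derivative - (2 * of_real pi * \<i>) * U 0 + deriv U 0 * (1 - ee 0)) (at 0)"
    by (rule DERIV_mult[OF e U])
  then have "deriv (\<lambda>z. theta_prod z \<tau>) 0 = - (2 * of_real pi * \<i>) * U 0"
    unfolding eq by (simp add: DERIV_imp_deriv)
  moreover have "U 0 \<noteq> 0" using qp_nonzero[OF q q] by (simp add: U_def)
  ultimately show ?thesis by simp
qed

lemma neg_inverse_uhp: "Im \<tau> > 0 \<Longrightarrow> Im (- 1 / \<tau>) > 0"
  using Im_complex_div_lt_0[of 1 \<tau>] by (simp add: Im_divide divide_neg_pos) 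

text \<open>Both sides, as functions of \<open>z\<close>, have the same multipliers under
  \<open>z \<mapsto> z + 1\<close> and \<open>z \<mapsto> z + \<tau>\<close>; the quadratic exponential is made for
  that. The constant \<open>C\<close> depends on \<open>\<tau>\<close> and is determined in \<open>siegel_inversion\<close>, up
  to a root of unity.\<close>

lemma theta_prod_inversion:
  assumes \<tau>: "Im \<tau> > 0"
  shows "\<exists>C. \<forall>z. z \<notin> lattice \<tau> \<longrightarrow>
     theta_prod (z / \<tau>) (- 1 / \<tau>) * exp (of_real pi * \<i> * (z - z / \<tau> - z ^ 2 / \<tau>)) = C * theta_prod z \<tau>"
proof (rule elliptic_quotient_constant[OF \<tau>, where m = "\<lambda>z. - ee (- z)"])
  have t0: "\<tau> \<noteq> 0" using \<tau> by auto
  have \<tau>': "Im (- 1 / \<tau>) > 0" by (rule neg_inverse_uhp[OF \<tau>])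
  define x where "x z = exp (of_real pi * \<i> * (z - z / \<tau> - z ^ 2 / \<tau>))" for z
  show "(\<lambda>z. theta_prod z \<tau>) holomorphic_on UNIV" using \<tau> by (intro theta_prod_holomorphic) (auto intro: holomorphic_intros)
  show "(\<lambda>z. theta_prod (z / \<tau>) (- 1 / \<tau>) * exp (of_real pi * \<i> * (z - z / \<tau> - z ^ 2 / \<tau>))) holomorphic_on UNIV"
    using \<tau>' t0 by (intro holomorphic_intros theta_prod_holomorphic) (auto intro!: holomorphic_intros)
  show "theta_prod (z + 1) \<tau> = theta_prod z \<tau>" for z by (rule theta_prod_add_1)
  show "theta_prod (z + \<tau>) \<tau> = - ee (- z) * theta_prod z \<tau>" for z by (rule theta_prod_add_tau[OF \<tau>])
  show "- ee (- z) \<noteq> 0" for z by simp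
  show "theta_prod z \<tau> = 0 \<longleftrightarrow> z \<in> lattice \<tau>" for z by (rule theta_prod_zero_iff[OF \<tau>])
  show "deriv (\<lambda>z. theta_prod z \<tau>) 0 \<noteq> 0" by (rule deriv_theta_prod[OF \<tau>])
  have "theta_prod 0 (- 1 / \<tau>) = 0" unfolding theta_prod_zero_iff[OF \<tau>'] lattice_iff by (intro exI[of _ 0]) simp
  then show "theta_prod (0 / \<tau>) (- 1 / \<tau>) * exp (of_real pi * \<i> * (0 - 0 / \<tau> - 0 ^ 2 / \<tau>)) = 0" by simp
  show "theta_prod ((z + \<tau>) / \<tau>) (- 1 / \<tau>) * exp (of_real pi * \<i> * ((z + \<tau>) - (z + \<tau>) / \<tau> - (z + \<tau>) ^ 2 / \<tau>))
     = - ee (- z) * (theta_prod (z / \<tau>) (- 1 / \<tau>) * exp (of_real pi * \<i> * (z - z / \<tau> - z ^ 2 / \<tau>)))" for z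
  proof -
    have 1: "theta_prod ((z + \<tau>) / \<tau>) (- 1 / \<tau>) = theta_prod (z / \<tau>) (- 1 / \<tau>)"
      using theta_prod_add_1[of "z / \<tau>" "- 1 / \<tau>"] t0 by (simp add: add_divide_distrib)
    have "of_real pi * \<i> * ((z + \<tau>) - (z + \<tau>) / \<tau> - (z + \<tau>) ^ 2 / \<tau>)
       = - (of_real pi * \<i>) + 2 * of_real pi * \<i> * (- z) + of_real pi * \<i> * (z - z / \<tau> - z ^ 2 / \<tau>)"
      using t0 by (simp add: field_simps power2_eq_square)
    then have 2: "x (z + \<tau>) = - ee (- z) * x z"
      unfolding x_def ee_def by (simp only: exp_add exp_minus exp_pi_i) simp
    show ?thesis using 1 2 by (simp add: x_def)
  qed
  show "theta_prod ((z + 1) / \<tau>) (- 1 / \<tau>) * exp (of_real pi * \<i> * ((z + 1) - (z + 1) / \<tau> - (z + 1) ^ 2 / \<tau>))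
     = theta_prod (z / \<tau>) (- 1 / \<tau>) * exp (of_real pi * \<i> * (z - z / \<tau> - z ^ 2 / \<tau>))" for z
  proof -
    have "theta_prod ((z + 1) / \<tau> + (- 1 / \<tau>)) (- 1 / \<tau>) = - ee (- ((z + 1) / \<tau>)) * theta_prod ((z + 1) / \<tau>) (- 1 / \<tau>)"
      by (rule theta_prod_add_tau[OF \<tau>'])
    moreover have "(z + 1) / \<tau> + (- 1 / \<tau>) = z / \<tau>" by (simp add: add_divide_distrib)
    ultimately have 1: "theta_prod (z / \<tau>) (- 1 / \<tau>) = - ee (- ((z + 1) / \<tau>)) * theta_prod ((z + 1) / \<tau>) (- 1 / \<tau>)" by simp
    have "of_real pi * \<i> * ((z + 1) - (z + 1) / \<tau> - (z + 1) ^ 2 / \<tau>)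
       = of_real pi * \<i> + 2 * of_real pi * \<i> * (- ((z + 1) / \<tau>)) + of_real pi * \<i> * (z - z / \<tau> - z ^ 2 / \<tau>)"
      using t0 by (simp add: field_simps power2_eq_square)
    then have 2: "x (z + 1) = - ee (- ((z + 1) / \<tau>)) * x z"
      unfolding x_def ee_def by (simp only: exp_add exp_pi_i) simp
    show ?thesis unfolding 1 x_def[symmetric] 2 by simp
  qed
qed

section \<open>Siegel functions\<close>

text \<open>The exponent \<open>a\<^sup>2 - a + 1/6\<close> is the second Bernoulli polynomial; with it,
  replacing \<open>a\<close> by \<open>a + 1\<close> changes the function by a constant factor only.\<close>

definition siegel :: "real \<Rightarrow> real \<Rightarrow> complex \<Rightarrow> complex" where
  "siegel a b \<tau> = exp (of_real pi * \<i> * of_real (a ^ 2 - a + 1 / 6) * \<tau>) * theta_prod (of_real a * \<tau> + of_real b) \<tau>"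

lemma siegel_add_int: "siegel a (b + 1) \<tau> = siegel a b \<tau>"
  using theta_prod_add_1[of "of_real a * \<tau> + of_real b" \<tau>] by (simp add: siegel_def add.assoc)

lemma siegel_add_1:
  assumes "Im \<tau> > 0"
  shows "siegel (a + 1) b \<tau> = - ee (- of_real b) * siegel a b \<tau>"
proof -
  have 1: "theta_prod (of_real (a + 1) * \<tau> + of_real b) \<tau> = - ee (- (of_real a * \<tau> + of_real b)) * theta_prod (of_real a * \<tau> + of_real b) \<tau>"
    using theta_prod_add_tau[OF assms, of "of_real a * \<tau> + of_real b"] by (simp add: algebra_simps)
  have "of_real pi * \<i> * of_real ((a + 1) ^ 2 - (a + 1) + 1 / 6) * \<tau>
     = of_real pi * \<i> * of_real (a ^ 2 - a + 1 / 6) * \<tau> + 2 * of_real pi * \<i> * (of_real a * \<tau>)"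
    by (simp add: power2_eq_square algebra_simps)
  then have 2: "exp (of_real pi * \<i> * of_real ((a + 1) ^ 2 - (a + 1) + 1 / 6) * \<tau>)
     = exp (of_real pi * \<i> * of_real (a ^ 2 - a + 1 / 6) * \<tau>) * ee (of_real a * \<tau>)"
    by (simp add: ee_def exp_add)
  have 3: "ee (of_real a * \<tau>) * ee (- (of_real a * \<tau> + of_real b)) = ee (- of_real b)"
    unfolding ee_add[symmetric] by simp
  show ?thesis unfolding siegel_def 1 2 using 3 by (simp add: mult_ac)
qed

lemma siegel_translate:
  "siegel a b (\<tau> + 1) = exp (of_real pi * \<i> * of_real (a ^ 2 - a + 1 / 6)) * siegel a (a + b) \<tau>"
proof -
  have "ee (\<tau> + 1 - z) = ee (\<tau> - z)" for z unfolding ee_eq_iff by (rule exI[of _ 1]) simp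
  then have 1: "theta_prod z (\<tau> + 1) = theta_prod z \<tau>" for z unfolding theta_prod_def by (simp add: ee_add)
  define X where "X = of_real pi * \<i> * of_real (a ^ 2 - a + 1 / 6)"
  have 2: "of_real a * (\<tau> + 1) + of_real b = of_real a * \<tau> + of_real (a + b)" by (simp add: algebra_simps)
  have 3: "exp (X * (\<tau> + 1)) = exp X * exp (X * \<tau>)" by (simp add: ring_distribs exp_add mult.commute)
  show ?thesis unfolding siegel_def X_def[symmetric] 1 2 3 by simp
qed

lemma lattice_real_iff:
  assumes "Im \<tau> > 0"
  shows "of_real a * \<tau> + of_real b \<in> lattice \<tau> \<longleftrightarrow> a \<in> \<int> \<and> b \<in> \<int>"
proof
  assume "of_real a * \<tau> + of_real b \<in> lattice \<tau>"
  then obtain i j :: int where e: "of_real a * \<tau> + of_real b = of_int i + of_int j * \<tau>" unfolding lattice_iff by blast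
  from arg_cong[OF e, of Im] have a: "a = of_int j" using assms by simp
  from arg_cong[OF e, of Re] have "b = of_int i" by (simp add: a)
  then show "a \<in> \<int> \<and> b \<in> \<int>" using a by simp
next
  assume "a \<in> \<int> \<and> b \<in> \<int>"
  then obtain i j :: int where "a = of_int i" "b = of_int j" by (auto elim!: Ints_cases)
  then have "of_real a * \<tau> + of_real b = of_int j + of_int i * \<tau>" by simp
  then show "of_real a * \<tau> + of_real b \<in> lattice \<tau>" unfolding lattice_iff by blast
qed

lemma siegel_nonzero:
  assumes "Im \<tau> > 0" "\<not> (a \<in> \<int> \<and> b \<in> \<int>)"
  shows "siegel a b \<tau> \<noteq> 0"
  using assms by (simp add: siegel_def theta_prod_zero_iff lattice_real_iff)

lemma siegel_holomorphic: "siegel a b holomorphic_on uhp"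
  unfolding siegel_def[abs_def]
  by (intro holomorphic_intros theta_prod_holomorphic) (auto simp: open_halfspace_Im_gt)

lemma qp_square:
  assumes q: "norm q < 1" shows "qp z q * qp (- z) q = qp (z ^ 2) (q ^ 2)"
proof -
  have "norm (q ^ 2) < 1" by (rule norm_power2_less_1[OF q])
  from qf_LIMSEQ[OF this, of "z ^ 2"] have "(\<lambda>n. qf z q n * qf (- z) q n) \<longlonglongrightarrow> qp (z ^ 2) (q ^ 2)"
    by (simp add: qf_square)
  moreover have "(\<lambda>n. qf z q n * qf (- z) q n) \<longlonglongrightarrow> qp z q * qp (- z) q"
    by (intro tendsto_mult qf_LIMSEQ q)
  ultimately show ?thesis by (rule LIMSEQ_unique[rotated])
qed

lemma qp_dissect:
  assumes q: "norm q < 1" and N: "N > 0"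
  shows "qp z q = (\<Prod>j<N. qp (z * q ^ j) (q ^ N))"
proof -
  have qN: "norm (q ^ N) < 1" using q N by (simp add: norm_power power_less_one_iff)
  have "qf z q (n * N) = (\<Prod>j<N. qf (z * q ^ j) (q ^ N) n)" for n
  proof (induction n)
    case (Suc n)
    have "qf z q (Suc n * N) = qf z q (n * N) * qf (z * q ^ (n * N)) q N"
      using qf_add[of z q "n * N" N] by (simp add: add.commute)
    also have "qf (z * q ^ (n * N)) q N = (\<Prod>j<N. 1 - z * q ^ j * (q ^ N) ^ n)"
      unfolding qf_def by (intro prod.cong refl) (simp add: mult_ac flip: power_mult)
    finally show ?case unfolding Suc by (simp add: qf_Suc prod.distrib)
  qed simp
  moreover have "(\<lambda>n. \<Prod>j<N. qf (z * q ^ j) (q ^ N) n) \<longlonglongrightarrow> (\<Prod>j<N. qp (z * q ^ j) (q ^ N))"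
    by (intro tendsto_prod qf_LIMSEQ qN)
  moreover have "(\<lambda>n. qf z q (n * N)) \<longlonglongrightarrow> qp z q"
    using LIMSEQ_subseq_LIMSEQ[OF qf_LIMSEQ[OF q], of "\<lambda>n. n * N" z] N by (simp add: o_def strict_mono_def)
  ultimately show ?thesis using LIMSEQ_unique by simp
qed

text \<open>As
  \<open>(p;q)\<^sub>\<infinity> (-p;q)\<^sub>\<infinity> = (q;q\<^sup>2)\<^sub>\<infinity>\<close>, this
  is Euler's theorem that partitions into distinct parts and into odd parts are equinumerous.\<close>

lemma weber_product:
  assumes q: "norm q < 1" and p: "p ^ 2 = q"
  shows "qp (- q) q * (qp p q * qp (- p) q) = 1"
proof -
  have q2: "norm (q ^ 2) < 1" by (rule norm_power2_less_1[OF q])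
  have 1: "qp p q * qp (- p) q = qp q (q ^ 2)" using qp_square[OF q, of p] p by simp
  have 2: "qp q q * qp (- q) q = qp (q ^ 2) (q ^ 2)" by (rule qp_square[OF q])
  have 3: "qp q q = qp q (q ^ 2) * qp (q ^ 2) (q ^ 2)"
    using qp_dissect[OF q, of 2 q] by (simp add: numeral_2_eq_2 power2_eq_square)
  have nz: "qp (q ^ 2) (q ^ 2) \<noteq> 0" by (rule qp_nonzero[OF q2 q2])
  have "qp (q ^ 2) (q ^ 2) * (qp (- q) q * qp q (q ^ 2)) = qp (q ^ 2) (q ^ 2) * 1"
    using 2 unfolding 3 by (simp add: mult_ac)
  then show ?thesis unfolding 1 using nz by (simp only: mult_cancel_left) simp
qed

lemma theta_prod_half_periods:
  assumes \<tau>: "Im \<tau> > 0"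
  defines "q \<equiv> ee \<tau>" and "p \<equiv> ee (\<tau> / 2)"
  shows "theta_prod (1 / 2) \<tau> = 2 * (qp (- q) q) ^ 2" "theta_prod (\<tau> / 2) \<tau> = (qp p q) ^ 2"
    "theta_prod (\<tau> / 2 + 1 / 2) \<tau> = (qp (- p) q) ^ 2"
proof -
  have q: "norm q < 1" unfolding q_def by (rule norm_ee_less_1[OF \<tau>])
  have h: "ee (1 / 2) = - 1" by (simp add: ee_def)
  then have h': "ee (- (1 / 2)) = - 1" by (simp add: ee_minus)
  have "qp (- 1) q = 2 * qp (- q) q" using qp_step[OF q, of "- 1"] by simp
  moreover have "ee (\<tau> - 1 / 2) = - q" using ee_add[of \<tau> "- (1 / 2)"] by (simp add: h' q_def)
  ultimately show "theta_prod (1 / 2) \<tau> = 2 * (qp (- q) q) ^ 2"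
    by (simp add: theta_prod_def h q_def power2_eq_square)
  have "ee (\<tau> - \<tau> / 2) = p" by (simp add: p_def)
  then show "theta_prod (\<tau> / 2) \<tau> = (qp p q) ^ 2"
    by (simp add: theta_prod_def p_def q_def power2_eq_square)
  have "ee (\<tau> - (\<tau> / 2 + 1 / 2)) = - p" using ee_add[of "\<tau> / 2" "- (1 / 2)"] by (simp add: h' p_def diff_diff_eq[symmetric])
  moreover have "ee (\<tau> / 2 + 1 / 2) = - p" by (simp add: ee_add h p_def)
  ultimately show "theta_prod (\<tau> / 2 + 1 / 2) \<tau> = (qp (- p) q) ^ 2"
    by (simp add: theta_prod_def q_def power2_eq_square)
qed

lemma siegel_half:
  assumes \<tau>: "Im \<tau> > 0"
  defines "q \<equiv> ee \<tau>" and "p \<equiv> ee (\<tau> / 2)"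
  shows "siegel 0 (1 / 2) \<tau> = exp (of_real pi * \<i> * \<tau> / 6) * (2 * (qp (- q) q) ^ 2)"
    "siegel (1 / 2) 0 \<tau> = exp (- of_real pi * \<i> * \<tau> / 12) * (qp p q) ^ 2"
    "siegel (1 / 2) (1 / 2) \<tau> = exp (- of_real pi * \<i> * \<tau> / 12) * (qp (- p) q) ^ 2"
  using theta_prod_half_periods[OF \<tau>] by (simp_all add: siegel_def power2_eq_square p_def q_def)

text \<open>This normalisation fixes the unknown constant in the inversion formula.\<close>

lemma siegel_half_product:
  assumes \<tau>: "Im \<tau> > 0"
  shows "siegel (1 / 2) (1 / 2) \<tau> * siegel (1 / 2) 0 \<tau> * siegel 0 (1 / 2) \<tau> = 2"
proof -
  have q: "norm (ee \<tau>) < 1" by (rule norm_ee_less_1[OF \<tau>])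
  have "ee (\<tau> / 2) ^ 2 = ee \<tau>" unfolding ee_power by simp
  from weber_product[OF q this]
  have 1: "qp (- ee \<tau>) (ee \<tau>) ^ 2 * (qp (ee (\<tau> / 2)) (ee \<tau>) ^ 2 * qp (- ee (\<tau> / 2)) (ee \<tau>) ^ 2) = 1"
    by (simp flip: power_mult_distrib)
  have 2: "exp (- of_real pi * \<i> * \<tau> / 12) * exp (- of_real pi * \<i> * \<tau> / 12) * exp (of_real pi * \<i> * \<tau> / 6) = 1"
    by (simp flip: exp_add)
  have "siegel (1 / 2) (1 / 2) \<tau> * siegel (1 / 2) 0 \<tau> * siegel 0 (1 / 2) \<tau>
    = 2 * (exp (- of_real pi * \<i> * \<tau> / 12) * exp (- of_real pi * \<i> * \<tau> / 12) * exp (of_real pi * \<i> * \<tau> / 6))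
      * (qp (- ee \<tau>) (ee \<tau>) ^ 2 * (qp (ee (\<tau> / 2)) (ee \<tau>) ^ 2 * qp (- ee (\<tau> / 2)) (ee \<tau>) ^ 2))"
    unfolding siegel_half[OF \<tau>] by (simp only: mult_ac)
  then show ?thesis unfolding 1 2 by simp
qed

text \<open>Specialising \<open>theta_prod_inversion\<close> gives the formula with one unknown \<open>D\<close>
  common to all \<open>a, b\<close>. The three Siegel functions at half periods are permuted by the
  inversion and have product \<open>2\<close>, hence \<open>D\<^sup>3\<close> is a fourth root of unity.\<close>

lemma siegel_inversion:
  assumes \<tau>: "Im \<tau> > 0"
  shows "\<exists>D. D ^ 12 = 1 \<and> (\<forall>a b. \<not> (a \<in> \<int> \<and> b \<in> \<int>) \<longrightarrow>
     siegel a b (- 1 / \<tau>) = D * exp (of_real pi * \<i> * of_real (a + b - 2 * a * b)) * siegel b (- a) \<tau>)"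
proof -
  have t0: "\<tau> \<noteq> 0" using \<tau> by auto
  obtain C where C: "\<And>z. z \<notin> lattice \<tau> \<Longrightarrow>
     theta_prod (z / \<tau>) (- 1 / \<tau>) * exp (of_real pi * \<i> * (z - z / \<tau> - z ^ 2 / \<tau>)) = C * theta_prod z \<tau>"
    using theta_prod_inversion[OF \<tau>] by blast
  define D where "D = C * exp (- of_real pi * \<i> * (\<tau> + 1 / \<tau>) / 6)"
  have main: "siegel a b (- 1 / \<tau>) = D * exp (of_real pi * \<i> * of_real (a + b - 2 * a * b)) * siegel b (- a) \<tau>"
    if ab: "\<not> (a \<in> \<int> \<and> b \<in> \<int>)" for a b
  proof -
    define z where "z = of_real b * \<tau> + of_real (- a)"
    have "z \<notin> lattice \<tau>" unfolding z_def using ab lattice_real_iff[OF \<tau>, of b "- a"] by (auto simp: minus_in_Ints_iff)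
    note CC = C[OF this]
    have "T = R * exp (- X)" if "T * exp X = R" for T R X :: complex
      using that by (simp add: exp_minus field_simps)
    from this[OF CC] have 1: "theta_prod (z / \<tau>) (- 1 / \<tau>) = C * theta_prod z \<tau> * exp (- (of_real pi * \<i> * (z - z / \<tau> - z ^ 2 / \<tau>)))" .
    have 2: "z / \<tau> = of_real a * (- 1 / \<tau>) + of_real b" using t0 by (simp add: z_def field_simps)
    have "of_real pi * \<i> * of_real (a ^ 2 - a + 1 / 6) * (- 1 / \<tau>) + - (of_real pi * \<i> * (z - z / \<tau> - z ^ 2 / \<tau>))
       = - of_real pi * \<i> * (\<tau> + 1 / \<tau>) / 6 + of_real pi * \<i> * of_real (a + b - 2 * a * b) + of_real pi * \<i> * of_real (b ^ 2 - b + 1 / 6) * \<tau>"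
      using t0 unfolding z_def by (simp add: field_simps power2_eq_square)
    from arg_cong[OF this, of exp]
    have 3: "exp (of_real pi * \<i> * of_real (a ^ 2 - a + 1 / 6) * (- 1 / \<tau>)) * exp (- (of_real pi * \<i> * (z - z / \<tau> - z ^ 2 / \<tau>)))
       = exp (- of_real pi * \<i> * (\<tau> + 1 / \<tau>) / 6) * exp (of_real pi * \<i> * of_real (a + b - 2 * a * b)) * exp (of_real pi * \<i> * of_real (b ^ 2 - b + 1 / 6) * \<tau>)"
      by (simp only: exp_add)
    have "siegel a b (- 1 / \<tau>) = (exp (of_real pi * \<i> * of_real (a ^ 2 - a + 1 / 6) * (- 1 / \<tau>)) * exp (- (of_real pi * \<i> * (z - z / \<tau> - z ^ 2 / \<tau>)))) * (C * theta_prod z \<tau>)"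
      unfolding siegel_def 2[symmetric] 1 by (simp only: mult_ac)
    also have "\<dots> = D * exp (of_real pi * \<i> * of_real (a + b - 2 * a * b)) * siegel b (- a) \<tau>"
      unfolding 3 siegel_def D_def z_def[symmetric] by (simp only: mult_ac)
    finally show ?thesis .
  qed
  have half: "(1 / 2 :: real) \<notin> \<int>"
  proof
    assume "(1 / 2 :: real) \<in> \<int>"
    then obtain n :: int where "1 / 2 = (of_int n :: real)" by (auto elim: Ints_cases)
    then have "of_int (2 * n) = (of_int 1 :: real)" by simp
    then have "2 * n = 1" by (simp only: of_int_eq_iff)
    then show False by presburger
  qed
  have i: "exp (of_real pi * \<i> * of_real (1 / 2)) = \<i>" by (simp add: exp_eq_polar cis_pi_half mult.commute flip: cis_conv_exp)
  have neg: "siegel a (- (1 / 2)) \<tau> = siegel a (1 / 2) \<tau>" for a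
    using siegel_add_int[of a "- (1 / 2)" \<tau>] by simp
  have s1: "siegel (1 / 2) (1 / 2) (- 1 / \<tau>) = D * \<i> * siegel (1 / 2) (1 / 2) \<tau>"
    using main[of "1 / 2" "1 / 2"] half i neg by simp
  have s2: "siegel (1 / 2) 0 (- 1 / \<tau>) = D * \<i> * siegel 0 (1 / 2) \<tau>"
    using main[of "1 / 2" 0] half i neg by simp
  have s3: "siegel 0 (1 / 2) (- 1 / \<tau>) = D * \<i> * siegel (1 / 2) 0 \<tau>"
    using main[of 0 "1 / 2"] half i by simp
  have "2 = D ^ 3 * \<i> ^ 3 * (siegel (1 / 2) (1 / 2) \<tau> * siegel (1 / 2) 0 \<tau> * siegel 0 (1 / 2) \<tau>)"
    using siegel_half_product[OF neg_inverse_uhp[OF \<tau>]] unfolding s1 s2 s3 by (simp add: power3_eq_cube mult_ac)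
  then have "D ^ 3 * \<i> ^ 3 = 1" unfolding siegel_half_product[OF \<tau>] by simp
  then have "(D ^ 3 * \<i> ^ 3) ^ 4 = 1" by simp
  moreover have "(D ^ 3 * \<i> ^ 3) ^ 4 = D ^ 12 * (\<i> ^ 4) ^ 3" by (simp add: power_mult_distrib flip: power_mult)
  ultimately have "D ^ 12 = 1" by simp
  then show ?thesis using main by blast
qed

section \<open>Growth of Siegel functions\<close>

lemma sum_geometric_bound: "0 \<le> \<rho> \<Longrightarrow> \<rho> < 1 \<Longrightarrow> (\<Sum>k<n. \<rho> ^ k) \<le> 1 / (1 - \<rho>)" for \<rho> :: real
  by (subst sum_gp_strict) (auto simp: divide_right_mono)

lemma qp_upper_bound:
  assumes q: "norm q < 1"
  shows "norm (qp z q) \<le> exp (norm z / (1 - norm q))"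
proof (rule LIMSEQ_le_const2[OF tendsto_norm[OF qf_LIMSEQ[OF q]]], intro exI[of _ 0] allI impI)
  fix n
  have "norm (qf z q n) \<le> (\<Prod>k<n. exp (norm z * norm q ^ k))"
    unfolding qf_def prod_norm[symmetric]
  proof (intro prod_mono conjI)
    fix k
    have "norm (1 - z * q ^ k) \<le> 1 + norm z * norm q ^ k"
      by (metis norm_mult norm_one norm_power norm_triangle_ineq4)
    also have "\<dots> \<le> exp (norm z * norm q ^ k)" by (rule exp_ge_add_one_self)
    finally show "norm (1 - z * q ^ k) \<le> exp (norm z * norm q ^ k)" .
  qed auto
  also have "\<dots> = exp (norm z * (\<Sum>k<n. norm q ^ k))" by (simp add: exp_sum sum_distrib_left)
  also have "\<dots> \<le> exp (norm z * (1 / (1 - norm q)))"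
    by (intro iffD2[OF exp_le_cancel_iff] mult_left_mono sum_geometric_bound) (use q in auto)
  finally show "norm (qf z q n) \<le> exp (norm z / (1 - norm q))" by simp
qed

lemma qp_lower_bound:
  assumes q: "norm q < 1" and z: "norm z \<le> r" and r: "r < 1"
  shows "norm (1 / qp z q) \<le> exp (r / (1 - r) / (1 - norm q))"
proof -
  have r0: "r \<ge> 0" using z norm_ge_zero order_trans by blast
  have z1: "norm z < 1" using z r by simp
  have lim: "(\<lambda>n. norm (1 / qf z q n)) \<longlonglongrightarrow> norm (1 / qp z q)"
    by (intro tendsto_norm tendsto_divide tendsto_const qf_LIMSEQ q qp_nonzero z1)
  show ?thesis
  proof (rule LIMSEQ_le_const2[OF lim], intro exI[of _ 0] allI impI)
    fix n
    have "norm (1 / qf z q n) = (\<Prod>k<n. norm (1 / (1 - z * q ^ k)))"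
      by (simp add: qf_def norm_divide prod_dividef prod_norm)
    also have "\<dots> \<le> (\<Prod>k<n. exp (r / (1 - r) * norm q ^ k))"
    proof (intro prod_mono conjI)
      fix k
      define y where "y = norm (z * q ^ k)"
      have y: "y \<le> r * norm q ^ k" unfolding y_def norm_mult norm_power using z by (intro mult_right_mono) auto
      also have "\<dots> \<le> r * 1" using r0 q by (intro mult_left_mono power_le_one) auto
      finally have yr: "y \<le> r" by simp
      have "1 - y \<le> norm (1 - z * q ^ k)" unfolding y_def using norm_triangle_ineq2[of 1 "z * q ^ k"] by simp
      then have "norm (1 / (1 - z * q ^ k)) \<le> 1 / (1 - y)"
        unfolding norm_divide using yr r by (simp add: frac_le)
      also have "\<dots> = 1 + y / (1 - y)" using yr r by (simp add: field_simps)
      also have "\<dots> \<le> exp (y / (1 - y))" by (rule exp_ge_add_one_self)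
      also have "y / (1 - y) \<le> (r * norm q ^ k) / (1 - r)"
        using y yr r r0 by (intro frac_le) (auto simp: y_def)
      finally show "norm (1 / (1 - z * q ^ k)) \<le> exp (r / (1 - r) * norm q ^ k)" by simp
    qed auto
    also have "\<dots> = exp (r / (1 - r) * (\<Sum>k<n. norm q ^ k))" by (simp add: exp_sum sum_distrib_left)
    also have "\<dots> \<le> exp (r / (1 - r) * (1 / (1 - norm q)))"
      using sum_geometric_bound[of "norm q" n] q r r0 by (intro iffD2[OF exp_le_cancel_iff] mult_left_mono) auto
    finally show "norm (1 / qf z q n) \<le> exp (r / (1 - r) / (1 - norm q))" by simp
  qed
qed

text \<open>For \<open>0 \<le> a < 1\<close> both products in \<open>theta_prod\<close> stay bounded near
  \<open>\<i>\<infinity>\<close>. They stay away from \<open>0\<close> as well: only the first factor with \<open>a = 0\<close>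
  does not tend to \<open>1\<close>, and it is a nonzero constant then.\<close>

lemma siegel_moderate:
  assumes a: "0 \<le> a" "a < 1" and ab: "\<not> (a \<in> \<int> \<and> b \<in> \<int>)"
  shows "moderate (siegel a b)" "moderate (\<lambda>\<tau>. 1 / siegel a b \<tau>)"
proof -
  define B where "B = a ^ 2 - a + 1 / 6"
  define \<rho> where "\<rho> = exp (- 2 * pi)"
  define r where "r = max \<rho> (exp (- 2 * pi * (1 - a)))"
  have \<rho>: "0 < \<rho>" "\<rho> < 1" by (auto simp: \<rho>_def)
  have r: "0 < r" "r < 1" using \<rho> a by (auto simp: r_def)
  define \<delta> where "\<delta> = (if a = 0 then norm (1 - ee (of_real b)) else 1 - exp (- 2 * pi * a))"
  have \<delta>: "\<delta> > 0"
  proof (cases "a = 0")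
    case True
    then have "b \<notin> \<int>" using ab by auto
    have "ee (of_real b) \<noteq> 1"
    proof
      assume "ee (of_real b) = 1"
      then obtain n :: int where "complex_of_real b = of_int n" unfolding ee_eq_1_iff by blast
      then have "b = of_int n" by (metis of_real_eq_iff of_real_of_int_eq)
      then show False using \<open>b \<notin> \<int>\<close> by simp
    qed
    then show ?thesis using True by (simp add: \<delta>_def)
  qed (use a in \<open>auto simp: \<delta>_def\<close>)
  define K where "K = exp (1 / (1 - \<rho>))"
  define L where "L = exp (r / (1 - r) / (1 - \<rho>))"
  have main: "norm (theta_prod (of_real a * \<tau> + of_real b) \<tau>) \<le> 2 * (K * K)"
      "norm (1 / theta_prod (of_real a * \<tau> + of_real b) \<tau>) \<le> 1 / \<delta> * (L * L)" if y: "Im \<tau> \<ge> 1" for \<tau>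
  proof -
    define z where "z = of_real a * \<tau> + of_real b"
    have Imz: "Im z = a * Im \<tau>" by (simp add: z_def)
    have mono: "exp (- 2 * pi * (c * Im \<tau>)) \<le> exp (- 2 * pi * c)" if "c \<ge> 0" for c
      using mult_left_mono[OF y that] by simp
    have q\<rho>: "norm (ee \<tau>) \<le> \<rho>" using mono[of 1] by (simp add: norm_ee \<rho>_def)
    then have q: "norm (ee \<tau>) < 1" using \<rho> by simp
    have w1: "norm (ee z * ee \<tau>) \<le> \<rho>"
    proof -
      have "norm (ee z) \<le> 1" using a y by (simp add: norm_ee Imz)
      then have "norm (ee z) * norm (ee \<tau>) \<le> 1 * norm (ee \<tau>)" by (intro mult_right_mono) auto
      then show ?thesis using q\<rho> unfolding norm_mult by linarith
    qed
    have w2: "norm (ee (\<tau> - z)) \<le> exp (- 2 * pi * (1 - a))"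
      using mono[of "1 - a"] a by (simp add: norm_ee Imz algebra_simps)
    have fac: "theta_prod z \<tau> = (1 - ee z) * (qp (ee z * ee \<tau>) (ee \<tau>) * qp (ee (\<tau> - z)) (ee \<tau>))"
      unfolding theta_prod_def using qp_step[OF q, of "ee z"] by simp
    have up: "norm (qp v (ee \<tau>)) \<le> K" if "norm v \<le> 1" for v
    proof -
      have "norm (qp v (ee \<tau>)) \<le> exp (norm v / (1 - norm (ee \<tau>)))" by (rule qp_upper_bound[OF q])
      also have "norm v / (1 - norm (ee \<tau>)) \<le> 1 / (1 - \<rho>)" using that q\<rho> \<rho> by (intro frac_le) auto
      finally show ?thesis by (simp add: K_def)
    qed
    have lo: "norm (1 / qp v (ee \<tau>)) \<le> L" if "norm v \<le> r" for v
    proof -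
      have "norm (1 / qp v (ee \<tau>)) \<le> exp (r / (1 - r) / (1 - norm (ee \<tau>)))" by (rule qp_lower_bound[OF q that r(2)])
      also have "r / (1 - r) / (1 - norm (ee \<tau>)) \<le> r / (1 - r) / (1 - \<rho>)" using r q\<rho> \<rho> by (intro frac_le) auto
      finally show ?thesis by (simp add: L_def)
    qed
    have "norm (1 - ee z) \<le> 2"
    proof -
      have "norm (ee z) \<le> 1" using a y by (simp add: norm_ee Imz)
      then show ?thesis using norm_triangle_ineq4[of 1 "ee z"] by simp
    qed
    then show "norm (theta_prod (of_real a * \<tau> + of_real b) \<tau>) \<le> 2 * (K * K)"
      unfolding z_def[symmetric] fac norm_mult using w1 w2 \<rho> r by (intro mult_mono up) (auto simp: K_def r_def intro: order_trans)
    have \<delta>le: "\<delta> \<le> norm (1 - ee z)"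
    proof (cases "a = 0")
      case True
      then show ?thesis by (simp add: \<delta>_def z_def)
    next
      case False
      have "norm (ee z) \<le> exp (- 2 * pi * a)" using mono[of a] a by (simp add: norm_ee Imz)
      then show ?thesis using False norm_triangle_ineq2[of 1 "ee z"] by (simp add: \<delta>_def)
    qed
    have "norm (1 / theta_prod z \<tau>) = norm (1 / (1 - ee z)) * (norm (1 / qp (ee z * ee \<tau>) (ee \<tau>)) * norm (1 / qp (ee (\<tau> - z)) (ee \<tau>)))"
      unfolding fac by (simp add: norm_mult norm_divide)
    also have "\<dots> \<le> 1 / \<delta> * (L * L)"
      using \<delta> \<delta>le w1 w2 r by (intro mult_mono lo) (auto simp: norm_divide frac_le r_def L_def)
    finally show "norm (1 / theta_prod (of_real a * \<tau> + of_real b) \<tau>) \<le> 1 / \<delta> * (L * L)" by (simp add: z_def)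
  qed
  have e: "norm (exp (of_real pi * \<i> * of_real B * \<tau>)) = exp (- pi * B * Im \<tau>)" for \<tau>
    by (simp add: norm_exp_eq_Re)
  show "moderate (siegel a b)"
  proof (rule moderateI[of 1 _ "2 * (K * K)" "- pi * B"])
    fix \<tau> assume "1 \<le> Im \<tau>"
    then show "norm (siegel a b \<tau>) \<le> 2 * (K * K) * exp (- pi * B * Im \<tau>)"
      unfolding siegel_def B_def[symmetric] norm_mult e using main(1)[of \<tau>] by simp
  qed
  show "moderate (\<lambda>\<tau>. 1 / siegel a b \<tau>)"
  proof (rule moderateI[of 1 _ "1 / \<delta> * (L * L)" "pi * B"])
    fix \<tau> assume y: "1 \<le> Im \<tau>"
    have "norm (1 / siegel a b \<tau>) = exp (pi * B * Im \<tau>) * norm (1 / theta_prod (of_real a * \<tau> + of_real b) \<tau>)"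
      unfolding siegel_def B_def[symmetric] norm_divide norm_mult e by (simp add: exp_minus field_simps)
    also have "\<dots> \<le> exp (pi * B * Im \<tau>) * (1 / \<delta> * (L * L))" by (intro mult_left_mono main(2) y) auto
    finally show "norm (1 / siegel a b \<tau>) \<le> 1 / \<delta> * (L * L) * exp (pi * B * Im \<tau>)" by (simp add: mult.commute)
  qed
qed

section \<open>Siegel functions have finite orbit\<close>

text \<open>The exponent \<open>12 N\<^sup>2\<close> kills all roots of unity in the transformation
  formulas for parameters in \<open>(1/N) \<int>\<close>.\<close>

definition siegel_pow :: "nat \<Rightarrow> int \<Rightarrow> int \<Rightarrow> complex \<Rightarrow> complex" where
  "siegel_pow N i j \<tau> = siegel (of_int i / of_nat N) (of_int j / of_nat N) \<tau> ^ (12 * N ^ 2)"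

text \<open>The Siegel function with parameters \<open>i / N\<close>, \<open>j / N\<close> vanishes identically
  exactly if both are integers.\<close>

definition nonzero_class :: "nat \<Rightarrow> int \<Rightarrow> int \<Rightarrow> bool" where
  "nonzero_class N i j \<longleftrightarrow> \<not> (int N dvd i \<and> int N dvd j)"

lemma frac_Ints_iff:
  assumes "N > 0"
  shows "(of_int i / of_nat N :: real) \<in> \<int> \<longleftrightarrow> int N dvd i"
proof
  assume "(of_int i / of_nat N :: real) \<in> \<int>"
  then obtain k :: int where "of_int i / of_nat N = (of_int k :: real)" by (auto elim: Ints_cases)
  then have "(of_int i :: real) = of_int (int N * k)" using assms by (simp add: field_simps)
  then have "i = int N * k" by (simp only: of_int_eq_iff)
  then show "int N dvd i" by simp
next
  assume "int N dvd i"
  then obtain k where "i = int N * k" by (elim dvdE)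
  then have "(of_int i / of_nat N :: real) = of_int k" using assms by simp
  then show "(of_int i / of_nat N :: real) \<in> \<int>" by simp
qed

lemma nonzero_class_iff:
  "N > 0 \<Longrightarrow> nonzero_class N i j \<longleftrightarrow> \<not> ((of_int i / of_nat N :: real) \<in> \<int> \<and> (of_int j / of_nat N :: real) \<in> \<int>)"
  by (simp add: nonzero_class_def frac_Ints_iff)

lemma exp_pi_power_eq_1:
  assumes "of_nat M * r / 2 = of_int k"
  shows "exp (of_real pi * \<i> * of_real r) ^ M = 1"
proof -
  have "exp (of_real pi * \<i> * of_real r) = ee (of_real (r / 2))" by (simp add: ee_def mult_ac)
  then have "exp (of_real pi * \<i> * of_real r) ^ M = ee (of_real (of_nat M * r / 2))"
    by (simp add: ee_power)
  also have "\<dots> = 1" unfolding assms by (simp only: of_real_of_int_eq ee_of_int)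
  finally show ?thesis .
qed

lemma siegel_pow_add_right: "N > 0 \<Longrightarrow> siegel_pow N i (j + int N) \<tau> = siegel_pow N i j \<tau>"
  using siegel_add_int[of "of_int i / of_nat N" "of_int j / of_nat N" \<tau>]
  by (simp add: siegel_pow_def add_divide_distrib)

lemma siegel_pow_add_left:
  assumes N: "N > 0" and \<tau>: "Im \<tau> > 0"
  shows "siegel_pow N (i + int N) j \<tau> = siegel_pow N i j \<tau>"
proof -
  have "siegel (of_int (i + int N) / of_nat N) (of_int j / of_nat N) \<tau>
     = - ee (- of_real (of_int j / of_nat N)) * siegel (of_int i / of_nat N) (of_int j / of_nat N) \<tau>"
    using siegel_add_1[OF \<tau>, of "of_int i / of_nat N" "of_int j / of_nat N"] N by (simp add: add_divide_distrib)
  moreover have "(- ee (- of_real (of_int j / of_nat N))) ^ (12 * N ^ 2) = 1"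
  proof -
    have "(- ee (- of_real (of_int j / of_nat N))) ^ (12 * N ^ 2) = ee (- of_real (of_int j / of_nat N)) ^ (12 * N ^ 2)"
      by simp
    also have "\<dots> = ee (of_nat (12 * N ^ 2) * (- of_real (of_int j / of_nat N)))" by (rule ee_power)
    also have "of_nat (12 * N ^ 2) * (- of_real (of_int j / of_nat N)) = (of_int (- 12 * int N * j) :: complex)"
      using N by (simp add: power2_eq_square)
    finally show ?thesis by (simp only: ee_of_int)
  qed
  ultimately show ?thesis unfolding siegel_pow_def by (simp add: power_mult_distrib)
qed

lemma siegel_pow_translate:
  assumes N: "N > 0"
  shows "siegel_pow N i j (\<tau> + 1) = siegel_pow N i (j + i) \<tau>"
proof -
  define a :: real where "a = of_int i / of_nat N"
  define b :: real where "b = of_int j / of_nat N"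
  have ab: "of_int (j + i) / of_nat N = a + b" by (simp add: a_def b_def add_divide_distrib)
  have "exp (of_real pi * \<i> * of_real (a ^ 2 - a + 1 / 6)) ^ (12 * N ^ 2) = 1"
    by (rule exp_pi_power_eq_1[of _ _ "6 * i ^ 2 - 6 * i * int N + int N ^ 2"])
       (use N in \<open>simp add: a_def field_simps power2_eq_square\<close>)
  then show ?thesis
    unfolding siegel_pow_def ab a_def[symmetric] b_def[symmetric] siegel_translate power_mult_distrib by simp
qed

lemma siegel_pow_translate_int:
  assumes N: "N > 0"
  shows "siegel_pow N i j (\<tau> + of_int k) = siegel_pow N i (j + k * i) \<tau>"
proof (induction k arbitrary: j rule: int_induct[where k = 0])
  case (step1 k)
  have "siegel_pow N i j (\<tau> + of_int (k + 1)) = siegel_pow N i j ((\<tau> + of_int k) + 1)" by (simp add: add.assoc)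
  also have "\<dots> = siegel_pow N i (j + i + k * i) \<tau>" unfolding siegel_pow_translate[OF N] by (rule step1)
  finally show ?case by (simp add: algebra_simps)
next
  case (step2 k)
  have "siegel_pow N i (j - i + i) (\<tau> + of_int (k - 1)) = siegel_pow N i (j - i) ((\<tau> + of_int (k - 1)) + 1)"
    unfolding siegel_pow_translate[OF N] ..
  also have "\<dots> = siegel_pow N i (j - i) (\<tau> + of_int k)" by simp
  also have "\<dots> = siegel_pow N i (j - i + k * i) \<tau>" by (rule step2)
  finally show ?case by (simp add: algebra_simps)
qed simp

lemma siegel_pow_inversion:
  assumes N: "N > 0" and \<tau>: "Im \<tau> > 0" and ij: "nonzero_class N i j"
  shows "siegel_pow N i j (- 1 / \<tau>) = siegel_pow N j (- i) \<tau>"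
proof -
  define a :: real where "a = of_int i / of_nat N"
  define b :: real where "b = of_int j / of_nat N"
  have ab: "of_int (- i) / of_nat N = - a" by (simp add: a_def)
  obtain D where D: "D ^ 12 = 1" "\<And>a b. \<not> (a \<in> \<int> \<and> b \<in> \<int>) \<Longrightarrow>
     siegel a b (- 1 / \<tau>) = D * exp (of_real pi * \<i> * of_real (a + b - 2 * a * b)) * siegel b (- a) \<tau>"
    using siegel_inversion[OF \<tau>] by blast
  have s: "siegel a b (- 1 / \<tau>) = D * exp (of_real pi * \<i> * of_real (a + b - 2 * a * b)) * siegel b (- a) \<tau>"
    by (rule D(2)) (use ij N in \<open>simp add: nonzero_class_iff a_def b_def\<close>)
  have e: "exp (of_real pi * \<i> * of_real (a + b - 2 * a * b)) ^ (12 * N ^ 2) = 1"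
    by (rule exp_pi_power_eq_1[of _ _ "6 * int N * (i + j) - 12 * i * j"])
       (use N in \<open>simp add: a_def b_def field_simps power2_eq_square\<close>)
  have d: "D ^ (12 * N ^ 2) = 1" by (simp add: power_mult D(1))
  show ?thesis
    unfolding siegel_pow_def ab a_def[symmetric] b_def[symmetric] s power_mult_distrib e d by simp
qed

text \<open>Euclid's algorithm on the first column of the matrix: subtract a multiple of the
  second row, swap the rows, and use the rules for \<open>\<tau> + k\<close> and \<open>- 1 / \<tau>\<close>.\<close>

lemma siegel_pow_moebius:
  fixes a b c d :: int
  assumes N: "N > 0" and "a * d - b * c = 1" and "nonzero_class N i j"
  shows "\<exists>i' j'. nonzero_class N i' j' \<and>
    (\<forall>\<tau>\<in>uhp. siegel_pow N i j ((of_int a * \<tau> + of_int b) / (of_int c * \<tau> + of_int d)) = siegel_pow N i' j' \<tau>)"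
  using assms(2,3)
proof (induction "nat \<bar>c\<bar>" arbitrary: a b c d i j rule: less_induct)
  case less
  show ?case
  proof (cases "c = 0")
    case True
    then have "a * d = 1" using less by simp
    then have ad: "(a = 1 \<and> d = 1) \<or> (a = - 1 \<and> d = - 1)" by (rule pos_zmult_eq_1_iff_lemma[THEN disjE]) (use \<open>a * d = 1\<close> in auto)
    have e: "(of_int a * \<tau> + of_int b) / (of_int c * \<tau> + of_int d) = \<tau> + of_int (a * b)" for \<tau> :: complex
      using ad True by auto
    have "nonzero_class N i (j + a * b * i)"
      using less(3) unfolding nonzero_class_def by (metis dvd_add_left_iff dvd_mult)
    then show ?thesis unfolding e siegel_pow_translate_int[OF N] by blast
  next
    case False
    define k where "k = a div c"
    define a' b' where "a' = a - k * c" and "b' = b - k * d"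
    have mod: "a' = a mod c" by (simp add: a'_def k_def minus_div_mult_eq_mod)
    have "\<bar>a'\<bar> < \<bar>c\<bar>" unfolding mod using False by (simp add: abs_mod_less)
    then have small: "nat \<bar>- a'\<bar> < nat \<bar>c\<bar>" by simp
    have det: "c * (- b') - d * (- a') = 1"
      using less(2) by (simp add: a'_def b'_def algebra_simps)
    have nt1: "nonzero_class N i (j + k * i)"
      using less(3) unfolding nonzero_class_def by (metis dvd_add_left_iff dvd_mult)
    have nt2: "nonzero_class N (j + k * i) (- i)"
      using nt1 unfolding nonzero_class_def by auto
    obtain i' j' where ij': "nonzero_class N i' j'" "\<And>\<tau>. \<tau> \<in> uhp \<Longrightarrow>
        siegel_pow N (j + k * i) (- i) ((of_int c * \<tau> + of_int d) / (of_int (- a') * \<tau> + of_int (- b'))) = siegel_pow N i' j' \<tau>"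
      using less(1)[OF small det nt2] by blast
    have "siegel_pow N i j ((of_int a * \<tau> + of_int b) / (of_int c * \<tau> + of_int d)) = siegel_pow N i' j' \<tau>" if \<tau>: "\<tau> \<in> uhp" for \<tau>
    proof -
      define A :: "int ^ 2 ^ 2" where "A = vector [vector [c, d], vector [- a', - b']]"
      have A: "A \<in> carrier SL2Z" unfolding SL2Z_iff using det by (simp add: A_def)
      define \<sigma> where "\<sigma> = moebius A \<tau>"
      have \<sigma>: "\<sigma> = (of_int c * \<tau> + of_int d) / (of_int (- a') * \<tau> + of_int (- b'))"
        by (simp add: \<sigma>_def moebius_def A_def)
      have Im\<sigma>: "Im \<sigma> > 0" unfolding \<sigma>_def using \<tau> by (intro Im_moebius A) simp
      then have \<sigma>0: "\<sigma> \<noteq> 0" by auto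
      then have cd: "of_int c * \<tau> + of_int d \<noteq> (0::complex)" unfolding \<sigma> by auto
      have "- 1 / \<sigma> = (of_int a' * \<tau> + of_int b') / (of_int c * \<tau> + of_int d)"
      proof -
        have "of_int (- a') * \<tau> + of_int (- b') = - (of_int a' * \<tau> + of_int b')" by simp
        then show ?thesis unfolding \<sigma> by simp
      qed
      then have e: "(of_int a * \<tau> + of_int b) / (of_int c * \<tau> + of_int d) = - 1 / \<sigma> + of_int k"
        using cd by (simp add: a'_def b'_def field_simps)
      show ?thesis
        unfolding e siegel_pow_translate_int[OF N] siegel_pow_inversion[OF N Im\<sigma> nt1] unfolding \<sigma> by (rule ij'(2)[OF \<tau>])
    qed
    then show ?thesis using ij'(1) by blast
  qed
qed

lemma siegel_pow_reduce:
  assumes N: "N > 0" and \<tau>: "Im \<tau> > 0"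
  shows "siegel_pow N (i mod int N) (j mod int N) \<tau> = siegel_pow N i j \<tau>"
proof -
  have 1: "siegel_pow N (i + int N * k) j \<tau> = siegel_pow N i j \<tau>" for i j k
  proof (induction k rule: int_induct[where k = 0])
    case (step1 k)
    then show ?case using siegel_pow_add_left[OF N \<tau>, of "i + int N * k" j] by (simp add: algebra_simps)
  next
    case (step2 k)
    then show ?case using siegel_pow_add_left[OF N \<tau>, of "i + int N * (k - 1)" j] by (simp add: algebra_simps)
  qed simp
  have 2: "siegel_pow N i (j + int N * k) \<tau> = siegel_pow N i j \<tau>" for i j k
  proof (induction k rule: int_induct[where k = 0])
    case (step1 k)
    then show ?case using siegel_pow_add_right[OF N, of i "j + int N * k" \<tau>] by (simp add: algebra_simps)
  next
    case (step2 k)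
    then show ?case using siegel_pow_add_right[OF N, of i "j + int N * (k - 1)" \<tau>] by (simp add: algebra_simps)
  qed simp
  have "siegel_pow N i j \<tau> = siegel_pow N (i mod int N + int N * (i div int N)) (j mod int N + int N * (j div int N)) \<tau>" by simp
  then show ?thesis unfolding 1 2 ..
qed

text \<open>Units of the ring of functions with finite orbit. Quotients can be formed with them,
  and they have no zeros, so that roots can be taken.\<close>

definition orbit_unit :: "(complex \<Rightarrow> complex) \<Rightarrow> bool" where
  "orbit_unit f \<longleftrightarrow> finite_orbit f \<and> finite_orbit (\<lambda>\<tau>. 1 / f \<tau>) \<and> (\<forall>\<tau>\<in>uhp. f \<tau> \<noteq> 0)"

lemma orbit_unit_finite_orbit: "orbit_unit f \<Longrightarrow> finite_orbit f" and orbit_unit_inverse: "orbit_unit f \<Longrightarrow> orbit_unit (\<lambda>\<tau>. 1 / f \<tau>)"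
  by (auto simp: orbit_unit_def)

lemma orbit_unit_mult: "orbit_unit f \<Longrightarrow> orbit_unit g \<Longrightarrow> orbit_unit (\<lambda>\<tau>. f \<tau> * g \<tau>)"
  using finite_orbit_mult[of f g] finite_orbit_mult[of "\<lambda>\<tau>. 1 / f \<tau>" "\<lambda>\<tau>. 1 / g \<tau>"]
  by (simp add: orbit_unit_def)

lemma orbit_unit_divide: "orbit_unit f \<Longrightarrow> orbit_unit g \<Longrightarrow> orbit_unit (\<lambda>\<tau>. f \<tau> / g \<tau>)"
  using orbit_unit_mult[of f "\<lambda>\<tau>. 1 / g \<tau>"] orbit_unit_inverse[of g] by simp

lemma orbit_unit_const: "c \<noteq> 0 \<Longrightarrow> orbit_unit (\<lambda>_. c)"
  by (simp add: orbit_unit_def finite_orbit_const)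

lemma orbit_unit_prod: "(\<And>i. i \<in> I \<Longrightarrow> orbit_unit (f i)) \<Longrightarrow> orbit_unit (\<lambda>\<tau>. \<Prod>i\<in>I. f i \<tau>)"
  by (induction I rule: infinite_finite_induct) (auto intro: orbit_unit_mult orbit_unit_const)

lemma orbit_unit_cong:
  assumes "orbit_unit f" "\<And>\<tau>. \<tau> \<in> uhp \<Longrightarrow> g \<tau> = f \<tau>"
  shows "orbit_unit g"
  using assms finite_orbit_cong[of f g] finite_orbit_cong[of "\<lambda>\<tau>. 1 / f \<tau>" "\<lambda>\<tau>. 1 / g \<tau>"]
  by (simp add: orbit_unit_def)

lemma orbit_unit_root:
  assumes k: "k > 0" and fk: "orbit_unit (\<lambda>\<tau>. f \<tau> ^ k)" and f: "f holomorphic_on uhp"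
  shows "orbit_unit f"
proof -
  have nz: "f \<tau> \<noteq> 0" if "\<tau> \<in> uhp" for \<tau> using fk k that by (auto simp: orbit_unit_def power_0_left)
  have "finite_orbit f" by (rule finite_orbit_root[OF k _ f nz]) (use fk in \<open>auto simp: orbit_unit_def\<close>)
  moreover have "finite_orbit (\<lambda>\<tau>. 1 / f \<tau>)"
    by (rule finite_orbit_root[OF k]) (use fk nz in \<open>auto simp: orbit_unit_def power_divide intro!: holomorphic_intros f\<close>)
  ultimately show ?thesis using nz by (simp add: orbit_unit_def)
qed

lemma orbit_unit_affine:
  fixes a b d :: int
  assumes f: "orbit_unit f" and ad: "a > 0" "d > 0"
  shows "orbit_unit (\<lambda>\<tau>. f ((of_int a * \<tau> + of_int b) / of_int d))"
  using assms finite_orbit_affine[of f a d b] finite_orbit_affine[of "\<lambda>\<tau>. 1 / f \<tau>" a d b]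
  by (simp add: orbit_unit_def)

lemma orbit_unit_scale: "orbit_unit f \<Longrightarrow> n > 0 \<Longrightarrow> orbit_unit (\<lambda>\<tau>. f (of_nat n * \<tau>))"
  using orbit_unit_affine[of f "int n" 1 0] by simp

text \<open>The orbit of a power \<open>siegel_pow\<close> lies in the finite set of those with residues
  modulo \<open>N\<close>; take roots.\<close>

theorem siegel_orbit_unit:
  assumes N: "N > 0" and ij: "nonzero_class N i j"
  shows "orbit_unit (siegel (of_int i / of_nat N) (of_int j / of_nat N))"
proof -
  define F where "F = (\<lambda>(i, j). siegel_pow N i j) ` ({0..<int N} \<times> {0..<int N})"
  define G where "G = (\<lambda>(i, j) \<tau>. 1 / siegel_pow N i j \<tau>) ` ({0..<int N} \<times> {0..<int N})"
  have orbit: "\<exists>i' j'. i' \<in> {0..<int N} \<and> j' \<in> {0..<int N} \<and> moderate (siegel_pow N i' j') \<and> moderate (\<lambda>\<tau>. 1 / siegel_pow N i' j' \<tau>)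
      \<and> (\<forall>\<tau>\<in>uhp. siegel_pow N i j (moebius A \<tau>) = siegel_pow N i' j' \<tau>)" if A: "A \<in> carrier SL2Z" for A
  proof -
    have "A $ 1 $ 1 * A $ 2 $ 2 - A $ 1 $ 2 * A $ 2 $ 1 = 1" using A by (simp add: SL2Z_iff)
    from siegel_pow_moebius[OF N this ij] obtain i1 j1 where 1: "nonzero_class N i1 j1"
      "\<And>\<tau>. \<tau> \<in> uhp \<Longrightarrow> siegel_pow N i j (moebius A \<tau>) = siegel_pow N i1 j1 \<tau>" unfolding moebius_def by blast
    define i' j' where "i' = i1 mod int N" and "j' = j1 mod int N"
    have r: "i' \<in> {0..<int N}" "j' \<in> {0..<int N}" using N by (auto simp: i'_def j'_def)
    have nt: "nonzero_class N i' j'" using 1(1) by (simp add: nonzero_class_def i'_def j'_def dvd_mod_iff)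
    have range: "0 \<le> (of_int i' / of_nat N :: real)" "(of_int i' / of_nat N :: real) < 1"
      using r N by auto
    note m = siegel_moderate[OF range, of "of_int j' / of_nat N"]
    have pow: "moderate (\<lambda>\<tau>. f \<tau> ^ k)" if "moderate f" for f k
      by (induction k) (auto intro: moderate_mult moderate_const that)
    have "moderate (siegel_pow N i' j')"
      unfolding siegel_pow_def[abs_def] by (intro pow m(1)) (use nt N in \<open>simp add: nonzero_class_iff\<close>)
    moreover have "moderate (\<lambda>\<tau>. (1 / siegel (of_int i' / of_nat N) (of_int j' / of_nat N) \<tau>) ^ (12 * N ^ 2))"
      by (intro pow m(2)) (use nt N in \<open>simp add: nonzero_class_iff\<close>)
    then have "moderate (\<lambda>\<tau>. 1 / siegel_pow N i' j' \<tau>)" by (simp add: siegel_pow_def power_divide)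
    moreover have "siegel_pow N i j (moebius A \<tau>) = siegel_pow N i' j' \<tau>" if "\<tau> \<in> uhp" for \<tau>
      unfolding 1(2)[OF that] i'_def j'_def using that by (intro siegel_pow_reduce[OF N, symmetric]) simp
    ultimately show ?thesis using r by blast
  qed
  have hol: "siegel_pow N i j holomorphic_on uhp"
    unfolding siegel_pow_def[abs_def] by (intro holomorphic_intros siegel_holomorphic)
  have nz: "siegel_pow N i j \<tau> \<noteq> 0" if "\<tau> \<in> uhp" for \<tau>
    unfolding siegel_pow_def using siegel_nonzero[of \<tau>] that ij N by (simp add: nonzero_class_iff)
  have "finite_orbit (siegel_pow N i j)"
  proof (rule finite_orbitI[OF hol])
    show "finite F" by (simp add: F_def)
    fix A assume "A \<in> carrier SL2Z"
    from orbit[OF this] show "\<exists>h\<in>F. moderate h \<and> (\<forall>\<tau>\<in>uhp. siegel_pow N i j (moebius A \<tau>) = h \<tau>)"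
      unfolding F_def by force
  qed
  moreover have "finite_orbit (\<lambda>\<tau>. 1 / siegel_pow N i j \<tau>)"
  proof (rule finite_orbitI)
    show "(\<lambda>\<tau>. 1 / siegel_pow N i j \<tau>) holomorphic_on uhp" by (intro holomorphic_intros hol nz)
    show "finite G" by (simp add: G_def)
    fix A assume "A \<in> carrier SL2Z"
    from orbit[OF this] show "\<exists>h\<in>G. moderate h \<and> (\<forall>\<tau>\<in>uhp. 1 / siegel_pow N i j (moebius A \<tau>) = h \<tau>)"
      unfolding G_def by force
  qed
  ultimately have "orbit_unit (siegel_pow N i j)" using nz by (simp add: orbit_unit_def)
  then show ?thesis
    unfolding siegel_pow_def[abs_def] by (rule orbit_unit_root[rotated]) (use N in \<open>auto intro: siegel_holomorphic\<close>)
qed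

section \<open>Eta quotients, theta series and Weber functions\<close>

text \<open>This is \<open>\<eta>(N\<tau>) / \<eta>(\<tau>)\<close>.\<close>

definition eta_quot :: "nat \<Rightarrow> complex \<Rightarrow> complex" where
  "eta_quot N \<tau> = exp (of_real pi * \<i> * of_real ((of_nat N - 1) / 12) * \<tau>) * qp (ee (of_nat N * \<tau>)) (ee (of_nat N * \<tau>)) / qp (ee \<tau>) (ee \<tau>)"

lemma sum_bernoulli_2:
  assumes N: "N > 0"
  shows "(\<Sum>j\<in>{1..<N}. ((of_nat j / of_nat N) ^ 2 - of_nat j / of_nat N + 1 / 6) * of_nat N) = - (of_nat N - 1) / (6 :: real)"
proof -
  have closed: "(\<Sum>j\<in>{1..<Suc n}. ((of_nat j / x) ^ 2 - of_nat j / x + 1 / 6) * x)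
     = of_nat n * (of_nat n + 1) * (2 * of_nat n + 1) / (6 * x) - of_nat n * (of_nat n + 1) / 2 + of_nat n * x / 6"
    if x: "x \<noteq> 0" for n and x :: real
  proof (induction n)
    case (Suc n)
    define S where "S m = (\<Sum>j\<in>{1..<Suc m}. ((of_nat j / x) ^ 2 - of_nat j / x + 1 / 6) * x)" for m
    have "S (Suc n) = S n + ((of_nat (Suc n) / x) ^ 2 - of_nat (Suc n) / x + 1 / 6) * x"
      unfolding S_def by (subst sum.atLeastLessThan_Suc) simp_all
    also have "S n = of_nat n * (of_nat n + 1) * (2 * of_nat n + 1) / (6 * x) - of_nat n * (of_nat n + 1) / 2 + of_nat n * x / 6"
      using Suc by (simp add: S_def)
    also have "\<dots> + ((of_nat (Suc n) / x) ^ 2 - of_nat (Suc n) / x + 1 / 6) * x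
      = of_nat (Suc n) * (of_nat (Suc n) + 1) * (2 * of_nat (Suc n) + 1) / (6 * x) - of_nat (Suc n) * (of_nat (Suc n) + 1) / 2 + of_nat (Suc n) * x / 6"
      using x by (simp add: field_simps power2_eq_square)
    finally show ?case unfolding S_def .
  qed simp
  have "Suc (N - 1) = N" and N1: "of_nat (N - 1) = (of_nat N - 1 :: real)" using N by (simp_all add: of_nat_diff)
  have "(\<Sum>j\<in>{1..<N}. ((of_nat j / of_nat N) ^ 2 - of_nat j / of_nat N + 1 / 6) * of_nat N)
    = (of_nat N - 1) * (of_nat N - 1 + 1) * (2 * (of_nat N - 1) + 1) / (6 * of_nat N) - (of_nat N - 1) * (of_nat N - 1 + 1) / 2 + (of_nat N - 1) * of_nat N / (6 :: real)"
    using closed[of "of_nat N" "N - 1"] N unfolding N1 \<open>Suc (N - 1) = N\<close> by simp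
  also have "\<dots> = - (of_nat N - 1) / 6" using N by (simp add: field_simps)
  finally show ?thesis .
qed

text \<open>Dissecting \<open>(q;q)\<^sub>\<infinity>\<close> modulo \<open>N\<close>, the factor
  \<open>(q\<^sup>N;q\<^sup>N)\<^sub>\<infinity>\<close> cancels and the residue classes \<open>j\<close> and
  \<open>N - j\<close> combine to a Siegel function at \<open>N\<tau>\<close>, each pair twice in the square. The
  powers of \<open>q\<close> match by \<open>sum_bernoulli_2\<close>.\<close>

lemma eta_quot_orbit_unit:
  assumes N: "N > 0"
  shows "orbit_unit (eta_quot N)"
proof -
  have sie: "orbit_unit (siegel (of_nat j / of_nat N) 0)" if "j \<in> {1..<N}" for j
  proof -
    have "\<not> int N dvd int j" using that nat_dvd_not_less[of j N] by (simp add: int_dvd_int_iff)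
    then show ?thesis using siegel_orbit_unit[of N "int j" 0] N by (simp add: nonzero_class_def)
  qed
  have prod: "orbit_unit (\<lambda>\<tau>. \<Prod>j\<in>{1..<N}. siegel (of_nat j / of_nat N) 0 (of_nat N * \<tau>))"
    by (intro orbit_unit_prod orbit_unit_scale[OF sie N])
  have eq: "(1 / eta_quot N \<tau>) ^ 2 = (\<Prod>j\<in>{1..<N}. siegel (of_nat j / of_nat N) 0 (of_nat N * \<tau>))" if \<tau>: "\<tau> \<in> uhp" for \<tau>
  proof -
    define q where "q = ee \<tau>"
    define Q where "Q = ee (of_nat N * \<tau>)"
    have q: "norm q < 1" unfolding q_def using \<tau> by (intro norm_ee_less_1) simp
    have Q: "norm Q < 1" unfolding Q_def using \<tau> N by (intro norm_ee_less_1) simp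
    have qQ: "q ^ N = Q" by (simp add: q_def Q_def ee_power)
    have nz: "qp q q \<noteq> 0" "qp Q Q \<noteq> 0" using qp_nonzero[OF q q] qp_nonzero[OF Q Q] by auto
    define R where "R = (\<Prod>j\<in>{1..<N}. qp (q ^ j) Q)"
    have dis: "qp q q = R * qp Q Q"
    proof -
      have "qp q q = (\<Prod>j<N. qp (q ^ Suc j) Q)" using qp_dissect[OF q N, of q] by (simp add: qQ)
      also have "\<dots> = (\<Prod>j\<in>{1..<Suc N}. qp (q ^ j) Q)"
        by (rule prod.reindex_bij_witness[of _ "\<lambda>j. j - 1" Suc]) auto
      also have "\<dots> = R * qp Q Q" using N by (simp add: R_def qQ)
      finally show ?thesis .
    qed
    have reflect: "(\<Prod>j\<in>{1..<N}. qp (q ^ (N - j)) Q) = R"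
      unfolding R_def by (rule prod.reindex_bij_witness[of _ "\<lambda>j. N - j" "\<lambda>j. N - j"]) auto
    have th: "theta_prod (of_real (of_nat j / of_nat N) * (of_nat N * \<tau>) + of_real 0) (of_nat N * \<tau>) = qp (q ^ j) Q * qp (q ^ (N - j)) Q"
      if "j \<in> {1..<N}" for j
    proof -
      have 1: "of_real (of_nat j / of_nat N) * (of_nat N * \<tau>) + of_real 0 = of_nat j * \<tau>" using N by simp
      have 2: "of_nat N * \<tau> - of_nat j * \<tau> = of_nat (N - j) * \<tau>" using that by (simp add: of_nat_diff algebra_simps)
      show ?thesis unfolding 1 theta_prod_def 2 q_def Q_def ee_power ..
    qed
    have "(\<Prod>j\<in>{1..<N}. siegel (of_nat j / of_nat N) 0 (of_nat N * \<tau>))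
      = (\<Prod>j\<in>{1..<N}. exp (of_real pi * \<i> * of_real ((of_nat j / of_nat N) ^ 2 - of_nat j / of_nat N + 1 / 6) * (of_nat N * \<tau>))
           * (qp (q ^ j) Q * qp (q ^ (N - j)) Q))"
      unfolding siegel_def by (intro prod.cong refl) (simp only: th)
    also have "\<dots> = exp (\<Sum>j\<in>{1..<N}. of_real pi * \<i> * of_real ((of_nat j / of_nat N) ^ 2 - of_nat j / of_nat N + 1 / 6) * (of_nat N * \<tau>)) * (R * R)"
      unfolding prod.distrib reflect R_def[symmetric] by (simp add: exp_sum)
    also have "(\<Sum>j\<in>{1..<N}. of_real pi * \<i> * of_real ((of_nat j / of_nat N) ^ 2 - of_nat j / of_nat N + 1 / 6) * (of_nat N * \<tau>))
      = of_real pi * \<i> * of_real (\<Sum>j\<in>{1..<N}. ((of_nat j / of_nat N) ^ 2 - of_nat j / of_nat N + 1 / 6) * of_nat N) * \<tau>"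
      unfolding of_real_sum sum_distrib_left sum_distrib_right by (intro sum.cong refl) (simp add: mult_ac)
    also have "\<dots> = - (2 * (of_real pi * \<i> * of_real ((of_nat N - 1) / 12) * \<tau>))"
      unfolding sum_bernoulli_2[OF N] by (simp add: field_simps)
    finally have A: "(\<Prod>j\<in>{1..<N}. siegel (of_nat j / of_nat N) 0 (of_nat N * \<tau>))
        = exp (- (2 * (of_real pi * \<i> * of_real ((of_nat N - 1) / 12) * \<tau>))) * (R * R)" .
    define X where "X = of_real pi * \<i> * of_real ((of_nat N - 1) / 12) * \<tau>"
    have "1 / eta_quot N \<tau> = exp (- X) * R"
      unfolding eta_quot_def q_def[symmetric] Q_def[symmetric] X_def[symmetric] dis using nz by (simp add: exp_minus field_simps)
    then have "(1 / eta_quot N \<tau>) ^ 2 = exp (- (2 * X)) * (R * R)"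
      by (simp add: power_mult_distrib power2_eq_square flip: exp_add)
    then show ?thesis unfolding A X_def .
  qed
  have hol: "(\<lambda>\<tau>. qp (ee \<tau>) (ee \<tau>)) holomorphic_on uhp" "(\<lambda>\<tau>. qp (ee (of_nat N * \<tau>)) (ee (of_nat N * \<tau>))) holomorphic_on uhp"
    using N by (auto intro!: qp_holomorphic holomorphic_intros norm_ee_less_1 simp: open_halfspace_Im_gt)
  have nz: "qp (ee (of_nat n * \<tau>)) (ee (of_nat n * \<tau>)) \<noteq> 0" if "\<tau> \<in> uhp" "n > 0" for \<tau> n
    using that by (intro qp_nonzero norm_ee_less_1) auto
  have "orbit_unit (\<lambda>\<tau>. 1 / eta_quot N \<tau>)"
  proof (rule orbit_unit_root[of 2])
    show "orbit_unit (\<lambda>\<tau>. (1 / eta_quot N \<tau>) ^ 2)" by (rule orbit_unit_cong[OF prod eq])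
    show "(\<lambda>\<tau>. 1 / eta_quot N \<tau>) holomorphic_on uhp"
      unfolding eta_quot_def using nz[of _ N] nz[of _ 1] N by (intro holomorphic_intros hol) auto
  qed simp
  from orbit_unit_inverse[OF this] show ?thesis by simp
qed

text \<open>The theta series
  \<open>\<Sum>\<^sub>n q\<^bsup>N (n + a)\<^sup>2 / 2\<^esup> e\<^bsup>2\<pi>\<i> n b\<^esup>\<close>
  divided by \<open>\<eta>(\<tau>)\<close>.\<close>

definition theta_quot :: "nat \<Rightarrow> real \<Rightarrow> real \<Rightarrow> complex \<Rightarrow> complex" where
  "theta_quot N a b \<tau> = exp (of_real pi * \<i> * of_real (of_nat N * a ^ 2 - 1 / 12) * \<tau>) *
     (\<Sum>\<^sub>\<infinity>n::int. exp (of_real pi * \<i> * (of_nat N * of_int (n ^ 2) * \<tau> + 2 * of_int n * (of_nat N * of_real a * \<tau> + of_real b))))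
       / qp (ee \<tau>) (ee \<tau>)"

text \<open>The Jacobi triple product.\<close>

lemma theta_quot_product:
  assumes N: "N > 0" and \<tau>: "Im \<tau> > 0"
  shows "theta_quot N a b \<tau> = eta_quot N \<tau> * siegel (a + 1 / 2) (b + 1 / 2) (of_nat N * \<tau>)"
proof -
  define P where "P = exp (of_real pi * \<i> * of_nat N * \<tau>)"
  define z where "z = ee (of_nat N * of_real a * \<tau> + of_real b)"
  define y where "y = of_real (a + 1 / 2) * (of_nat N * \<tau>) + of_real (b + 1 / 2)"
  have h: "ee (1 / 2) = - 1" by (simp add: ee_def)
  have PP: "P = ee (of_nat N * \<tau> / 2)" by (simp add: P_def ee_def mult_ac)
  have P2: "P ^ 2 = ee (of_nat N * \<tau>)" unfolding PP ee_power by simp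
  have P: "norm P < 1" "P \<noteq> 0" unfolding PP using \<tau> N by (auto intro: norm_ee_less_1)
  have y1: "- P * z = ee y"
  proof -
    have "y = (of_nat N * \<tau> / 2 + (of_nat N * of_real a * \<tau> + of_real b)) + 1 / 2" by (simp add: y_def algebra_simps)
    then show ?thesis unfolding PP z_def by (simp only: ee_add h) simp
  qed
  have y2: "- P / z = ee (of_nat N * \<tau> - y)"
  proof -
    have "of_nat N * \<tau> - y = (of_nat N * \<tau> / 2 + - (of_nat N * of_real a * \<tau> + of_real b)) + - (1 / 2)" by (simp add: y_def algebra_simps)
    then show ?thesis unfolding PP z_def by (simp only: ee_add ee_minus h) simp
  qed
  have summand: "P powi (n ^ 2) * z powi n = exp (of_real pi * \<i> * (of_nat N * of_int (n ^ 2) * \<tau> + 2 * of_int n * (of_nat N * of_real a * \<tau> + of_real b)))" for n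
    unfolding P_def z_def ee_def exp_power_int by (simp add: algebra_simps flip: exp_add)
  have "((\<lambda>n::int. P powi (n ^ 2) * z powi n) has_sum
            qp (P ^ 2) (P ^ 2) * qp (- P * z) (P ^ 2) * qp (- P / z) (P ^ 2)) UNIV"
    by (rule jacobi_triple_product[OF P]) (simp add: z_def)
  then have S: "(\<Sum>\<^sub>\<infinity>n::int. exp (of_real pi * \<i> * (of_nat N * of_int (n ^ 2) * \<tau> + 2 * of_int n * (of_nat N * of_real a * \<tau> + of_real b))))
     = qp (ee (of_nat N * \<tau>)) (ee (of_nat N * \<tau>)) * theta_prod y (of_nat N * \<tau>)"
    unfolding summand P2 y1 y2 by (simp add: infsumI theta_prod_def)
  have e: "exp (of_real pi * \<i> * of_real (of_nat N * a ^ 2 - 1 / 12) * \<tau>)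
     = exp (of_real pi * \<i> * of_real ((of_nat N - 1) / 12) * \<tau>) * exp (of_real pi * \<i> * of_real ((a + 1 / 2) ^ 2 - (a + 1 / 2) + 1 / 6) * (of_nat N * \<tau>))"
    unfolding exp_add[symmetric] by (rule arg_cong[of _ _ exp]) (simp add: field_simps power2_eq_square)
  show ?thesis unfolding theta_quot_def S e eta_quot_def siegel_def y_def by simp
qed

lemma theta_quot_finite_orbit:
  assumes N: "N > 0" and K: "K > 0" and "nonzero_class K i j"
    and a: "a + 1 / 2 = of_int i / of_nat K" and b: "b + 1 / 2 = of_int j / of_nat K"
  shows "finite_orbit (theta_quot N a b)"
proof -
  have "orbit_unit (\<lambda>\<tau>. eta_quot N \<tau> * siegel (a + 1 / 2) (b + 1 / 2) (of_nat N * \<tau>))"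
    unfolding a b by (intro orbit_unit_mult eta_quot_orbit_unit orbit_unit_scale[OF siegel_orbit_unit] assms)
  then have "orbit_unit (theta_quot N a b)" by (rule orbit_unit_cong) (use theta_quot_product[OF N] in auto)
  then show ?thesis by (rule orbit_unit_finite_orbit)
qed

text \<open>The three Weber functions, the last one divided by the square root of \<open>2\<close>.\<close>

definition weber0 :: "complex \<Rightarrow> complex" where
  "weber0 \<tau> = ee (- \<tau> / 48) * qp (- ee (\<tau> / 2)) (ee \<tau>)"
definition weber1 :: "complex \<Rightarrow> complex" where
  "weber1 \<tau> = ee (- \<tau> / 48) * qp (ee (\<tau> / 2)) (ee \<tau>)"
definition weber2 :: "complex \<Rightarrow> complex" where
  "weber2 \<tau> = ee (\<tau> / 24) * qp (- ee \<tau>) (ee \<tau>)"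

lemma weber_orbit_unit: "orbit_unit weber0" "orbit_unit weber1" "orbit_unit weber2"
proof -
  have s: "orbit_unit (siegel (1 / 2) (1 / 2))" "orbit_unit (siegel (1 / 2) 0)" "orbit_unit (siegel 0 (1 / 2))"
    using siegel_orbit_unit[of 2 1 1] siegel_orbit_unit[of 2 1 0] siegel_orbit_unit[of 2 0 1] by (simp_all add: nonzero_class_def)
  have e1: "ee (- (\<tau> / 48)) ^ 2 = exp (- (of_real pi * \<i> * \<tau> / 12))" "ee (\<tau> / 24) ^ 2 = exp (of_real pi * \<i> * \<tau> / 6)" for \<tau>
    unfolding ee_power by (simp_all add: ee_def mult_ac)
  show "orbit_unit weber0"
  proof (rule orbit_unit_root[of 2])
    show "orbit_unit (\<lambda>\<tau>. weber0 \<tau> ^ 2)"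
      by (rule orbit_unit_cong[OF s(1)]) (simp add: weber0_def siegel_half power_mult_distrib e1)
    show "weber0 holomorphic_on uhp" unfolding weber0_def[abs_def]
      by (auto intro!: qp_holomorphic holomorphic_intros norm_ee_less_1 simp: open_halfspace_Im_gt)
  qed simp
  show "orbit_unit weber1"
  proof (rule orbit_unit_root[of 2])
    show "orbit_unit (\<lambda>\<tau>. weber1 \<tau> ^ 2)"
      by (rule orbit_unit_cong[OF s(2)]) (simp add: weber1_def siegel_half power_mult_distrib e1)
    show "weber1 holomorphic_on uhp" unfolding weber1_def[abs_def]
      by (auto intro!: qp_holomorphic holomorphic_intros norm_ee_less_1 simp: open_halfspace_Im_gt)
  qed simp
  show "orbit_unit weber2"
  proof (rule orbit_unit_root[of 2])
    have "orbit_unit (\<lambda>\<tau>. siegel 0 (1 / 2) \<tau> * (1 / 2))" by (intro orbit_unit_mult s orbit_unit_const) simp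
    then show "orbit_unit (\<lambda>\<tau>. weber2 \<tau> ^ 2)"
      by (rule orbit_unit_cong) (simp add: weber2_def siegel_half power_mult_distrib e1)
    show "weber2 holomorphic_on uhp" unfolding weber2_def[abs_def]
      by (auto intro!: qp_holomorphic holomorphic_intros norm_ee_less_1 simp: open_halfspace_Im_gt)
  qed simp
qed

section \<open>The two Nahm sums\<close>

lemma ee_powi: "ee z powi n = ee (of_int n * z)"
  by (simp add: ee_def exp_power_int mult_ac)

lemma ee_half_eq:
  assumes "even (m - n)" shows "ee (of_int m / 2) = ee (of_int n / 2)"
proof -
  obtain k where "m = n + 2 * k" using assms by (metis dvdE diff_add_cancel add.commute)
  then have e: "of_int m / 2 = of_int n / 2 + (of_int k :: complex)" by (simp add: field_simps)
  show ?thesis unfolding e ee_add by simp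
qed

text \<open>Recognises a theta series: completing the square in the exponent yields \<open>a\<close>, the
  phase linear in \<open>n\<close> yields \<open>b\<close>, and what remains is the constant \<open>c\<close>.\<close>

lemma infsum_eq_theta_quot:
  assumes \<tau>: "Im \<tau> > 0"
    and f: "\<And>n::int. f n = ee (c + (of_nat N / 2 * (of_int n + of_real a) ^ 2 * \<tau> + of_int n * of_real b))"
  shows "infsum f UNIV = ee (c + \<tau> / 24) * qp (ee \<tau>) (ee \<tau>) * theta_quot N a b \<tau>"
proof -
  have nz: "qp (ee \<tau>) (ee \<tau>) \<noteq> 0" using \<tau> by (intro qp_nonzero norm_ee_less_1)
  have "f n = ee (c + \<tau> / 24) * exp (of_real pi * \<i> * of_real (of_nat N * a ^ 2 - 1 / 12) * \<tau>)
     * exp (of_real pi * \<i> * (of_nat N * of_int (n ^ 2) * \<tau> + 2 * of_int n * (of_nat N * of_real a * \<tau> + of_real b)))" for n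
    unfolding f ee_def exp_add[symmetric]
    by (rule arg_cong[of _ _ exp]) (simp add: field_simps power2_eq_square)
  then have "f = (\<lambda>n. ee (c + \<tau> / 24) * exp (of_real pi * \<i> * of_real (of_nat N * a ^ 2 - 1 / 12) * \<tau>)
     * exp (of_real pi * \<i> * (of_nat N * of_int (n ^ 2) * \<tau> + 2 * of_int n * (of_nat N * of_real a * \<tau> + of_real b))))"
    by (rule ext)
  then show ?thesis using nz by (simp add: theta_quot_def infsum_cmult_right')
qed

text \<open>The parameters of \<open>theta_quot_finite_orbit\<close> are \<open>a + 1/2 = i / K\<close> and
  \<open>b + 1/2 = j / K\<close>, with \<open>K = 2\<close> or \<open>K = 42\<close>.\<close>

lemma finite_orbit_thetas:
  "finite_orbit (theta_quot 2 0 0)" "finite_orbit (theta_quot 2 (1 / 2) 0)"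
  "finite_orbit (theta_quot 3 0 0)" "finite_orbit (theta_quot 3 0 (1 / 2))"
  "finite_orbit (theta_quot 21 (1 / 21) 0)" "finite_orbit (theta_quot 21 (13 / 21) 0)"
  "finite_orbit (theta_quot 21 (1 / 21) (1 / 2))" "finite_orbit (theta_quot 21 (13 / 21) (1 / 2))"
  "finite_orbit (theta_quot 21 (5 / 42) 0)" "finite_orbit (theta_quot 21 (23 / 42) 0)"
  by (rule theta_quot_finite_orbit[of _ 2 1 1] theta_quot_finite_orbit[of _ 2 2 1] theta_quot_finite_orbit[of _ 2 1 2]
        theta_quot_finite_orbit[of _ 42 23 21] theta_quot_finite_orbit[of _ 42 47 21] theta_quot_finite_orbit[of _ 42 23 42] theta_quot_finite_orbit[of _ 42 47 42]
        theta_quot_finite_orbit[of _ 42 26 21] theta_quot_finite_orbit[of _ 42 44 21]; simp add: nonzero_class_def; fail)+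

lemma finite_orbit_minus: "finite_orbit f \<Longrightarrow> finite_orbit g \<Longrightarrow> finite_orbit (\<lambda>\<tau>. f \<tau> - g \<tau>)"
  using finite_orbit_add[of f "\<lambda>\<tau>. (-1) * g \<tau>"] finite_orbit_mult[OF finite_orbit_const[of "-1"], of g] by simp

lemma finite_orbit_power: "finite_orbit f \<Longrightarrow> finite_orbit (\<lambda>\<tau>. f \<tau> ^ k)"
  by (induction k) (auto intro: finite_orbit_const finite_orbit_mult)

text \<open>The function at \<open>t = (\<tau> + 1) / 2\<close> comes from the base \<open>w\<close>: \<open>- p = ee t\<close>
  and \<open>w = ee (t / 2)\<close>.\<close>

definition form4 :: "complex \<Rightarrow> complex" where
  "form4 \<tau> = (let t = (\<tau> + 1) / 2 in
     weber0 \<tau> ^ 3 * ((theta_quot 2 0 0 \<tau> + (- \<i>) * theta_quot 2 (1 / 2) 0 \<tau>) * (theta_quot 3 0 (1 / 2) t + weber0 t / (weber1 t * weber2 t))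
       + (theta_quot 2 0 0 \<tau> + \<i> * theta_quot 2 (1 / 2) 0 \<tau>) * (theta_quot 3 0 0 t + weber1 t / (weber0 t * weber2 t))))"

definition form5 :: "complex \<Rightarrow> complex" where
  "form5 \<tau> = weber0 \<tau> *
     ((1 / 2) * (theta_quot 2 0 0 \<tau> ^ 2 + theta_quot 2 (1 / 2) 0 \<tau> ^ 2) * weber0 \<tau> ^ 2 * (theta_quot 21 (1 / 21) 0 \<tau> - theta_quot 21 (13 / 21) 0 \<tau>)
      + (1 / 2) * (theta_quot 2 0 0 \<tau> ^ 2 - theta_quot 2 (1 / 2) 0 \<tau> ^ 2) * weber1 \<tau> ^ 2 * (theta_quot 21 (1 / 21) (1 / 2) \<tau> - theta_quot 21 (13 / 21) (1 / 2) \<tau>)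
      + 2 * theta_quot 2 0 0 \<tau> * theta_quot 2 (1 / 2) 0 \<tau> * weber2 \<tau> ^ 2 * (theta_quot 21 (5 / 42) 0 \<tau> - theta_quot 21 (23 / 42) 0 \<tau>))"

lemma form4_finite_orbit: "finite_orbit form4"
proof -
  have aff: "finite_orbit (\<lambda>\<tau>. f ((\<tau> + 1) / 2))" if "finite_orbit f" for f
    using finite_orbit_affine[OF that, of 1 2 1] by simp
  have quot: "finite_orbit (\<lambda>\<tau>. weber0 \<tau> / (weber1 \<tau> * weber2 \<tau>))" "finite_orbit (\<lambda>\<tau>. weber1 \<tau> / (weber0 \<tau> * weber2 \<tau>))"
    by (intro orbit_unit_finite_orbit orbit_unit_divide orbit_unit_mult weber_orbit_unit)+
  show ?thesis
    unfolding form4_def[abs_def] Let_def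
    by (intro finite_orbit_mult finite_orbit_add finite_orbit_power finite_orbit_const finite_orbit_thetas
        aff[OF finite_orbit_thetas(3)] aff[OF finite_orbit_thetas(4)] aff[OF quot(1)] aff[OF quot(2)]
        orbit_unit_finite_orbit[OF weber_orbit_unit(1)])
qed

lemma form5_finite_orbit: "finite_orbit form5"
  unfolding form5_def[abs_def]
  by (intro finite_orbit_mult finite_orbit_add finite_orbit_minus finite_orbit_power finite_orbit_const
      finite_orbit_thetas orbit_unit_finite_orbit[OF weber_orbit_unit(1)] orbit_unit_finite_orbit[OF weber_orbit_unit(2)]
      orbit_unit_finite_orbit[OF weber_orbit_unit(3)])

text \<open>Substitution into \<open>chain4_evaluation\<close>. The factors of \<open>(q;q)\<^sub>\<infinity>\<close>
  and \<open>(-p;-p)\<^sub>\<infinity>\<close> that normalise the theta series cancel, and the powers of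
  \<open>q\<close> add up to \<open>q\<^bsup>1/8\<^esup>\<close>.\<close>

lemma tadpole_4_eq_form4:
  assumes \<tau>: "Im \<tau> > 0"
  shows "ee (- \<tau> / 8) * tadpole_nahm_sum 4 (\<lambda>_. 1) \<tau> = ee (1 / 48) / 4 * form4 \<tau>"
proof -
  define x where "x = ee (\<tau> / 4)"
  have x: "x = exp (\<i> * of_real pi * \<tau> / 2)" by (simp add: x_def ee_def mult_ac)
  interpret nome x unfolding x by (rule nome_exp[OF \<tau>])
  define t where "t = (\<tau> + 1) / 2"
  have t: "Im t > 0" using \<tau> by (simp add: t_def)
  have h: "ee (1 / 2) = - 1" and h': "ee (1 / 4) = \<i>" by (simp_all add: ee_def exp_eq_polar cis.ctr complex_eq_iff)
  have p: "p = ee (\<tau> / 2)" and q: "q = ee \<tau>" unfolding p_def q_def unfolding x_def ee_power by simp_all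
  have mp: "- p = ee t" unfolding p t_def add_divide_distrib ee_add h by simp
  have "w = ee (1 / 4) * ee (\<tau> / 4)" unfolding w_def unfolding x_def h' ..
  also have "\<dots> = ee (t / 2)"
    unfolding ee_add[symmetric] by (rule arg_cong[of _ _ ee]) (simp add: t_def field_simps)
  finally have w: "w = ee (t / 2)" .
  have p': "p = - ee t" unfolding mp[symmetric] by simp
  define Q where "Q = qp q q"
  define Qt where "Qt = qp (- p) (- p)"
  have nz: "Q \<noteq> 0" "Qt \<noteq> 0" unfolding Q_def Qt_def by (intro qp_nonzero; simp add: norm_q norm_p)+
  define a0 a1 where "a0 = theta_quot 2 0 0 \<tau>" and "a1 = theta_quot 2 (1 / 2) 0 \<tau>"
  define f0 f1 where "f0 = theta_quot 3 0 (1 / 2) t" and "f1 = theta_quot 3 0 0 t"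
  define u0 u1 u2 where "u0 = weber0 t" and "u1 = weber1 t" and "u2 = weber2 t"
  define E e k c g where "E = ee (\<tau> / 24)" and "e = ee (\<tau> / 48)" and "k = ee (t / 24)" and "c = ee (t / 48)" and "g = ee (- t / 24)"
  have A: "A 0 = E * Q * a0" "A 1 = E * Q * a1"
  proof -
    show "A 0 = E * Q * a0"
      unfolding A_def E_def Q_def q a0_def unfolding x_def ee_powi
      by (subst infsum_eq_theta_quot[OF \<tau>, where c = 0 and N = 2 and a = 0 and b = 0])
        ((rule arg_cong[of _ _ ee])?; simp add: field_simps power2_eq_square)+
    show "A 1 = E * Q * a1"
      unfolding A_def E_def Q_def q a1_def unfolding x_def ee_powi
      by (subst infsum_eq_theta_quot[OF \<tau>, where c = 0 and N = 2 and a = "1 / 2" and b = 0])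
        ((rule arg_cong[of _ _ ee])?; simp add: field_simps power2_eq_square)+
  qed
  have sg: "parity_sign n = ee (of_int n / 2)" for n
  proof (cases "even n")
    case True
    then show ?thesis using ee_half_eq[of n 0] by (simp add: parity_sign_def)
  next
    case False
    then show ?thesis using ee_half_eq[of n 1] by (simp add: parity_sign_def h)
  qed
  have F: "(\<Sum>\<^sub>\<infinity>j. parity_sign j * w powi (3 * j ^ 2)) = k * Qt * f0" "(\<Sum>\<^sub>\<infinity>j. w powi (3 * j ^ 2)) = k * Qt * f1"
  proof -
    show "(\<Sum>\<^sub>\<infinity>j. parity_sign j * w powi (3 * j ^ 2)) = k * Qt * f0"
      unfolding k_def Qt_def mp f0_def w sg ee_powi ee_add[symmetric]
      by (subst infsum_eq_theta_quot[OF t, where c = 0 and N = 3 and a = 0 and b = "1 / 2"])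
        ((rule arg_cong[of _ _ ee])?; simp add: field_simps power2_eq_square)+
    show "(\<Sum>\<^sub>\<infinity>j. w powi (3 * j ^ 2)) = k * Qt * f1"
      unfolding k_def Qt_def mp f1_def w ee_powi
      by (subst infsum_eq_theta_quot[OF t, where c = 0 and N = 3 and a = 0 and b = 0])
        ((rule arg_cong[of _ _ ee])?; simp add: field_simps power2_eq_square)+
  qed
  have W0: "qp (- p) q = e * weber0 \<tau>"
    unfolding p q e_def weber0_def mult.assoc[symmetric] ee_add[symmetric] by simp
  have U: "qp (- w) (- p) = c * u0" "qp w (- p) = c * u1" "qp p (- p) = g * u2"
    unfolding w mp unfolding p' c_def g_def u0_def u1_def u2_def weber0_def weber1_def weber2_def mult.assoc[symmetric] ee_add[symmetric]
    by simp_all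
  have nz': "c \<noteq> 0" "g \<noteq> 0" "k * g = 1" by (simp_all add: c_def g_def k_def flip: ee_add)
  have "tadpole_nahm_sum 4 (\<lambda>_. 1) \<tau> = infsum chain4 UNIV"
    using tadpole_nahm_sum_4[OF \<tau>] unfolding x .
  also have "\<dots> = (e * weber0 \<tau>) ^ 3 / (2 * Q) *
     (((E * Q * a0 - \<i> * (E * Q * a1)) / 2 * (k * Qt * f0) + (E * Q * a0 + \<i> * (E * Q * a1)) / 2 * (k * Qt * f1)) / Qt
       + ((E * Q * a0 - \<i> * (E * Q * a1)) / 2 * ((c * u0) / (c * u1)) + (E * Q * a0 + \<i> * (E * Q * a1)) / 2 * ((c * u1) / (c * u0))) / (g * u2))"
    unfolding chain4_evaluation A F W0 U Q_def[symmetric] Qt_def[symmetric] ..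
  also have "\<dots> = (e ^ 3 * E * k) * weber0 \<tau> ^ 3 / 4 * ((a0 + (- \<i>) * a1) * (f0 + u0 / (u1 * u2)) + (a0 + \<i> * a1) * (f1 + u1 / (u0 * u2)))"
  proof -
    have 1: "s / (g * u2) = k * (s / u2)" for s
    proof -
      have "s / (g * u2) = (k * g) * (s / (g * u2))" unfolding nz'(3) by simp
      also have "\<dots> = k * (s / u2)" using nz'(2) by simp
      finally show ?thesis .
    qed
    have 2: "(c * u0) / (c * u1) = u0 / u1" "(c * u1) / (c * u0) = u1 / u0" using nz' by simp_all
    show ?thesis
      unfolding 1 2 using nz(1,2) by (simp add: divide_simps) (simp add: algebra_simps power3_eq_cube)
  qed
  also have "e ^ 3 * E * k = ee (\<tau> / 8) * ee (1 / 48)"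
    unfolding e_def E_def k_def ee_power t_def ee_add[symmetric]
    by (rule arg_cong[of _ _ ee]) (simp add: field_simps)
  also have "ee (- \<tau> / 8) * (ee (\<tau> / 8) * ee (1 / 48) * weber0 \<tau> ^ 3 / 4 * ((a0 + (- \<i>) * a1) * (f0 + u0 / (u1 * u2)) + (a0 + \<i> * a1) * (f1 + u1 / (u0 * u2))))
     = (ee (- \<tau> / 8) * ee (\<tau> / 8)) * (ee (1 / 48) / 4 * form4 \<tau>)"
    unfolding form4_def Let_def t_def[symmetric] a0_def a1_def f0_def f1_def u0_def u1_def u2_def by simp
  also have "ee (- \<tau> / 8) * ee (\<tau> / 8) = 1" by (simp flip: ee_add)
  finally show ?thesis by simp
qed

text \<open>Substitution into \<open>chain5_evaluation\<close>; the powers of \<open>q\<close> in all three terms add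
  up to \<open>q\<^bsup>55/336\<^esup>\<close>.\<close>

lemma tadpole_5_eq_form5:
  assumes \<tau>: "Im \<tau> > 0"
  shows "ee (- 55 * \<tau> / 336) * tadpole_nahm_sum 5 (\<lambda>_. 1) \<tau> = form5 \<tau>"
proof -
  define x where "x = ee (\<tau> / 4)"
  have x: "x = exp (\<i> * of_real pi * \<tau> / 2)" by (simp add: x_def ee_def mult_ac)
  interpret nome x unfolding x by (rule nome_exp[OF \<tau>])
  have h: "ee (1 / 2) = - 1" by (simp add: ee_def)
  have p: "p = ee (\<tau> / 2)" and q: "q = ee \<tau>" unfolding p_def q_def unfolding x_def ee_power by simp_all
  have mp: "- p = ee (\<tau> / 2 + 1 / 2)" unfolding p ee_add h by simp
  define Q where "Q = qp q q"
  have nz: "Q \<noteq> 0" unfolding Q_def by (intro qp_nonzero norm_q)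
  define a0 a1 where "a0 = theta_quot 2 0 0 \<tau>" and "a1 = theta_quot 2 (1 / 2) 0 \<tau>"
  define s1 s2 s3 where "s1 = theta_quot 21 (1 / 21) 0 \<tau> - theta_quot 21 (13 / 21) 0 \<tau>"
    and "s2 = theta_quot 21 (1 / 21) (1 / 2) \<tau> - theta_quot 21 (13 / 21) (1 / 2) \<tau>" and "s3 = theta_quot 21 (5 / 42) 0 \<tau> - theta_quot 21 (23 / 42) 0 \<tau>"
  define E e g k l where "E = ee (\<tau> / 24)" and "e = ee (\<tau> / 48)" and "g = ee (- \<tau> / 24)"
    and "k = ee (- \<tau> / 42 + \<tau> / 24)" and "l = ee (- 25 * \<tau> / 168 + \<tau> / 24)"
  have A: "A 0 = E * Q * a0" "A 1 = E * Q * a1"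
  proof -
    show "A 0 = E * Q * a0"
      unfolding A_def E_def Q_def q a0_def unfolding x_def ee_powi
      by (subst infsum_eq_theta_quot[OF \<tau>, where c = 0 and N = 2 and a = 0 and b = 0])
        ((rule arg_cong[of _ _ ee])?; simp add: field_simps power2_eq_square)+
    show "A 1 = E * Q * a1"
      unfolding A_def E_def Q_def q a1_def unfolding x_def ee_powi
      by (subst infsum_eq_theta_quot[OF \<tau>, where c = 0 and N = 2 and a = "1 / 2" and b = 0])
        ((rule arg_cong[of _ _ ee])?; simp add: field_simps power2_eq_square)+
  qed
  have parity: "ee (of_int m * (\<tau> / 2 + 1 / 2)) = ee (of_int m * \<tau> / 2 + of_int n / 2)" if "even (m - n)" for m n
    using ee_half_eq[OF that] by (simp add: ee_add ring_distribs)
  have T1p: "T1 p = k * Q * s1"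
  proof -
    have "(\<Sum>\<^sub>\<infinity>i::int. p powi (21 * i ^ 2 + 2 * i)) = k * Q * theta_quot 21 (1 / 21) 0 \<tau>"
      unfolding p Q_def q k_def ee_powi
      by (subst infsum_eq_theta_quot[OF \<tau>, where c = "- \<tau> / 42" and N = 21 and a = "1 / 21" and b = "0"])
        ((rule arg_cong[of _ _ ee])?; simp add: field_simps power2_eq_square)+
    moreover have "(\<Sum>\<^sub>\<infinity>i::int. p powi (21 * i ^ 2 + 26 * i + 8)) = k * Q * theta_quot 21 (13 / 21) 0 \<tau>"
      unfolding p Q_def q k_def ee_powi
      by (subst infsum_eq_theta_quot[OF \<tau>, where c = "- \<tau> / 42" and N = 21 and a = "13 / 21" and b = "0"])
        ((rule arg_cong[of _ _ ee])?; simp add: field_simps power2_eq_square)+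
    ultimately show ?thesis by (simp add: T1_def s1_def right_diff_distrib)
  qed
  have T1m: "T1 (- p) = k * Q * s2"
  proof -
    have e: "ee (of_int (21 * i ^ 2 + 2 * i) * (\<tau> / 2 + 1 / 2)) = ee (of_int (21 * i ^ 2 + 2 * i) * \<tau> / 2 + of_int i / 2)"
      "ee (of_int (21 * i ^ 2 + 26 * i + 8) * (\<tau> / 2 + 1 / 2)) = ee (of_int (21 * i ^ 2 + 26 * i + 8) * \<tau> / 2 + of_int i / 2)" for i
      by (rule parity; simp)+
    have "(\<Sum>\<^sub>\<infinity>i::int. (- p) powi (21 * i ^ 2 + 2 * i)) = k * Q * theta_quot 21 (1 / 21) (1 / 2) \<tau>"
      unfolding mp Q_def q k_def ee_powi e
      by (subst infsum_eq_theta_quot[OF \<tau>, where c = "- \<tau> / 42" and N = 21 and a = "1 / 21" and b = "1 / 2"])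
        ((rule arg_cong[of _ _ ee])?; simp add: field_simps power2_eq_square)+
    moreover have "(\<Sum>\<^sub>\<infinity>i::int. (- p) powi (21 * i ^ 2 + 26 * i + 8)) = k * Q * theta_quot 21 (13 / 21) (1 / 2) \<tau>"
      unfolding mp Q_def q k_def ee_powi e
      by (subst infsum_eq_theta_quot[OF \<tau>, where c = "- \<tau> / 42" and N = 21 and a = "13 / 21" and b = "1 / 2"])
        ((rule arg_cong[of _ _ ee])?; simp add: field_simps power2_eq_square)+
    ultimately show ?thesis by (simp add: T1_def s2_def right_diff_distrib)
  qed
  have T2: "T2 = l * Q * s3"
  proof -
    have "(\<Sum>\<^sub>\<infinity>i::int. p powi (21 * i ^ 2 + 5 * i)) = l * Q * theta_quot 21 (5 / 42) 0 \<tau>"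
      unfolding p Q_def q l_def ee_powi
      by (subst infsum_eq_theta_quot[OF \<tau>, where c = "- 25 * \<tau> / 168" and N = 21 and a = "5 / 42" and b = "0"])
        ((rule arg_cong[of _ _ ee])?; simp add: field_simps power2_eq_square)+
    moreover have "(\<Sum>\<^sub>\<infinity>i::int. p powi (21 * i ^ 2 + 23 * i + 6)) = l * Q * theta_quot 21 (23 / 42) 0 \<tau>"
      unfolding p Q_def q l_def ee_powi
      by (subst infsum_eq_theta_quot[OF \<tau>, where c = "- 25 * \<tau> / 168" and N = 21 and a = "23 / 42" and b = "0"])
        ((rule arg_cong[of _ _ ee])?; simp add: field_simps power2_eq_square)+
    ultimately show ?thesis by (simp add: T2_def s3_def right_diff_distrib)
  qed
  have W: "qp (- p) q = e * weber0 \<tau>" "qp p q = e * weber1 \<tau>" "qp (- q) q = g * weber2 \<tau>"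
    unfolding p q e_def g_def weber0_def weber1_def weber2_def mult.assoc[symmetric] ee_add[symmetric] by simp_all
  have c1: "e ^ 3 * E ^ 2 * k = ee (55 * \<tau> / 336)"
    unfolding e_def E_def k_def ee_power ee_add[symmetric] by (rule arg_cong[of _ _ ee]) (simp add: field_simps)
  have c2: "e * E ^ 2 * x * g ^ 2 * l = ee (55 * \<tau> / 336)"
    unfolding e_def E_def l_def g_def x_def ee_power ee_add[symmetric] by (rule arg_cong[of _ _ ee]) (simp add: field_simps)
  have "tadpole_nahm_sum 5 (\<lambda>_. 1) \<tau> = infsum chain5 UNIV"
    using tadpole_nahm_sum_5[OF \<tau>] unfolding x .
  also have "\<dots> = e * weber0 \<tau> / Q ^ 3 *
     (((E * Q * a0) ^ 2 + (E * Q * a1) ^ 2) / 2 * (e * weber0 \<tau>) ^ 2 * (k * Q * s1)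
      + ((E * Q * a0) ^ 2 - (E * Q * a1) ^ 2) / 2 * (e * weber1 \<tau>) ^ 2 * (k * Q * s2)
      + 2 * (E * Q * a0) * (E * Q * a1) * x * (g * weber2 \<tau>) ^ 2 * (l * Q * s3))"
    unfolding chain5_evaluation A T1p T1m T2 W Q_def[symmetric] ..
  also have "\<dots> = weber0 \<tau> * ((e ^ 3 * E ^ 2 * k) * ((1 / 2) * (a0 ^ 2 + a1 ^ 2) * weber0 \<tau> ^ 2 * s1)
      + (e ^ 3 * E ^ 2 * k) * ((1 / 2) * (a0 ^ 2 - a1 ^ 2) * weber1 \<tau> ^ 2 * s2)
      + (e * E ^ 2 * x * g ^ 2 * l) * (2 * a0 * a1 * weber2 \<tau> ^ 2 * s3))"
    using nz by (simp add: field_simps power2_eq_square power3_eq_cube)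
  also have "\<dots> = ee (55 * \<tau> / 336) * form5 \<tau>"
    unfolding c1 c2 form5_def a0_def a1_def s1_def s2_def s3_def by (simp only: distrib_left mult_ac)
  also have "ee (- 55 * \<tau> / 336) * \<dots> = form5 \<tau>"
    unfolding mult.assoc[symmetric] ee_add[symmetric] by simp
  finally show ?thesis .
qed

theorem corollary1p6:
  "\<forall>r\<in>{4, 5}. \<exists>a::rat. modular (\<lambda>\<tau>. q_pow \<tau> a * tadpole_nahm_sum r (\<lambda>_. 1) \<tau>)"
proof -
  have "finite_orbit (\<lambda>\<tau>. q_pow \<tau> (- 1 / 8) * tadpole_nahm_sum 4 (\<lambda>_. 1) \<tau>)"
  proof (rule finite_orbit_cong)
    show "finite_orbit (\<lambda>\<tau>. ee (1 / 48) / 4 * form4 \<tau>)"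
      by (intro finite_orbit_mult finite_orbit_const form4_finite_orbit)
    show "q_pow \<tau> (- 1 / 8) * tadpole_nahm_sum 4 (\<lambda>_. 1) \<tau> = ee (1 / 48) / 4 * form4 \<tau>" if "\<tau> \<in> uhp" for \<tau>
      using tadpole_4_eq_form4[of \<tau>] that by (simp add: q_pow_def ee_def of_rat_divide of_rat_minus mult_ac)
  qed
  moreover have "finite_orbit (\<lambda>\<tau>. q_pow \<tau> (- 55 / 336) * tadpole_nahm_sum 5 (\<lambda>_. 1) \<tau>)"
  proof (rule finite_orbit_cong[OF form5_finite_orbit])
    show "q_pow \<tau> (- 55 / 336) * tadpole_nahm_sum 5 (\<lambda>_. 1) \<tau> = form5 \<tau>" if "\<tau> \<in> uhp" for \<tau>
      using tadpole_5_eq_form5[of \<tau>] that by (simp add: q_pow_def ee_def of_rat_divide of_rat_minus mult_ac)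
  qed
  ultimately show ?thesis by (auto dest!: finite_orbit_imp_modular)
qed

end
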